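(* Let $V=\mathcal{M}_n(\mathbb{C})$ or $V=\mathcal{M}_n(\mathbb{R})$, and let $X$ be a random matrix in $V$ whose distribution is invariant under rotations of $V$. Suppose that $\mathbb{E}\|X\|^2=n$ and that for each $k$ there is a constant $\alpha_k$ depending only on $k$ such that $$t_k(X)=\left|n^{-k/2}\,\mathbb{E}\|X\|^{k}-1\right|\le\frac{\alpha_k}{n}.$$ Fix $m\in\mathbb{N}$ with $m\ge3$ and let $W=(W_1,\dots,W_m)=(\operatorname{tr}(X),\operatorname{tr}(X^2),\dots,\operatorname{tr}(X^m))$, a random vector in $\mathbb{C}^m$ if $V=\mathcal{M}_n(\mathbb{C})$ and in $\mathbb{R}^m$ if $V=\mathcal{M}_n(\mathbb{R})$. (1) If $V=\mathcal{M}_n(\mathbb{C})$ and $G$ is a standard complex Gaussian random vector in $\mathbb{C}^m$, then for any $f\in C^2(\mathbb{C}^m)$, $$\big|\mathbb{E}f(W)-\mathbb{E}f(\Sigma^{1/2}G)\big|\le\frac{\kappa_m M_2(f)}{n},$$ where $\Sigma$ is the $m\times m$ diagonal matrix with $(p,p)$ entry $\sigma_{pp}=p$ and $\kappa_m$ is a positive constant depending only on $m$ and $\alpha_1,\dots,\alpha_m$. (2) If $V=\mathcal{M}_n(\mathbb{R})$ and $G$ is a standard Gaussian random vector in $\mathbb{R}^m$, then for any $f\in C^2(\mathbb{R}^m)$, $$\big|\mathbb{E}f(W-\mathbb{E}W)-\mathbb{E}f(\Sigma^{1/2}G)\big|\le\frac{\kappa_m\,(M_1(f)+M_2(f))}{n},$$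 where $\Sigma$ is the $m\times m$ diagonal matrix with $(p,p)$ entry $\sigma_{pp}=p$ and $\kappa_m$ is a positive constant depending only on $m$ and $\alpha_1,\dots,\alpha_m$.
   Context: $\mathcal{M}_n(\mathbb{F})$ is the space of all $n\times n$ matrices over $\mathbb{F}\in\{\mathbb{R},\mathbb{C}\}$, regarded as a real vector space with real inner product $\langle A,B\rangle=\operatorname{Re}\operatorname{tr}(AB^* )$ and Hilbert–Schmidt norm $\|A\|=\sqrt{\operatorname{tr}(AA^* )}$. The distribution of $X$ is invariant under rotations of $V$ if it is invariant under all real-linear isometries of $(V,\langle\cdot,\cdot\rangle)$. Test functions are real-valued. For $g\in C^2(\mathbb{R}^m)$, $M_1(g)=\sup_x|\nabla g(x)|$ and $M_2(g)=\sup_x\|\operatorname{Hess}(g)(x)\|_{op}$ (operator norm); for $g:\mathbb{C}^m\to\mathbb{R}$ these quantities are computed by identifying $g$ with a function on $\mathbb{R}^{2m}$. A standard complex Gaussian vector $G\in\mathbb{C}^m$ has components $G_j=\xi_j+i\eta_j$ with $\xi_1,\eta_1,\dots,\xi_m,\eta_m$ i.i.d. real Gaussian of mean $0$ and variance $\tfrac12$.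
   Formalization: In (1) the constant κ_m depends on m and α_1,…,α_{2m} rather than α_1,…,α_m, as rare large values of ‖X‖ make the original bound fail for f(w)=(Re w_m)²; X and G are taken on sample spaces inside their value spaces, which covers every law. *)

theory Defs
  imports
    "HOL-Probability.Probability"
    "Jordan_Normal_Form.Schur_Decomposition"
begin

no_notation vec_index (infixl "$" 100)
hide_const (open) Determinants.trace

text \<open>
  Square matrices are elements of \<^term>\<open>carrier_mat n n\<close>, so that the size \<open>n\<close> is a number that
  can be quantified after a constant.  The definitions are meant for entries in \<^typ>\<open>complex\<close>
  or \<^typ>\<open>real\<close>.
\<close>

definition mat_trace :: "'a::comm_monoid_add mat \<Rightarrow> 'a" where
  "mat_trace A = (\<Sum>i<dim_row A. A $$ (i, i))"

text \<open>
  On both \<^typ>\<open>complex\<close> and \<^typ>\<open>real\<close> the real number \<open>1 \<bullet> z\<close> is the real part of \<open>z\<close>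
  (\<open>\<bullet>\<close> being the real inner product), and \<^const>\<open>mat_adjoint\<close> is the conjugate transpose
  (the transpose, in the real case).
\<close>

definition hs_inner :: "'a::{conjugatable_field, real_normed_field, real_inner} mat \<Rightarrow> 'a mat \<Rightarrow> real" where
  "hs_inner A B = 1 \<bullet> mat_trace (A * mat_adjoint B)"

definition hs_norm :: "'a::{conjugatable_field, real_normed_field, real_inner} mat \<Rightarrow> real" where
  "hs_norm A = sqrt (1 \<bullet> mat_trace (A * mat_adjoint A))"

lemma one_inner_complex: "1 \<bullet> z = Re z" for z :: complex
  by (simp add: inner_complex_def)

lemma one_inner_real: "1 \<bullet> z = z" for z :: real
  by simp

text \<open>
  Real-linear isometries of the space of \<open>n\<close> by \<open>n\<close> matrices.  Only the values on
  \<^term>\<open>carrier_mat n n\<close> matter; bijectivity is automatic in finite dimension.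
\<close>

definition rotation :: "nat \<Rightarrow> ('a::{conjugatable_field, real_normed_field, real_inner} mat \<Rightarrow> 'a mat) \<Rightarrow> bool" where
  "rotation n T \<longleftrightarrow>
     T \<in> carrier_mat n n \<rightarrow> carrier_mat n n \<and>
     (\<forall>A \<in> carrier_mat n n. \<forall>B \<in> carrier_mat n n. T (A + B) = T A + T B) \<and>
     (\<forall>c::real. \<forall>A \<in> carrier_mat n n. T (of_real c \<cdot>\<^sub>m A) = of_real c \<cdot>\<^sub>m T A) \<and>
     (\<forall>A \<in> carrier_mat n n. \<forall>B \<in> carrier_mat n n. hs_inner (T A) (T B) = hs_inner A B)"

text \<open>The Borel sets of \<^term>\<open>carrier_mat n n\<close>: the sigma-algebra generated by the entries.\<close>

definition mat_borel :: "nat \<Rightarrow> 'a::topological_space mat measure" where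
  "mat_borel n = vimage_algebra (carrier_mat n n)
     (\<lambda>A. \<lambda>ij \<in> {..<n} \<times> {..<n}. A $$ ij)
     (\<Pi>\<^sub>M ij \<in> {..<n} \<times> {..<n}. borel)"

definition rotation_invariant ::
  "nat \<Rightarrow> 'w measure \<Rightarrow> ('w \<Rightarrow> 'a::{conjugatable_field, real_normed_field, real_inner} mat) \<Rightarrow> bool" where
  "rotation_invariant n M X \<longleftrightarrow>
     (\<forall>T. rotation n T \<longrightarrow> distr M (mat_borel n) (\<lambda>\<omega>. T (X \<omega>)) = distr M (mat_borel n) X)"

definition moment_dev ::
  "nat \<Rightarrow> 'w measure \<Rightarrow> ('w \<Rightarrow> 'a::{conjugatable_field, real_normed_field, real_inner} mat) \<Rightarrow> nat \<Rightarrow> real" where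
  "moment_dev n M X k = \<bar>real n powr (- (real k / 2)) * (\<integral>\<omega>. hs_norm (X \<omega>) ^ k \<partial>M) - 1\<bar>"

text \<open>
  Vectors of length \<open>m\<close> are indexed by a finite type \<open>'m\<close> of cardinality \<open>m\<close>, and
  \<open>idx :: 'm \<Rightarrow> nat\<close> is the numbering of the coordinates by \<open>1, \<dots>, m\<close>.
\<close>

definition trace_vec :: "('m::finite \<Rightarrow> nat) \<Rightarrow> 'a::semiring_1 mat \<Rightarrow> 'a ^ 'm" where
  "trace_vec idx A = (\<chi> p. mat_trace (A ^\<^sub>m idx p))"

definition diag_matrix :: "('m::finite \<Rightarrow> 'a::zero) \<Rightarrow> 'a ^ 'm ^ 'm" where
  "diag_matrix d = (\<chi> p q. if p = q then d p else 0)"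

definition Sigma_half :: "('m::finite \<Rightarrow> nat) \<Rightarrow> 'a::real_algebra_1 ^ 'm ^ 'm" where
  "Sigma_half idx = diag_matrix (\<lambda>p. of_real (sqrt (real (idx p))))"

lemma Sigma_half_square:
  "Sigma_half idx ** Sigma_half idx = (diag_matrix (\<lambda>p. of_nat (idx p)) :: 'a::real_algebra_1 ^ 'm::finite ^ 'm)"
proof -
  define d :: "'m \<Rightarrow> 'a" where "d = (\<lambda>p. of_real (sqrt (real (idx p))))"
  have d: "d p * d p = of_nat (idx p)" for p
    by (simp add: d_def flip: of_real_mult)
  have "(\<Sum>k\<in>UNIV. (if p = k then d p else 0) * (if k = q then d k else 0))
      = (if p = q then of_nat (idx p) else 0)" for p q
  proof -
    have "(\<Sum>k\<in>UNIV. (if p = k then d p else 0) * (if k = q then d k else 0))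
        = (\<Sum>k\<in>UNIV. if p = k then (if p = q then d p * d p else 0) else 0)"
      by (rule sum.cong) auto
    then show ?thesis
      by (simp add: d)
  qed
  then show ?thesis
    unfolding Sigma_half_def diag_matrix_def matrix_matrix_mult_def vec_lambda_beta d_def[symmetric]
    by (simp add: d_def)
qed

definition std_gaussian :: "'w measure \<Rightarrow> ('w \<Rightarrow> real ^ 'm::finite) \<Rightarrow> bool" where
  "std_gaussian N G \<longleftrightarrow>
     prob_space N \<and>
     prob_space.indep_vars N (\<lambda>_. borel) (\<lambda>j \<omega>. G \<omega> $ j) UNIV \<and>
     (\<forall>j. distributed N lborel (\<lambda>\<omega>. G \<omega> $ j) (normal_density 0 1))"

definition re_im_parts :: "('w \<Rightarrow> complex ^ 'm) \<Rightarrow> 'm + 'm \<Rightarrow> 'w \<Rightarrow> real" where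
  "re_im_parts G k \<omega> = (case k of Inl j \<Rightarrow> Re (G \<omega> $ j) | Inr j \<Rightarrow> Im (G \<omega> $ j))"

text \<open>The second argument of \<^const>\<open>normal_density\<close> is the standard deviation.\<close>

definition std_complex_gaussian :: "'w measure \<Rightarrow> ('w \<Rightarrow> complex ^ 'm::finite) \<Rightarrow> bool" where
  "std_complex_gaussian N G \<longleftrightarrow>
     prob_space N \<and>
     prob_space.indep_vars N (\<lambda>_. borel) (re_im_parts G) UNIV \<and>
     (\<forall>k. distributed N lborel (re_im_parts G k) (normal_density 0 (sqrt (1 / 2))))"

text \<open>
  Calculus on a Euclidean space, to be used for both \<open>real ^ 'm\<close> and \<open>complex ^ 'm\<close>.  The inner
  product of the latter is the real one, which is the identification with a real space of twice
  the dimension.  The values of \<open>grad\<close> and \<open>hess\<close> are meaningful where the derivatives exist.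
\<close>

definition grad :: "('a::euclidean_space \<Rightarrow> real) \<Rightarrow> 'a \<Rightarrow> 'a" where
  "grad f x = (THE D. GDERIV f x :> D)"

definition hess :: "('a::euclidean_space \<Rightarrow> real) \<Rightarrow> 'a \<Rightarrow> 'a \<Rightarrow> 'a" where
  "hess f x = frechet_derivative (grad f) (at x)"

definition C2 :: "('a::euclidean_space \<Rightarrow> real) \<Rightarrow> bool" where
  "C2 f \<longleftrightarrow>
     (\<forall>x. f differentiable (at x)) \<and>
     (\<forall>x. grad f differentiable (at x)) \<and>
     (\<forall>v. continuous_on UNIV (\<lambda>x. hess f x v))"

lemma GDERIV_grad:
  assumes "f differentiable (at x)"
  shows "GDERIV f x :> grad f x"
proof -
  obtain f' where f': "(f has_derivative f') (at x)"
    using assms by (auto simp: differentiable_def)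
  then interpret f': bounded_linear f' by (rule has_derivative_bounded_linear)
  define D where "D = (\<Sum>b\<in>Basis. f' b *\<^sub>R b)"
  have "f' = (\<lambda>h. h \<bullet> D)"
  proof
    fix h
    have "f' h = f' (\<Sum>b\<in>Basis. (h \<bullet> b) *\<^sub>R b)"
      by (simp add: euclidean_representation)
    also have "\<dots> = h \<bullet> D"
      unfolding D_def f'.sum inner_sum_right by (simp only: f'.scaleR inner_scaleR_right real_scaleR_def mult.commute)
    finally show "f' h = h \<bullet> D" .
  qed
  then have D: "GDERIV f x :> D"
    using f' by (simp add: gderiv_def)
  moreover have "D' = D" if "GDERIV f x :> D'" for D'
  proof -
    have "(\<lambda>h. h \<bullet> D') = (\<lambda>h. h \<bullet> D)"
      using that D unfolding gderiv_def by (rule has_derivative_unique)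
    then have "\<forall>h. h \<bullet> D' = h \<bullet> D"
      by (auto dest: fun_cong)
    then show ?thesis
      by (simp only: vector_eq_ldot)
  qed
  ultimately show ?thesis
    unfolding grad_def by (rule theI)
qed

text \<open>The suprema are extended reals and may be infinite.\<close>

definition M1 :: "('a::euclidean_space \<Rightarrow> real) \<Rightarrow> ennreal" where
  "M1 f = (SUP x. ennreal (norm (grad f x)))"

definition M2 :: "('a::euclidean_space \<Rightarrow> real) \<Rightarrow> ennreal" where
  "M2 f = (SUP x. ennreal (onorm (hess f x)))"

end

theory Submission
  imports Defs "HOL-Real_Asymp.Real_Asymp"
begin

text \<open>In the \<open>d = n * n * card K\<close> real coordinates of a matrix
  (\<open>K = {True}\<close> for real, \<open>K = UNIV\<close> for complex entries) the law of X is
  invariant under the rotations of each coordinate plane. Differentiating an expectation along such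
  a rotation at angle zero, and adding up the planes through one axis, gives (d - 1) E[x_a g] =
  E[|x|^2 d_a g - x_a <x, grad g>] (\<open>spherical_ibp\<close>). This is the spherical form of
  Gaussian integration by parts. Radial functions pass through it as constants, so every estimate
  can carry an arbitrary nonnegative radial weight r and in effect holds conditionally on the radius
  s = ||X|| / sqrt n.

  For entries of words in X and its adjoint this becomes a system of loop equations
  (\<open>schwinger_dyson\<close>): a letter of a trace, contracted with another letter, cuts the
  trace in two or joins it to another trace. To leading order tr w is n c(w) s^|w|, where c(w)
  (\<open>cw\<close>) counts the noncrossing pairings of letters with opposite letters. In
  particular the trace of X^a times the b-th power of the adjoint is about n s^(a+b) if a = b, and
  of order one otherwise. By induction on the degree, products of centred traces have bounded means
  (\<open>fluctuation_moments\<close>): the terms of order n^3 cancel by the recursion for c, the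
  rest is of order n^2, and the factor d - 1 >= n^2 / 2 is divided out.

  The same equations, applied to tr(X^p) H with H a function of the traces, form a Stein identity
  (\<open>stein_identity\<close>): E[r (W_p - tau_p s^p) H] = E[r (kerR_p H + sum_q kerA_pq d_q H)].
  The fluctuation bounds put kerA_pq within O(1/n) in L1 of delta_pq p s^(2p) / card K
  (\<open>kerA_L1\<close>). The remainder kerR vanishes for complex matrices
  (\<open>kerR_complex\<close>) and is O(1/n) in L1 for real ones (\<open>kerR_L1\<close>), where
  the limiting mean tau_p is 1 for even p and 0 for odd p.

  Now the centred traces are rotated into a Gaussian vector whose p-th coordinate is multiplied by
  s^p. Given s, the kernel and the Gaussian covariance agree up to O(1/n), so along the path the
  Hessian of f is integrated only against the kernel error, and the gradient only against kerR
  (\<open>interpolation_bound\<close>). Hence the bound is in terms of M2 for complex matrices and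
  of M1 + M2 for real ones. The radius is removed by a second order expansion in s^p - 1, which is
  independent of the Gaussian vector and has mean and second moment O(1/n)
  (\<open>radial_comparison\<close>).

  In the complex case f may grow quadratically, and the moments of s up to order 2m enter
  (\<open>complex_comparison\<close>). In the real case the moments up to m are used: s is truncated
  at 2, and since s^m lies above its tangent in the variable s^2 while E s^2 = 1, the part of E s^m
  beyond 2 is O(1/n) (\<open>truncated_moments\<close>). There, and when E W is replaced by the
  vector of the tau_p, the gradient bound takes over (\<open>real_comparison\<close>). Real 1 by 1
  matrices have no plane to rotate; for them 1/n = 1 and a Lipschitz estimate is enough.\<close>

section \<open>Differentiation under the integral sign\<close>

lemma has_vector_derivative_iff_quotient:
  fixes f :: "real \<Rightarrow> 'b::real_normed_vector"
  shows "(f has_vector_derivative D) (at t) \<longleftrightarrow> ((\<lambda>u. (f (t + u) - f t) /\<^sub>R u) \<longlongrightarrow> D) (at 0)"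
proof -
  have "norm (f (t + u) - f t - u *\<^sub>R D) / norm u = norm ((f (t + u) - f t) /\<^sub>R u - D)" if "u \<noteq> 0" for u
  proof -
    have "(f (t + u) - f t) /\<^sub>R u - D = (f (t + u) - f t - u *\<^sub>R D) /\<^sub>R u"
      using that by (simp add: scaleR_diff_right)
    then show ?thesis by (simp add: divide_inverse mult.commute)
  qed
  then have "((\<lambda>u. norm (f (t + u) - f t - u *\<^sub>R D) / norm u) \<longlongrightarrow> 0) (at 0)
      \<longleftrightarrow> ((\<lambda>u. norm ((f (t + u) - f t) /\<^sub>R u - D)) \<longlongrightarrow> 0) (at 0)"
    by (intro Lim_cong_within) auto
  then show ?thesis
    unfolding has_vector_derivative_def has_derivative_at
    by (simp add: bounded_linear_scaleR_left tendsto_norm_zero_iff LIM_zero_iff)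
qed

text \<open>By the mean value inequality the bound \<open>B\<close> on the derivative dominates all
  difference quotients, so dominated convergence applies along every null sequence. Measurability of
  \<open>h' t\<close> comes out as that of a limit of quotients.\<close>

lemma has_vector_derivative_integral:
  fixes h :: "real \<Rightarrow> 'w \<Rightarrow> 'b::{banach, second_countable_topology}"
  assumes int: "\<And>t. integrable M (h t)"
    and der: "\<And>t x. x \<in> space M \<Longrightarrow> ((\<lambda>t. h t x) has_vector_derivative h' t x) (at t)"
    and B: "integrable M B" "\<And>t x. x \<in> space M \<Longrightarrow> norm (h' t x) \<le> B x"
  shows "integrable M (h' t)" "((\<lambda>t. \<integral>x. h t x \<partial>M) has_vector_derivative (\<integral>x. h' t x \<partial>M)) (at t)"
proof -
  have lip: "norm (h (t + u) x - h t x) \<le> B x * \<bar>u\<bar>" if "x \<in> space M" for u x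
  proof -
    have "norm (h (t + u) x - h t x) \<le> B x * norm ((t + u) - t)"
    proof (rule differentiable_bound[where S = UNIV and f' = "\<lambda>t u. u *\<^sub>R h' t x"])
      show "((\<lambda>t. h t x) has_derivative (\<lambda>u. u *\<^sub>R h' s x)) (at s within UNIV)" for s
        using der[OF that] by (simp add: has_vector_derivative_def)
      show "onorm (\<lambda>u. u *\<^sub>R h' s x) \<le> B x" for s
      proof (rule onorm_bound)
        show "norm (u *\<^sub>R h' s x) \<le> B x * norm u" for u
          using mult_left_mono[OF B(2)[OF that], of "\<bar>u\<bar>" s] by (simp add: mult.commute)
        show "0 \<le> B x"
          using B(2)[OF that, of s] norm_ge_zero order_trans by blast
      qed
    qed auto
    then show ?thesis by simp
  qed
  have lim: "((\<lambda>u. (h (t + u) x - h t x) /\<^sub>R u) \<longlongrightarrow> h' t x) (at 0)" if "x \<in> space M" for x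
    using der[OF that, of t] unfolding has_vector_derivative_iff_quotient .
  have dct: "integrable M (h' t) \<and> (\<lambda>i. \<integral>x. (h (t + u i) x - h t x) /\<^sub>R u i \<partial>M) \<longlonglongrightarrow> (\<integral>x. h' t x \<partial>M)"
    if u: "\<And>i. u i \<noteq> 0" "u \<longlonglongrightarrow> 0" for u :: "nat \<Rightarrow> real"
  proof -
    have ms: "(\<lambda>x. (h (t + u i) x - h t x) /\<^sub>R u i) \<in> borel_measurable M" for i
      using int by (intro borel_measurable_scaleR borel_measurable_diff borel_measurable_const) auto
    have lm: "(\<lambda>i. (h (t + u i) x - h t x) /\<^sub>R u i) \<longlonglongrightarrow> h' t x" if "x \<in> space M" for x
      using lim[OF that] u unfolding tendsto_at_iff_sequentially by (auto simp: o_def)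
    have mh: "h' t \<in> borel_measurable M"
      using ms lm by (rule borel_measurable_LIMSEQ_metric)
    have bd: "norm ((h (t + u i) x - h t x) /\<^sub>R u i) \<le> B x" if "x \<in> space M" for i x
    proof -
      have "norm ((h (t + u i) x - h t x) /\<^sub>R u i) = norm (h (t + u i) x - h t x) / \<bar>u i\<bar>"
        unfolding norm_scaleR by (simp add: divide_inverse mult.commute)
      also have "\<dots> \<le> B x"
        using lip[OF that, of "u i"] u(1)[of i] by (simp add: pos_divide_le_eq)
      finally show ?thesis .
    qed
    show ?thesis
      using integrable_dominated_convergence[OF mh ms B(1) AE_I2[OF lm] AE_I2[OF bd]]
        integral_dominated_convergence[OF mh ms B(1) AE_I2[OF lm] AE_I2[OF bd]] by blast
  qed
  have "(\<lambda>i. 1 / real (Suc i)) \<longlonglongrightarrow> 0"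
    by (rule LIMSEQ_Suc) (rule lim_1_over_n)
  from dct[OF _ this] show "integrable M (h' t)" by simp
  have "((\<lambda>u. ((\<integral>x. h (t + u) x \<partial>M) - (\<integral>x. h t x \<partial>M)) /\<^sub>R u) \<longlongrightarrow> (\<integral>x. h' t x \<partial>M)) (at 0)"
    unfolding tendsto_at_iff_sequentially
  proof (intro allI impI)
    fix u :: "nat \<Rightarrow> real"
    assume "\<forall>i. u i \<in> UNIV - {0}" "u \<longlonglongrightarrow> 0"
    then have "(\<lambda>i. \<integral>x. (h (t + u i) x - h t x) /\<^sub>R u i \<partial>M) \<longlonglongrightarrow> (\<integral>x. h' t x \<partial>M)"
      using dct[of u] by auto
    then show "((\<lambda>u. ((\<integral>x. h (t + u) x \<partial>M) - (\<integral>x. h t x \<partial>M)) /\<^sub>R u) \<circ> u) \<longlonglongrightarrow> (\<integral>x. h' t x \<partial>M)"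
      by (simp add: o_def int)
  qed
  then show "((\<lambda>t. \<integral>x. h t x \<partial>M) has_vector_derivative (\<integral>x. h' t x \<partial>M)) (at t)"
    unfolding has_vector_derivative_iff_quotient .
qed

section \<open>Rotation invariance as an integration by parts formula\<close>

section \<open>Integration by parts for rotation invariant measures\<close>

definition rot :: "'c \<Rightarrow> 'c \<Rightarrow> real \<Rightarrow> ('c \<Rightarrow> real) \<Rightarrow> 'c \<Rightarrow> real" where
  "rot a b t x = x(a := cos t * x a - sin t * x b, b := sin t * x a + cos t * x b)"

definition nrm :: "'c set \<Rightarrow> ('c \<Rightarrow> real) \<Rightarrow> real" where
  "nrm C x = sqrt (\<Sum>c\<in>C. (x c)\<^sup>2)"

text \<open>Only curves on a sphere are tested, so that radial factors behave as constants.\<close>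

definition tdiff :: "'c set \<Rightarrow> (('c \<Rightarrow> real) \<Rightarrow> 'b::real_normed_vector) \<Rightarrow> (('c \<Rightarrow> real) \<Rightarrow> 'c \<Rightarrow> 'b) \<Rightarrow> bool" where
  "tdiff C g dg \<longleftrightarrow> (\<forall>\<gamma> \<gamma>'. (\<forall>t. \<gamma> t \<in> extensional C \<and> nrm C (\<gamma> t) = nrm C (\<gamma> 0)) \<longrightarrow>
     (\<forall>c\<in>C. ((\<lambda>t. \<gamma> t c) has_vector_derivative \<gamma>' c) (at (0::real))) \<longrightarrow>
     ((\<lambda>t. g (\<gamma> t)) has_vector_derivative (\<Sum>c\<in>C. \<gamma>' c *\<^sub>R dg (\<gamma> 0) c)) (at 0))"

lemma tdiffD:
  assumes "tdiff C g dg" "\<And>t. \<gamma> t \<in> extensional C" "\<And>t. nrm C (\<gamma> t) = nrm C (\<gamma> 0)"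
    "\<And>c. c \<in> C \<Longrightarrow> ((\<lambda>t. \<gamma> t c) has_vector_derivative \<gamma>' c) (at (0::real))"
  shows "((\<lambda>t. g (\<gamma> t)) has_vector_derivative (\<Sum>c\<in>C. \<gamma>' c *\<^sub>R dg (\<gamma> 0) c)) (at 0)"
  using assms unfolding tdiff_def by blast

text \<open>The radius does not move along the curves tested by \<open>tdiff\<close>, so
  \<open>h\<close> may be any function, indicators included. This is what allows cut-offs in the
  radius to be used as weights later.\<close>

lemma tdiff_radial:
  fixes C :: "'c set"
  shows "tdiff C (\<lambda>x. h (nrm C x)) (\<lambda>_ _. 0)"
  unfolding tdiff_def
proof (intro allI impI)
  fix \<gamma> :: "real \<Rightarrow> 'c \<Rightarrow> real" and \<gamma>' :: "'c \<Rightarrow> real"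
  assume "\<forall>t. \<gamma> t \<in> extensional C \<and> nrm C (\<gamma> t) = nrm C (\<gamma> 0)"
  then have "(\<lambda>t. h (nrm C (\<gamma> t))) = (\<lambda>t. h (nrm C (\<gamma> 0)))" by metis
  then show "((\<lambda>t. h (nrm C (\<gamma> t))) has_vector_derivative (\<Sum>c\<in>C. \<gamma>' c *\<^sub>R 0)) (at 0)"
    by simp
qed

lemma tdiff_const: "tdiff C (\<lambda>x. k) (\<lambda>_ _. 0)"
  by (rule tdiff_radial)

lemma tdiff_coord:
  fixes C :: "'c set"
  assumes "finite C" "a \<in> C"
  shows "tdiff C (\<lambda>x. x a *\<^sub>R u) (\<lambda>_ c. if c = a then u else 0)"
  unfolding tdiff_def
proof (intro allI impI)
  fix \<gamma> :: "real \<Rightarrow> 'c \<Rightarrow> real" and \<gamma>' :: "'c \<Rightarrow> real"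
  assume "\<forall>c\<in>C. ((\<lambda>t. \<gamma> t c) has_vector_derivative \<gamma>' c) (at 0)"
  then have "((\<lambda>t. \<gamma> t a) has_field_derivative \<gamma>' a) (at 0)"
    using assms by (simp add: has_real_derivative_iff_has_vector_derivative)
  then have "((\<lambda>t. \<gamma> t a *\<^sub>R u) has_vector_derivative \<gamma>' a *\<^sub>R u) (at 0)"
    using has_vector_derivative_scaleR[OF _ has_vector_derivative_const] by fastforce
  moreover have "(\<Sum>c\<in>C. \<gamma>' c *\<^sub>R (if c = a then u else 0)) = \<gamma>' a *\<^sub>R u"
    using assms by (simp add: if_distrib cong: if_cong)
  ultimately show "((\<lambda>t. \<gamma> t a *\<^sub>R u) has_vector_derivative (\<Sum>c\<in>C. \<gamma>' c *\<^sub>R (if c = a then u else 0))) (at 0)"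
    by simp
qed

lemma tdiff_add:
  assumes "tdiff C g dg" "tdiff C h dh"
  shows "tdiff C (\<lambda>x. g x + h x) (\<lambda>x c. dg x c + dh x c)"
  using assms unfolding tdiff_def
  by (auto simp: scaleR_add_right sum.distrib intro!: has_vector_derivative_add)

lemma tdiff_sum:
  assumes "\<And>i. i \<in> I \<Longrightarrow> tdiff C (g i) (dg i)"
  shows "tdiff C (\<lambda>x. \<Sum>i\<in>I. g i x) (\<lambda>x c. \<Sum>i\<in>I. dg i x c)"
  using assms
  by (induction I rule: infinite_finite_induct) (auto intro: tdiff_const tdiff_add)

lemma tdiff_mult:
  fixes g h :: "('c \<Rightarrow> real) \<Rightarrow> 'b::real_normed_algebra"
  assumes "tdiff C g dg" "tdiff C h dh"
  shows "tdiff C (\<lambda>x. g x * h x) (\<lambda>x c. dg x c * h x + g x * dh x c)"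
  unfolding tdiff_def
proof (intro allI impI)
  fix \<gamma> :: "real \<Rightarrow> 'c \<Rightarrow> real" and \<gamma>' :: "'c \<Rightarrow> real"
  assume "\<forall>t. \<gamma> t \<in> extensional C \<and> nrm C (\<gamma> t) = nrm C (\<gamma> 0)"
    and "\<forall>c\<in>C. ((\<lambda>t. \<gamma> t c) has_vector_derivative \<gamma>' c) (at 0)"
  then have "((\<lambda>t. g (\<gamma> t)) has_vector_derivative (\<Sum>c\<in>C. \<gamma>' c *\<^sub>R dg (\<gamma> 0) c)) (at 0)"
    "((\<lambda>t. h (\<gamma> t)) has_vector_derivative (\<Sum>c\<in>C. \<gamma>' c *\<^sub>R dh (\<gamma> 0) c)) (at 0)"
    using assms unfolding tdiff_def by blast+
  from has_vector_derivative_mult[OF this]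
  show "((\<lambda>t. g (\<gamma> t) * h (\<gamma> t)) has_vector_derivative
      (\<Sum>c\<in>C. \<gamma>' c *\<^sub>R (dg (\<gamma> 0) c * h (\<gamma> 0) + g (\<gamma> 0) * dh (\<gamma> 0) c))) (at 0)"
    by (simp add: scaleR_add_right sum.distrib sum_distrib_left sum_distrib_right add.commute)
qed

lemma tdiff_bounded_linear:
  fixes C :: "'c set"
  assumes "bounded_linear L" "tdiff C g dg"
  shows "tdiff C (\<lambda>x. L (g x)) (\<lambda>x c. L (dg x c))"
  unfolding tdiff_def
proof (intro allI impI)
  interpret L: bounded_linear L by fact
  fix \<gamma> :: "real \<Rightarrow> 'c \<Rightarrow> real" and \<gamma>' :: "'c \<Rightarrow> real"
  assume "\<forall>t. \<gamma> t \<in> extensional C \<and> nrm C (\<gamma> t) = nrm C (\<gamma> 0)"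
    and "\<forall>c\<in>C. ((\<lambda>t. \<gamma> t c) has_vector_derivative \<gamma>' c) (at 0)"
  then have "((\<lambda>t. g (\<gamma> t)) has_vector_derivative (\<Sum>c\<in>C. \<gamma>' c *\<^sub>R dg (\<gamma> 0) c)) (at 0)"
    using assms unfolding tdiff_def by blast
  from L.has_vector_derivative[OF this]
  show "((\<lambda>t. L (g (\<gamma> t))) has_vector_derivative (\<Sum>c\<in>C. \<gamma>' c *\<^sub>R L (dg (\<gamma> 0) c))) (at 0)"
    by (simp add: L.sum L.scaleR)
qed

lemma tdiff_compose:
  fixes C :: "'c set"
  assumes G: "\<And>x. (G has_derivative G' (g x)) (at (g x))" and g: "tdiff C g dg"
  shows "tdiff C (\<lambda>x. G (g x)) (\<lambda>x c. G' (g x) (dg x c))"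
  unfolding tdiff_def
proof (intro allI impI)
  fix \<gamma> :: "real \<Rightarrow> 'c \<Rightarrow> real" and \<gamma>' :: "'c \<Rightarrow> real"
  interpret L: bounded_linear "G' (g (\<gamma> 0))" by (rule has_derivative_bounded_linear[OF G])
  assume "\<forall>t. \<gamma> t \<in> extensional C \<and> nrm C (\<gamma> t) = nrm C (\<gamma> 0)"
    and "\<forall>c\<in>C. ((\<lambda>t. \<gamma> t c) has_vector_derivative \<gamma>' c) (at 0)"
  then have "((\<lambda>t. g (\<gamma> t)) has_vector_derivative (\<Sum>c\<in>C. \<gamma>' c *\<^sub>R dg (\<gamma> 0) c)) (at 0)"
    using g unfolding tdiff_def by blast
  from vector_derivative_diff_chain_within[OF this has_derivative_at_withinI[OF G]]
  show "((\<lambda>t. G (g (\<gamma> t))) has_vector_derivative (\<Sum>c\<in>C. \<gamma>' c *\<^sub>R G' (g (\<gamma> 0)) (dg (\<gamma> 0) c))) (at 0)"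
    by (simp add: L.sum L.scaleR o_def)
qed

lemma nrm_nonneg: "0 \<le> nrm C x"
  by (simp add: nrm_def sum_nonneg)

lemma nrm_sq: "(nrm C x)\<^sup>2 = (\<Sum>c\<in>C. (x c)\<^sup>2)"
  by (simp add: nrm_def sum_nonneg)

lemma coord_le_nrm: "finite C \<Longrightarrow> c \<in> C \<Longrightarrow> \<bar>x c\<bar> \<le> nrm C x"
  unfolding nrm_def by (rule real_le_rsqrt) (auto intro: member_le_sum)

lemma rot_rot: "a \<noteq> b \<Longrightarrow> rot a b u (rot a b t x) = rot a b (u + t) x"
  by (auto simp: rot_def fun_eq_iff cos_add sin_add algebra_simps)

lemma rot_0: "rot a b 0 x = x"
  by (auto simp: rot_def)

lemma rot_extensional: "a \<in> C \<Longrightarrow> b \<in> C \<Longrightarrow> x \<in> extensional C \<Longrightarrow> rot a b t x \<in> extensional C"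
  by (auto simp: rot_def extensional_def)

lemma nrm_rot:
  assumes "finite C" "a \<in> C" "b \<in> C" "a \<noteq> b"
  shows "nrm C (rot a b t x) = nrm C x"
proof -
  have C: "C = insert a (insert b (C - {a, b}))" using assms by auto
  have rest: "(\<Sum>c\<in>C - {a, b}. (rot a b t x c)\<^sup>2) = (\<Sum>c\<in>C - {a, b}. (x c)\<^sup>2)"
    by (intro sum.cong) (auto simp: rot_def)
  have id: "(p * X - q * Y)\<^sup>2 + (q * X + p * Y)\<^sup>2 = (p\<^sup>2 + q\<^sup>2) * (X\<^sup>2 + Y\<^sup>2)" for p q X Y :: real
    by (simp add: power2_eq_square algebra_simps)
  have "(cos t * x a - sin t * x b)\<^sup>2 + (sin t * x a + cos t * x b)\<^sup>2
      = ((cos t)\<^sup>2 + (sin t)\<^sup>2) * ((x a)\<^sup>2 + (x b)\<^sup>2)"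
    by (rule id)
  with rest have "(\<Sum>c\<in>C. (rot a b t x c)\<^sup>2) = (\<Sum>c\<in>C. (x c)\<^sup>2)"
    using assms by (subst (1 2) C) (simp add: rot_def)
  then show ?thesis by (simp add: nrm_def)
qed

lemma rot_derivative:
  assumes "a \<noteq> b"
  shows "((\<lambda>t. rot a b t x c) has_vector_derivative (if c = a then - x b else if c = b then x a else 0)) (at 0)"
  unfolding has_real_derivative_iff_has_vector_derivative[symmetric] rot_def
  using assms by (auto intro!: derivative_eq_intros)

text \<open>The law of the coordinates of a random matrix. Invariance is recorded for rotations of
  coordinate planes only, the ones that integration by parts differentiates along.\<close>

locale rot_inv = prob_space \<mu> for \<mu> :: "('c \<Rightarrow> real) measure" +
  fixes C :: "'c set"
  assumes fin: "finite C"
    and sets_mu: "sets \<mu> = sets (\<Pi>\<^sub>M c\<in>C. borel)"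
    and rot: "\<And>a b t. a \<in> C \<Longrightarrow> b \<in> C \<Longrightarrow> a \<noteq> b \<Longrightarrow> distr \<mu> \<mu> (rot a b t) = \<mu>"
    and moments: "\<And>k. integrable \<mu> (\<lambda>x. nrm C x ^ k)"
begin

lemma space_mu: "space \<mu> = extensional C"
  using sets_eq_imp_space_eq[OF sets_mu] by (simp add: space_PiM PiE_def)

lemma coord_measurable [measurable]: "c \<in> C \<Longrightarrow> (\<lambda>x. x c) \<in> borel_measurable \<mu>"
  unfolding measurable_cong_sets[OF sets_mu refl] by (rule measurable_component_singleton)

lemma nrm_measurable [measurable]: "nrm C \<in> borel_measurable \<mu>"
  unfolding nrm_def by measurable

lemma rot_measurable [measurable]:
  assumes "a \<in> C" "b \<in> C"
  shows "rot a b t \<in> \<mu> \<rightarrow>\<^sub>M \<mu>"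
  unfolding measurable_cong_sets[OF refl sets_mu]
proof (rule measurable_PiM_single')
  show "(\<lambda>x. rot a b t x c) \<in> borel_measurable \<mu>" if "c \<in> C" for c
    unfolding rot_def using assms that by (cases "c = b"; cases "c = a") auto
  show "rot a b t \<in> space \<mu> \<rightarrow> (\<Pi>\<^sub>E c\<in>C. space borel)"
    using rot_extensional[OF assms] by (auto simp: space_mu PiE_def)
qed

text \<open>Polynomial boundedness in the radius: a class closed under the algebraic operations and
  integrable because all radial moments are finite. It settles the integrability side conditions
  throughout.\<close>

definition pb :: "(('c \<Rightarrow> real) \<Rightarrow> 'b::real_normed_vector) \<Rightarrow> bool" where
  "pb g \<longleftrightarrow> g \<in> borel_measurable \<mu> \<and> (\<exists>B\<ge>0. \<exists>k. \<forall>x\<in>space \<mu>. norm (g x) \<le> B * (1 + nrm C x) ^ k)"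

lemma pbI: "g \<in> borel_measurable \<mu> \<Longrightarrow> 0 \<le> B \<Longrightarrow> (\<And>x. x \<in> space \<mu> \<Longrightarrow> norm (g x) \<le> B * (1 + nrm C x) ^ k) \<Longrightarrow> pb g"
  unfolding pb_def by blast

lemma pb_measurable: "pb g \<Longrightarrow> g \<in> borel_measurable \<mu>"
  by (simp add: pb_def)

lemma integrable_poly: "integrable \<mu> (\<lambda>x. (1 + nrm C x) ^ k)"
  unfolding add.commute[of 1] binomial_ring by (auto intro!: moments)

lemma pb_integrable:
  fixes g :: "_ \<Rightarrow> 'b::{banach, second_countable_topology}"
  assumes "pb g"
  shows "integrable \<mu> g"
proof -
  obtain B k where g: "g \<in> borel_measurable \<mu>" "0 \<le> B" "\<forall>x\<in>space \<mu>. norm (g x) \<le> B * (1 + nrm C x) ^ k"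
    using assms by (auto simp: pb_def)
  show ?thesis
  proof (rule Bochner_Integration.integrable_bound[of _ "\<lambda>x. B * (1 + nrm C x) ^ k"])
    show "integrable \<mu> (\<lambda>x. B * (1 + nrm C x) ^ k)" using integrable_poly by simp
    show "AE x in \<mu>. norm (g x) \<le> norm (B * (1 + nrm C x) ^ k)"
      using g by (auto simp: nrm_nonneg)
  qed (use g in auto)
qed

lemma pb_bound:
  assumes "pb (g :: _ \<Rightarrow> 'b::real_normed_vector)"
  obtains B k0 where "B \<ge> 0" "\<And>x k. x \<in> space \<mu> \<Longrightarrow> k0 \<le> k \<Longrightarrow> norm (g x) \<le> B * (1 + nrm C x) ^ k"
proof -
  obtain B k where g: "0 \<le> B" "\<forall>x\<in>space \<mu>. norm (g x) \<le> B * (1 + nrm C x) ^ k"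
    using assms by (auto simp: pb_def)
  have "norm (g x) \<le> B * (1 + nrm C x) ^ k'" if "x \<in> space \<mu>" "k \<le> k'" for x k'
    using g that nrm_nonneg[of C x]
    by (meson order_trans mult_left_mono power_increasing le_add_same_cancel1)
  then show ?thesis using that g(1) by blast
qed

lemma pb_dom:
  assumes "pb (h :: _ \<Rightarrow> 'd::real_normed_vector)" "g \<in> borel_measurable \<mu>" "\<And>x. x \<in> space \<mu> \<Longrightarrow> norm (g x) \<le> norm (h x)"
  shows "pb g"
  using assms unfolding pb_def by (meson order_trans)

lemma pb_const [intro, simp]: "pb (\<lambda>x. k)"
  by (rule pbI[of _ "norm k" 0]) auto

lemma pb_nrm [intro, simp]: "pb (nrm C)"
  by (rule pbI[of _ 1 1]) (auto simp: nrm_nonneg)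

lemma pb_coord [intro, simp]: "c \<in> C \<Longrightarrow> pb (\<lambda>x. x c)"
  by (rule pb_dom[OF pb_nrm]) (auto simp: nrm_nonneg coord_le_nrm[OF fin])

lemma pb_add [intro]:
  fixes g h :: "_ \<Rightarrow> 'b::{real_normed_vector, second_countable_topology}"
  assumes "pb g" "pb h"
  shows "pb (\<lambda>x. g x + h x)"
proof -
  obtain B1 k1 where 1: "B1 \<ge> 0" "\<And>x k. x \<in> space \<mu> \<Longrightarrow> k1 \<le> k \<Longrightarrow> norm (g x) \<le> B1 * (1 + nrm C x) ^ k"
    using pb_bound[OF assms(1)] by blast
  obtain B2 k2 where 2: "B2 \<ge> 0" "\<And>x k. x \<in> space \<mu> \<Longrightarrow> k2 \<le> k \<Longrightarrow> norm (h x) \<le> B2 * (1 + nrm C x) ^ k"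
    using pb_bound[OF assms(2)] by blast
  have [measurable]: "g \<in> borel_measurable \<mu>" "h \<in> borel_measurable \<mu>"
    using assms by (auto simp: pb_def)
  show ?thesis
  proof (rule pbI[where B = "B1 + B2" and k = "k1 + k2"])
    fix x assume x: "x \<in> space \<mu>"
    have "norm (g x + h x) \<le> norm (g x) + norm (h x)" by (rule norm_triangle_ineq)
    also have "\<dots> \<le> B1 * (1 + nrm C x) ^ (k1 + k2) + B2 * (1 + nrm C x) ^ (k1 + k2)"
      using x by (intro add_mono 1 2) auto
    finally show "norm (g x + h x) \<le> (B1 + B2) * (1 + nrm C x) ^ (k1 + k2)"
      by (simp add: distrib_right)
  qed (use 1 2 in auto)
qed

lemma pb_norm_mult:
  fixes k :: "_ \<Rightarrow> 'd::real_normed_vector"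
  assumes "pb g" "pb h" "k \<in> borel_measurable \<mu>" "\<And>x. x \<in> space \<mu> \<Longrightarrow> norm (k x) \<le> norm (g x) * norm (h x)"
  shows "pb k"
proof -
  obtain B1 k1 where 1: "B1 \<ge> 0" "\<And>x k. x \<in> space \<mu> \<Longrightarrow> k1 \<le> k \<Longrightarrow> norm (g x) \<le> B1 * (1 + nrm C x) ^ k"
    using pb_bound[OF assms(1)] by blast
  obtain B2 k2 where 2: "B2 \<ge> 0" "\<And>x k. x \<in> space \<mu> \<Longrightarrow> k2 \<le> k \<Longrightarrow> norm (h x) \<le> B2 * (1 + nrm C x) ^ k"
    using pb_bound[OF assms(2)] by blast
  show ?thesis
  proof (rule pbI[where B = "B1 * B2" and k = "k1 + k2"])
    fix x assume x: "x \<in> space \<mu>"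
    have "norm (g x) * norm (h x) \<le> (B1 * (1 + nrm C x) ^ k1) * (B2 * (1 + nrm C x) ^ k2)"
      using x 1 2 by (intro mult_mono) (auto simp: nrm_nonneg)
    then show "norm (k x) \<le> B1 * B2 * (1 + nrm C x) ^ (k1 + k2)"
      using assms(4)[OF x] by (simp add: power_add mult_ac)
  qed (use 1 2 assms in auto)
qed

lemma pb_mult [intro]:
  fixes g h :: "_ \<Rightarrow> 'b::{real_normed_algebra, second_countable_topology}"
  assumes "pb g" "pb h"
  shows "pb (\<lambda>x. g x * h x)"
  using assms by (intro pb_norm_mult[OF assms] borel_measurable_times) (auto simp: pb_def norm_mult_ineq)

lemma pb_scaleR [intro]:
  fixes h :: "_ \<Rightarrow> 'b::{real_normed_vector, second_countable_topology}"
  assumes "pb g" "pb h"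
  shows "pb (\<lambda>x. g x *\<^sub>R h x)"
  using assms by (intro pb_norm_mult[OF assms] borel_measurable_scaleR) (auto simp: pb_def)

lemma pb_sum [intro]:
  fixes g :: "_ \<Rightarrow> _ \<Rightarrow> 'b::{real_normed_vector, second_countable_topology}"
  assumes "\<And>i. i \<in> I \<Longrightarrow> pb (g i)"
  shows "pb (\<lambda>x. \<Sum>i\<in>I. g i x)"
  using assms by (induction I rule: infinite_finite_induct) auto

lemma pb_minus [intro]:
  fixes g :: "_ \<Rightarrow> 'b::{real_normed_vector, second_countable_topology}"
  assumes "pb g"
  shows "pb (\<lambda>x. - g x)"
  using pb_scaleR[OF pb_const[of "-1"] assms] by simp

lemma pb_diff [intro]:
  fixes g h :: "_ \<Rightarrow> 'b::{real_normed_vector, second_countable_topology}"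
  assumes "pb g" "pb h"
  shows "pb (\<lambda>x. g x - h x)"
  using pb_add[OF assms(1) pb_minus[OF assms(2)]] by simp

lemma pb_power [intro]:
  fixes g :: "_ \<Rightarrow> 'b::{real_normed_algebra_1, second_countable_topology}"
  assumes "pb g"
  shows "pb (\<lambda>x. g x ^ k)"
  by (induction k) (use assms in auto)

lemma pb_norm [intro]:
  fixes g :: "_ \<Rightarrow> 'b::{real_normed_vector, second_countable_topology}"
  assumes "pb g"
  shows "pb (\<lambda>x. norm (g x))"
  by (rule pb_dom[OF assms]) (use assms in \<open>auto simp: pb_def\<close>)

lemma pb_bounded_linear [intro]:
  fixes g :: "_ \<Rightarrow> 'b::{real_normed_vector, second_countable_topology}"
    and L :: "'b \<Rightarrow> 'd::{real_normed_vector, second_countable_topology}"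
  assumes "bounded_linear L" "pb g"
  shows "pb (\<lambda>x. L (g x))"
proof -
  have "L \<in> borel_measurable borel"
    using assms(1) by (intro borel_measurable_continuous_onI linear_continuous_on)
  then have "(\<lambda>x. L (g x)) \<in> borel_measurable \<mu>"
    using assms(2) by (auto simp: pb_def)
  moreover have "norm (L (g x)) \<le> norm (onorm L) * norm (g x)" for x
    using onorm[OF assms(1), of "g x"] onorm_pos_le[OF assms(1)] by simp
  ultimately show ?thesis
    by (rule pb_norm_mult[OF pb_const[of "onorm L"] assms(2)])
qed

lemma integral_rot:
  fixes h :: "_ \<Rightarrow> 'b::{banach, second_countable_topology}"
  assumes "a \<in> C" "b \<in> C" "a \<noteq> b" "h \<in> borel_measurable \<mu>"
  shows "(\<integral>x. h (rot a b t x) \<partial>\<mu>) = (\<integral>x. h x \<partial>\<mu>)"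
  using integral_distr[OF rot_measurable[OF assms(1,2), of t] assms(4)] rot[OF assms(1-3), of t] by simp

text \<open>The mean of \<open>g\<close> along the rotation is constant by invariance; its
  derivative at angle zero is the mean of the infinitesimal rotation applied to
  \<open>g\<close>.\<close>

lemma rotation_derivative_integral:
  fixes g :: "_ \<Rightarrow> 'b::{banach, second_countable_topology}"
  assumes ab: "a \<in> C" "b \<in> C" "a \<noteq> b"
    and g: "tdiff C g dg" "pb g" "\<And>c. c \<in> C \<Longrightarrow> pb (\<lambda>x. dg x c)"
  shows "(\<integral>x. x a *\<^sub>R dg x b - x b *\<^sub>R dg x a \<partial>\<mu>) = 0"
proof -
  define L where "L x = x a *\<^sub>R dg x b - x b *\<^sub>R dg x a" for x
  have pbL: "pb L" unfolding L_def using ab g by (intro pb_diff pb_scaleR) auto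
  then obtain B k where B: "B \<ge> 0" "\<And>x. x \<in> space \<mu> \<Longrightarrow> norm (L x) \<le> B * (1 + nrm C x) ^ k"
    using pb_bound by (metis order_refl)
  have rs: "rot a b t x \<in> space \<mu>" if "x \<in> space \<mu>" for t x
    using rot_extensional[OF ab(1,2)] that by (simp add: space_mu)
  have der: "((\<lambda>t. g (rot a b t x)) has_vector_derivative L (rot a b t x)) (at t)" if x: "x \<in> space \<mu>" for t x
  proof -
    define y where "y = rot a b t x"
    have y: "y \<in> extensional C" using rs[OF x] by (simp add: y_def space_mu)
    have "((\<lambda>u. g (rot a b u y)) has_vector_derivative
        (\<Sum>c\<in>C. (if c = a then - y b else if c = b then y a else 0) *\<^sub>R dg (rot a b 0 y) c)) (at 0)"
      using ab y by (intro tdiffD[OF g(1)] rot_derivative)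
        (auto simp: rot_extensional nrm_rot[OF fin])
    also have "(\<Sum>c\<in>C. (if c = a then - y b else if c = b then y a else 0) *\<^sub>R dg (rot a b 0 y) c)
        = (\<Sum>c\<in>{a, b}. (if c = a then - y b else if c = b then y a else 0) *\<^sub>R dg y c)"
      unfolding rot_0 using ab fin by (intro sum.mono_neutral_right) auto
    also have "\<dots> = L y" using ab by (simp add: L_def)
    finally have "((\<lambda>u. g (rot a b u y)) has_vector_derivative L y) (at 0)" .
    \<comment> \<open>The group law \<open>rot_rot\<close> transports the derivative from angle 0 to
      an arbitrary angle \<open>t\<close>.\<close>
    then show ?thesis
      unfolding has_vector_derivative_iff_quotient by (simp add: y_def rot_rot[OF ab(3)] rot_0 add.commute)
  qed
  have "((\<lambda>t. \<integral>x. g (rot a b t x) \<partial>\<mu>) has_vector_derivative (\<integral>x. L (rot a b 0 x) \<partial>\<mu>)) (at 0)"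
  proof (rule has_vector_derivative_integral(2))
    show "integrable \<mu> (\<lambda>x. g (rot a b t x))" for t
    proof -
      have "integrable (distr \<mu> \<mu> (rot a b t)) g"
        using pb_integrable[OF g(2)] rot[OF ab] by simp
      then show ?thesis
        using integrable_distr[OF rot_measurable[OF ab(1,2)]] by blast
    qed
    show "integrable \<mu> (\<lambda>x. B * (1 + nrm C x) ^ k)"
      using integrable_poly by simp
    show "norm (L (rot a b t x)) \<le> B * (1 + nrm C x) ^ k" if "x \<in> space \<mu>" for t x
      using B(2)[OF rs[OF that]] by (simp add: nrm_rot[OF fin ab])
  qed (rule der)
  moreover have "(\<lambda>t. \<integral>x. g (rot a b t x) \<partial>\<mu>) = (\<lambda>t. \<integral>x. g x \<partial>\<mu>)"
    using integral_rot[OF ab pb_measurable[OF g(2)]] by simp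
  ultimately have "((\<lambda>t::real. \<integral>x. g x \<partial>\<mu>) has_vector_derivative (\<integral>x. L x \<partial>\<mu>)) (at 0)"
    by (simp add: rot_0)
  then show ?thesis
    unfolding L_def using vector_derivative_unique_at[OF _ has_vector_derivative_const] by blast
qed

text \<open>Each plane spanned by \<open>a\<close> and another axis \<open>b\<close> gives one
  identity, and the \<open>card C - 1\<close> identities are added. The right side does not change
  when a multiple of \<open>x\<close> is added to the gradient, which is why an arbitrary radial
  factor can be given derivative zero.\<close>

lemma spherical_ibp:
  fixes g :: "_ \<Rightarrow> 'b::{real_normed_algebra_1, banach, second_countable_topology}"
  assumes a: "a \<in> C"
    and g: "tdiff C g dg" "pb g" "\<And>c. c \<in> C \<Longrightarrow> pb (\<lambda>x. dg x c)"
    and r: "pb (\<lambda>x. r (nrm C x) :: real)"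
  shows "(real (card C) - 1) *\<^sub>R (\<integral>x. r (nrm C x) *\<^sub>R (x a *\<^sub>R g x) \<partial>\<mu>)
    = (\<integral>x. r (nrm C x) *\<^sub>R ((nrm C x)\<^sup>2 *\<^sub>R dg x a - x a *\<^sub>R (\<Sum>c\<in>C. x c *\<^sub>R dg x c)) \<partial>\<mu>)"
proof -
  have one: "(\<integral>x. r (nrm C x) *\<^sub>R (x a *\<^sub>R g x) \<partial>\<mu>)
      = (\<integral>x. r (nrm C x) *\<^sub>R ((x b)\<^sup>2 *\<^sub>R dg x a - x a *\<^sub>R x b *\<^sub>R dg x b) \<partial>\<mu>)"
    if b: "b \<in> C" "b \<noteq> a" for b
  proof -
    \<comment> \<open>The factor \<open>x b\<close> is the choice that matters: its derivative along
      the rotation returns \<open>x a * g\<close>.\<close>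
    define h where "h x = r (nrm C x) *\<^sub>R 1 * (x b *\<^sub>R 1 * g x)" for x
    define dh where "dh x c = 0 * (x b *\<^sub>R 1 * g x)
       + r (nrm C x) *\<^sub>R 1 * ((if c = b then 1 else 0) * g x + x b *\<^sub>R 1 * dg x c)" for x c
    have "tdiff C h dh"
      unfolding h_def dh_def by (intro tdiff_mult tdiff_radial tdiff_coord fin b g)
    moreover have "pb h" unfolding h_def using b g r by (intro pb_mult pb_scaleR) auto
    moreover have "pb (\<lambda>x. dh x c)" if "c \<in> C" for c
      unfolding dh_def using b g r that by (intro pb_add pb_mult pb_scaleR) auto
    ultimately have "(\<integral>x. x a *\<^sub>R dh x b - x b *\<^sub>R dh x a \<partial>\<mu>) = 0"
      using a b by (intro rotation_derivative_integral[of a b h]) auto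
    also have "(\<lambda>x. x a *\<^sub>R dh x b - x b *\<^sub>R dh x a) = (\<lambda>x. r (nrm C x) *\<^sub>R (x a *\<^sub>R g x)
       - r (nrm C x) *\<^sub>R ((x b)\<^sup>2 *\<^sub>R dg x a - x a *\<^sub>R x b *\<^sub>R dg x b))"
      using b by (auto simp: dh_def algebra_simps power2_eq_square)
    finally show ?thesis
      using a b g r by (subst (asm) Bochner_Integration.integral_diff)
        (auto intro!: pb_integrable pb_scaleR pb_diff)
  qed
  have "(real (card C) - 1) *\<^sub>R (\<integral>x. r (nrm C x) *\<^sub>R (x a *\<^sub>R g x) \<partial>\<mu>)
      = (\<Sum>b\<in>C - {a}. \<integral>x. r (nrm C x) *\<^sub>R (x a *\<^sub>R g x) \<partial>\<mu>)"
    using a fin card_Diff_singleton[OF a] card_gt_0_iff[of C] by (auto simp: sum_constant_scaleR of_nat_diff Suc_leI simp del: sum_constant)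
  also have "\<dots> = (\<Sum>b\<in>C - {a}. \<integral>x. r (nrm C x) *\<^sub>R ((x b)\<^sup>2 *\<^sub>R dg x a - x a *\<^sub>R x b *\<^sub>R dg x b) \<partial>\<mu>)"
    using one by (intro sum.cong) auto
  \<comment> \<open>The summand for \<open>b = a\<close> is zero, so it may be included to complete
    the sum of squares to \<open>nrm C x\<close> squared.\<close>
  also have "\<dots> = (\<Sum>b\<in>C. \<integral>x. r (nrm C x) *\<^sub>R ((x b)\<^sup>2 *\<^sub>R dg x a - x a *\<^sub>R x b *\<^sub>R dg x b) \<partial>\<mu>)"
    using a fin by (intro sum.mono_neutral_left) (auto simp: power2_eq_square)
  also have "\<dots> = (\<integral>x. (\<Sum>b\<in>C. r (nrm C x) *\<^sub>R ((x b)\<^sup>2 *\<^sub>R dg x a - x a *\<^sub>R x b *\<^sub>R dg x b)) \<partial>\<mu>)"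
    using a g r by (intro Bochner_Integration.integral_sum[symmetric] pb_integrable pb_scaleR pb_diff) auto
  also have "\<dots> = (\<integral>x. r (nrm C x) *\<^sub>R ((nrm C x)\<^sup>2 *\<^sub>R dg x a - x a *\<^sub>R (\<Sum>c\<in>C. x c *\<^sub>R dg x c)) \<partial>\<mu>)"
    by (simp add: nrm_sq scaleR_sum_left scaleR_sum_right sum_subtractf scaleR_diff_right)
  finally show ?thesis .
qed

end

section \<open>Traces of words: derivatives, contractions, cutting and joining\<close>

section \<open>Words in a matrix and its adjoint\<close>

text \<open>
  A point \<open>x\<close> holds the real coordinates of an \<open>n\<close> by \<open>n\<close> matrix \<open>Z\<close>: the coordinate
  \<open>((i, j), k)\<close> is the real part of \<open>Z\<^sub>i\<^sub>j\<close> for \<open>k = True\<close> and its imaginary part for \<open>k = False\<close>;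
  \<open>K = {True}\<close> for real matrices and \<open>K = UNIV\<close> for complex ones.
  In a word, \<open>True\<close> stands for \<open>Z\<close> and \<open>False\<close> for its adjoint.
\<close>

type_synonym pt = "(nat \<times> nat) \<times> bool \<Rightarrow> real"

definition ix :: "nat \<Rightarrow> bool set \<Rightarrow> ((nat \<times> nat) \<times> bool) set" where
  "ix n K = ({..<n} \<times> {..<n}) \<times> K"

text \<open>The coefficient of the real coordinate of kind \<open>k\<close> in an entry of the
  letter \<open>b\<close>; the sign of the imaginary unit distinguishes an entry from its
  conjugate.\<close>

definition uc :: "bool \<Rightarrow> bool \<Rightarrow> complex" where
  "uc b k = (if k then 1 else if b then \<i> else - \<i>)"

definition pos :: "bool \<Rightarrow> nat \<Rightarrow> nat \<Rightarrow> nat \<times> nat" where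
  "pos b i j = (if b then (i, j) else (j, i))"

definition ltr :: "bool set \<Rightarrow> bool \<Rightarrow> nat \<Rightarrow> nat \<Rightarrow> pt \<Rightarrow> complex" where
  "ltr K b i j x = (\<Sum>k\<in>K. x (pos b i j, k) *\<^sub>R uc b k)"

definition dltr :: "bool set \<Rightarrow> bool \<Rightarrow> nat \<Rightarrow> nat \<Rightarrow> (nat \<times> nat) \<times> bool \<Rightarrow> complex" where
  "dltr K b i j c = (\<Sum>k\<in>K. if c = (pos b i j, k) then uc b k else 0)"

fun wd :: "nat \<Rightarrow> bool set \<Rightarrow> bool list \<Rightarrow> nat \<Rightarrow> nat \<Rightarrow> pt \<Rightarrow> complex" where
  "wd n K [] i j x = (if i = j then 1 else 0)"
| "wd n K (b # w) i j x = (\<Sum>k<n. ltr K b i k x * wd n K w k j x)"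

fun dwd :: "nat \<Rightarrow> bool set \<Rightarrow> bool list \<Rightarrow> nat \<Rightarrow> nat \<Rightarrow> pt \<Rightarrow> (nat \<times> nat) \<times> bool \<Rightarrow> complex" where
  "dwd n K [] i j x c = 0"
| "dwd n K (b # w) i j x c = (\<Sum>k<n. dltr K b i k c * wd n K w k j x + ltr K b i k x * dwd n K w k j x c)"

definition tr :: "nat \<Rightarrow> bool set \<Rightarrow> bool list \<Rightarrow> pt \<Rightarrow> complex" where
  "tr n K w x = (\<Sum>i<n. wd n K w i i x)"

definition dtr :: "nat \<Rightarrow> bool set \<Rightarrow> bool list \<Rightarrow> pt \<Rightarrow> (nat \<times> nat) \<times> bool \<Rightarrow> complex" where
  "dtr n K w x c = (\<Sum>i<n. dwd n K w i i x c)"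

definition adj :: "bool list \<Rightarrow> bool list" where
  "adj w = rev (map Not w)"

text \<open>The contraction that appears when a letter is expanded in real coordinates and each
  coordinate is integrated by parts. For complex matrices and \<open>b = True\<close> it is d/dRe +
  i d/dIm in the entry (i, j), twice the derivative by the conjugate entry.\<close>

definition con :: "bool set \<Rightarrow> bool \<Rightarrow> nat \<Rightarrow> nat \<Rightarrow> ((nat \<times> nat) \<times> bool \<Rightarrow> complex) \<Rightarrow> complex" where
  "con K b i j d = (\<Sum>k\<in>K. uc b k * d (pos b i j, k))"

text \<open>\<open>ep\<close> and \<open>kp\<close> are the weights of the contraction of two equal
  and of two opposite letters, as \<open>con_dltr\<close> shows.\<close>

definition ep :: "bool set \<Rightarrow> complex" where
  "ep K = (if K = {True} then 1 else 0)"

definition kp :: "bool set \<Rightarrow> complex" where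
  "kp K = of_nat (card K)"

text \<open>The ways to single out one letter of the second argument, with what stands to its left
  and to its right. The first argument accumulates on the left, which inductions over the second
  argument require.\<close>

fun splits :: "bool list \<Rightarrow> bool list \<Rightarrow> (bool list \<times> bool \<times> bool list) list" where
  "splits v [] = []"
| "splits v (b # w) = (v, b, w) # splits (v @ [b]) w"

lemma ep_real [simp]: "ep {True} = 1" and ep_complex [simp]: "ep UNIV = 0"
  and kp_real [simp]: "kp {True} = 1" and kp_complex [simp]: "kp UNIV = 2"
proof -
  have "(UNIV :: bool set) \<noteq> {True}" by blast
  then show "ep UNIV = 0" by (simp add: ep_def)
qed (simp_all add: ep_def kp_def)

lemma finite_ix [simp]: "finite (ix n K)"
  by (simp add: ix_def)

lemma pos_ix: "i < n \<Longrightarrow> j < n \<Longrightarrow> k \<in> K \<Longrightarrow> (pos b i j, k) \<in> ix n K"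
  by (simp add: ix_def pos_def)

lemma card_ix: "card (ix n K) = n * n * card K"
  by (simp add: ix_def card_cartesian_product)

lemma wd_append:
  "i < n \<Longrightarrow> wd n K (u @ v) i j x = (\<Sum>k<n. wd n K u i k x * wd n K v k j x)"
proof (induction u arbitrary: i)
  case Nil
  have "(\<Sum>k<n. wd n K [] i k x * wd n K v k j x) = (\<Sum>k<n. if k = i then wd n K v k j x else 0)"
    by (intro sum.cong) auto
  then show ?case using Nil by simp
next
  case (Cons b u)
  have "wd n K ((b # u) @ v) i j x = (\<Sum>l<n. \<Sum>k<n. ltr K b i l x * (wd n K u l k x * wd n K v k j x))"
    using Cons.IH by (simp add: sum_distrib_left)
  also have "\<dots> = (\<Sum>k<n. \<Sum>l<n. ltr K b i l x * (wd n K u l k x * wd n K v k j x))"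
    by (rule sum.swap)
  finally show ?case by (simp add: sum_distrib_right mult.assoc)
qed

lemma wd_single: "j < n \<Longrightarrow> wd n K [b] i j x = ltr K b i j x"
proof -
  assume "j < n"
  then show ?thesis
    by (simp add: if_distrib cong: if_cong)
qed

lemma tr_append: "tr n K (u @ v) x = (\<Sum>i<n. \<Sum>j<n. wd n K u i j x * wd n K v j i x)"
  by (simp add: tr_def wd_append)

lemma tr_Nil [simp]: "tr n K [] x = of_nat n"
  by (simp add: tr_def)

lemma cnj_ltr: "cnj (ltr K b i j x) = ltr K (\<not> b) j i x"
  by (auto simp: ltr_def pos_def uc_def cnj_sum intro!: sum.cong)

lemma ltr_real: "K = {True} \<Longrightarrow> ltr K (\<not> b) j i x = ltr K b i j x"
  by (auto simp: ltr_def pos_def uc_def)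

lemma adj_Cons: "adj (b # w) = adj w @ [\<not> b]"
  by (simp add: adj_def)

lemma adj_Nil [simp]: "adj [] = []"
  by (simp add: adj_def)

lemma length_adj [simp]: "length (adj w) = length w"
  by (simp add: adj_def)

lemma adj_replicate [simp]: "adj (replicate k b) = replicate k (\<not> b)"
  by (simp add: adj_def)

lemma wd_adj:
  "i < n \<Longrightarrow> j < n \<Longrightarrow> wd n K (adj w) j i x = cnj (wd n K w i j x)"
proof (induction w arbitrary: i)
  case (Cons b w)
  show ?case
    using Cons.prems by (simp add: adj_Cons wd_append wd_single Cons.IH cnj_sum cnj_ltr mult.commute del: wd.simps(2))
      (simp add: cnj_sum cnj_ltr mult.commute)
qed simp

lemma tr_adj: "tr n K (adj w) x = cnj (tr n K w x)"
  by (simp add: tr_def wd_adj cnj_sum)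

text \<open>For real matrices the adjoint is the transpose, so a word read backwards with letters
  exchanged has the transposed entries. This turns index patterns produced by equal letters into
  products of words.\<close>

lemma wd_real: 
  assumes "K = {True}" "i < n" "j < n"
  shows "wd n K (adj w) j i x = wd n K w i j x"
  using assms(2,3)
proof (induction w arbitrary: i)
  case (Cons b w)
  have "wd n K (adj (b # w)) j i x = (\<Sum>k<n. wd n K w k j x * ltr K (\<not> b) k i x)"
    using Cons by (simp add: adj_Cons wd_append wd_single del: wd.simps)
  then show ?case by (simp add: ltr_real[OF assms(1)] mult.commute)
qed simp

lemma tdiff_ltr: "i < n \<Longrightarrow> j < n \<Longrightarrow> tdiff (ix n K) (ltr K b i j) (\<lambda>_. dltr K b i j)"
  unfolding ltr_def dltr_def by (intro tdiff_sum tdiff_coord) (auto intro: pos_ix)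

lemma tdiff_wd: "i < n \<Longrightarrow> tdiff (ix n K) (wd n K w i j) (dwd n K w i j)"
proof (induction w arbitrary: i)
  case Nil
  then show ?case by (simp add: tdiff_const fun_eq_iff del: if_split_eq1 flip: wd.simps) (simp add: tdiff_const)
next
  case (Cons b w)
  show ?case
    unfolding wd.simps(2)[abs_def] dwd.simps(2)[abs_def]
    using Cons by (intro tdiff_sum tdiff_mult tdiff_ltr) auto
qed

lemma tdiff_tr: "tdiff (ix n K) (tr n K w) (dtr n K w)"
  unfolding tr_def[abs_def] dtr_def[abs_def] by (intro tdiff_sum tdiff_wd) auto

lemma cnj_dltr: "cnj (dltr K b i j c) = dltr K (\<not> b) j i c"
  by (auto simp: dltr_def pos_def uc_def cnj_sum intro!: sum.cong)

lemma euler_ltr: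
  assumes "finite K" "i < n" "j < n"
  shows "(\<Sum>c\<in>ix n K. x c *\<^sub>R dltr K b i j c) = ltr K b i j x"
proof -
  have "(\<Sum>c\<in>ix n K. x c *\<^sub>R dltr K b i j c)
      = (\<Sum>k\<in>K. \<Sum>c\<in>ix n K. if c = (pos b i j, k) then x c *\<^sub>R uc b k else 0)"
    unfolding dltr_def scaleR_sum_right by (subst sum.swap) (auto intro!: sum.cong)
  also have "\<dots> = ltr K b i j x"
    unfolding ltr_def by (intro sum.cong refl) (simp add: pos_ix assms)
  finally show ?thesis .
qed

lemma euler_wd:
  assumes "finite K" "i < n" "j < n"
  shows "(\<Sum>c\<in>ix n K. x c *\<^sub>R dwd n K w i j x c) = of_nat (length w) * wd n K w i j x"
  using assms(2)
proof (induction w arbitrary: i)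
  case (Cons b w)
  have "(\<Sum>c\<in>ix n K. x c *\<^sub>R dwd n K (b # w) i j x c)
      = (\<Sum>k<n. \<Sum>c\<in>ix n K. (x c *\<^sub>R dltr K b i k c) * wd n K w k j x + ltr K b i k x * (x c *\<^sub>R dwd n K w k j x c))"
    unfolding dwd.simps scaleR_sum_right by (subst sum.swap) (simp add: scaleR_add_right)
  also have "\<dots> = (\<Sum>k<n. (\<Sum>c\<in>ix n K. x c *\<^sub>R dltr K b i k c) * wd n K w k j x
      + ltr K b i k x * (\<Sum>c\<in>ix n K. x c *\<^sub>R dwd n K w k j x c))"
    by (simp add: sum.distrib sum_distrib_left sum_distrib_right)
  also have "\<dots> = (\<Sum>k<n. ltr K b i k x * wd n K w k j x + ltr K b i k x * (of_nat (length w) * wd n K w k j x))"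
    using Cons assms(1) by (intro sum.cong) (auto simp: euler_ltr)
  finally show ?case
    by (simp add: sum_distrib_left algebra_simps sum.distrib)
qed simp

lemma euler_tr:
  assumes "finite K"
  shows "(\<Sum>c\<in>ix n K. x c *\<^sub>R dtr n K w x c) = of_nat (length w) * tr n K w x"
proof -
  have "(\<Sum>c\<in>ix n K. x c *\<^sub>R dtr n K w x c) = (\<Sum>i<n. \<Sum>c\<in>ix n K. x c *\<^sub>R dwd n K w i i x c)"
    unfolding dtr_def scaleR_sum_right by (rule sum.swap)
  then show ?thesis by (simp add: euler_wd[OF assms] tr_def sum_distrib_left)
qed

lemma con_add: "con K b i j (\<lambda>c. d c + e c) = con K b i j d + con K b i j e"
  by (simp add: con_def distrib_left sum.distrib)

lemma con_cmult: "con K b i j (\<lambda>c. a * d c) = a * con K b i j d"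
  by (simp add: con_def sum_distrib_left mult.left_commute)

lemma con_cmult_right: "con K b i j (\<lambda>c. d c * a) = con K b i j d * a"
  by (simp add: con_def sum_distrib_right mult.assoc)

lemma con_sum: "con K b i j (\<lambda>c. \<Sum>l\<in>I. d l c) = (\<Sum>l\<in>I. con K b i j (d l))"
  unfolding con_def sum_distrib_left by (rule sum.swap)

text \<open>All of the difference between the two fields is here. In the complex case d/dRe + i
  d/dIm annihilates z and sends its conjugate to 2; in the real case a matrix and its transpose both
  contribute 1, with different index patterns.\<close>

lemma con_dltr:
  assumes K: "K = {True} \<or> K = UNIV"
  shows "con K b i j (dltr K b' q k) = (if b = b' then if i = q \<and> j = k then ep K else 0
    else if i = k \<and> j = q then kp K else 0)"
proof -
  have finK: "finite K" by simp
  have "dltr K b' q k (pos b i j, k1) = (if pos b i j = pos b' q k then uc b' k1 else 0)" if "k1 \<in> K" for k1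
  proof (cases "pos b i j = pos b' q k")
    case True
    then have "dltr K b' q k (pos b i j, k1) = (\<Sum>k2\<in>K. if k1 = k2 then uc b' k2 else 0)"
      by (simp add: dltr_def)
    then show ?thesis using that finK True by simp
  qed (simp add: dltr_def)
  then have "con K b i j (dltr K b' q k) = (\<Sum>k1\<in>K. uc b k1 * (if pos b i j = pos b' q k then uc b' k1 else 0))"
    unfolding con_def by (intro sum.cong) auto
  also have "\<dots> = (if pos b i j = pos b' q k then \<Sum>k1\<in>K. uc b k1 * uc b' k1 else 0)"
    by simp
  also have "(\<Sum>k1\<in>K. uc b k1 * uc b' k1) = (if b = b' then ep K else kp K)"
    using K
  proof
    assume K: "K = {True}"
    show ?thesis by (cases b; cases b') (simp_all add: K uc_def)
  next
    assume K: "K = UNIV"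
    have "(\<Sum>k1\<in>K. uc b k1 * uc b' k1) = uc b True * uc b' True + uc b False * uc b' False"
      unfolding K UNIV_bool by simp
    then show ?thesis by (cases b; cases b') (simp_all add: K uc_def)
  qed
  finally show ?thesis
    by (cases b; cases b') (simp_all add: pos_def conj_commute)
qed

lemma con_dwd_Cons:
  "con K b i j (dwd n K (b' # w) q l x)
    = (\<Sum>k<n. con K b i j (dltr K b' q k) * wd n K w k l x) + (\<Sum>k<n. ltr K b' q k x * con K b i j (dwd n K w k l x))"
  unfolding dwd.simps(2)[abs_def] by (simp add: con_sum con_add con_cmult con_cmult_right sum.distrib)

lemma wd_snoc: "j < n \<Longrightarrow> k < n \<Longrightarrow> wd n K (v @ [b]) j k x = (\<Sum>q<n. wd n K v j q x * ltr K b q k x)"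
  by (simp add: wd_append wd_single del: wd.simps)

lemma ep_cases: "ep K = 0 \<or> K = {True}"
  by (simp add: ep_def)

lemma sum_delta_pair:
  fixes A W :: "nat \<Rightarrow> 'a::comm_semiring_1"
  assumes "i < n" "j < n"
  shows "(\<Sum>q<n. A q * (\<Sum>k<n. (if i = q \<and> j = k then e else 0) * W k)) = e * (A i * W j)"
proof -
  have "(\<Sum>k<n. (if i = q \<and> j = k then e else 0) * W k) = (if q = i then e * W j else 0)" for q
  proof -
    have "(\<Sum>k<n. (if i = q \<and> j = k then e else 0) * W k)
        = (\<Sum>k<n. if k = j then (if q = i then e * W k else 0) else 0)"
      by (intro sum.cong) auto
    then show ?thesis using assms by simp
  qed
  then have "(\<Sum>q<n. A q * (\<Sum>k<n. (if i = q \<and> j = k then e else 0) * W k))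
      = (\<Sum>q<n. if q = i then A q * (e * W j) else 0)"
    by (intro sum.cong refl) (simp only:, simp)
  also have "\<dots> = e * (A i * W j)"
    using assms by (simp add: mult_ac)
  finally show ?thesis .
qed

lemma sum_delta_pair':
  fixes A W :: "nat \<Rightarrow> 'a::comm_semiring_1"
  assumes "i < n" "j < n"
  shows "(\<Sum>q<n. A q * (\<Sum>k<n. (if i = k \<and> j = q then e else 0) * W k)) = e * (A j * W i)"
proof -
  have "(\<Sum>q<n. A q * (\<Sum>k<n. (if i = k \<and> j = q then e else 0) * W k))
      = (\<Sum>q<n. A q * (\<Sum>k<n. (if j = q \<and> i = k then e else 0) * W k))"
    by (intro sum.cong refl arg_cong[of _ _ "\<lambda>y. _ * y"]) auto
  then show ?thesis
    by (simp only: sum_delta_pair[OF assms(2,1)])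
qed

text \<open>Contracting at a letter of \<open>v\<close> cuts the word there. Opposite letters close
  both pieces into traces, which raises the number of traces; equal letters, which count only for
  real matrices, glue the left piece to the reversed right piece. The prefix \<open>v0\<close> is
  there for the induction on \<open>v\<close>.\<close>

lemma con_wd_sum:
  assumes K: "K = {True} \<or> K = UNIV"
  shows "(\<Sum>i<n. \<Sum>j<n. \<Sum>q<n. wd n K v0 j q x * con K b i j (dwd n K v q i x))
    = (\<Sum>(v1, b', v2)\<leftarrow>splits v0 v. if b = b' then ep K * tr n K (v1 @ adj v2) x else kp K * (tr n K v1 x * tr n K v2 x))"
proof (induction v arbitrary: v0)
  case Nil
  then show ?case by (simp add: con_def)
next
  case (Cons b' w)
  have A: "(\<Sum>i<n. \<Sum>j<n. \<Sum>q<n. wd n K v0 j q x * (\<Sum>k<n. con K b i j (dltr K b' q k) * wd n K w k i x))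
      = (if b = b' then ep K * tr n K (v0 @ adj w) x else kp K * (tr n K v0 x * tr n K w x))"
  proof (cases "b = b'")
    case True
    have "(\<Sum>q<n. wd n K v0 j q x * (\<Sum>k<n. con K b i j (dltr K b' q k) * wd n K w k i x))
        = ep K * (wd n K v0 j i x * wd n K (adj w) i j x)" if "i < n" "j < n" for i j
    proof -
      have "(\<Sum>q<n. wd n K v0 j q x * (\<Sum>k<n. con K b i j (dltr K b' q k) * wd n K w k i x))
          = ep K * (wd n K v0 j i x * wd n K w j i x)"
        unfolding con_dltr[OF K] using True that by (simp add: sum_delta_pair)
      \<comment> \<open>Either \<open>ep K\<close> is zero or the matrix is real and
        \<open>wd_real\<close> swaps the indices.\<close>
      also have "\<dots> = ep K * (wd n K v0 j i x * wd n K (adj w) i j x)"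
        using ep_cases[of K] that by (auto simp: wd_real)
      finally show ?thesis .
    qed
    then have "(\<Sum>i<n. \<Sum>j<n. \<Sum>q<n. wd n K v0 j q x * (\<Sum>k<n. con K b i j (dltr K b' q k) * wd n K w k i x))
        = (\<Sum>i<n. \<Sum>j<n. ep K * (wd n K v0 j i x * wd n K (adj w) i j x))"
      by simp
    also have "\<dots> = (\<Sum>j<n. \<Sum>i<n. ep K * (wd n K v0 j i x * wd n K (adj w) i j x))"
      by (rule sum.swap)
    finally show ?thesis using True by (simp add: tr_append sum_distrib_left)
  next
    case False
    have "(\<Sum>q<n. wd n K v0 j q x * (\<Sum>k<n. con K b i j (dltr K b' q k) * wd n K w k i x))
        = kp K * (wd n K v0 j j x * wd n K w i i x)" if "i < n" "j < n" for i j
      unfolding con_dltr[OF K] using False that by (simp add: sum_delta_pair')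
    then have "(\<Sum>i<n. \<Sum>j<n. \<Sum>q<n. wd n K v0 j q x * (\<Sum>k<n. con K b i j (dltr K b' q k) * wd n K w k i x))
        = (\<Sum>i<n. \<Sum>j<n. kp K * (wd n K v0 j j x * wd n K w i i x))"
      by simp
    also have "\<dots> = kp K * (tr n K v0 x * tr n K w x)"
      by (simp add: tr_def sum_product mult.commute sum_distrib_left)
    finally show ?thesis using False by simp
  qed
  have B: "(\<Sum>i<n. \<Sum>j<n. \<Sum>q<n. wd n K v0 j q x * (\<Sum>k<n. ltr K b' q k x * con K b i j (dwd n K w k i x)))
      = (\<Sum>i<n. \<Sum>j<n. \<Sum>k<n. wd n K (v0 @ [b']) j k x * con K b i j (dwd n K w k i x))"
  proof (rule sum.cong[OF refl], rule sum.cong[OF refl])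
    fix i j assume "j \<in> {..<n}"
    then have "(\<Sum>k<n. wd n K (v0 @ [b']) j k x * con K b i j (dwd n K w k i x))
        = (\<Sum>k<n. \<Sum>q<n. wd n K v0 j q x * (ltr K b' q k x * con K b i j (dwd n K w k i x)))"
      by (intro sum.cong) (auto simp: wd_snoc sum_distrib_right mult.assoc)
    also have "\<dots> = (\<Sum>q<n. \<Sum>k<n. wd n K v0 j q x * (ltr K b' q k x * con K b i j (dwd n K w k i x)))"
      by (rule sum.swap)
    finally show "(\<Sum>q<n. wd n K v0 j q x * (\<Sum>k<n. ltr K b' q k x * con K b i j (dwd n K w k i x)))
        = (\<Sum>k<n. wd n K (v0 @ [b']) j k x * con K b i j (dwd n K w k i x))"
      by (simp add: sum_distrib_left)
  qed
  show ?case
    unfolding con_dwd_Cons distrib_left sum.distrib A B Cons.IH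
    by (simp only: splits.simps list.map sum_list.Cons prod.case)
qed

text \<open>The same computation when the derivative falls on another trace: removing a letter from
  the cyclic word \<open>u\<close> opens it at that place, and the rest is joined to
  \<open>v\<close> in the cyclic order right piece, left piece.\<close>

lemma con_trace_sum:
  assumes K: "K = {True} \<or> K = UNIV"
  shows "(\<Sum>i<n. \<Sum>j<n. wd n K v j i x * (\<Sum>q<n. \<Sum>r<n. wd n K u0 q r x * con K b i j (dwd n K u r q x)))
    = (\<Sum>(u1, b', u2)\<leftarrow>splits u0 u. if b = b' then ep K * tr n K (v @ adj (u2 @ u1)) x else kp K * tr n K (v @ u2 @ u1) x)"
proof (induction u arbitrary: u0)
  case Nil
  then show ?case by (simp add: con_def)
next
  case (Cons b' w)
  have A: "(\<Sum>i<n. \<Sum>j<n. wd n K v j i x * (\<Sum>q<n. \<Sum>r<n. wd n K u0 q r x * (\<Sum>k<n. con K b i j (dltr K b' r k) * wd n K w k q x)))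
      = (if b = b' then ep K * tr n K (v @ adj (w @ u0)) x else kp K * tr n K (v @ w @ u0) x)"
  proof (cases "b = b'")
    case True
    have "(\<Sum>q<n. \<Sum>r<n. wd n K u0 q r x * (\<Sum>k<n. con K b i j (dltr K b' r k) * wd n K w k q x))
        = ep K * wd n K (adj (w @ u0)) i j x" if "i < n" "j < n" for i j
    proof -
      have "(\<Sum>q<n. \<Sum>r<n. wd n K u0 q r x * (\<Sum>k<n. con K b i j (dltr K b' r k) * wd n K w k q x))
          = ep K * wd n K (w @ u0) j i x"
        unfolding con_dltr[OF K] using True that
        by (simp add: sum_delta_pair) (simp add: wd_append sum_distrib_left mult_ac)
      also have "\<dots> = ep K * wd n K (adj (w @ u0)) i j x"
        using ep_cases[of K] that by (auto simp: wd_real)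
      finally show ?thesis .
    qed
    then have "(\<Sum>i<n. \<Sum>j<n. wd n K v j i x * (\<Sum>q<n. \<Sum>r<n. wd n K u0 q r x * (\<Sum>k<n. con K b i j (dltr K b' r k) * wd n K w k q x)))
        = (\<Sum>i<n. \<Sum>j<n. wd n K v j i x * (ep K * wd n K (adj (w @ u0)) i j x))"
      by simp
    also have "\<dots> = (\<Sum>j<n. \<Sum>i<n. wd n K v j i x * (ep K * wd n K (adj (w @ u0)) i j x))"
      by (rule sum.swap)
    finally show ?thesis using True by (simp add: tr_append sum_distrib_left mult_ac)
  next
    case False
    have "(\<Sum>q<n. \<Sum>r<n. wd n K u0 q r x * (\<Sum>k<n. con K b i j (dltr K b' r k) * wd n K w k q x))
        = kp K * wd n K (w @ u0) i j x" if "i < n" "j < n" for i j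
      unfolding con_dltr[OF K] using False that
      by (simp add: sum_delta_pair') (simp add: wd_append sum_distrib_left mult_ac)
    then have "(\<Sum>i<n. \<Sum>j<n. wd n K v j i x * (\<Sum>q<n. \<Sum>r<n. wd n K u0 q r x * (\<Sum>k<n. con K b i j (dltr K b' r k) * wd n K w k q x)))
        = (\<Sum>i<n. \<Sum>j<n. wd n K v j i x * (kp K * wd n K (w @ u0) i j x))"
      by simp
    also have "\<dots> = (\<Sum>j<n. \<Sum>i<n. wd n K v j i x * (kp K * wd n K (w @ u0) i j x))"
      by (rule sum.swap)
    finally show ?thesis using False by (simp add: tr_append sum_distrib_left mult_ac)
  qed
  have B: "(\<Sum>q<n. \<Sum>r<n. wd n K u0 q r x * (\<Sum>k<n. ltr K b' r k x * con K b i j (dwd n K w k q x)))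
      = (\<Sum>q<n. \<Sum>k<n. wd n K (u0 @ [b']) q k x * con K b i j (dwd n K w k q x))" for i j
  proof (rule sum.cong[OF refl])
    fix q assume "q \<in> {..<n}"
    then have "(\<Sum>k<n. wd n K (u0 @ [b']) q k x * con K b i j (dwd n K w k q x))
        = (\<Sum>k<n. \<Sum>r<n. wd n K u0 q r x * (ltr K b' r k x * con K b i j (dwd n K w k q x)))"
      by (intro sum.cong) (auto simp: wd_snoc sum_distrib_right mult.assoc)
    also have "\<dots> = (\<Sum>r<n. \<Sum>k<n. wd n K u0 q r x * (ltr K b' r k x * con K b i j (dwd n K w k q x)))"
      by (rule sum.swap)
    finally show "(\<Sum>r<n. wd n K u0 q r x * (\<Sum>k<n. ltr K b' r k x * con K b i j (dwd n K w k q x)))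
        = (\<Sum>k<n. wd n K (u0 @ [b']) q k x * con K b i j (dwd n K w k q x))"
      by (simp add: sum_distrib_left)
  qed
  show ?case
    unfolding con_dwd_Cons distrib_left sum.distrib A B Cons.IH
    by (simp only: splits.simps list.map sum_list.Cons prod.case)
qed

lemma con_dwd_trace:
  assumes K: "K = {True} \<or> K = UNIV"
  shows "(\<Sum>i<n. \<Sum>j<n. con K b i j (dwd n K v j i x))
    = (\<Sum>(v1, b', v2)\<leftarrow>splits [] v. if b = b' then ep K * tr n K (v1 @ adj v2) x else kp K * (tr n K v1 x * tr n K v2 x))"
proof -
  have "(\<Sum>q<n. wd n K [] j q x * con K b i j (dwd n K v q i x)) = con K b i j (dwd n K v j i x)" if "j < n" for i j
  proof -
    have "(\<Sum>q<n. wd n K [] j q x * con K b i j (dwd n K v q i x))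
        = (\<Sum>q<n. if q = j then con K b i j (dwd n K v q i x) else 0)"
      by (intro sum.cong) auto
    then show ?thesis using that by simp
  qed
  then have "(\<Sum>i<n. \<Sum>j<n. con K b i j (dwd n K v j i x))
      = (\<Sum>i<n. \<Sum>j<n. \<Sum>q<n. wd n K [] j q x * con K b i j (dwd n K v q i x))"
    by (simp del: wd.simps)
  also note con_wd_sum[OF K]
  finally show ?thesis .
qed

lemma con_dtr:
  assumes K: "K = {True} \<or> K = UNIV"
  shows "(\<Sum>i<n. \<Sum>j<n. wd n K v j i x * con K b i j (dtr n K u x))
    = (\<Sum>(u1, b', u2)\<leftarrow>splits [] u. if b = b' then ep K * tr n K (v @ adj (u2 @ u1)) x else kp K * tr n K (v @ u2 @ u1) x)"
proof -
  have "(\<Sum>q<n. \<Sum>r<n. wd n K [] q r x * con K b i j (dwd n K u r q x)) = con K b i j (dtr n K u x)" for i j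
  proof -
    have "(\<Sum>r<n. wd n K [] q r x * con K b i j (dwd n K u r q x)) = con K b i j (dwd n K u q q x)" if "q < n" for q
    proof -
      have "(\<Sum>r<n. wd n K [] q r x * con K b i j (dwd n K u r q x))
          = (\<Sum>r<n. if r = q then con K b i j (dwd n K u r q x) else 0)"
        by (intro sum.cong) auto
      then show ?thesis using that by simp
    qed
    then show ?thesis unfolding dtr_def[abs_def] con_sum by (simp del: wd.simps)
  qed
  then have "(\<Sum>i<n. \<Sum>j<n. wd n K v j i x * con K b i j (dtr n K u x))
      = (\<Sum>i<n. \<Sum>j<n. wd n K v j i x * (\<Sum>q<n. \<Sum>r<n. wd n K [] q r x * con K b i j (dwd n K u r q x)))"
    by simp
  also note con_trace_sum[OF K]
  finally show ?thesis .
qed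

section \<open>Loop equations for random matrices with rotation invariant law\<close>

section \<open>Schwinger--Dyson equations\<close>

text \<open>The normalised radius, written s in other comments; under the moment hypotheses it is
  close to 1.\<close>

definition sr :: "nat \<Rightarrow> bool set \<Rightarrow> pt \<Rightarrow> real" where
  "sr n K x = nrm (ix n K) x / sqrt (real n)"

lemma sr_nonneg: "0 \<le> sr n K x"
  by (simp add: sr_def nrm_nonneg)

lemma nrm_sr: "0 < n \<Longrightarrow> (nrm (ix n K) x)\<^sup>2 = real n * (sr n K x)\<^sup>2"
  by (simp add: sr_def power_divide)

lemma sum_ix: "(\<Sum>p\<in>ix n K. f p) = (\<Sum>i<n. \<Sum>j<n. \<Sum>k\<in>K. f ((i, j), k))"
  unfolding ix_def by (simp only: sum.cartesian_product')

text \<open>The condition on \<open>n\<close> excludes real 1 by 1 matrices, which have a single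
  coordinate, so that d - 1 = 0 and no rotation is available.\<close>

locale sph_mat = rot_inv \<mu> "ix n K" for \<mu> :: "pt measure" and n :: nat and K :: "bool set" +
  assumes K: "K = {True} \<or> K = UNIV"
    and n: "2 \<le> n \<or> K = UNIV" and n_pos: "0 < n"
begin

lemma pb_ltr: "i < n \<Longrightarrow> j < n \<Longrightarrow> pb (ltr K b i j)"
  unfolding ltr_def by (intro pb_sum pb_scaleR pb_coord pb_const) (auto intro: pos_ix)

lemma pb_wd: "i < n \<Longrightarrow> pb (wd n K w i j)"
proof (induction w arbitrary: i)
  case Nil
  show ?case by (cases "i = j") auto
next
  case (Cons b w)
  then show ?case
    unfolding wd.simps(2)[abs_def] by (intro pb_sum pb_mult pb_ltr) auto
qed

lemma pb_dwd: "i < n \<Longrightarrow> pb (\<lambda>x. dwd n K w i j x c)"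
proof (induction w arbitrary: i)
  case (Cons b w)
  then show ?case
    unfolding dwd.simps(2)[abs_def] by (intro pb_sum pb_add pb_mult pb_ltr pb_wd pb_const) auto
qed simp

lemma pb_tr: "pb (tr n K w)"
  unfolding tr_def[abs_def] by (intro pb_sum pb_wd) auto

lemma pb_dtr: "pb (\<lambda>x. dtr n K w x c)"
  unfolding dtr_def[abs_def] by (intro pb_sum pb_dwd) auto

lemma pb_sr: "pb (sr n K)"
proof -
  have "pb (\<lambda>x. nrm (ix n K) x * (1 / sqrt (real n)))" by (intro pb_mult pb_nrm pb_const)
  then show ?thesis by (simp add: sr_def[abs_def])
qed

text \<open>The first letter of the trace is expanded in real coordinates, and
  \<open>spherical_ibp\<close> is applied to each of them with the matching entry of the word
  \<open>v\<close> times \<open>F\<close> as test function. The derivative of the word cuts the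
  trace, that of \<open>F\<close> is left as a contraction, and the tangential correction is
  computed by Euler's identity for homogeneous functions.\<close>

lemma schwinger_dyson:
  fixes F :: "pt \<Rightarrow> complex"
  assumes F: "tdiff (ix n K) F dF" "pb F" "\<And>c. c \<in> ix n K \<Longrightarrow> pb (\<lambda>x. dF x c)"
    and r: "pb (\<lambda>x. r (nrm (ix n K) x) :: real)"
  shows "(real (card (ix n K)) - 1) *\<^sub>R (\<integral>x. r (nrm (ix n K) x) *\<^sub>R (tr n K (b # v) x * F x) \<partial>\<mu>)
    = (\<integral>x. r (nrm (ix n K) x) *\<^sub>R ((nrm (ix n K) x)\<^sup>2 *\<^sub>R
        ((\<Sum>(v1, b', v2)\<leftarrow>splits [] v. if b = b' then ep K * tr n K (v1 @ adj v2) x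
            else kp K * (tr n K v1 x * tr n K v2 x)) * F x
         + (\<Sum>i<n. \<Sum>j<n. wd n K v j i x * con K b i j (dF x)))
       - tr n K (b # v) x * (of_nat (length v) * F x + (\<Sum>c\<in>ix n K. x c *\<^sub>R dF x c))) \<partial>\<mu>)"
    (is "_ *\<^sub>R ?L = (\<integral>x. ?r x *\<^sub>R ?R x \<partial>\<mu>)")
proof -
  define ps where "ps p = (pos b (fst (fst p)) (snd (fst p)), snd p)" for p :: "(nat \<times> nat) \<times> bool"
  define g where "g p x = uc b (snd p) * (wd n K v (snd (fst p)) (fst (fst p)) x * F x)" for p x
  define dg where "dg p x c = uc b (snd p) * (dwd n K v (snd (fst p)) (fst (fst p)) x c * F x
      + wd n K v (snd (fst p)) (fst (fst p)) x * dF x c)" for p x c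
  have ps: "ps p \<in> ix n K" if "p \<in> ix n K" for p
    using that by (auto simp: ps_def ix_def pos_def)
  have tg: "tdiff (ix n K) (g p) (dg p)" if "p \<in> ix n K" for p
    unfolding g_def dg_def using that
    by (intro tdiff_bounded_linear[OF bounded_linear_mult_right] tdiff_mult tdiff_wd F) (auto simp: ix_def)
  have pg: "pb (g p)" if "p \<in> ix n K" for p
    unfolding g_def[abs_def] using that by (intro pb_mult pb_const pb_wd F) (auto simp: ix_def)
  have pdg: "pb (\<lambda>x. dg p x c)" if "p \<in> ix n K" "c \<in> ix n K" for p c
    unfolding dg_def using that by (intro pb_mult pb_add pb_const pb_wd pb_dwd F) (auto simp: ix_def)
  have L: "tr n K (b # v) x * F x = (\<Sum>p\<in>ix n K. x (ps p) *\<^sub>R g p x)" for x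
    by (simp add: sum_ix tr_def g_def ps_def ltr_def sum_distrib_right sum_distrib_left mult_ac)
  have E: "(\<Sum>c\<in>ix n K. x c *\<^sub>R dg p x c)
      = uc b (snd p) * wd n K v (snd (fst p)) (fst (fst p)) x * (of_nat (length v) * F x + (\<Sum>c\<in>ix n K. x c *\<^sub>R dF x c))"
    if "p \<in> ix n K" for x p
  proof -
    have "(\<Sum>c\<in>ix n K. x c *\<^sub>R dg p x c) = uc b (snd p) * ((\<Sum>c\<in>ix n K. x c *\<^sub>R dwd n K v (snd (fst p)) (fst (fst p)) x c) * F x
        + wd n K v (snd (fst p)) (fst (fst p)) x * (\<Sum>c\<in>ix n K. x c *\<^sub>R dF x c))"
      by (simp add: dg_def sum_distrib_left sum_distrib_right sum.distrib scaleR_add_right distrib_left)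
    also have "(\<Sum>c\<in>ix n K. x c *\<^sub>R dwd n K v (snd (fst p)) (fst (fst p)) x c) = of_nat (length v) * wd n K v (snd (fst p)) (fst (fst p)) x"
      using that by (intro euler_wd) (auto simp: ix_def)
    finally show ?thesis by (simp add: algebra_simps)
  qed
  have D: "(\<Sum>p\<in>ix n K. dg p x (ps p))
      = (\<Sum>i<n. \<Sum>j<n. con K b i j (dwd n K v j i x)) * F x + (\<Sum>i<n. \<Sum>j<n. wd n K v j i x * con K b i j (dF x))" for x
    by (simp add: sum_ix dg_def ps_def con_def distrib_left sum.distrib sum_distrib_left sum_distrib_right mult_ac)
  have "(real (card (ix n K)) - 1) *\<^sub>R ?L
      = (\<Sum>p\<in>ix n K. (real (card (ix n K)) - 1) *\<^sub>R (\<integral>x. ?r x *\<^sub>R (x (ps p) *\<^sub>R g p x) \<partial>\<mu>))"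
    unfolding L scaleR_sum_right
    by (subst Bochner_Integration.integral_sum) (auto simp: scaleR_sum_right intro!: pb_integrable pb_scaleR r pb_coord ps pg)
  also have "\<dots> = (\<Sum>p\<in>ix n K. \<integral>x. ?r x *\<^sub>R ((nrm (ix n K) x)\<^sup>2 *\<^sub>R dg p x (ps p) - x (ps p) *\<^sub>R (\<Sum>c\<in>ix n K. x c *\<^sub>R dg p x c)) \<partial>\<mu>)"
    by (intro sum.cong refl spherical_ibp ps tg pg pdg r)
  also have "\<dots> = (\<integral>x. (\<Sum>p\<in>ix n K. ?r x *\<^sub>R ((nrm (ix n K) x)\<^sup>2 *\<^sub>R dg p x (ps p) - x (ps p) *\<^sub>R (\<Sum>c\<in>ix n K. x c *\<^sub>R dg p x c))) \<partial>\<mu>)"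
    by (intro Bochner_Integration.integral_sum[symmetric] pb_integrable pb_scaleR pb_diff pb_sum r pb_power pb_nrm pb_coord ps pdg)
  also have "\<dots> = (\<integral>x. ?r x *\<^sub>R ?R x \<partial>\<mu>)"
  proof (intro Bochner_Integration.integral_cong refl)
    fix x
    have T: "(\<Sum>p\<in>ix n K. x (ps p) *\<^sub>R (\<Sum>c\<in>ix n K. x c *\<^sub>R dg p x c))
        = tr n K (b # v) x * (of_nat (length v) * F x + (\<Sum>c\<in>ix n K. x c *\<^sub>R dF x c))"
    proof -
      have "(\<Sum>p\<in>ix n K. x (ps p) *\<^sub>R (\<Sum>c\<in>ix n K. x c *\<^sub>R dg p x c))
          = (\<Sum>p\<in>ix n K. x (ps p) *\<^sub>R (uc b (snd p) * wd n K v (snd (fst p)) (fst (fst p)) x))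
            * (of_nat (length v) * F x + (\<Sum>c\<in>ix n K. x c *\<^sub>R dF x c))"
        unfolding sum_distrib_right by (intro sum.cong refl) (simp only: E mult_scaleR_left)
      also have "(\<Sum>p\<in>ix n K. x (ps p) *\<^sub>R (uc b (snd p) * wd n K v (snd (fst p)) (fst (fst p)) x)) = tr n K (b # v) x"
        by (simp add: sum_ix tr_def ps_def ltr_def sum_distrib_right sum_distrib_left mult_ac)
      finally show ?thesis .
    qed
    have "(\<Sum>p\<in>ix n K. ?r x *\<^sub>R ((nrm (ix n K) x)\<^sup>2 *\<^sub>R dg p x (ps p) - x (ps p) *\<^sub>R (\<Sum>c\<in>ix n K. x c *\<^sub>R dg p x c)))
        = ?r x *\<^sub>R ((nrm (ix n K) x)\<^sup>2 *\<^sub>R (\<Sum>p\<in>ix n K. dg p x (ps p))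
          - (\<Sum>p\<in>ix n K. x (ps p) *\<^sub>R (\<Sum>c\<in>ix n K. x c *\<^sub>R dg p x c)))"
      by (simp only: scaleR_sum_right[symmetric] sum_subtractf)
    then show "(\<Sum>p\<in>ix n K. ?r x *\<^sub>R ((nrm (ix n K) x)\<^sup>2 *\<^sub>R dg p x (ps p) - x (ps p) *\<^sub>R (\<Sum>c\<in>ix n K. x c *\<^sub>R dg p x c)))
        = ?r x *\<^sub>R ?R x"
      unfolding T D con_dwd_trace[OF K] .
  qed
  finally show ?thesis .
qed

text \<open>Every negative power of \<open>n\<close> in the estimates is obtained by dividing by
  this number.\<close>

lemma card_lower: "real n ^ 2 / 2 \<le> real (card (ix n K)) - 1"
proof (cases "K = UNIV")
  case True
  have "1 * 1 \<le> real n * real n" using n_pos by (intro mult_mono) auto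
  then show ?thesis using True by (simp add: card_ix power2_eq_square)
next
  case False
  then have "K = {True}" "2 \<le> n" using K n by auto
  moreover have "2 * 2 \<le> real n * real n" using \<open>2 \<le> n\<close> by (intro mult_mono) auto
  ultimately show ?thesis by (simp add: card_ix power2_eq_square)
qed

end

section \<open>Bounded means of products of centred traces\<close>

section \<open>Uniform moment bounds for fluctuations of traces\<close>

definition adm :: "bool set \<Rightarrow> nat \<Rightarrow> pt measure \<Rightarrow> (real \<Rightarrow> real) \<Rightarrow> bool" where
  "adm K n \<mu> r \<longleftrightarrow> sph_mat \<mu> n K \<and> (\<forall>y. 0 \<le> r y) \<and> rot_inv.pb \<mu> (ix n K) (\<lambda>x. r (nrm (ix n K) x))"

text \<open>\<open>q\<close> counts powers of \<open>n\<close> and \<open>k\<close> is the degree in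
  the radius. One constant serves all sizes, laws and weights \<open>r\<close>, so the bound is a
  conditional one given the radius, stated without conditional expectations.\<close>

definition EB :: "bool set \<Rightarrow> nat \<Rightarrow> nat \<Rightarrow> (nat \<Rightarrow> pt \<Rightarrow> complex) \<Rightarrow> bool" where
  "EB K q k \<phi> \<longleftrightarrow> (\<exists>B\<ge>0. \<forall>n \<mu> r. adm K n \<mu> r \<longrightarrow> rot_inv.pb \<mu> (ix n K) (\<phi> n) \<and>
     norm (\<integral>x. r (nrm (ix n K) x) *\<^sub>R \<phi> n x \<partial>\<mu>) \<le> B * real n ^ q * (\<integral>x. r (nrm (ix n K) x) * sr n K x ^ k \<partial>\<mu>))"

lemma EB_I:
  assumes "0 \<le> B" "\<And>n \<mu> r. adm K n \<mu> r \<Longrightarrow> rot_inv.pb \<mu> (ix n K) (\<phi> n)"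
    "\<And>n \<mu> r. adm K n \<mu> r \<Longrightarrow> norm (\<integral>x. r (nrm (ix n K) x) *\<^sub>R \<phi> n x \<partial>\<mu>)
      \<le> B * real n ^ q * (\<integral>x. r (nrm (ix n K) x) * sr n K x ^ k \<partial>\<mu>)"
  shows "EB K q k \<phi>"
  using assms unfolding EB_def by blast

lemma adm_nonneg: 
  assumes "adm K n \<mu> r"
  shows "0 \<le> (\<integral>x. r (nrm (ix n K) x) * sr n K x ^ k \<partial>\<mu>)"
  using assms by (intro integral_nonneg_AE AE_I2) (simp add: adm_def sr_nonneg)

lemma EB_zero: "EB K q k (\<lambda>n x. 0)"
proof (rule EB_I[of 0])
  fix n \<mu> r assume "adm K n \<mu> r"
  then interpret sph_mat \<mu> n K by (simp add: adm_def)
  show "pb (\<lambda>x. 0 :: complex)" by simp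
qed simp_all

lemma EB_add:
  assumes "EB K q k \<phi>" "EB K q k \<psi>"
  shows "EB K q k (\<lambda>n x. \<phi> n x + \<psi> n x)"
proof -
  obtain B1 where B1: "B1 \<ge> 0" "\<And>n \<mu> r. adm K n \<mu> r \<Longrightarrow> rot_inv.pb \<mu> (ix n K) (\<phi> n) \<and>
     norm (\<integral>x. r (nrm (ix n K) x) *\<^sub>R \<phi> n x \<partial>\<mu>) \<le> B1 * real n ^ q * (\<integral>x. r (nrm (ix n K) x) * sr n K x ^ k \<partial>\<mu>)"
    using assms(1) unfolding EB_def by blast
  obtain B2 where B2: "B2 \<ge> 0" "\<And>n \<mu> r. adm K n \<mu> r \<Longrightarrow> rot_inv.pb \<mu> (ix n K) (\<psi> n) \<and>
     norm (\<integral>x. r (nrm (ix n K) x) *\<^sub>R \<psi> n x \<partial>\<mu>) \<le> B2 * real n ^ q * (\<integral>x. r (nrm (ix n K) x) * sr n K x ^ k \<partial>\<mu>)"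
    using assms(2) unfolding EB_def by blast
  show ?thesis
  proof (rule EB_I[of "B1 + B2"])
    fix n \<mu> r assume a: "adm K n \<mu> r"
    then interpret sph_mat \<mu> n K by (simp add: adm_def)
    have r: "pb (\<lambda>x. r (nrm (ix n K) x))" using a by (simp add: adm_def)
    have p: "pb (\<phi> n)" "pb (\<psi> n)" using B1(2)[OF a] B2(2)[OF a] by auto
    then show "pb (\<lambda>x. \<phi> n x + \<psi> n x)" by auto
    have "(\<integral>x. r (nrm (ix n K) x) *\<^sub>R (\<phi> n x + \<psi> n x) \<partial>\<mu>)
        = (\<integral>x. r (nrm (ix n K) x) *\<^sub>R \<phi> n x \<partial>\<mu>) + (\<integral>x. r (nrm (ix n K) x) *\<^sub>R \<psi> n x \<partial>\<mu>)"
      unfolding scaleR_add_right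
      by (intro Bochner_Integration.integral_add pb_integrable pb_scaleR r p)
    then have "norm (\<integral>x. r (nrm (ix n K) x) *\<^sub>R (\<phi> n x + \<psi> n x) \<partial>\<mu>)
        \<le> B1 * real n ^ q * (\<integral>x. r (nrm (ix n K) x) * sr n K x ^ k \<partial>\<mu>) + B2 * real n ^ q * (\<integral>x. r (nrm (ix n K) x) * sr n K x ^ k \<partial>\<mu>)"
      using B1(2)[OF a] B2(2)[OF a] by (simp only: order_trans[OF norm_triangle_ineq add_mono])
    then show "norm (\<integral>x. r (nrm (ix n K) x) *\<^sub>R (\<phi> n x + \<psi> n x) \<partial>\<mu>)
        \<le> (B1 + B2) * real n ^ q * (\<integral>x. r (nrm (ix n K) x) * sr n K x ^ k \<partial>\<mu>)"
      by (simp add: distrib_right)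
  qed (use B1 B2 in auto)
qed

lemma EB_coeff:
  assumes "EB K q k \<phi>" and a: "0 \<le> A" "\<And>n. 0 < n \<Longrightarrow> norm (a n) \<le> A * real n ^ p" and q: "q' = q + p"
  shows "EB K q' k (\<lambda>n x. a n * \<phi> n x)"
proof -
  obtain B where B: "B \<ge> 0" "\<And>n \<mu> r. adm K n \<mu> r \<Longrightarrow> rot_inv.pb \<mu> (ix n K) (\<phi> n) \<and>
     norm (\<integral>x. r (nrm (ix n K) x) *\<^sub>R \<phi> n x \<partial>\<mu>) \<le> B * real n ^ q * (\<integral>x. r (nrm (ix n K) x) * sr n K x ^ k \<partial>\<mu>)"
    using assms(1) unfolding EB_def by blast
  show ?thesis
  proof (rule EB_I[of "A * B"])
    fix n \<mu> r assume ad: "adm K n \<mu> r"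
    then interpret sph_mat \<mu> n K by (simp add: adm_def)
    show "pb (\<lambda>x. a n * \<phi> n x)" using B(2)[OF ad] by auto
    have "norm (\<integral>x. r (nrm (ix n K) x) *\<^sub>R (a n * \<phi> n x) \<partial>\<mu>) = norm (a n) * norm (\<integral>x. r (nrm (ix n K) x) *\<^sub>R \<phi> n x \<partial>\<mu>)"
      by (simp flip: mult_scaleR_right norm_mult)
    also have "\<dots> \<le> (A * real n ^ p) * (B * real n ^ q * (\<integral>x. r (nrm (ix n K) x) * sr n K x ^ k \<partial>\<mu>))"
      using B(2)[OF ad] a n_pos by (intro mult_mono) auto
    finally show "norm (\<integral>x. r (nrm (ix n K) x) *\<^sub>R (a n * \<phi> n x) \<partial>\<mu>)
        \<le> (A * B) * real n ^ q' * (\<integral>x. r (nrm (ix n K) x) * sr n K x ^ k \<partial>\<mu>)"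
      by (simp add: q power_add mult_ac)
  qed (use B a in auto)
qed

lemma EB_cmult: "EB K q k \<phi> \<Longrightarrow> EB K q k (\<lambda>n x. a * \<phi> n x)"
  by (rule EB_coeff[where p = 0 and A = "norm a"]) auto

lemma EB_n: "EB K q k \<phi> \<Longrightarrow> q' = Suc q \<Longrightarrow> EB K q' k (\<lambda>n x. of_nat n * \<phi> n x)"
  by (rule EB_coeff[where p = 1 and A = 1]) auto

lemma EB_mono:
  assumes "EB K q k \<phi>" "q \<le> q'"
  shows "EB K q' k \<phi>"
proof -
  have "EB K q' k (\<lambda>n x. 1 * \<phi> n x)"
    using assms by (intro EB_coeff[where p = "q' - q" and A = 1 and a = "\<lambda>_. 1"]) auto
  then show ?thesis by simp
qed

text \<open>A power of the radius is absorbed into the weight, over which \<open>EB\<close> is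
  uniform.\<close>

lemma EB_sr:
  assumes "EB K q k \<phi>" and k: "k' = k + j"
  shows "EB K q k' (\<lambda>n x. of_real (sr n K x ^ j) * \<phi> n x)"
proof -
  obtain B where B: "B \<ge> 0" "\<And>n \<mu> r. adm K n \<mu> r \<Longrightarrow> rot_inv.pb \<mu> (ix n K) (\<phi> n) \<and>
     norm (\<integral>x. r (nrm (ix n K) x) *\<^sub>R \<phi> n x \<partial>\<mu>) \<le> B * real n ^ q * (\<integral>x. r (nrm (ix n K) x) * sr n K x ^ k \<partial>\<mu>)"
    using assms(1) unfolding EB_def by blast
  show ?thesis
  proof (rule EB_I[of B])
    fix n \<mu> r assume ad: "adm K n \<mu> r"
    then interpret sph_mat \<mu> n K by (simp add: adm_def)
    \<comment> \<open>The absolute value keeps the weight nonnegative at negative arguments, as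
      \<open>adm\<close> demands.\<close>
    define r' where "r' y = r y * (\<bar>y\<bar> / sqrt (real n)) ^ j" for y
    have r': "r' (nrm (ix n K) x) = r (nrm (ix n K) x) * sr n K x ^ j" for x
      by (simp add: r'_def sr_def nrm_nonneg)
    have "pb (\<lambda>x. r' (nrm (ix n K) x))"
      unfolding r' using ad by (intro pb_mult pb_power pb_sr) (simp add: adm_def)
    then have ad': "adm K n \<mu> r'"
      using ad by (simp add: adm_def r'_def)
    show "pb (\<lambda>x. of_real (sr n K x ^ j) * \<phi> n x)"
      using B(2)[OF ad] by (intro pb_mult pb_bounded_linear[OF bounded_linear_of_real] pb_power pb_sr) auto
    show "norm (\<integral>x. r (nrm (ix n K) x) *\<^sub>R (of_real (sr n K x ^ j) * \<phi> n x) \<partial>\<mu>)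
        \<le> B * real n ^ q * (\<integral>x. r (nrm (ix n K) x) * sr n K x ^ k' \<partial>\<mu>)"
      using B(2)[OF ad'] by (simp add: r' k power_add scaleR_conv_of_real mult_ac)
  qed (use B in auto)
qed

lemma EB_sum_list:
  assumes "\<And>p. p \<in> set ps \<Longrightarrow> EB K q k (\<lambda>n x. f p n x)"
  shows "EB K q k (\<lambda>n x. \<Sum>p\<leftarrow>ps. f p n x)"
  using assms by (induction ps) (auto intro: EB_zero EB_add)

lemma EB_one: "EB K 0 0 (\<lambda>n x. 1)"
proof (rule EB_I[of 1])
  fix n \<mu> r assume ad: "adm K n \<mu> r"
  then interpret sph_mat \<mu> n K by (simp add: adm_def)
  show "pb (\<lambda>x. 1 :: complex)" by simp
  have "(\<integral>x. r (nrm (ix n K) x) *\<^sub>R (1::complex) \<partial>\<mu>) = of_real (\<integral>x. r (nrm (ix n K) x) \<partial>\<mu>)"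
    by (simp flip: integral_of_real add: scaleR_conv_of_real)
  then show "norm (\<integral>x. r (nrm (ix n K) x) *\<^sub>R (1::complex) \<partial>\<mu>)
      \<le> 1 * real n ^ 0 * (\<integral>x. r (nrm (ix n K) x) * sr n K x ^ 0 \<partial>\<mu>)"
    using adm_nonneg[OF ad, of 0] by simp
qed simp

lemma splits_mem: "p \<in> set (splits u w) \<Longrightarrow> u @ w = fst p @ fst (snd p) # snd (snd p)"
  by (induction u w arbitrary: p rule: splits.induct) auto

lemma splits_append: "splits u (v @ w) = map (\<lambda>p. (fst p, fst (snd p), snd (snd p) @ w)) (splits u v) @ splits (u @ v) w"
  by (induction v arbitrary: u) auto

lemma splits_replicate: "p \<in> set (splits u (replicate k d)) \<Longrightarrow> fst (snd p) = d"
  by (induction k arbitrary: u p) auto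

text \<open>The large \<open>n\<close> limit of \<open>tr w / n\<close> for a matrix of squared norm \<open>n\<close>.\<close>

function cw :: "bool list \<Rightarrow> real" where
  "cw [] = 1"
| "cw (b # v) = (\<Sum>p\<leftarrow>splits [] v. if b = fst (snd p) then 0 else cw (fst p) * cw (snd (snd p)))"
  by pat_completeness auto
termination
  by (relation "Wellfounded.measure length") (auto dest!: splits_mem)

declare cw.simps(2) [simp del]

lemma sum_list_zero: "(\<And>p. p \<in> set ps \<Longrightarrow> f p = 0) \<Longrightarrow> (\<Sum>p\<leftarrow>ps. f p) = (0::real)"
  by (induction ps) auto

lemma cw_replicate: "0 < k \<Longrightarrow> cw (replicate k d) = 0"
  by (cases k) (auto simp: cw.simps(2) intro!: sum_list_zero dest: splits_replicate)

text \<open>Only the last letter of the block can contribute: for any other one, the piece to its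
  right is a nonempty constant word, which has no pairing of opposite letters.\<close>

lemma sum_splits_replicate:
  "(\<Sum>p\<leftarrow>splits u (replicate b d). if c = fst (snd p) then 0 else cw (fst p) * cw (snd (snd p)))
    = (if c = d \<or> b = 0 then 0 else cw (u @ replicate (b - 1) d))"
proof (induction b arbitrary: u)
  case (Suc b)
  have "(\<Sum>p\<leftarrow>splits u (replicate (Suc b) d). if c = fst (snd p) then 0 else cw (fst p) * cw (snd (snd p)))
      = (if c = d then 0 else cw u * cw (replicate b d))
        + (if c = d \<or> b = 0 then 0 else cw ((u @ [d]) @ replicate (b - 1) d))"
    unfolding replicate_Suc splits.simps list.map sum_list.Cons Suc.IH by simp
  moreover have "(u @ [d]) @ replicate (b - 1) d = u @ replicate b d" if "b \<noteq> 0"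
    using that by (cases b) auto
  ultimately show ?case
    by (cases "b = 0") (auto simp: cw_replicate)
qed simp

text \<open>\<open>cw\<close> gives the star-moments of a circular element. For a block of one
  letter followed by a block of the other, the nested pairing is the only noncrossing one, and it
  exists exactly when the blocks have equal length.\<close>

lemma cw_alternating: "cw (replicate a c @ replicate b (\<not> c)) = (if a = b then 1 else 0)"
proof (induction a arbitrary: b)
  case 0
  then show ?case using cw_replicate[of b] by auto
next
  case (Suc a)
  have Z: "(\<Sum>p\<leftarrow>map (\<lambda>p. (fst p, fst (snd p), snd (snd p) @ z)) (splits [] (replicate a c)).
      if c = fst (snd p) then 0 else cw (fst p) * cw (snd (snd p))) = 0" for z
    by (intro sum_list_zero) (auto dest: splits_replicate)
  have "replicate (Suc a) c @ replicate b (\<not> c) = c # (replicate a c @ replicate b (\<not> c))"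
    by simp
  then have "cw (replicate (Suc a) c @ replicate b (\<not> c))
      = (if b = 0 then 0 else cw (replicate a c @ replicate (b - 1) (\<not> c)))"
    by (simp only: cw.simps splits_append map_append sum_list_append Z sum_splits_replicate) simp
  then show ?case
    using Suc.IH[of "b - 1"] by auto
qed

text \<open>The centring is a function of the radius, not a constant. It is therefore invisible to
  \<open>tdiff\<close>, and the derivative of \<open>fl\<close> is that of the trace alone; this is
  also why only \<open>dtr\<close> occurs in \<open>dpl\<close>.\<close>

definition fl :: "bool set \<Rightarrow> bool list \<Rightarrow> nat \<Rightarrow> pt \<Rightarrow> complex" where
  "fl K w n x = tr n K w x - of_real (real n * cw w * sr n K x ^ length w)"

fun pl :: "bool set \<Rightarrow> bool list list \<Rightarrow> nat \<Rightarrow> pt \<Rightarrow> complex" where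
  "pl K [] n x = 1"
| "pl K (u # us) n x = fl K u n x * pl K us n x"

fun dpl :: "bool set \<Rightarrow> bool list list \<Rightarrow> nat \<Rightarrow> pt \<Rightarrow> (nat \<times> nat) \<times> bool \<Rightarrow> complex" where
  "dpl K [] n x c = 0"
| "dpl K (u # us) n x c = dtr n K u x c * pl K us n x + fl K u n x * dpl K us n x c"

fun deg :: "bool list list \<Rightarrow> nat" where
  "deg [] = 0"
| "deg (u # us) = length u + deg us"

declare pl.simps [simp del] dpl.simps [simp del]

lemma pl_Nil: "pl K [] n = (\<lambda>x. 1)"
  by (auto simp: pl.simps)

lemma pl_append: "pl K (us @ vs) n x = pl K us n x * pl K vs n x"
  by (induction us) (auto simp: pl.simps)

lemma deg_append: "deg (us @ vs) = deg us + deg vs"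
  by (induction us) auto

lemma fl_Nil [simp]: "fl K [] n x = 0"
  by (simp add: fl_def)

lemma tdiff_fl: "tdiff (ix n K) (fl K w n) (dtr n K w)"
proof -
  have "tdiff (ix n K) (\<lambda>x. tr n K w x + (\<lambda>y. - of_real (real n * cw w * (y / sqrt (real n)) ^ length w)) (nrm (ix n K) x))
     (\<lambda>x c. dtr n K w x c + 0)"
    by (intro tdiff_add tdiff_tr tdiff_radial)
  then show ?thesis by (simp add: fl_def[abs_def] sr_def)
qed

lemma tdiff_pl: "tdiff (ix n K) (pl K us n) (dpl K us n)"
proof (induction us)
  case Nil
  have "pl K [] n = (\<lambda>x. 1)" "dpl K [] n = (\<lambda>_ _. 0)"
    by (auto simp: fun_eq_iff pl.simps dpl.simps)
  then show ?case by (simp add: tdiff_const)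
next
  case (Cons u us)
  then show ?case
    unfolding pl.simps(2)[abs_def] dpl.simps(2)[abs_def] by (intro tdiff_mult tdiff_fl)
qed

context sph_mat
begin

lemma pb_fl: "pb (fl K w n)"
  unfolding fl_def[abs_def]
  by (intro pb_diff pb_tr pb_bounded_linear[OF bounded_linear_of_real] pb_mult pb_power pb_const pb_sr)

lemma pb_pl: "pb (pl K us n)"
proof (induction us)
  case (Cons u us)
  then show ?case unfolding pl.simps(2)[abs_def] by (intro pb_mult pb_fl)
qed (simp add: pl_Nil)

lemma pb_dpl: "pb (\<lambda>x. dpl K us n x c)"
proof (induction us)
  case (Cons u us)
  then show ?case unfolding dpl.simps(2)[abs_def] by (intro pb_mult pb_add pb_fl pb_pl pb_dtr)
qed (simp add: dpl.simps)

end

text \<open>The three terms of the loop equation for a product of centred traces: \<open>S1\<close>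
  cuts the distinguished trace, \<open>S2\<close> joins it to one factor and \<open>cs\<close> adds
  this up over the factors, and \<open>eu\<close> is the radial derivative of the product.\<close>

definition S1 :: "bool set \<Rightarrow> bool \<Rightarrow> bool list \<Rightarrow> nat \<Rightarrow> pt \<Rightarrow> complex" where
  "S1 K b v n x = (\<Sum>(v1, b', v2)\<leftarrow>splits [] v. if b = b' then ep K * tr n K (v1 @ adj v2) x
      else kp K * (tr n K v1 x * tr n K v2 x))"

definition S2 :: "bool set \<Rightarrow> bool \<Rightarrow> bool list \<Rightarrow> bool list \<Rightarrow> nat \<Rightarrow> pt \<Rightarrow> complex" where
  "S2 K b v u n x = (\<Sum>(u1, b', u2)\<leftarrow>splits [] u. if b = b' then ep K * tr n K (v @ adj (u2 @ u1)) x
      else kp K * tr n K (v @ u2 @ u1) x)"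

definition cs :: "bool set \<Rightarrow> bool \<Rightarrow> bool list \<Rightarrow> bool list list \<Rightarrow> nat \<Rightarrow> pt \<Rightarrow> complex" where
  "cs K b v us n x = (\<Sum>i<n. \<Sum>j<n. wd n K v j i x * con K b i j (dpl K us n x))"

definition eu :: "bool set \<Rightarrow> bool list list \<Rightarrow> nat \<Rightarrow> pt \<Rightarrow> complex" where
  "eu K us n x = (\<Sum>c\<in>ix n K. x c *\<^sub>R dpl K us n x c)"

lemma cs_Nil: "cs K b v [] n x = 0"
  by (simp add: cs_def con_def dpl.simps)

lemma cs_Cons:
  assumes K: "K = {True} \<or> K = UNIV"
  shows "cs K b v (u # us) n x = S2 K b v u n x * pl K us n x + fl K u n x * cs K b v us n x"
proof -
  have "con K b i j (dpl K (u # us) n x) = con K b i j (dtr n K u x) * pl K us n x + fl K u n x * con K b i j (dpl K us n x)" for i j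
    unfolding dpl.simps(2)[abs_def] by (simp add: con_add con_cmult con_cmult_right)
  then have "cs K b v (u # us) n x = (\<Sum>i<n. \<Sum>j<n. wd n K v j i x * con K b i j (dtr n K u x)) * pl K us n x + fl K u n x * cs K b v us n x"
    by (simp add: cs_def distrib_left sum.distrib sum_distrib_left sum_distrib_right mult_ac)
  then show ?thesis unfolding con_dtr[OF K] S2_def .
qed

lemma eu_Nil: "eu K [] n x = 0"
  by (simp add: eu_def dpl.simps)

lemma eu_Cons:
  assumes K: "K = {True} \<or> K = UNIV"
  shows "eu K (u # us) n x = of_nat (length u) * tr n K u x * pl K us n x + fl K u n x * eu K us n x"
proof -
  have "eu K (u # us) n x = (\<Sum>c\<in>ix n K. x c *\<^sub>R dtr n K u x c) * pl K us n x + fl K u n x * eu K us n x"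
    by (simp add: eu_def dpl.simps scaleR_add_right sum.distrib sum_distrib_left sum_distrib_right)
  moreover have "finite K" by simp
  ultimately show ?thesis by (simp add: euler_tr)
qed

text \<open>An uncentred trace is a centred one plus n times a radial term, so it costs one power of
  \<open>n\<close>.\<close>

lemma EB_tr_pl:
  assumes "EB K 0 (length w + deg us) (pl K (w # us))" "EB K 0 (deg us) (pl K us)" "k = length w + deg us"
  shows "EB K 1 k (\<lambda>n x. tr n K w x * pl K us n x)"
proof -
  have "EB K 1 k (\<lambda>n x. pl K (w # us) n x + of_nat n * (of_real (sr n K x ^ length w) * (of_real (cw w) * pl K us n x)))"
    using assms by (intro EB_add EB_n EB_sr EB_cmult) (auto intro: EB_mono)
  moreover have "(\<lambda>n x. pl K (w # us) n x + of_nat n * (of_real (sr n K x ^ length w) * (of_real (cw w) * pl K us n x)))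
      = (\<lambda>n x. tr n K w x * pl K us n x)"
    by (auto simp: fun_eq_iff pl.simps fl_def algebra_simps)
  ultimately show ?thesis by simp
qed

text \<open>Joining to a factor \<open>u\<close> leaves one uncentred trace, of order n, times the
  other centred factors, in total degree lower by two. With the prefactor n s^2 this is of order
  n^2. The list \<open>ws\<close> holds the factors already passed over.\<close>

lemma EB_cs:
  assumes K: "K = {True} \<or> K = UNIV"
    and IH: "\<And>us. deg us < D \<Longrightarrow> EB K 0 (deg us) (pl K us)"
    and D: "length v + 1 + deg us + deg ws \<le> D"
  shows "EB K 2 (length v + 1 + deg us + deg ws)
    (\<lambda>n x. of_nat n * (of_real (sr n K x ^ 2) * (cs K b v us n x * pl K ws n x)))"
  using D
proof (induction us arbitrary: ws)
  case Nil
  then show ?case by (simp add: cs_Nil EB_zero)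
next
  case (Cons u us)
  let ?k = "length v + 1 + deg (u # us) + deg ws"
  have t: "EB K 1 (deg (w # us @ ws)) (\<lambda>n x. tr n K w x * pl K (us @ ws) n x)"
    if "deg (w # us @ ws) < D" for w
    using that by (intro EB_tr_pl IH[of "w # us @ ws", simplified] IH) (auto simp: deg_append)
  have "EB K 2 ?k (\<lambda>n x. \<Sum>p\<leftarrow>splits [] u. of_nat n * (of_real (sr n K x ^ 2) *
      ((if b = fst (snd p) then ep K else kp K) * (tr n K (if b = fst (snd p) then v @ adj (snd (snd p) @ fst p) else v @ snd (snd p) @ fst p) x * pl K (us @ ws) n x))))"
  proof (intro EB_sum_list)
    fix p assume "p \<in> set (splits [] u)"
    from splits_mem[OF this] have lu: "length u = Suc (length (fst p) + length (snd (snd p)))" by simp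
    define w where "w = (if b = fst (snd p) then v @ adj (snd (snd p) @ fst p) else v @ snd (snd p) @ fst p)"
    have lw: "length w + 1 = length v + length u" by (auto simp: w_def lu)
    show "EB K 2 ?k (\<lambda>n x. of_nat n * (of_real (sr n K x ^ 2) *
      ((if b = fst (snd p) then ep K else kp K) * (tr n K (if b = fst (snd p) then v @ adj (snd (snd p) @ fst p) else v @ snd (snd p) @ fst p) x * pl K (us @ ws) n x))))"
      unfolding w_def[symmetric]
      by (rule EB_n[OF EB_sr[OF EB_cmult[OF t]]]) (use lw Cons.prems in \<open>auto simp: deg_append\<close>)
  qed
  moreover have "EB K 2 ?k (\<lambda>n x. of_nat n * (of_real (sr n K x ^ 2) * (cs K b v us n x * pl K (u # ws) n x)))"
    using Cons.IH[of "u # ws"] Cons.prems by (simp add: add_ac)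
  ultimately have "EB K 2 ?k (\<lambda>n x. (\<Sum>p\<leftarrow>splits [] u. of_nat n * (of_real (sr n K x ^ 2) *
      ((if b = fst (snd p) then ep K else kp K) * (tr n K (if b = fst (snd p) then v @ adj (snd (snd p) @ fst p) else v @ snd (snd p) @ fst p) x * pl K (us @ ws) n x))))
      + of_nat n * (of_real (sr n K x ^ 2) * (cs K b v us n x * pl K (u # ws) n x)))"
    by (rule EB_add)
  also have "(\<lambda>n x. (\<Sum>p\<leftarrow>splits [] u. of_nat n * (of_real (sr n K x ^ 2) *
      ((if b = fst (snd p) then ep K else kp K) * (tr n K (if b = fst (snd p) then v @ adj (snd (snd p) @ fst p) else v @ snd (snd p) @ fst p) x * pl K (us @ ws) n x))))
      + of_nat n * (of_real (sr n K x ^ 2) * (cs K b v us n x * pl K (u # ws) n x)))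
    = (\<lambda>n x. of_nat n * (of_real (sr n K x ^ 2) * (cs K b v (u # us) n x * pl K ws n x)))"
  proof (intro ext)
    fix n x
    have "S2 K b v u n x = (\<Sum>p\<leftarrow>splits [] u. (if b = fst (snd p) then ep K else kp K) *
        tr n K (if b = fst (snd p) then v @ adj (snd (snd p) @ fst p) else v @ snd (snd p) @ fst p) x)"
      unfolding S2_def by (intro arg_cong[of _ _ sum_list] map_cong) auto
    then have "of_nat n * (of_real (sr n K x ^ 2) * (S2 K b v u n x * pl K (us @ ws) n x)) = (\<Sum>p\<leftarrow>splits [] u. of_nat n * (of_real (sr n K x ^ 2) *
      ((if b = fst (snd p) then ep K else kp K) * (tr n K (if b = fst (snd p) then v @ adj (snd (snd p) @ fst p) else v @ snd (snd p) @ fst p) x * pl K (us @ ws) n x))))"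
      by (simp only: sum_list_const_mult[symmetric] sum_list_mult_const[symmetric] mult.assoc)
    from this[symmetric] show "(\<Sum>p\<leftarrow>splits [] u. of_nat n * (of_real (sr n K x ^ 2) *
      ((if b = fst (snd p) then ep K else kp K) * (tr n K (if b = fst (snd p) then v @ adj (snd (snd p) @ fst p) else v @ snd (snd p) @ fst p) x * pl K (us @ ws) n x))))
      + of_nat n * (of_real (sr n K x ^ 2) * (cs K b v us n x * pl K (u # ws) n x))
      = of_nat n * (of_real (sr n K x ^ 2) * (cs K b v (u # us) n x * pl K ws n x))"
      by (simp only: cs_Cons[OF K] pl_append pl.simps) (simp add: algebra_simps)
  qed
  finally show ?case .
qed

text \<open>By Euler's identity the radial derivative of a centred factor \<open>u\<close> is |u|
  times the whole trace of \<open>u\<close>. After |u| times the centred trace is subtracted, n |u|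
  \<open>cw u\<close> s^|u| is left in place of the factor \<open>u\<close>, so a product of lower
  degree remains, and the trace of \<open>w\<close> costs one more n.\<close>

lemma EB_eu:
  assumes K: "K = {True} \<or> K = UNIV"
    and IH: "\<And>us. deg us < D \<Longrightarrow> EB K 0 (deg us) (pl K us)"
    and D: "length w + deg us + deg ws \<le> D"
  shows "EB K 2 (length w + deg us + deg ws)
    (\<lambda>n x. tr n K w x * ((eu K us n x - of_nat (deg us) * pl K us n x) * pl K ws n x))"
  using D
proof (induction us arbitrary: ws)
  case Nil
  then show ?case by (simp add: eu_Nil EB_zero)
next
  case (Cons u us)
  let ?k = "length w + deg (u # us) + deg ws"
  have "EB K 2 ?k (\<lambda>n x. of_nat n * (of_real (sr n K x ^ length u) *
      (of_real (real (length u) * cw u) * (tr n K w x * pl K (us @ ws) n x))))"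
  proof (cases "u = []")
    case False
    then obtain u0 u' where u: "u = u0 # u'" by (cases u) auto
    have "EB K 1 (deg (w # us @ ws)) (\<lambda>n x. tr n K w x * pl K (us @ ws) n x)"
      using Cons.prems u
      by (intro EB_tr_pl IH[of "w # us @ ws", simplified] IH) (auto simp: deg_append)
    then show ?thesis
      by (intro EB_n[OF EB_sr[OF EB_cmult]]) (auto simp: deg_append)
  qed (simp add: EB_zero)
  moreover have "EB K 2 ?k (\<lambda>n x. tr n K w x * ((eu K us n x - of_nat (deg us) * pl K us n x) * pl K (u # ws) n x))"
    using Cons.IH[of "u # ws"] Cons.prems by (simp add: add_ac)
  ultimately have "EB K 2 ?k (\<lambda>n x. of_nat n * (of_real (sr n K x ^ length u) *
      (of_real (real (length u) * cw u) * (tr n K w x * pl K (us @ ws) n x)))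
      + tr n K w x * ((eu K us n x - of_nat (deg us) * pl K us n x) * pl K (u # ws) n x))"
    by (rule EB_add)
  also have "(\<lambda>n x. of_nat n * (of_real (sr n K x ^ length u) *
      (of_real (real (length u) * cw u) * (tr n K w x * pl K (us @ ws) n x)))
      + tr n K w x * ((eu K us n x - of_nat (deg us) * pl K us n x) * pl K (u # ws) n x))
    = (\<lambda>n x. tr n K w x * ((eu K (u # us) n x - of_nat (deg (u # us)) * pl K (u # us) n x) * pl K ws n x))"
    unfolding eu_Cons[OF K] pl_append pl.simps deg.simps fl_def by (auto simp: fun_eq_iff algebra_simps)
  finally show ?case .
qed

text \<open>In a product of two traces with both factors centred, the product of the two centrings
  is of order n^2; these products add up to n^2 \<open>cw (b # v)\<close> by the very recursion that
  defines \<open>cw\<close>. With the prefactor this is the term of order n^3 subtracted here, and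
  every remaining term is of order n^2 with products of lower degree.\<close>

lemma EB_S1:
  assumes IH: "\<And>us. deg us < D \<Longrightarrow> EB K 0 (deg us) (pl K us)"
    and D: "length v + 1 + deg us \<le> D"
  shows "EB K 2 (length v + 1 + deg us) (\<lambda>n x. of_nat n * (of_real (sr n K x ^ 2) * (S1 K b v n x * pl K us n x))
    - of_nat n ^ 3 * (of_real (sr n K x ^ (length v + 1)) * (kp K * of_real (cw (b # v)) * pl K us n x)))"
proof -
  let ?k = "length v + 1 + deg us"
  \<comment> \<open>The contribution of one cut after its leading part is removed; for opposite
    letters this expands the product of two traces as centred times centred plus two mixed
    terms.\<close>
  define T where "T p n x = (if b = fst (snd p) then ep K * (tr n K (fst p @ adj (snd (snd p))) x * pl K us n x)
     else kp K * (pl K (fst p # snd (snd p) # us) n x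
        + of_nat n * (of_real (sr n K x ^ length (fst p)) * (of_real (cw (fst p)) * pl K (snd (snd p) # us) n x))
        + of_nat n * (of_real (sr n K x ^ length (snd (snd p))) * (of_real (cw (snd (snd p))) * pl K (fst p # us) n x))))"
    for p :: "bool list \<times> bool \<times> bool list" and n x
  have "EB K 2 ?k (\<lambda>n x. \<Sum>p\<leftarrow>splits [] v. of_nat n * (of_real (sr n K x ^ 2) * T p n x))"
  proof (intro EB_sum_list)
    fix p assume "p \<in> set (splits [] v)"
    from splits_mem[OF this] have lv: "length v = Suc (length (fst p) + length (snd (snd p)))" by simp
    have "EB K 1 (length v - 1 + deg us) (T p)"
    proof (cases "b = fst (snd p)")
      case True
      have "EB K 1 (length v - 1 + deg us) (\<lambda>n x. ep K * (tr n K (fst p @ adj (snd (snd p))) x * pl K us n x))"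
        using D lv by (intro EB_cmult EB_tr_pl IH[of "(fst p @ adj (snd (snd p))) # us", unfolded deg.simps] IH) auto
      then show ?thesis using True by (simp add: T_def[abs_def])
    next
      case False
      have "EB K 1 (length v - 1 + deg us) (\<lambda>n x. kp K * (pl K (fst p # snd (snd p) # us) n x
        + of_nat n * (of_real (sr n K x ^ length (fst p)) * (of_real (cw (fst p)) * pl K (snd (snd p) # us) n x))
        + of_nat n * (of_real (sr n K x ^ length (snd (snd p))) * (of_real (cw (snd (snd p))) * pl K (fst p # us) n x))))"
      proof (intro EB_cmult EB_add)
        have "EB K 0 (length v - 1 + deg us) (pl K (fst p # snd (snd p) # us))"
          using IH[of "fst p # snd (snd p) # us"] D lv by (simp add: add_ac)
        then show "EB K 1 (length v - 1 + deg us) (pl K (fst p # snd (snd p) # us))"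
          by (rule EB_mono) simp
        show "EB K 1 (length v - 1 + deg us) (\<lambda>n x. of_nat n * (of_real (sr n K x ^ length (fst p)) * (of_real (cw (fst p)) * pl K (snd (snd p) # us) n x)))"
          using D lv by (intro EB_n[OF EB_sr[OF EB_cmult[OF IH]]]) auto
        show "EB K 1 (length v - 1 + deg us) (\<lambda>n x. of_nat n * (of_real (sr n K x ^ length (snd (snd p))) * (of_real (cw (snd (snd p))) * pl K (fst p # us) n x)))"
          using D lv by (intro EB_n[OF EB_sr[OF EB_cmult[OF IH]]]) auto
      qed
      then show ?thesis using False by (simp add: T_def[abs_def])
    qed
    then show "EB K 2 ?k (\<lambda>n x. of_nat n * (of_real (sr n K x ^ 2) * T p n x))"
      by (rule EB_n[OF EB_sr]) (use lv in auto)
  qed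
  also have "(\<lambda>n x. \<Sum>p\<leftarrow>splits [] v. of_nat n * (of_real (sr n K x ^ 2) * T p n x))
    = (\<lambda>n x. of_nat n * (of_real (sr n K x ^ 2) * (S1 K b v n x * pl K us n x))
    - of_nat n ^ 3 * (of_real (sr n K x ^ (length v + 1)) * (kp K * of_real (cw (b # v)) * pl K us n x)))"
  proof (intro ext)
    fix n x
    define t where "t p = (if b = fst (snd p) then ep K * tr n K (fst p @ adj (snd (snd p))) x
      else kp K * (tr n K (fst p) x * tr n K (snd (snd p)) x))" for p
    define c where "c p = (if b = fst (snd p) then 0 else cw (fst p) * cw (snd (snd p)))" for p :: "bool list \<times> bool \<times> bool list"
    have S1: "S1 K b v n x = (\<Sum>p\<leftarrow>splits [] v. t p)"
      unfolding S1_def t_def by (intro arg_cong[of _ _ sum_list] map_cong) auto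
    have cw: "cw (b # v) = (\<Sum>p\<leftarrow>splits [] v. c p)"
      by (simp add: c_def cw.simps(2))
    have "of_nat n * (of_real (sr n K x ^ 2) * T p n x)
      = of_nat n * (of_real (sr n K x ^ 2) * (t p * pl K us n x))
        - of_nat n ^ 3 * (of_real (sr n K x ^ (length v + 1)) * (kp K * of_real (c p) * pl K us n x))"
      if p: "p \<in> set (splits [] v)" for p
    proof (cases "b = fst (snd p)")
      case True
      then show ?thesis by (simp add: T_def t_def c_def)
    next
      case False
      from splits_mem[OF p] have lv: "length v + 1 = 2 + (length (fst p) + length (snd (snd p)))" by simp
      show ?thesis
        using False unfolding lv by (simp add: T_def t_def c_def pl.simps fl_def power_add power3_eq_cube power2_eq_square algebra_simps)
    qed
    then have "(\<Sum>p\<leftarrow>splits [] v. of_nat n * (of_real (sr n K x ^ 2) * T p n x))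
      = (\<Sum>p\<leftarrow>splits [] v. of_nat n * (of_real (sr n K x ^ 2) * (t p * pl K us n x))
        - of_nat n ^ 3 * (of_real (sr n K x ^ (length v + 1)) * (kp K * of_real (c p) * pl K us n x)))"
      by (intro arg_cong[of _ _ sum_list] map_cong) auto
    also have "\<dots> = of_nat n * (of_real (sr n K x ^ 2) * ((\<Sum>p\<leftarrow>ps. t p) * pl K us n x))
        - of_nat n ^ 3 * (of_real (sr n K x ^ (length v + 1)) * (kp K * of_real (\<Sum>p\<leftarrow>ps. c p) * pl K us n x))"
      if "ps = splits [] v" for ps
      unfolding that[symmetric] by (induction ps) (simp_all add: algebra_simps)
    finally show "(\<Sum>p\<leftarrow>splits [] v. of_nat n * (of_real (sr n K x ^ 2) * T p n x))
      = of_nat n * (of_real (sr n K x ^ 2) * (S1 K b v n x * pl K us n x))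
        - of_nat n ^ 3 * (of_real (sr n K x ^ (length v + 1)) * (kp K * of_real (cw (b # v)) * pl K us n x))"
      unfolding S1 cw by blast
  qed
  finally show ?thesis .
qed

text \<open>Strong induction on the total degree. The loop equation for the first trace expresses (d
  - 1 + deg - 1) times the wanted mean through products of smaller degree, all of order n^2, and the
  coefficient on the left is at least n^2 / 2.\<close>

theorem fluctuation_moments:
  assumes K: "K = {True} \<or> K = UNIV"
  shows "EB K 0 (deg us) (pl K us)"
proof (induction "deg us" arbitrary: us rule: less_induct)
  case less
  consider "us = []" | "\<exists>us'. us = [] # us'" | "\<exists>b v us'. us = (b # v) # us'"
    by (metis list.exhaust)
  then show ?case
  proof cases
    case 1
    have "pl K [] = (\<lambda>n x. 1)" by (auto simp: pl_Nil)
    then show ?thesis using 1 EB_one by simp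
  next
    case 2
    then have "pl K us = (\<lambda>n x. 0)" by (auto simp: fun_eq_iff pl.simps)
    then show ?thesis using EB_zero by simp
  next
    case 3
    then obtain b v us' where us: "us = (b # v) # us'" by blast
    let ?k = "length v + 1 + deg us'"
    have k: "deg us = ?k" by (simp add: us)
    have IH: "EB K 0 (deg ws) (pl K ws)" if "deg ws < ?k" for ws
      using less[of ws] that k by simp
    \<comment> \<open>Everything on the right of the loop equation except the part that is a
      multiple of the wanted product itself and the leading radial part, which also stands on the
      left. The third summand corrects for d - 1 and the word lengths multiplying the
      centring.\<close>
    define \<Phi> where "\<Phi> n x = (of_nat n * (of_real (sr n K x ^ 2) * (S1 K b v n x * pl K us' n x))
        - of_nat n ^ 3 * (of_real (sr n K x ^ (length v + 1)) * (kp K * of_real (cw (b # v)) * pl K us' n x)))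
      + of_nat n * (of_real (sr n K x ^ 2) * (cs K b v us' n x * pl K [] n x))
      + of_nat n * (of_real (sr n K x ^ (length v + 1)) * (of_real ((1 - real (length v + deg us')) * cw (b # v)) * pl K us' n x))
      + (- 1) * (tr n K (b # v) x * ((eu K us' n x - of_nat (deg us') * pl K us' n x) * pl K [] n x))" for n x
    have "EB K 2 ?k \<Phi>"
      unfolding \<Phi>_def[abs_def]
    proof (intro EB_add)
      show "EB K 2 ?k (\<lambda>n x. of_nat n * (of_real (sr n K x ^ 2) * (S1 K b v n x * pl K us' n x))
        - of_nat n ^ 3 * (of_real (sr n K x ^ (length v + 1)) * (kp K * of_real (cw (b # v)) * pl K us' n x)))"
        by (rule EB_S1[OF IH]) auto
      show "EB K 2 ?k (\<lambda>n x. of_nat n * (of_real (sr n K x ^ 2) * (cs K b v us' n x * pl K [] n x)))"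
        using EB_cs[OF K IH, where D = ?k and v = v and us = us' and ws = "[]" and b = b] by (simp add: pl_Nil)
      have "EB K 1 ?k (\<lambda>n x. of_nat n * (of_real (sr n K x ^ (length v + 1)) * (of_real ((1 - real (length v + deg us')) * cw (b # v)) * pl K us' n x)))"
        by (rule EB_n[OF EB_sr[OF EB_cmult[OF IH]]]) auto
      then show "EB K 2 ?k (\<lambda>n x. of_nat n * (of_real (sr n K x ^ (length v + 1)) * (of_real ((1 - real (length v + deg us')) * cw (b # v)) * pl K us' n x)))"
        by (rule EB_mono) simp
      show "EB K 2 ?k (\<lambda>n x. (- 1) * (tr n K (b # v) x * ((eu K us' n x - of_nat (deg us') * pl K us' n x) * pl K [] n x)))"
        using EB_eu[OF K IH, where D = ?k and w = "b # v" and us = us' and ws = "[]"] by (intro EB_cmult) simp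
    qed
    then obtain B where B: "B \<ge> 0" "\<And>n \<mu> r. adm K n \<mu> r \<Longrightarrow> rot_inv.pb \<mu> (ix n K) (\<Phi> n) \<and>
       norm (\<integral>x. r (nrm (ix n K) x) *\<^sub>R \<Phi> n x \<partial>\<mu>) \<le> B * real n ^ 2 * (\<integral>x. r (nrm (ix n K) x) * sr n K x ^ ?k \<partial>\<mu>)"
      unfolding EB_def by blast
    show ?thesis
    proof (rule EB_I[of "2 * B"])
      fix n \<mu> r assume ad: "adm K n \<mu> r"
      then interpret sph_mat \<mu> n K by (simp add: adm_def)
      show "pb (pl K us n)" by (rule pb_pl)
      have r: "pb (\<lambda>x. r (nrm (ix n K) x))" using ad by (simp add: adm_def)
      define I where "I \<phi> = (\<integral>x. r (nrm (ix n K) x) *\<^sub>R \<phi> x \<partial>\<mu>)" for \<phi> :: "pt \<Rightarrow> complex"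
      define d where "d = real (card (ix n K))"
      have d: "of_real d = of_nat n * of_nat n * kp K"
        by (simp add: d_def card_ix kp_def)
      have I_add: "I (\<lambda>x. \<phi> x + \<psi> x) = I \<phi> + I \<psi>" if "pb \<phi>" "pb \<psi>" for \<phi> \<psi>
        unfolding I_def scaleR_add_right
        by (intro Bochner_Integration.integral_add pb_integrable pb_scaleR r that)
      have I_mult: "I (\<lambda>x. a * \<phi> x) = a * I \<phi>" for a \<phi>
        unfolding I_def by (simp flip: mult_scaleR_right)
      have pbY: "pb (\<lambda>x. fl K (b # v) n x * pl K us' n x)" by (intro pb_mult pb_fl pb_pl)
      have pbR: "pb (\<lambda>x. of_real (sr n K x ^ (length v + 1)) * pl K us' n x)"
        by (intro pb_mult pb_pl pb_bounded_linear[OF bounded_linear_of_real] pb_power pb_sr)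
      have sd: "(d - 1) *\<^sub>R I (\<lambda>x. tr n K (b # v) x * pl K us' n x)
        = I (\<lambda>x. (nrm (ix n K) x)\<^sup>2 *\<^sub>R (S1 K b v n x * pl K us' n x + cs K b v us' n x)
             - tr n K (b # v) x * (of_nat (length v) * pl K us' n x + eu K us' n x))"
        using schwinger_dyson[OF tdiff_pl[of n K us'] pb_pl pb_dpl r, where b = b and v = v]
        unfolding I_def d_def S1_def cs_def eu_def .
      have e1: "I (\<lambda>x. tr n K (b # v) x * pl K us' n x)
        = I (\<lambda>x. fl K (b # v) n x * pl K us' n x)
          + of_real (real n * cw (b # v)) * I (\<lambda>x. of_real (sr n K x ^ (length v + 1)) * pl K us' n x)"
      proof -
        have "I (\<lambda>x. tr n K (b # v) x * pl K us' n x) = I (\<lambda>x. fl K (b # v) n x * pl K us' n x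
            + of_real (real n * cw (b # v)) * (of_real (sr n K x ^ (length v + 1)) * pl K us' n x))"
          by (intro arg_cong[of _ _ I] ext) (simp add: fl_def algebra_simps)
        then show ?thesis
          by (simp only: I_add[OF pbY pb_mult[OF pb_const pbR]] I_mult)
      qed
      have "I (\<lambda>x. (nrm (ix n K) x)\<^sup>2 *\<^sub>R (S1 K b v n x * pl K us' n x + cs K b v us' n x)
             - tr n K (b # v) x * (of_nat (length v) * pl K us' n x + eu K us' n x))
         = I (\<lambda>x. (\<Phi> n x + (- of_nat (length v + deg us')) * (fl K (b # v) n x * pl K us' n x))
             + ((of_real d - 1) * of_real (real n * cw (b # v))) * (of_real (sr n K x ^ (length v + 1)) * pl K us' n x))"
        unfolding \<Phi>_def d nrm_sr[OF n_pos] fl_def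
        by (intro arg_cong[of _ _ I] ext) (simp add: scaleR_conv_of_real power3_eq_cube pl_Nil algebra_simps)
      also have "\<dots> = I (\<Phi> n) - of_nat (length v + deg us') * I (\<lambda>x. fl K (b # v) n x * pl K us' n x)
          + (of_real d - 1) * of_real (real n * cw (b # v)) * I (\<lambda>x. of_real (sr n K x ^ (length v + 1)) * pl K us' n x)"
      proof -
        have p: "pb (\<Phi> n)" using B(2)[OF ad] by blast
        show ?thesis
          by (simp only: I_add[OF pb_add[OF p pb_mult[OF pb_const pbY]] pb_mult[OF pb_const pbR]]
              I_add[OF p pb_mult[OF pb_const pbY]] I_mult) (simp add: algebra_simps)
      qed
      finally have J: "(d - 1) *\<^sub>R I (\<lambda>x. tr n K (b # v) x * pl K us' n x) = I (\<Phi> n)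
          - of_nat (length v + deg us') * I (\<lambda>x. fl K (b # v) n x * pl K us' n x)
          + (of_real d - 1) * of_real (real n * cw (b # v)) * I (\<lambda>x. of_real (sr n K x ^ (length v + 1)) * pl K us' n x)"
        unfolding sd .
      \<comment> \<open>Here \<open>Y\<close> is the wanted mean and \<open>a * R\<close> the
        leading radial term, which drops out from both sides.\<close>
      have elim: "(D - 1 + L) * Y = P" if "(D - 1) * (Y + a * R) = P - L * Y + (D - 1) * a * R" for D L Y P a R :: complex
        using that by (simp add: algebra_simps)
      have key: "of_real (d - 1 + real (length v + deg us')) * I (\<lambda>x. fl K (b # v) n x * pl K us' n x) = I (\<Phi> n)"
        using elim[of "of_real d"] J[unfolded e1 scaleR_conv_of_real of_real_diff of_real_1] by simp
      have dl: "real n ^ 2 / 2 \<le> d - 1 + real (length v + deg us')"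
        using card_lower by (simp add: d_def)
      have E: "0 \<le> (\<integral>x. r (nrm (ix n K) x) * sr n K x ^ deg us \<partial>\<mu>)" by (rule adm_nonneg[OF ad])
      have nn: "0 < real n ^ 2" using n_pos by simp
      have "real n ^ 2 / 2 * norm (I (pl K us n)) \<le> (d - 1 + real (length v + deg us')) * norm (I (pl K us n))"
        by (rule mult_right_mono[OF dl]) simp
      also have "\<dots> = norm (I (\<Phi> n))"
      proof -
        have "0 \<le> d - 1 + real (length v + deg us')" using dl nn by linarith
        then show ?thesis unfolding key[symmetric] norm_mult norm_of_real us pl.simps by simp
      qed
      also have "\<dots> \<le> B * real n ^ 2 * (\<integral>x. r (nrm (ix n K) x) * sr n K x ^ deg us \<partial>\<mu>)"
        using B(2)[OF ad] by (simp add: I_def k)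
      finally have "real n ^ 2 * norm (I (pl K us n)) \<le> real n ^ 2 * (2 * B * (\<integral>x. r (nrm (ix n K) x) * sr n K x ^ deg us \<partial>\<mu>))"
        by (simp add: mult_ac)
      then show "norm (\<integral>x. r (nrm (ix n K) x) *\<^sub>R pl K us n x \<partial>\<mu>)
          \<le> 2 * B * real n ^ 0 * (\<integral>x. r (nrm (ix n K) x) * sr n K x ^ deg us \<partial>\<mu>)"
        using nn unfolding I_def by simp
    qed (use B in simp)
  qed
qed

section \<open>Power traces: the Stein identity and its kernel\<close>

section \<open>The Stein kernel of the power traces\<close>

lemma dwd_append:
  "i < n \<Longrightarrow> dwd n K (u @ v) i j x c = (\<Sum>k<n. dwd n K u i k x c * wd n K v k j x + wd n K u i k x * dwd n K v k j x c)"
proof (induction u arbitrary: i)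
  case Nil
  have "(\<Sum>k<n. dwd n K [] i k x c * wd n K v k j x + wd n K [] i k x * dwd n K v k j x c)
      = (\<Sum>k<n. if k = i then dwd n K v k j x c else 0)"
    by (intro sum.cong) auto
  then show ?case using Nil by simp
next
  case (Cons b u)
  have "dwd n K ((b # u) @ v) i j x c = (\<Sum>l<n. \<Sum>k<n. (dltr K b i l c * wd n K u l k x + ltr K b i l x * dwd n K u l k x c) * wd n K v k j x
      + ltr K b i l x * wd n K u l k x * dwd n K v k j x c)"
    using Cons.IH by (simp add: wd_append sum_distrib_left sum.distrib algebra_simps)
  also have "\<dots> = (\<Sum>k<n. \<Sum>l<n. (dltr K b i l c * wd n K u l k x + ltr K b i l x * dwd n K u l k x c) * wd n K v k j x
      + ltr K b i l x * wd n K u l k x * dwd n K v k j x c)"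
    by (rule sum.swap)
  finally show ?case by (simp add: sum_distrib_left sum_distrib_right sum.distrib algebra_simps)
qed

lemma dwd_single: "j < n \<Longrightarrow> dwd n K [b] i j x c = dltr K b i j c"
proof -
  assume "j < n"
  have "dwd n K [b] i j x c = (\<Sum>k<n. if k = j then dltr K b i k c else 0)"
    unfolding dwd.simps wd.simps by (intro sum.cong refl) simp
  also have "\<dots> = dltr K b i j c" using \<open>j < n\<close> by simp
  finally show ?thesis .
qed

lemma dwd_adj:
  "i < n \<Longrightarrow> j < n \<Longrightarrow> dwd n K (adj w) j i x c = cnj (dwd n K w i j x c)"
proof (induction w arbitrary: i)
  case (Cons b w)
  have "dwd n K (adj (b # w)) j i x c = (\<Sum>k<n. cnj (dwd n K w k j x c) * ltr K (\<not> b) k i x + cnj (wd n K w k j x) * dltr K (\<not> b) k i c)"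
    using Cons by (simp add: adj_Cons dwd_append dwd_single wd_single wd_adj del: wd.simps dwd.simps)
  then show ?case by (simp add: cnj_sum cnj_ltr cnj_dltr add.commute mult.commute)
qed simp

lemma dtr_adj: "dtr n K (adj w) x c = cnj (dtr n K w x c)"
  by (simp add: dtr_def dwd_adj cnj_sum)

lemma length_splits: "length (splits u w) = length w"
  by (induction w arbitrary: u) auto

lemma S2_replicate:
  "S2 K b v (replicate q c) n x = of_nat q * (if b = c then ep K * tr n K (v @ replicate (q - 1) (\<not> c)) x
     else kp K * tr n K (v @ replicate (q - 1) c) x)"
proof -
  have "S2 K b v (replicate q c) n x = (\<Sum>p\<leftarrow>splits [] (replicate q c). if b = c then ep K * tr n K (v @ replicate (q - 1) (\<not> c)) x
     else kp K * tr n K (v @ replicate (q - 1) c) x)"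
    unfolding S2_def
  proof (intro arg_cong[of _ _ sum_list] map_cong refl)
    fix p assume p: "p \<in> set (splits [] (replicate q c))"
    obtain u1 b' u2 where pp: "p = (u1, b', u2)" by (cases p)
    have m: "replicate q c = u1 @ b' # u2" using splits_mem[OF p] pp by simp
    then have "set (u1 @ b' # u2) \<subseteq> {c}" by (metis set_replicate_conv_if empty_subsetI order_refl)
    then have b': "b' = c" and s: "\<And>y. y \<in> set (u2 @ u1) \<Longrightarrow> y = c" by auto
    have "length (u2 @ u1) = q - 1" using arg_cong[OF m, of length] by simp
    then have "u2 @ u1 = replicate (q - 1) c" using s by (intro replicate_eqI) auto
    then show "(case p of (u1, b', u2) \<Rightarrow> if b = b' then ep K * tr n K (v @ adj (u2 @ u1)) x else kp K * tr n K (v @ u2 @ u1) x)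
       = (if b = c then ep K * tr n K (v @ replicate (q - 1) (\<not> c)) x else kp K * tr n K (v @ replicate (q - 1) c) x)"
      unfolding pp b' by simp
  qed
  then show ?thesis by (simp add: sum_list_triv length_splits)
qed

lemma splits_replicate_map:
  "splits u (replicate k c) = map (\<lambda>i. (u @ replicate i c, c, replicate (k - 1 - i) c)) [0..<k]"
proof (induction k arbitrary: u)
  case (Suc k)
  have "[0..<Suc k] = 0 # map Suc [0..<k]"
    by (simp add: upt_conv_Cons map_Suc_upt del: upt_Suc)
  then show ?case
    by (simp add: Suc.IH del: upt_Suc)
qed simp

lemma S1_replicate:
  "S1 K c (replicate k c) n x = ep K * (\<Sum>i<k. tr n K (replicate i c @ replicate (k - 1 - i) (\<not> c)) x)"
  unfolding S1_def splits_replicate_map map_map o_def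
  by (simp add: interv_sum_list_conv_sum_set_nat sum_distrib_left lessThan_atLeast0)

text \<open>Exactly one index makes the two blocks equally long, and only for odd \<open>k\<close>.
  With \<open>k = p - 1\<close> this produces the limiting mean 1 of the trace of an even power of a
  real matrix.\<close>

lemma sum_cw_replicate:
  "(\<Sum>i<k. cw (replicate i c @ replicate (k - 1 - i) (\<not> c))) = (if odd k then 1 else 0)"
proof -
  have "(\<Sum>i<k. cw (replicate i c @ replicate (k - 1 - i) (\<not> c))) = (\<Sum>i<k. if i = k div 2 then (if odd k then 1 else 0) else 0)"
    unfolding cw_alternating by (intro sum.cong) (auto, presburger+)
  then show ?thesis by (cases "k = 0") auto
qed

text \<open>The real part (\<open>k = True\<close>) or the imaginary part (\<open>k = False\<close>)
  of the trace of the \<open>p\<close>-th power, so that both fields are treated by real-valued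
  coordinates.\<close>

definition pw :: "bool set \<Rightarrow> nat \<Rightarrow> nat \<Rightarrow> bool \<Rightarrow> pt \<Rightarrow> real" where
  "pw K n p k x = Re (cnj (uc True k) * tr n K (replicate p True) x)"

definition dpw :: "bool set \<Rightarrow> nat \<Rightarrow> nat \<Rightarrow> bool \<Rightarrow> pt \<Rightarrow> (nat \<times> nat) \<times> bool \<Rightarrow> real" where
  "dpw K n p k x c = Re (cnj (uc True k) * dtr n K (replicate p True) x c)"

definition tau :: "bool set \<Rightarrow> nat \<Rightarrow> real" where
  "tau K p = (if K = {True} \<and> even p then 1 else 0)"

text \<open>The product of traces in the numerator is the tangential correction on the sphere; the
  summand \<open>p - 1\<close> in the denominator comes from the homogeneity of the remaining
  word.\<close>

definition kerA :: "bool set \<Rightarrow> nat \<Rightarrow> nat \<Rightarrow> bool \<Rightarrow> nat \<Rightarrow> bool \<Rightarrow> pt \<Rightarrow> real" where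
  "kerA K n p k q l x = real q * (real n * sr n K x ^ 2 * Re (cnj (uc True k) * uc True l *
       tr n K (replicate (p - 1) True @ replicate (q - 1) False) x) - pw K n p k x * pw K n q l x)
     / (real (card (ix n K)) - 1 + real (p - 1))"

definition kerR :: "bool set \<Rightarrow> nat \<Rightarrow> nat \<Rightarrow> bool \<Rightarrow> pt \<Rightarrow> real" where
  "kerR K n p k x = real n * sr n K x ^ 2 * Re (cnj (uc True k) * S1 K True (replicate (p - 1) True) n x)
     / (real (card (ix n K)) - 1 + real (p - 1)) - tau K p * sr n K x ^ p"

lemma tdiff_pw: "tdiff (ix n K) (pw K n p k) (dpw K n p k)"
  unfolding pw_def[abs_def] dpw_def[abs_def]
  by (intro tdiff_bounded_linear[OF bounded_linear_Re] tdiff_bounded_linear[OF bounded_linear_mult_right] tdiff_tr)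

lemma euler_pw:
  assumes "finite K"
  shows "(\<Sum>c\<in>ix n K. x c * dpw K n p k x c) = real p * pw K n p k x"
proof -
  have "(\<Sum>c\<in>ix n K. x c * dpw K n p k x c) = Re (cnj (uc True k) * (\<Sum>c\<in>ix n K. x c *\<^sub>R dtr n K (replicate p True) x c))"
    by (simp add: dpw_def sum_distrib_left Re_sum mult_ac)
  then show ?thesis unfolding euler_tr[OF assms] by (simp add: pw_def algebra_simps)
qed

text \<open>A real or imaginary part is half the sum of a rotated trace and its conjugate. For
  complex matrices only the conjugate half survives the contraction, with factor 2; for real ones
  the two halves contribute equally.\<close>

lemma con_dpw:
  assumes K: "K = {True} \<or> K = UNIV" and l: "l \<in> K"
  shows "(\<Sum>i<n. \<Sum>j<n. wd n K v j i x * con K True i j (\<lambda>c. of_real (dpw K n q l x c)))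
    = of_nat q * uc True l * tr n K (v @ replicate (q - 1) False) x"
proof -
  let ?S = "\<lambda>u. \<Sum>i<n. \<Sum>j<n. wd n K v j i x * con K True i j (dtr n K u x)"
  have S: "?S u = S2 K True v u n x" for u
    unfolding con_dtr[OF K] S2_def ..
  have re: "of_real (Re z) = (1 / 2) * z + (1 / 2) * cnj z" for z
    by (simp add: complex_eq_iff)
  have a: "adj (replicate q True) = replicate q False" by simp
  define \<alpha> \<beta> where "\<alpha> = cnj (uc True l) / 2" and "\<beta> = uc True l / 2"
  have "(\<lambda>c. complex_of_real (dpw K n q l x c)) = (\<lambda>c. \<alpha> * dtr n K (replicate q True) x c
      + \<beta> * dtr n K (replicate q False) x c)"
    unfolding dpw_def re dtr_adj[of n K "replicate q True", unfolded a] by (auto simp: fun_eq_iff \<alpha>_def \<beta>_def)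
  then have "(\<Sum>i<n. \<Sum>j<n. wd n K v j i x * con K True i j (\<lambda>c. of_real (dpw K n q l x c)))
      = \<alpha> * ?S (replicate q True) + \<beta> * ?S (replicate q False)"
    by (simp add: con_add con_cmult distrib_left sum.distrib sum_distrib_left mult_ac)
  also have "\<dots> = of_nat q * (\<alpha> * ep K + \<beta> * kp K) * tr n K (v @ replicate (q - 1) False) x"
    unfolding S S2_replicate by (simp add: algebra_simps)
  also have "\<alpha> * ep K + \<beta> * kp K = uc True l"
    using K
  proof
    assume "K = {True}"
    then show ?thesis using l by (simp add: uc_def \<alpha>_def \<beta>_def)
  qed (simp add: uc_def \<alpha>_def \<beta>_def)
  finally show ?thesis .
qed

context sph_mat
begin

lemma pb_pw: "pb (pw K n p k)"
  unfolding pw_def[abs_def]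
  by (intro pb_bounded_linear[OF bounded_linear_Re] pb_mult pb_const pb_tr)

lemma pb_dpw: "pb (\<lambda>x. dpw K n p k x c)"
  unfolding dpw_def[abs_def]
  by (intro pb_bounded_linear[OF bounded_linear_Re] pb_mult pb_const pb_dtr)

lemma pb_kerA: "pb (kerA K n p k q l)"
  unfolding kerA_def[abs_def] divide_inverse
  by (intro pb_bounded_linear[OF bounded_linear_Re] pb_mult pb_diff pb_power pb_sr pb_pw pb_const pb_tr)

lemma pb_S1: "pb (S1 K b v n)"
proof -
  have "pb (\<lambda>x. \<Sum>p\<leftarrow>ps. (case p of (v1, b', v2) \<Rightarrow> if b = b' then ep K * tr n K (v1 @ adj v2) x
      else kp K * (tr n K v1 x * tr n K v2 x)))" for ps
  proof (induction ps)
    case (Cons p ps)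
    obtain v1 b' v2 where p: "p = (v1, b', v2)" by (cases p)
    show ?case
      unfolding list.map sum_list.Cons p prod.case
      by (intro pb_add Cons.IH, cases "b = b'") (auto intro!: pb_mult pb_tr)
  qed simp
  then show ?thesis unfolding S1_def[abs_def] .
qed

lemma pb_kerR: "pb (kerR K n p k)"
  unfolding kerR_def[abs_def] divide_inverse
  by (intro pb_bounded_linear[OF bounded_linear_Re] pb_mult pb_diff pb_power pb_sr pb_const pb_S1)

lemma denominator_pos: "0 < real (card (ix n K)) - 1 + real (p - 1)"
proof -
  have "0 < real n ^ 2" using n_pos by simp
  then show ?thesis using card_lower by linarith
qed

text \<open>The loop equation for the word of \<open>p\<close> letters \<open>True\<close>,
  multiplied by a function \<open>H\<close> whose derivative is a combination of derivatives of
  power traces. Joining with these derivatives and the Euler term produce \<open>kerA\<close>;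
  cutting the word produces \<open>kerR\<close>.\<close>

lemma stein_identity:
  fixes H :: "pt \<Rightarrow> real" and E :: "'i set"
  assumes r: "pb (\<lambda>x. r (nrm (ix n K) x) :: real)"
    and H: "tdiff (ix n K) H (\<lambda>x c. \<Sum>e\<in>E. h e x * dpw K n (q e) (l e) x c)" "pb H"
    and h: "\<And>e. e \<in> E \<Longrightarrow> pb (h e)" and l: "\<And>e. e \<in> E \<Longrightarrow> l e \<in> K" and p: "1 \<le> p"
  shows "(\<integral>x. r (nrm (ix n K) x) * ((pw K n p k x - tau K p * sr n K x ^ p) * H x) \<partial>\<mu>)
    = (\<integral>x. r (nrm (ix n K) x) * (kerR K n p k x * H x + (\<Sum>e\<in>E. kerA K n p k (q e) (l e) x * h e x)) \<partial>\<mu>)"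
proof -
  define d where "d = real (card (ix n K)) - 1"
  define d' where "d' = d + real (p - 1)"
  have d': "d' > 0" using denominator_pos by (simp add: d'_def d_def)
  define v where "v = replicate (p - 1) True"
  have v: "True # v = replicate p True" using p by (cases p) (auto simp: v_def)
  have lv: "length v = p - 1" by (simp add: v_def)
  define dH where "dH x c = (\<Sum>e\<in>E. h e x * dpw K n (q e) (l e) x c)" for x c
  have finK: "finite K" by simp
  let ?r = "\<lambda>x. r (nrm (ix n K) x)"
  have pbo: "pb (\<lambda>x. complex_of_real (f x))" if "pb f" for f
    using pb_bounded_linear[OF bounded_linear_of_real that] .
  have pdH: "pb (\<lambda>x. dH x c)" for c
    unfolding dH_def by (intro pb_sum pb_mult h pb_dpw)
  have t: "tdiff (ix n K) (\<lambda>x. complex_of_real (H x)) (\<lambda>x c. of_real (dH x c))"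
    using tdiff_bounded_linear[OF bounded_linear_of_real H(1)] by (simp add: dH_def)
  define CS where "CS x = (\<Sum>e\<in>E. of_real (h e x) * (of_nat (q e) * uc True (l e) * tr n K (v @ replicate (q e - 1) False) x))" for x
  have cs: "(\<Sum>i<n. \<Sum>j<n. wd n K v j i x * con K True i j (\<lambda>c. complex_of_real (dH x c))) = CS x" for x
  proof -
    have "(\<Sum>i<n. \<Sum>j<n. wd n K v j i x * con K True i j (\<lambda>c. complex_of_real (dH x c)))
        = (\<Sum>i<n. \<Sum>j<n. \<Sum>e\<in>E. of_real (h e x) * (wd n K v j i x * con K True i j (\<lambda>c. of_real (dpw K n (q e) (l e) x c))))"
      unfolding dH_def of_real_sum of_real_mult con_sum con_cmult by (simp add: sum_distrib_left mult_ac)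
    also have "\<dots> = (\<Sum>i<n. \<Sum>e\<in>E. \<Sum>j<n. of_real (h e x) * (wd n K v j i x * con K True i j (\<lambda>c. of_real (dpw K n (q e) (l e) x c))))"
      by (intro sum.cong refl sum.swap)
    also have "\<dots> = (\<Sum>e\<in>E. \<Sum>i<n. \<Sum>j<n. of_real (h e x) * (wd n K v j i x * con K True i j (\<lambda>c. of_real (dpw K n (q e) (l e) x c))))"
      by (rule sum.swap)
    also have "\<dots> = CS x"
      unfolding CS_def by (intro sum.cong refl) (simp only: con_dpw[OF K l] flip: sum_distrib_left)
    finally show ?thesis .
  qed
  have eul: "(\<Sum>c\<in>ix n K. x c *\<^sub>R complex_of_real (dH x c)) = of_real (\<Sum>e\<in>E. h e x * (real (q e) * pw K n (q e) (l e) x))" for x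
  proof -
    have "(\<Sum>c\<in>ix n K. x c * dH x c) = (\<Sum>c\<in>ix n K. \<Sum>e\<in>E. h e x * (x c * dpw K n (q e) (l e) x c))"
      by (simp add: dH_def sum_distrib_left mult_ac)
    also have "\<dots> = (\<Sum>e\<in>E. \<Sum>c\<in>ix n K. h e x * (x c * dpw K n (q e) (l e) x c))"
      by (rule sum.swap)
    also have "\<dots> = (\<Sum>e\<in>E. h e x * (real (q e) * pw K n (q e) (l e) x))"
      unfolding sum_distrib_left[symmetric] euler_pw[OF finK] ..
    finally show ?thesis by (simp add: scaleR_conv_of_real flip: of_real_mult of_real_sum)
  qed
  define EU where "EU x = (\<Sum>e\<in>E. h e x * (real (q e) * pw K n (q e) (l e) x))" for x
  have pCS: "pb CS"
    unfolding CS_def[abs_def] by (intro pb_sum pb_mult pbo h pb_const pb_tr)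
  have pEU: "pb EU"
    unfolding EU_def[abs_def] by (intro pb_sum pb_mult h pb_const pb_pw)
  have "d *\<^sub>R (\<integral>x. ?r x *\<^sub>R (tr n K (True # v) x * of_real (H x)) \<partial>\<mu>)
      = (\<integral>x. ?r x *\<^sub>R ((nrm (ix n K) x)\<^sup>2 *\<^sub>R (S1 K True v n x * of_real (H x) + CS x)
          - tr n K (True # v) x * (of_nat (length v) * of_real (H x) + of_real (EU x))) \<partial>\<mu>)"
    using schwinger_dyson[OF t pbo[OF H(2)] pbo[OF pdH] r, where b = True and v = v]
    unfolding cs eul S1_def d_def EU_def .
  then have "Re (cnj (uc True k) * (d *\<^sub>R (\<integral>x. ?r x *\<^sub>R (tr n K (True # v) x * of_real (H x)) \<partial>\<mu>)))
      = Re (cnj (uc True k) * (\<integral>x. ?r x *\<^sub>R ((nrm (ix n K) x)\<^sup>2 *\<^sub>R (S1 K True v n x * of_real (H x) + CS x)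
          - tr n K (True # v) x * (of_nat (length v) * of_real (H x) + of_real (EU x))) \<partial>\<mu>))"
    by simp
  also have "Re (cnj (uc True k) * (d *\<^sub>R (\<integral>x. ?r x *\<^sub>R (tr n K (True # v) x * of_real (H x)) \<partial>\<mu>)))
      = d * (\<integral>x. ?r x * (pw K n p k x * H x) \<partial>\<mu>)"
  proof -
    have i: "integrable \<mu> (\<lambda>x. cnj (uc True k) * (?r x *\<^sub>R (tr n K (True # v) x * of_real (H x))))"
      by (intro pb_integrable pb_mult pb_scaleR pb_const r pb_tr pbo H)
    have "Re (cnj (uc True k) * (d *\<^sub>R (\<integral>x. ?r x *\<^sub>R (tr n K (True # v) x * of_real (H x)) \<partial>\<mu>)))
        = d * Re (\<integral>x. cnj (uc True k) * (?r x *\<^sub>R (tr n K (True # v) x * of_real (H x))) \<partial>\<mu>)"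
      unfolding integral_mult_right_zero by (simp add: algebra_simps)
    also have "Re (\<integral>x. cnj (uc True k) * (?r x *\<^sub>R (tr n K (True # v) x * of_real (H x))) \<partial>\<mu>)
        = (\<integral>x. Re (cnj (uc True k) * (?r x *\<^sub>R (tr n K (True # v) x * of_real (H x)))) \<partial>\<mu>)"
      by (simp only: integral_Re[OF i] integral_mult_right_zero)
    also have "(\<lambda>x. Re (cnj (uc True k) * (?r x *\<^sub>R (tr n K (True # v) x * of_real (H x))))) = (\<lambda>x. ?r x * (pw K n p k x * H x))"
      unfolding v pw_def by (auto simp: fun_eq_iff algebra_simps)
    finally show ?thesis .
  qed
  also have "Re (cnj (uc True k) * (\<integral>x. ?r x *\<^sub>R ((nrm (ix n K) x)\<^sup>2 *\<^sub>R (S1 K True v n x * of_real (H x) + CS x)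
          - tr n K (True # v) x * (of_nat (length v) * of_real (H x) + of_real (EU x))) \<partial>\<mu>))
      = (\<integral>x. ?r x * ((real n * sr n K x ^ 2) * (Re (cnj (uc True k) * S1 K True v n x) * H x + Re (cnj (uc True k) * CS x))
          - pw K n p k x * EU x) - real (p - 1) * (?r x * (pw K n p k x * H x)) \<partial>\<mu>)"
  proof -
    have i: "integrable \<mu> (\<lambda>x. cnj (uc True k) * (?r x *\<^sub>R ((nrm (ix n K) x)\<^sup>2 *\<^sub>R (S1 K True v n x * of_real (H x) + CS x)
          - tr n K (True # v) x * (of_nat (length v) * of_real (H x) + of_real (EU x)))))"
      by (intro pb_integrable pb_mult pb_scaleR pb_add pb_diff pb_const r pb_tr pbo pb_power pb_nrm H pb_S1 pCS pEU)
    have "Re (cnj (uc True k) * (\<integral>x. ?r x *\<^sub>R ((nrm (ix n K) x)\<^sup>2 *\<^sub>R (S1 K True v n x * of_real (H x) + CS x)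
          - tr n K (True # v) x * (of_nat (length v) * of_real (H x) + of_real (EU x))) \<partial>\<mu>))
        = (\<integral>x. Re (cnj (uc True k) * (?r x *\<^sub>R ((nrm (ix n K) x)\<^sup>2 *\<^sub>R (S1 K True v n x * of_real (H x) + CS x)
          - tr n K (True # v) x * (of_nat (length v) * of_real (H x) + of_real (EU x))))) \<partial>\<mu>)"
      by (simp only: integral_Re[OF i] integral_mult_right_zero)
    also have "(\<lambda>x. Re (cnj (uc True k) * (?r x *\<^sub>R ((nrm (ix n K) x)\<^sup>2 *\<^sub>R (S1 K True v n x * of_real (H x) + CS x)
          - tr n K (True # v) x * (of_nat (length v) * of_real (H x) + of_real (EU x))))))
        = (\<lambda>x. ?r x * ((real n * sr n K x ^ 2) * (Re (cnj (uc True k) * S1 K True v n x) * H x + Re (cnj (uc True k) * CS x))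
          - pw K n p k x * EU x) - real (p - 1) * (?r x * (pw K n p k x * H x)))"
      unfolding v pw_def nrm_sr[OF n_pos] lv by (auto simp: fun_eq_iff algebra_simps)
    finally show ?thesis .
  qed
  also have "\<dots> = (\<integral>x. ?r x * ((real n * sr n K x ^ 2) * (Re (cnj (uc True k) * S1 K True v n x) * H x + Re (cnj (uc True k) * CS x))
          - pw K n p k x * EU x) \<partial>\<mu>) - real (p - 1) * (\<integral>x. ?r x * (pw K n p k x * H x) \<partial>\<mu>)"
    by (subst Bochner_Integration.integral_diff, (intro pb_integrable pb_mult pb_add pb_diff pb_const r pb_power
      pb_sr H pb_pw pb_S1 pCS pEU pb_bounded_linear[OF bounded_linear_Re])+) simp
  \<comment> \<open>The Euler term of the word is \<open>p - 1\<close> times the left side; moving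
    it over changes the factor \<open>d\<close> into \<open>d'\<close>.\<close>
  finally have e: "d' * (\<integral>x. ?r x * (pw K n p k x * H x) \<partial>\<mu>)
      = (\<integral>x. ?r x * ((real n * sr n K x ^ 2) * (Re (cnj (uc True k) * S1 K True v n x) * H x + Re (cnj (uc True k) * CS x))
          - pw K n p k x * EU x) \<partial>\<mu>)"
    by (simp add: d'_def algebra_simps)
  have "(\<integral>x. ?r x * (pw K n p k x * H x) \<partial>\<mu>)
      = (\<integral>x. ?r x * ((real n * sr n K x ^ 2) * (Re (cnj (uc True k) * S1 K True v n x) * H x + Re (cnj (uc True k) * CS x))
          - pw K n p k x * EU x) / d' \<partial>\<mu>)"
    using e d' by (simp add: field_simps)
  also have "\<dots> = (\<integral>x. ?r x * (kerR K n p k x * H x + (\<Sum>e\<in>E. kerA K n p k (q e) (l e) x * h e x))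
        + ?r x * (tau K p * sr n K x ^ p * H x) \<partial>\<mu>)"
  proof (intro Bochner_Integration.integral_cong refl)
    fix x
    define t where "t e = Re (cnj (uc True k) * uc True (l e) * tr n K (v @ replicate (q e - 1) False) x)" for e
    have CS: "Re (cnj (uc True k) * CS x) = (\<Sum>e\<in>E. h e x * (real (q e) * t e))"
      unfolding CS_def sum_distrib_left Re_sum t_def by (intro sum.cong refl) (simp add: algebra_simps)
    have kA: "d' * kerA K n p k (q e) (l e) x = real (q e) * (real n * sr n K x ^ 2 * t e - pw K n p k x * pw K n (q e) (l e) x)" for e
      using d' unfolding kerA_def t_def v_def d_def d'_def by simp
    have kA': "d' * (kerA K n p k (q e) (l e) x * h e x)
        = (real n * sr n K x ^ 2) * (h e x * (real (q e) * t e)) - pw K n p k x * (h e x * (real (q e) * pw K n (q e) (l e) x))" for e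
      unfolding mult.assoc[symmetric] kA by (simp add: algebra_simps)
    have X: "(real n * sr n K x ^ 2) * Re (cnj (uc True k) * CS x) - pw K n p k x * EU x
        = d' * (\<Sum>e\<in>E. kerA K n p k (q e) (l e) x * h e x)"
      unfolding CS EU_def sum_distrib_left kA' sum_subtractf ..
    have kR: "kerR K n p k x = (real n * sr n K x ^ 2) * Re (cnj (uc True k) * S1 K True v n x) / d' - tau K p * sr n K x ^ p"
      unfolding kerR_def v_def d_def d'_def ..
    have alg: "R * (N * (S * h + C) - P) / d' = R * ((N * S / d' - T) * h + Y) + R * (T * h)"
      if "N * C - P = d' * Y" for R N S h C P Y T
    proof -
      have "N * (S * h + C) - P = N * S * h + d' * Y" using that by (simp add: algebra_simps)
      then show ?thesis using d' by (simp add: field_simps)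
    qed
    show "?r x * ((real n * sr n K x ^ 2) * (Re (cnj (uc True k) * S1 K True v n x) * H x + Re (cnj (uc True k) * CS x))
          - pw K n p k x * EU x) / d'
        = ?r x * (kerR K n p k x * H x + (\<Sum>e\<in>E. kerA K n p k (q e) (l e) x * h e x))
          + ?r x * (tau K p * sr n K x ^ p * H x)"
      unfolding kR by (rule alg[OF X])
  qed
  also have "\<dots> = (\<integral>x. ?r x * (kerR K n p k x * H x + (\<Sum>e\<in>E. kerA K n p k (q e) (l e) x * h e x)) \<partial>\<mu>)
        + (\<integral>x. ?r x * (tau K p * sr n K x ^ p * H x) \<partial>\<mu>)"
    by (intro Bochner_Integration.integral_add pb_integrable pb_mult pb_add pb_sum pb_const r pb_power pb_sr H pb_kerA pb_kerR h)
  finally have "(\<integral>x. ?r x * (pw K n p k x * H x) \<partial>\<mu>) - (\<integral>x. ?r x * (tau K p * sr n K x ^ p * H x) \<partial>\<mu>)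
      = (\<integral>x. ?r x * (kerR K n p k x * H x + (\<Sum>e\<in>E. kerA K n p k (q e) (l e) x * h e x)) \<partial>\<mu>)"
    by simp
  also have "(\<integral>x. ?r x * (pw K n p k x * H x) \<partial>\<mu>) - (\<integral>x. ?r x * (tau K p * sr n K x ^ p * H x) \<partial>\<mu>)
      = (\<integral>x. ?r x * (pw K n p k x * H x) - ?r x * (tau K p * sr n K x ^ p * H x) \<partial>\<mu>)"
    by (intro Bochner_Integration.integral_diff[symmetric] pb_integrable pb_mult pb_const r pb_power pb_sr H pb_pw)
  finally show ?thesis by (simp add: algebra_simps)
qed

end

section \<open>Absolute moments of centred traces and of the kernel errors\<close>

lemma fl_adj: "cw (adj w) = cw w \<Longrightarrow> fl K (adj w) n x = cnj (fl K w n x)"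
  by (simp add: fl_def tr_adj)

lemma admD:
  assumes "adm K n \<mu> r"
  shows "sph_mat \<mu> n K" "0 \<le> r y" "rot_inv.pb \<mu> (ix n K) (\<lambda>x. r (nrm (ix n K) x))"
  using assms by (auto simp: adm_def)

text \<open>The squared modulus is the product of the centred traces of \<open>w\<close> and
  \<open>adj w\<close>, a case of \<open>fluctuation_moments\<close>.\<close>

lemma fl_L2:
  assumes K: "K = {True} \<or> K = UNIV" and w: "cw (adj w) = cw w"
  obtains B where "B \<ge> 0" "\<And>n \<mu> r. adm K n \<mu> r \<Longrightarrow>
    (\<integral>x. r (nrm (ix n K) x) * norm (fl K w n x) ^ 2 \<partial>\<mu>) \<le> B * (\<integral>x. r (nrm (ix n K) x) * sr n K x ^ (2 * length w) \<partial>\<mu>)"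
proof -
  have "EB K 0 (2 * length w) (pl K [w, adj w])"
    using fluctuation_moments[OF K, of "[w, adj w]"] by (simp add: mult_2)
  then obtain B where B: "B \<ge> 0" "\<And>n \<mu> r. adm K n \<mu> r \<Longrightarrow>
     norm (\<integral>x. r (nrm (ix n K) x) *\<^sub>R pl K [w, adj w] n x \<partial>\<mu>) \<le> B * real n ^ 0 * (\<integral>x. r (nrm (ix n K) x) * sr n K x ^ (2 * length w) \<partial>\<mu>)"
    unfolding EB_def by blast
  show ?thesis
  proof
    fix n \<mu> r assume ad: "adm K n \<mu> r"
    have "r (nrm (ix n K) x) *\<^sub>R pl K [w, adj w] n x = of_real (r (nrm (ix n K) x) * norm (fl K w n x) ^ 2)" for x
      by (simp add: pl.simps fl_adj[OF w] scaleR_conv_of_real flip: complex_norm_square)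
    then have "(\<integral>x. r (nrm (ix n K) x) *\<^sub>R pl K [w, adj w] n x \<partial>\<mu>)
        = of_real (\<integral>x. r (nrm (ix n K) x) * norm (fl K w n x) ^ 2 \<partial>\<mu>)"
      by (simp only: integral_complex_of_real)
    then show "(\<integral>x. r (nrm (ix n K) x) * norm (fl K w n x) ^ 2 \<partial>\<mu>) \<le> B * (\<integral>x. r (nrm (ix n K) x) * sr n K x ^ (2 * length w) \<partial>\<mu>)"
      using B(2)[OF ad] by (simp add: abs_le_iff)
  qed (rule B(1))
qed

lemma mult_le_squares: "a * b \<le> a\<^sup>2 + b\<^sup>2" for a b :: real
  using sum_squares_bound[of a b] zero_le_power2[of a] zero_le_power2[of b] by linarith

lemma power_le_one_plus:
  fixes s :: real
  assumes "0 \<le> s" "j \<le> D"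
  shows "s ^ j \<le> 1 + s ^ D"
proof (cases "s \<le> 1")
  case True
  then have "s ^ j \<le> 1" using assms by (simp add: power_le_one)
  then show ?thesis using assms zero_le_power[of s D] by linarith
next
  case False
  then have "s ^ j \<le> s ^ D" using assms by (intro power_increasing) auto
  then show ?thesis by simp
qed

context sph_mat
begin

lemma weighted_mono:
  fixes f g :: "pt \<Rightarrow> real" and r :: "real \<Rightarrow> real"
  assumes "\<And>y. 0 \<le> r y" "pb (\<lambda>x. r (nrm (ix n K) x))" "pb f" "pb g" "\<And>x. f x \<le> g x"
  shows "(\<integral>x. r (nrm (ix n K) x) * f x \<partial>\<mu>) \<le> (\<integral>x. r (nrm (ix n K) x) * g x \<partial>\<mu>)"
proof (rule Bochner_Integration.integral_mono)
  show "r (nrm (ix n K) x) * f x \<le> r (nrm (ix n K) x) * g x" for x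
    using assms(1,5) by (rule mult_left_mono[rotated])
qed (intro pb_integrable pb_mult assms)+

end

text \<open>A direct use of the second moment would cost degree 2 |w| in the radius. Where the
  radius is at least 1, s^|w| |fl| <= s^(2|w|) + |fl|^2 is used with a weight divided by s^|w|,
  which restores the true degree; where it is below 1, |fl| <= 1 + |fl|^2 suffices. The sharp degree
  lets the real case be done with moments up to m.\<close>

lemma fl_L1:
  assumes K: "K = {True} \<or> K = UNIV" and w: "cw (adj w) = cw w" and D: "j + length w \<le> D"
  obtains B where "B \<ge> 0" "\<And>n \<mu> r. adm K n \<mu> r \<Longrightarrow>
    (\<integral>x. r (nrm (ix n K) x) * (sr n K x ^ j * norm (fl K w n x)) \<partial>\<mu>) \<le> B * (\<integral>x. r (nrm (ix n K) x) * (1 + sr n K x ^ D) \<partial>\<mu>)"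
proof -
  define k where "k = length w"
  obtain B where B: "B \<ge> 0" "\<And>n \<mu> r. adm K n \<mu> r \<Longrightarrow>
    (\<integral>x. r (nrm (ix n K) x) * norm (fl K w n x) ^ 2 \<partial>\<mu>) \<le> B * (\<integral>x. r (nrm (ix n K) x) * sr n K x ^ (2 * k) \<partial>\<mu>)"
    using fl_L2[OF K w] unfolding k_def by blast
  show ?thesis
  proof
    fix n \<mu> r assume ad: "adm K n \<mu> r"
    interpret sph_mat \<mu> n K by (rule admD(1)[OF ad])
    let ?N = "nrm (ix n K)" and ?s = "sr n K"
    \<comment> \<open>\<open>r1\<close> lives on radius below 1 and \<open>r2\<close> on its
      complement, where division by the power is harmless. Both are again admissible
      weights.\<close>
    define r1 where "r1 y = r y * ((if \<bar>y\<bar> / sqrt n < 1 then 1 else 0) * (\<bar>y\<bar> / sqrt n) ^ j)" for y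
    define r2 where "r2 y = r y * ((if \<bar>y\<bar> / sqrt n < 1 then 0 else 1 / (\<bar>y\<bar> / sqrt n) ^ k) * (\<bar>y\<bar> / sqrt n) ^ j)" for y
    have r1: "r1 (?N x) = r (?N x) * ((if ?s x < 1 then 1 else 0) * ?s x ^ j)" for x
      by (simp add: r1_def sr_def nrm_nonneg)
    have r2: "r2 (?N x) = r (?N x) * ((if ?s x < 1 then 0 else 1 / ?s x ^ k) * ?s x ^ j)" for x
      by (simp add: r2_def sr_def nrm_nonneg)
    have [measurable]: "?s \<in> borel_measurable \<mu>" using pb_sr by (rule pb_measurable)
    have p1: "pb (\<lambda>x. r1 (?N x))"
      unfolding r1 by (intro pb_mult pb_power pb_sr admD[OF ad], rule pb_dom[OF pb_const[of "1::real"]]) auto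
    have p2: "pb (\<lambda>x. r2 (?N x))"
      unfolding r2
    proof (intro pb_mult pb_power pb_sr admD[OF ad], rule pb_dom[OF pb_const[of "1::real"]])
      show "(\<lambda>x. if ?s x < 1 then 0 else 1 / ?s x ^ k) \<in> borel_measurable \<mu>" by measurable
      show "norm (if ?s x < 1 then 0 else 1 / ?s x ^ k) \<le> norm (1::real)" for x
        using one_le_power[of "?s x" k] by (simp add: divide_simps)
    qed
    have a1: "adm K n \<mu> r1" and a2: "adm K n \<mu> r2"
      using p1 p2 ad by (auto simp: adm_def r1_def r2_def)
    have pn: "pb (\<lambda>x. norm (fl K w n x))" by (intro pb_norm pb_fl)
    have pr: "pb (\<lambda>x. r (?N x))" by (rule admD[OF ad])
    have 1: "r (?N x) * (?s x ^ j * norm (fl K w n x)) = r1 (?N x) * norm (fl K w n x) + r2 (?N x) * (?s x ^ k * norm (fl K w n x))" for x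
      unfolding r1 r2 using sr_nonneg[of n K x] by auto
    have T: "r1 (?N x) + r2 (?N x) * ?s x ^ (2 * k) \<le> r (?N x) * (1 + ?s x ^ D)" for x
    proof (cases "?s x < 1")
      case True
      then show ?thesis
        unfolding r1 r2 using admD(2)[OF ad, of "?N x"] power_le_one_plus[OF sr_nonneg[of n K x], of j D] D by (simp add: mult_left_mono)
    next
      case False
      then have eq: "1 / ?s x ^ k * ?s x ^ j * ?s x ^ (2 * k) = ?s x ^ (j + k)"
        by (simp add: power_add mult_2)
      have "r1 (?N x) = 0" "r2 (?N x) * ?s x ^ (2 * k) = r (?N x) * ?s x ^ (j + k)"
        by (simp_all only: r1 r2 False if_False mult.assoc eq[unfolded mult.assoc] mult_zero_left mult_zero_right)
      then show ?thesis
        using admD(2)[OF ad, of "?N x"] power_le_one_plus[OF sr_nonneg[of n K x], of "j + k" D] D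
        by (simp add: mult_left_mono k_def)
    qed
    have T1: "(\<integral>x. r1 (?N x) \<partial>\<mu>) + (\<integral>x. r2 (?N x) * ?s x ^ (2 * k) \<partial>\<mu>) \<le> (\<integral>x. r (?N x) * (1 + ?s x ^ D) \<partial>\<mu>)"
      by (subst Bochner_Integration.integral_add[symmetric])
        (auto intro!: Bochner_Integration.integral_mono T pb_integrable pb_mult pb_add pb_power pb_sr p1 p2 pr)
    have b1: "(\<integral>x. r1 (?N x) * norm (fl K w n x) \<partial>\<mu>) \<le> (1 + B) * (\<integral>x. r1 (?N x) \<partial>\<mu>)"
    proof -
      have "(\<integral>x. r1 (?N x) * norm (fl K w n x) \<partial>\<mu>) \<le> (\<integral>x. r1 (?N x) * (1 + norm (fl K w n x) ^ 2) \<partial>\<mu>)"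
      proof (intro weighted_mono p1 pn pb_add pb_const pb_power)
        show "norm (fl K w n x) \<le> 1 + norm (fl K w n x) ^ 2" for x
          using power_le_one_plus[of "norm (fl K w n x)" 1 2] by simp
      qed (use a1 in \<open>simp add: adm_def\<close>)
      also have "\<dots> = (\<integral>x. r1 (?N x) \<partial>\<mu>) + (\<integral>x. r1 (?N x) * norm (fl K w n x) ^ 2 \<partial>\<mu>)"
        unfolding distrib_left mult_1_right
        by (intro Bochner_Integration.integral_add pb_integrable pb_mult pb_power p1 pn)
      also have "(\<integral>x. r1 (?N x) * norm (fl K w n x) ^ 2 \<partial>\<mu>) \<le> B * (\<integral>x. r1 (?N x) * ?s x ^ (2 * k) \<partial>\<mu>)"
        by (rule B(2)[OF a1])
      also have "(\<integral>x. r1 (?N x) * ?s x ^ (2 * k) \<partial>\<mu>) \<le> (\<integral>x. r1 (?N x) \<partial>\<mu>)"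
      proof (intro Bochner_Integration.integral_mono pb_integrable pb_mult pb_power pb_sr p1)
        fix x
        show "r1 (?N x) * ?s x ^ (2 * k) \<le> r1 (?N x)"
        proof (cases "?s x < 1")
          case True
          then have "?s x ^ (2 * k) \<le> 1" using sr_nonneg[of n K x] by (simp add: power_le_one)
          then show ?thesis using mult_left_mono[of "?s x ^ (2 * k)" 1 "r1 (?N x)"] a1 by (simp add: adm_def)
        qed (simp add: r1)
      qed
      finally show ?thesis using B(1) by (simp add: distrib_right mult_left_mono)
    qed
    have b2: "(\<integral>x. r2 (?N x) * (?s x ^ k * norm (fl K w n x)) \<partial>\<mu>) \<le> (1 + B) * (\<integral>x. r2 (?N x) * ?s x ^ (2 * k) \<partial>\<mu>)"
    proof -
      have "(\<integral>x. r2 (?N x) * (?s x ^ k * norm (fl K w n x)) \<partial>\<mu>) \<le> (\<integral>x. r2 (?N x) * (?s x ^ (2 * k) + norm (fl K w n x) ^ 2) \<partial>\<mu>)"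
      proof (intro weighted_mono p2 pn pb_add pb_const pb_power pb_mult pb_sr)
        show "?s x ^ k * norm (fl K w n x) \<le> ?s x ^ (2 * k) + norm (fl K w n x) ^ 2" for x
          using mult_le_squares[of "?s x ^ k" "norm (fl K w n x)"] by (simp add: power_mult[symmetric] mult.commute)
      qed (use a2 in \<open>simp add: adm_def\<close>)
      also have "\<dots> = (\<integral>x. r2 (?N x) * ?s x ^ (2 * k) \<partial>\<mu>) + (\<integral>x. r2 (?N x) * norm (fl K w n x) ^ 2 \<partial>\<mu>)"
        unfolding distrib_left
        by (intro Bochner_Integration.integral_add pb_integrable pb_mult pb_power p2 pn pb_sr)
      also have "(\<integral>x. r2 (?N x) * norm (fl K w n x) ^ 2 \<partial>\<mu>) \<le> B * (\<integral>x. r2 (?N x) * ?s x ^ (2 * k) \<partial>\<mu>)"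
        by (rule B(2)[OF a2])
      finally show ?thesis by (simp add: distrib_right)
    qed
    have "(\<integral>x. r (?N x) * (?s x ^ j * norm (fl K w n x)) \<partial>\<mu>)
        = (\<integral>x. r1 (?N x) * norm (fl K w n x) \<partial>\<mu>) + (\<integral>x. r2 (?N x) * (?s x ^ k * norm (fl K w n x)) \<partial>\<mu>)"
      unfolding 1 by (intro Bochner_Integration.integral_add pb_integrable pb_mult pb_power pb_sr p1 p2 pn)
    also have "\<dots> \<le> (1 + B) * ((\<integral>x. r1 (?N x) \<partial>\<mu>) + (\<integral>x. r2 (?N x) * ?s x ^ (2 * k) \<partial>\<mu>))"
      using b1 b2 by (simp add: distrib_left)
    also have "\<dots> \<le> (1 + B) * (\<integral>x. r (?N x) * (1 + ?s x ^ D) \<partial>\<mu>)"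
      using T1 B(1) by (intro mult_left_mono) auto
    finally show "(\<integral>x. r (?N x) * (?s x ^ j * norm (fl K w n x)) \<partial>\<mu>) \<le> (1 + B) * (\<integral>x. r (?N x) * (1 + ?s x ^ D) \<partial>\<mu>)" .
  qed (use B in simp)
qed

text \<open>
  The predicate \<open>LB K D \<phi>\<close> is the absolute counterpart of \<open>EB\<close>: the weighted mean of \<open>\<phi> \<ge> 0\<close> is
  bounded by that of \<open>1 + s ^ D\<close>, uniformly in the size, the distribution and the weight.
\<close>

definition LB :: "bool set \<Rightarrow> nat \<Rightarrow> (nat \<Rightarrow> pt \<Rightarrow> real) \<Rightarrow> bool" where
  "LB K D \<phi> \<longleftrightarrow> (\<exists>B\<ge>0. \<forall>n \<mu> r. adm K n \<mu> r \<longrightarrow> rot_inv.pb \<mu> (ix n K) (\<phi> n) \<and>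
     (\<integral>x. r (nrm (ix n K) x) * \<phi> n x \<partial>\<mu>) \<le> B * (\<integral>x. r (nrm (ix n K) x) * (1 + sr n K x ^ D) \<partial>\<mu>))"

lemma LB_I:
  assumes "0 \<le> B" "\<And>n \<mu> r. adm K n \<mu> r \<Longrightarrow> rot_inv.pb \<mu> (ix n K) (\<phi> n)"
    "\<And>n \<mu> r. adm K n \<mu> r \<Longrightarrow> (\<integral>x. r (nrm (ix n K) x) * \<phi> n x \<partial>\<mu>)
      \<le> B * (\<integral>x. r (nrm (ix n K) x) * (1 + sr n K x ^ D) \<partial>\<mu>)"
  shows "LB K D \<phi>"
  using assms unfolding LB_def by blast

lemma LB_fl:
  assumes K: "K = {True} \<or> K = UNIV" and w: "cw (adj w) = cw w" and D: "j + length w \<le> D"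
  shows "LB K D (\<lambda>n x. sr n K x ^ j * norm (fl K w n x))"
proof -
  obtain B where B: "B \<ge> 0" "\<And>n \<mu> r. adm K n \<mu> r \<Longrightarrow>
    (\<integral>x. r (nrm (ix n K) x) * (sr n K x ^ j * norm (fl K w n x)) \<partial>\<mu>) \<le> B * (\<integral>x. r (nrm (ix n K) x) * (1 + sr n K x ^ D) \<partial>\<mu>)"
    using fl_L1[OF assms] by blast
  show ?thesis
  proof (rule LB_I[OF B(1)])
    fix n \<mu> r assume ad: "adm K n \<mu> r"
    interpret sph_mat \<mu> n K by (rule admD(1)[OF ad])
    show "pb (\<lambda>x. sr n K x ^ j * norm (fl K w n x))" by (intro pb_mult pb_norm pb_fl pb_power pb_sr)
  qed (rule B(2))
qed

lemma LB_sr: "j \<le> D \<Longrightarrow> LB K D (\<lambda>n x. sr n K x ^ j)"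
proof (rule LB_I[of 1])
  fix n \<mu> r assume ad: "adm K n \<mu> r" and j: "j \<le> D"
  interpret sph_mat \<mu> n K by (rule admD(1)[OF ad])
  show "pb (\<lambda>x. sr n K x ^ j)" by (intro pb_power pb_sr)
  show "(\<integral>x. r (nrm (ix n K) x) * sr n K x ^ j \<partial>\<mu>) \<le> 1 * (\<integral>x. r (nrm (ix n K) x) * (1 + sr n K x ^ D) \<partial>\<mu>)"
    unfolding mult_1 using j
    by (intro weighted_mono admD[OF ad] pb_power pb_sr pb_add pb_const power_le_one_plus sr_nonneg)
qed simp

lemma LB_fl_square:
  assumes K: "K = {True} \<or> K = UNIV" and w: "cw (adj w) = cw w" and D: "2 * length w \<le> D"
  shows "LB K D (\<lambda>n x. norm (fl K w n x) ^ 2)"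
proof -
  obtain B where B: "B \<ge> 0" "\<And>n \<mu> r. adm K n \<mu> r \<Longrightarrow>
    (\<integral>x. r (nrm (ix n K) x) * norm (fl K w n x) ^ 2 \<partial>\<mu>) \<le> B * (\<integral>x. r (nrm (ix n K) x) * sr n K x ^ (2 * length w) \<partial>\<mu>)"
    using fl_L2[OF K w] by blast
  show ?thesis
  proof (rule LB_I[OF B(1)])
    fix n \<mu> r assume ad: "adm K n \<mu> r"
    interpret sph_mat \<mu> n K by (rule admD(1)[OF ad])
    show "pb (\<lambda>x. norm (fl K w n x) ^ 2)" by (intro pb_power pb_norm pb_fl)
    have "(\<integral>x. r (nrm (ix n K) x) * sr n K x ^ (2 * length w) \<partial>\<mu>) \<le> (\<integral>x. r (nrm (ix n K) x) * (1 + sr n K x ^ D) \<partial>\<mu>)"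
      using D by (intro weighted_mono admD[OF ad] pb_power pb_sr pb_add pb_const power_le_one_plus sr_nonneg)
    then show "(\<integral>x. r (nrm (ix n K) x) * norm (fl K w n x) ^ 2 \<partial>\<mu>) \<le> B * (\<integral>x. r (nrm (ix n K) x) * (1 + sr n K x ^ D) \<partial>\<mu>)"
      using B(2)[OF ad] mult_left_mono[OF _ B(1)] order_trans by blast
  qed
qed

lemma LB_add:
  assumes "LB K D \<phi>" "LB K D \<psi>"
  shows "LB K D (\<lambda>n x. \<phi> n x + \<psi> n x)"
proof -
  obtain B1 where B1: "B1 \<ge> 0" "\<And>n \<mu> r. adm K n \<mu> r \<Longrightarrow> rot_inv.pb \<mu> (ix n K) (\<phi> n) \<and>
     (\<integral>x. r (nrm (ix n K) x) * \<phi> n x \<partial>\<mu>) \<le> B1 * (\<integral>x. r (nrm (ix n K) x) * (1 + sr n K x ^ D) \<partial>\<mu>)"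
    using assms(1) unfolding LB_def by blast
  obtain B2 where B2: "B2 \<ge> 0" "\<And>n \<mu> r. adm K n \<mu> r \<Longrightarrow> rot_inv.pb \<mu> (ix n K) (\<psi> n) \<and>
     (\<integral>x. r (nrm (ix n K) x) * \<psi> n x \<partial>\<mu>) \<le> B2 * (\<integral>x. r (nrm (ix n K) x) * (1 + sr n K x ^ D) \<partial>\<mu>)"
    using assms(2) unfolding LB_def by blast
  show ?thesis
  proof (rule LB_I[of "B1 + B2"])
    fix n \<mu> r assume a: "adm K n \<mu> r"
    interpret sph_mat \<mu> n K by (rule admD(1)[OF a])
    have p: "pb (\<phi> n)" "pb (\<psi> n)" using B1(2)[OF a] B2(2)[OF a] by auto
    then show "pb (\<lambda>x. \<phi> n x + \<psi> n x)" by auto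
    have "(\<integral>x. r (nrm (ix n K) x) * (\<phi> n x + \<psi> n x) \<partial>\<mu>)
        = (\<integral>x. r (nrm (ix n K) x) * \<phi> n x \<partial>\<mu>) + (\<integral>x. r (nrm (ix n K) x) * \<psi> n x \<partial>\<mu>)"
      unfolding distrib_left
      by (intro Bochner_Integration.integral_add pb_integrable pb_mult admD[OF a] p)
    then show "(\<integral>x. r (nrm (ix n K) x) * (\<phi> n x + \<psi> n x) \<partial>\<mu>) \<le> (B1 + B2) * (\<integral>x. r (nrm (ix n K) x) * (1 + sr n K x ^ D) \<partial>\<mu>)"
      using B1(2)[OF a] B2(2)[OF a] by (simp add: distrib_right)
  qed (use B1 B2 in auto)
qed

lemma LB_cmult:
  assumes "LB K D \<phi>" "0 \<le> a"
  shows "LB K D (\<lambda>n x. a * \<phi> n x)"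
proof -
  obtain B1 where B1: "B1 \<ge> 0" "\<And>n \<mu> r. adm K n \<mu> r \<Longrightarrow> rot_inv.pb \<mu> (ix n K) (\<phi> n) \<and>
     (\<integral>x. r (nrm (ix n K) x) * \<phi> n x \<partial>\<mu>) \<le> B1 * (\<integral>x. r (nrm (ix n K) x) * (1 + sr n K x ^ D) \<partial>\<mu>)"
    using assms(1) unfolding LB_def by blast
  show ?thesis
  proof (rule LB_I[of "a * B1"])
    fix n \<mu> r assume ad: "adm K n \<mu> r"
    interpret sph_mat \<mu> n K by (rule admD(1)[OF ad])
    show "pb (\<lambda>x. a * \<phi> n x)" using B1(2)[OF ad] by auto
    show "(\<integral>x. r (nrm (ix n K) x) * (a * \<phi> n x) \<partial>\<mu>) \<le> a * B1 * (\<integral>x. r (nrm (ix n K) x) * (1 + sr n K x ^ D) \<partial>\<mu>)"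
      using mult_left_mono[OF conjunct2[OF B1(2)[OF ad]] assms(2)] by (simp add: mult.left_commute[of _ a] mult.assoc)
  qed (use B1 assms in auto)
qed

lemma LB_zero: "LB K D (\<lambda>n x. 0)"
  using LB_cmult[OF LB_sr[of 0 D K], of 0] by simp

lemma LB_sum: "finite I \<Longrightarrow> (\<And>i. i \<in> I \<Longrightarrow> LB K D (\<phi> i)) \<Longrightarrow> LB K D (\<lambda>n x. \<Sum>i\<in>I. \<phi> i n x)"
  by (induction I rule: finite_induct) (auto intro: LB_zero LB_add)

lemma LB_bound:
  assumes "LB K D \<phi>" and \<psi>: "\<And>n \<mu> r. adm K n \<mu> r \<Longrightarrow> rot_inv.pb \<mu> (ix n K) (\<psi> n)"
    "\<And>n \<mu> r x. adm K n \<mu> r \<Longrightarrow> \<bar>\<psi> n x\<bar> \<le> \<phi> n x / real n"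
  obtains B where "B \<ge> 0" "\<And>n \<mu> r. adm K n \<mu> r \<Longrightarrow>
    (\<integral>x. r (nrm (ix n K) x) * \<bar>\<psi> n x\<bar> \<partial>\<mu>) \<le> B / real n * (\<integral>x. r (nrm (ix n K) x) * (1 + sr n K x ^ D) \<partial>\<mu>)"
proof -
  obtain B where B: "B \<ge> 0" "\<And>n \<mu> r. adm K n \<mu> r \<Longrightarrow> rot_inv.pb \<mu> (ix n K) (\<phi> n) \<and>
     (\<integral>x. r (nrm (ix n K) x) * \<phi> n x \<partial>\<mu>) \<le> B * (\<integral>x. r (nrm (ix n K) x) * (1 + sr n K x ^ D) \<partial>\<mu>)"
    using assms(1) unfolding LB_def by blast
  show ?thesis
  proof
    fix n \<mu> r assume ad: "adm K n \<mu> r"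
    interpret sph_mat \<mu> n K by (rule admD(1)[OF ad])
    have p: "pb (\<lambda>x. \<bar>\<psi> n x\<bar>)" using pb_norm[OF \<psi>(1)[OF ad]] by simp
    have "(\<integral>x. r (nrm (ix n K) x) * \<bar>\<psi> n x\<bar> \<partial>\<mu>) \<le> (\<integral>x. r (nrm (ix n K) x) * (\<phi> n x * (1 / real n)) \<partial>\<mu>)"
      using B(2)[OF ad] \<psi>(2)[OF ad] by (intro weighted_mono admD[OF ad] p pb_mult pb_const) auto
    also have "\<dots> = (\<integral>x. r (nrm (ix n K) x) * \<phi> n x \<partial>\<mu>) / real n"
      by simp
    also have "\<dots> \<le> B * (\<integral>x. r (nrm (ix n K) x) * (1 + sr n K x ^ D) \<partial>\<mu>) / real n"
      using B(2)[OF ad] by (intro divide_right_mono) auto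
    finally show "(\<integral>x. r (nrm (ix n K) x) * \<bar>\<psi> n x\<bar> \<partial>\<mu>) \<le> B / real n * (\<integral>x. r (nrm (ix n K) x) * (1 + sr n K x ^ D) \<partial>\<mu>)"
      by simp
  qed (rule B(1))
qed

lemma cw_adj_alternating: "cw (adj (replicate a c @ replicate b (\<not> c))) = cw (replicate a c @ replicate b (\<not> c))"
proof -
  have "adj (replicate a c @ replicate b (\<not> c)) = replicate b c @ replicate a (\<not> c)"
    by (simp add: adj_def)
  then show ?thesis by (auto simp: cw_alternating)
qed

lemma tr_fl: "tr n K w x = fl K w n x + of_real (real n * cw w * sr n K x ^ length w)"
  by (simp add: fl_def)

lemma abs_pw_le:
  assumes "1 \<le> p"
  shows "\<bar>pw K n p k x\<bar> \<le> norm (fl K (replicate p True) n x)"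
proof -
  have "norm (uc True k) = 1" by (simp add: uc_def)
  then have "\<bar>pw K n p k x\<bar> \<le> norm (tr n K (replicate p True) x)"
    unfolding pw_def using abs_Re_le_cmod[of "cnj (uc True k) * tr n K (replicate p True) x"] by (simp add: norm_mult)
  then show ?thesis using assms by (simp add: fl_def cw_replicate)
qed

text \<open>The numerator contains n s^2 times the trace of a block of \<open>p - 1\<close> letters
  and one of \<open>q - 1\<close> opposite letters, whose leading part n s^(2p-2) is present only
  for \<open>p = q\<close> and, after taking the real part, for \<open>k = l\<close>. Dividing by d,
  about n^2 \<open>card K\<close>, gives the limit; centred traces and bounded products leave O(n)
  over d.\<close>

lemma kerA_L1:
  assumes K: "K = {True} \<or> K = UNIV" and p: "1 \<le> p" "1 \<le> q" and D: "2 * p \<le> D" "2 * q \<le> D"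
  obtains B where "B \<ge> 0" "\<And>n \<mu> r. adm K n \<mu> r \<Longrightarrow>
    (\<integral>x. r (nrm (ix n K) x) * \<bar>kerA K n p k q l x - (if p = q \<and> k = l then real p / real (card K) * sr n K x ^ (2 * p) else 0)\<bar> \<partial>\<mu>)
      \<le> B / real n * (\<integral>x. r (nrm (ix n K) x) * (1 + sr n K x ^ D) \<partial>\<mu>)"
proof -
  define w where "w = replicate (p - 1) True @ replicate (q - 1) False"
  define w1 where "w1 = replicate p True"
  define w2 where "w2 = replicate q True"
  define \<phi> where "\<phi> n x = 2 * (real q * (sr n K x ^ 2 * norm (fl K w n x)))
    + 2 * (real q * (norm (fl K w1 n x) ^ 2 + norm (fl K w2 n x) ^ 2)) + 2 * (real p * real p * sr n K x ^ (2 * p))" for n x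
  have cw1: "cw (adj (replicate p True)) = cw (replicate p True)" for p
    using cw_adj_alternating[of p True 0] by simp
  have "LB K D \<phi>"
    unfolding \<phi>_def[abs_def] w_def w1_def w2_def
    using cw_adj_alternating[of "p - 1" True "q - 1"] p D
    by (intro LB_add LB_cmult LB_fl LB_fl_square LB_sr K cw1) auto
  moreover have "rot_inv.pb \<mu> (ix n K) (\<lambda>x. kerA K n p k q l x - (if p = q \<and> k = l then real p / real (card K) * sr n K x ^ (2 * p) else 0))"
    if ad: "adm K n \<mu> r" for n \<mu> r
  proof -
    interpret sph_mat \<mu> n K by (rule admD(1)[OF ad])
    show ?thesis
    proof (cases "p = q \<and> k = l")
      case True
      show ?thesis unfolding if_P[OF True] by (intro pb_diff pb_mult pb_power pb_sr pb_kerA pb_const)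
    next
      case False
      show ?thesis unfolding if_not_P[OF False] by (intro pb_diff pb_kerA pb_const)
    qed
  qed
  moreover have "\<bar>kerA K n p k q l x - (if p = q \<and> k = l then real p / real (card K) * sr n K x ^ (2 * p) else 0)\<bar> \<le> \<phi> n x / real n"
    if ad: "adm K n \<mu> r" for n \<mu> r x
  proof -
    interpret sph_mat \<mu> n K by (rule admD(1)[OF ad])
    define d where "d = real (card (ix n K)) - 1 + real (p - 1)"
    have d: "real n ^ 2 / 2 \<le> d" using card_lower by (simp add: d_def)
    have d0: "0 < d" using denominator_pos by (simp add: d_def)
    have nn: "0 < real n" "1 \<le> real n" using n_pos by auto
    define s where "s = sr n K x"
    have s: "0 \<le> s" by (simp add: s_def sr_nonneg)
    define u where "u = cnj (uc True k) * uc True l"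
    have u: "norm u = 1" by (simp add: u_def uc_def norm_mult)
    have Reu: "Re u = (if k = l then 1 else 0)" by (auto simp: u_def uc_def)
    define \<delta> where "\<delta> = (if p = q \<and> k = l then 1 else 0 :: real)"
    have cK: "0 < real (card K)" using K by auto
    have T: "Re (u * tr n K w x) = Re (u * fl K w n x) + \<delta> * (real n * s ^ (2 * p - 2))"
    proof -
      have lw: "p = q \<Longrightarrow> length w = 2 * p - 2" by (simp add: w_def)
      have "cw w = (if p = q then 1 else 0)" unfolding w_def using cw_alternating[of "p - 1" True "q - 1"] p by auto
      then show ?thesis
        unfolding tr_fl distrib_left plus_complex.sel mult.commute[of u "of_real _"]
        using lw by (auto simp: \<delta>_def Reu s_def)
    qed
    \<comment> \<open>The limit multiplied by the exact denominator: the term in n^2 cancels the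
      leading part of the numerator, and a constant is left.\<close>
    have dk: "d * (real p / real (card K)) = real p * real n ^ 2 + real p / real (card K) * (real p - 2)"
    proof -
      have "d = real (card K) * real n ^ 2 + (real p - 2)"
        using p by (simp add: d_def card_ix of_nat_diff power2_eq_square)
      moreover have "(\<kappa> * N + a) * (b / \<kappa>) = b * N + b / \<kappa> * a" if "0 < \<kappa>" for \<kappa> N a b :: real
        using that by (simp add: field_simps)
      ultimately show ?thesis using cK by blast
    qed
    have sp: "s ^ 2 * s ^ (2 * p - 2) = s ^ (2 * p)"
    proof -
      have "2 * p = 2 + (2 * p - 2)" using p by simp
      then have "s ^ (2 * p) = s ^ (2 + (2 * p - 2))" by (rule arg_cong)
      then show ?thesis by (simp only: power_add)
    qed
    have pq: "real q * \<delta> = real p * \<delta>" by (simp add: \<delta>_def)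
    have "d * (kerA K n p k q l x - \<delta> * (real p / real (card K) * s ^ (2 * p)))
        = real q * (real n * s ^ 2 * Re (u * tr n K w x) - pw K n p k x * pw K n q l x) - \<delta> * (d * (real p / real (card K))) * s ^ (2 * p)"
      using d0 unfolding kerA_def w_def[symmetric] s_def[symmetric] u_def[symmetric] d_def[symmetric] by (simp add: field_simps)
    also have "\<dots> = real q * (real n * s ^ 2 * Re (u * fl K w n x)) - real q * (pw K n p k x * pw K n q l x)
        - \<delta> * (real p / real (card K) * (real p - 2)) * s ^ (2 * p)"
    proof -
      have "real q * (real n * s ^ 2 * (\<delta> * (real n * s ^ (2 * p - 2)))) = \<delta> * (real p * real n ^ 2) * s ^ (2 * p)"
        using sp by (cases "p = q") (auto simp: \<delta>_def power2_eq_square mult_ac)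
      then show ?thesis unfolding T dk by (simp add: algebra_simps)
    qed
    finally have e: "d * (kerA K n p k q l x - \<delta> * (real p / real (card K) * s ^ (2 * p))) = \<dots>" .
    have "d * \<bar>kerA K n p k q l x - \<delta> * (real p / real (card K) * s ^ (2 * p))\<bar>
        = \<bar>d * (kerA K n p k q l x - \<delta> * (real p / real (card K) * s ^ (2 * p)))\<bar>"
      using d0 by (simp add: abs_mult)
    also have "\<dots> \<le> \<bar>real q * (real n * s ^ 2 * Re (u * fl K w n x))\<bar> + \<bar>real q * (pw K n p k x * pw K n q l x)\<bar>
        + \<bar>\<delta> * (real p / real (card K) * (real p - 2)) * s ^ (2 * p)\<bar>"
    proof -
      have "\<bar>a - b - c\<bar> \<le> \<bar>a\<bar> + \<bar>b\<bar> + \<bar>c\<bar>" for a b c :: real by linarith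
      then show ?thesis unfolding e by blast
    qed
    also have "\<dots> \<le> real n * (real q * (s ^ 2 * norm (fl K w n x))) + real n * (real q * (norm (fl K w1 n x) ^ 2 + norm (fl K w2 n x) ^ 2))
        + real n * (real p * real p * s ^ (2 * p))"
    proof (intro add_mono)
      have "\<bar>Re (u * fl K w n x)\<bar> \<le> norm (fl K w n x)"
        using abs_Re_le_cmod[of "u * fl K w n x"] by (simp add: norm_mult u)
      then show "\<bar>real q * (real n * s ^ 2 * Re (u * fl K w n x))\<bar> \<le> real n * (real q * (s ^ 2 * norm (fl K w n x)))"
      proof -
        assume *: "\<bar>Re (u * fl K w n x)\<bar> \<le> norm (fl K w n x)"
        have "\<bar>real q * (real n * s ^ 2 * R)\<bar> = (real n * (real q * s ^ 2)) * \<bar>R\<bar>" for R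
          by (simp add: abs_mult)
        then have "\<bar>real q * (real n * s ^ 2 * Re (u * fl K w n x))\<bar> = (real n * (real q * s ^ 2)) * \<bar>Re (u * fl K w n x)\<bar>" .
        also have "\<dots> \<le> (real n * (real q * s ^ 2)) * norm (fl K w n x)"
          using * by (intro mult_left_mono) auto
        finally show ?thesis by (simp only: mult.assoc)
      qed
      have "\<bar>pw K n p k x * pw K n q l x\<bar> \<le> norm (fl K w1 n x) * norm (fl K w2 n x)"
        unfolding abs_mult w1_def w2_def using p by (intro mult_mono abs_pw_le) auto
      also have "\<dots> \<le> norm (fl K w1 n x) ^ 2 + norm (fl K w2 n x) ^ 2"
        by (rule mult_le_squares)
      finally have "\<bar>real q * (pw K n p k x * pw K n q l x)\<bar> \<le> real q * (norm (fl K w1 n x) ^ 2 + norm (fl K w2 n x) ^ 2)"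
        by (simp add: abs_mult mult_left_mono)
      also have "\<dots> \<le> real n * (real q * (norm (fl K w1 n x) ^ 2 + norm (fl K w2 n x) ^ 2))"
        using mult_right_mono[OF nn(2), of "real q * (norm (fl K w1 n x) ^ 2 + norm (fl K w2 n x) ^ 2)"] by simp
      finally show "\<bar>real q * (pw K n p k x * pw K n q l x)\<bar> \<le> real n * (real q * (norm (fl K w1 n x) ^ 2 + norm (fl K w2 n x) ^ 2))" .
      have "\<bar>real p - 2\<bar> \<le> real p" using p by auto
      moreover have "real p / real (card K) \<le> real p" using cK K by auto
      ultimately have "\<bar>\<delta> * (real p / real (card K) * (real p - 2)) * s ^ (2 * p)\<bar> \<le> 1 * (real p * real p) * s ^ (2 * p)"
        unfolding abs_mult using s by (intro mult_mono) (auto simp: \<delta>_def)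
      also have "\<dots> \<le> real n * (real p * real p * s ^ (2 * p))"
        using mult_right_mono[OF nn(2), of "real p * real p * s ^ (2 * p)"] s by simp
      finally show "\<bar>\<delta> * (real p / real (card K) * (real p - 2)) * s ^ (2 * p)\<bar> \<le> real n * (real p * real p * s ^ (2 * p))" .
    qed
    also have "\<dots> = real n * \<phi> n x / 2" by (simp add: \<phi>_def s_def algebra_simps)
    finally have "d * \<bar>kerA K n p k q l x - \<delta> * (real p / real (card K) * s ^ (2 * p))\<bar> \<le> real n * \<phi> n x / 2" .
    moreover have "real n ^ 2 / 2 * \<bar>kerA K n p k q l x - \<delta> * (real p / real (card K) * s ^ (2 * p))\<bar>
        \<le> d * \<bar>kerA K n p k q l x - \<delta> * (real p / real (card K) * s ^ (2 * p))\<bar>"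
      using d by (intro mult_right_mono) auto
    ultimately have "real n * (real n * \<bar>kerA K n p k q l x - \<delta> * (real p / real (card K) * s ^ (2 * p))\<bar>) \<le> real n * \<phi> n x"
      by (simp add: power2_eq_square mult.assoc)
    then have "real n * \<bar>kerA K n p k q l x - \<delta> * (real p / real (card K) * s ^ (2 * p))\<bar> \<le> \<phi> n x"
      using nn by (simp only: mult_le_cancel_left_pos)
    then show ?thesis using nn by (auto simp: \<delta>_def s_def field_simps split: if_splits)
  qed
  ultimately show ?thesis
    by (rule LB_bound) (assumption+, blast intro: that)
qed

text \<open>All cuts of a power of Z are at equal letters, and these have weight
  \<open>ep UNIV = 0\<close>. Complex power traces are therefore exactly centred, and no gradient
  term enters their comparison.\<close>

lemma kerR_complex: "kerR UNIV n p k x = 0"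
proof -
  have "(UNIV :: bool set) \<noteq> {True}" by blast
  then show ?thesis by (simp add: kerR_def S1_replicate tau_def)
qed

text \<open>Each cut glues a power of the matrix to a power of its transpose; only the balanced one
  has a trace of order n, and it occurs exactly when \<open>p\<close> is even. It accounts for
  \<open>tau\<close>, up to O(1/n).\<close>

lemma kerR_L1:
  assumes p: "1 \<le> p" and D: "p \<le> D"
  obtains B where "B \<ge> 0" "\<And>n \<mu> r. adm {True} n \<mu> r \<Longrightarrow>
    (\<integral>x. r (nrm (ix n {True}) x) * \<bar>kerR {True} n p True x\<bar> \<partial>\<mu>)
      \<le> B / real n * (\<integral>x. r (nrm (ix n {True}) x) * (1 + sr n {True} x ^ D) \<partial>\<mu>)"
proof -
  define K where "K = {True}"
  have K: "K = {True} \<or> K = UNIV" by (simp add: K_def)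
  define w where "w i = replicate i True @ replicate (p - 1 - 1 - i) False" for i
  define \<phi> where "\<phi> n x = (\<Sum>i<p - 1. 2 * (sr n K x ^ 2 * norm (fl K (w i) n x))) + 2 * (real p * sr n K x ^ p)" for n x
  have cww: "cw (adj (w i)) = cw (w i)" for i
    unfolding w_def using cw_adj_alternating[of i True "p - 1 - 1 - i"] by simp
  have "LB K D \<phi>"
    unfolding \<phi>_def[abs_def] 
  proof (intro LB_add LB_sum LB_cmult LB_fl LB_sr K cww D)
    show "2 + length (w i) \<le> D" if "i \<in> {..<p - 1}" for i
      using that D by (auto simp: w_def)
  qed auto
  moreover have "rot_inv.pb \<mu> (ix n K) (kerR K n p True)" if ad: "adm K n \<mu> r" for n \<mu> r
    using sph_mat.pb_kerR[OF admD(1)[OF ad]] .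
  moreover have "\<bar>kerR K n p True x\<bar> \<le> \<phi> n x / real n" if ad: "adm K n \<mu> r" for n \<mu> r x
  proof -
    interpret sph_mat \<mu> n K by (rule admD(1)[OF ad])
    define d where "d = real (card (ix n K)) - 1 + real (p - 1)"
    have d: "real n ^ 2 / 2 \<le> d" using card_lower by (simp add: d_def)
    have d0: "0 < d" using denominator_pos by (simp add: d_def)
    have nn: "0 < real n" "1 \<le> real n" using n_pos by auto
    define s where "s = sr n K x"
    have s: "0 \<le> s" by (simp add: s_def sr_nonneg)
    define F where "F = (\<Sum>i<p - 1. Re (fl K (w i) n x))"
    have "S1 K True (replicate (p - 1) True) n x = (\<Sum>i<p - 1. tr n K (w i) x)"
      by (simp add: S1_replicate K_def w_def)
    then have "Re (S1 K True (replicate (p - 1) True) n x) = (\<Sum>i<p - 1. Re (fl K (w i) n x) + cw (w i) * (real n * s ^ (p - 2)))"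
      by (simp add: tr_fl s_def w_def numeral_2_eq_2 mult_ac)
    also have "\<dots> = F + tau K p * (real n * s ^ (p - 2))"
      unfolding sum.distrib sum_distrib_right[symmetric] F_def w_def
      using sum_cw_replicate[where k = "p - 1" and c = True] p by (simp add: tau_def K_def)
    finally have S: "Re (S1 K True (replicate (p - 1) True) n x) = F + tau K p * (real n * s ^ (p - 2))" .
    have u: "uc True True = 1" by (simp add: uc_def)
    have dd: "d = real n ^ 2 + (real p - 2)"
      using p by (simp add: d_def card_ix K_def of_nat_diff power2_eq_square)
    have sp: "tau K p * (s ^ 2 * s ^ (p - 2)) = tau K p * s ^ p"
    proof (cases "even p")
      case True
      then have "2 \<le> p" using p by (cases "p = 1") auto
      then have "p = 2 + (p - 2)" by simp
      then have "s ^ p = s ^ (2 + (p - 2))" by (rule arg_cong)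
      then show ?thesis by (simp only: power_add)
    qed (simp add: tau_def)
    have "d * kerR K n p True x = real n * s ^ 2 * Re (S1 K True (replicate (p - 1) True) n x) - d * (tau K p * s ^ p)"
      using d0 unfolding kerR_def d_def[symmetric] s_def[symmetric] u by (simp add: right_diff_distrib)
    also have "\<dots> = real n * (s ^ 2 * F) + real n ^ 2 * (tau K p * (s ^ 2 * s ^ (p - 2))) - d * (tau K p * s ^ p)"
      unfolding S by (simp add: algebra_simps power2_eq_square)
    also have "\<dots> = real n * (s ^ 2 * F) - (real p - 2) * tau K p * s ^ p"
      unfolding sp dd by (simp add: algebra_simps)
    finally have e: "d * kerR K n p True x = \<dots>" .
    have "d * \<bar>kerR K n p True x\<bar> = \<bar>d * kerR K n p True x\<bar>" using d0 by (simp add: abs_mult)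
    also have "\<dots> \<le> \<bar>real n * (s ^ 2 * F)\<bar> + \<bar>(real p - 2) * tau K p * s ^ p\<bar>"
      unfolding e by linarith
    also have "\<dots> \<le> real n * (s ^ 2 * (\<Sum>i<p - 1. norm (fl K (w i) n x))) + real n * (real p * s ^ p)"
    proof (intro add_mono)
      have "\<bar>F\<bar> \<le> (\<Sum>i<p - 1. norm (fl K (w i) n x))"
        unfolding F_def by (intro order_trans[OF sum_abs] sum_mono abs_Re_le_cmod)
      then show "\<bar>real n * (s ^ 2 * F)\<bar> \<le> real n * (s ^ 2 * (\<Sum>i<p - 1. norm (fl K (w i) n x)))"
        by (simp add: abs_mult mult_left_mono)
      have "\<bar>real p - 2\<bar> \<le> real p" using p by auto
      then have "\<bar>(real p - 2) * tau K p * s ^ p\<bar> \<le> real p * 1 * s ^ p"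
        unfolding abs_mult using s by (intro mult_mono) (auto simp: tau_def)
      also have "\<dots> \<le> real n * (real p * s ^ p)"
        using mult_right_mono[OF nn(2), of "real p * s ^ p"] s by simp
      finally show "\<bar>(real p - 2) * tau K p * s ^ p\<bar> \<le> real n * (real p * s ^ p)" .
    qed
    also have "\<dots> = real n * \<phi> n x / 2" by (simp add: \<phi>_def s_def algebra_simps sum_distrib_left)
    finally have "d * \<bar>kerR K n p True x\<bar> \<le> real n * \<phi> n x / 2" .
    moreover have "real n ^ 2 / 2 * \<bar>kerR K n p True x\<bar> \<le> d * \<bar>kerR K n p True x\<bar>"
      using d by (intro mult_right_mono) auto
    ultimately have "real n * (real n * \<bar>kerR K n p True x\<bar>) \<le> real n * \<phi> n x"
      by (simp add: power2_eq_square mult.assoc)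
    then have "real n * \<bar>kerR K n p True x\<bar> \<le> \<phi> n x"
      using nn by (simp only: mult_le_cancel_left_pos)
    then show ?thesis using nn by (simp add: field_simps)
  qed
  ultimately show ?thesis
    unfolding K_def by (rule LB_bound) (assumption+, blast intro: that)
qed

section \<open>Gaussian vectors in Euclidean coordinates\<close>

section \<open>Gaussian integration by parts\<close>

lemma normal_decay:
  fixes \<sigma> a b :: real
  assumes "0 < \<sigma>"
  shows "((\<lambda>x. normal_density 0 \<sigma> x * (a + b * \<bar>x\<bar>)) \<longlongrightarrow> 0) at_top"
    "((\<lambda>x. normal_density 0 \<sigma> x * (a + b * \<bar>x\<bar>)) \<longlongrightarrow> 0) at_bot"
proof -
  define k c where "k = 1 / (2 * \<sigma>\<^sup>2)" and "c = 1 / sqrt (2 * pi * \<sigma>\<^sup>2)"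
  have k: "k > 0" using assms by (simp add: k_def)
  have nd: "normal_density 0 \<sigma> x = c * exp (- k * x ^ 2)" for x
    by (simp add: normal_density_def k_def c_def)
  have 1: "((\<lambda>x. c * exp (- k * x ^ 2) * (a + b * x)) \<longlongrightarrow> 0) at_top"
    using k by real_asymp
  have e: "eventually (\<lambda>x. c * exp (- k * x ^ 2) * (a + b * x) = normal_density 0 \<sigma> x * (a + b * \<bar>x\<bar>)) at_top"
    using eventually_ge_at_top[of 0] by eventually_elim (simp add: nd)
  show t: "((\<lambda>x. normal_density 0 \<sigma> x * (a + b * \<bar>x\<bar>)) \<longlongrightarrow> 0) at_top"
    using 1 e by (rule Lim_transform_eventually)
  show "((\<lambda>x. normal_density 0 \<sigma> x * (a + b * \<bar>x\<bar>)) \<longlongrightarrow> 0) at_bot"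
    unfolding filterlim_at_bot_mirror using t by (simp add: normal_density_def)
qed

text \<open>The integrand of the difference is the derivative of minus the variance times density
  times \<open>G\<close>, which vanishes at both ends since \<open>G\<close> grows at most
  linearly.\<close>

lemma normal_ibp:
  fixes G G' :: "real \<Rightarrow> real"
  assumes \<sigma>: "0 < \<sigma>" and G: "\<And>x. (G has_real_derivative G' x) (at x)"
    and B: "\<And>x. \<bar>G' x\<bar> \<le> B" and cont: "continuous_on UNIV G'"
  shows "(\<integral>x. x * G x \<partial>density lborel (normal_density 0 \<sigma>)) = \<sigma>\<^sup>2 * (\<integral>x. G' x \<partial>density lborel (normal_density 0 \<sigma>))"
proof -
  let ?n = "normal_density 0 \<sigma>"
  have B0: "0 \<le> B" using B[of 0] by linarith
  have contG: "continuous_on UNIV G"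
    using G by (meson DERIV_continuous continuous_at_imp_continuous_on)
  have [measurable]: "G \<in> borel_measurable borel" "G' \<in> borel_measurable borel"
    using contG cont by (auto intro: borel_measurable_continuous_onI)
  have Gb: "\<bar>G x\<bar> \<le> \<bar>G 0\<bar> + B * \<bar>x\<bar>" for x
  proof -
    have "norm (G x - G 0) \<le> B * norm (x - 0)"
      by (rule field_differentiable_bound[where S = UNIV and f' = G']) (use G B in auto)
    then show ?thesis by simp
  qed
  have n2: "integrable lborel (\<lambda>x. ?n x * x ^ 2)" "integrable lborel ?n"
    using normal_moment_even[OF \<sigma>, of 0 1] normal_moment_even[OF \<sigma>, of 0 0]
    by (auto simp: has_bochner_integral_iff)
  have i1: "integrable lborel (\<lambda>x. ?n x * (x * G x))"
  proof (rule Bochner_Integration.integrable_bound)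
    show "integrable lborel (\<lambda>x. (\<bar>G 0\<bar> + B) * (?n x * x ^ 2 + ?n x))"
      using n2 by simp
    show "AE x in lborel. norm (?n x * (x * G x)) \<le> norm ((\<bar>G 0\<bar> + B) * (?n x * x ^ 2 + ?n x))"
    proof (rule AE_I2)
      fix x
      have "\<bar>x\<bar> * \<bar>G x\<bar> \<le> \<bar>x\<bar> * (\<bar>G 0\<bar> + B * \<bar>x\<bar>)"
        using Gb[of x] by (intro mult_left_mono) auto
      also have "\<dots> = \<bar>G 0\<bar> * \<bar>x\<bar> + B * x ^ 2"
        unfolding distrib_left power2_abs[of x, symmetric] power2_eq_square by (simp only: mult_ac)
      also have "\<dots> \<le> \<bar>G 0\<bar> * (x ^ 2 + 1) + B * (x ^ 2 + 1)"
        using mult_le_squares[of "\<bar>x\<bar>" 1] B0 by (intro add_mono mult_left_mono) auto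
      finally have "\<bar>x * G x\<bar> \<le> (\<bar>G 0\<bar> + B) * (x ^ 2 + 1)"
        by (simp add: abs_mult distrib_right)
      then have "?n x * \<bar>x * G x\<bar> \<le> ?n x * ((\<bar>G 0\<bar> + B) * (x ^ 2 + 1))"
        by (intro mult_left_mono) auto
      also have "\<dots> = norm ((\<bar>G 0\<bar> + B) * (?n x * x ^ 2 + ?n x))"
        using B0 by (simp add: abs_mult algebra_simps)
      finally show "norm (?n x * (x * G x)) \<le> norm ((\<bar>G 0\<bar> + B) * (?n x * x ^ 2 + ?n x))"
        by (simp add: abs_mult)
    qed
  qed simp
  have i2: "integrable lborel (\<lambda>x. ?n x * G' x)"
  proof (rule Bochner_Integration.integrable_bound)
    show "integrable lborel (\<lambda>x. B * ?n x)" using n2 by simp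
    show "AE x in lborel. norm (?n x * G' x) \<le> norm (B * ?n x)"
      using B0 by (intro AE_I2) (simp add: abs_mult mult_right_mono[OF B] mult.commute)
  qed simp
  define F where "F x = - \<sigma>\<^sup>2 * (?n x * G x)" for x
  define f where "f x = ?n x * (x * G x) - \<sigma>\<^sup>2 * (?n x * G' x)" for x
  have if': "integrable lborel f"
    unfolding f_def using i1 i2 by simp
  have derF: "(F has_vector_derivative f x) (at x)" for x
  proof -
    have "(?n has_real_derivative (- x / \<sigma>\<^sup>2 * ?n x)) (at x)"
    proof -
      define k c where "k = 1 / (2 * \<sigma>\<^sup>2)" and "c = 1 / sqrt (2 * pi * \<sigma>\<^sup>2)"
      have n: "?n = (\<lambda>x. c * exp (- k * x\<^sup>2))"
        by (auto simp: normal_density_def c_def k_def)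
      have "((\<lambda>x. c * exp (- k * x\<^sup>2)) has_real_derivative (c * (exp (- k * x\<^sup>2) * (- k * (2 * x))))) (at x)"
        by (auto intro!: derivative_eq_intros)
      moreover have "c * (E * (- k * (2 * x))) = - x / \<sigma>\<^sup>2 * (c * E)" for E
        using \<sigma> by (simp add: k_def field_simps)
      ultimately show ?thesis unfolding n by simp
    qed
    from DERIV_mult[OF this G[of x]]
    have "((\<lambda>x. ?n x * G x) has_real_derivative (- x / \<sigma>\<^sup>2 * ?n x * G x + G' x * ?n x)) (at x)" .
    from DERIV_cmult[OF this, of "- \<sigma>\<^sup>2"]
    have "(F has_real_derivative (- \<sigma>\<^sup>2 * (- x / \<sigma>\<^sup>2 * ?n x * G x + G' x * ?n x))) (at x)"
      unfolding F_def .
    also have "- \<sigma>\<^sup>2 * (- x / \<sigma>\<^sup>2 * ?n x * G x + G' x * ?n x) = f x"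
      using \<sigma> by (simp add: f_def field_simps)
    finally show ?thesis by (simp add: has_real_derivative_iff_has_vector_derivative)
  qed
  have contn: "continuous_on UNIV ?n"
    unfolding normal_density_def using \<sigma> by (intro continuous_intros) auto
  have "continuous_on UNIV f"
    unfolding f_def by (intro continuous_intros contn contG cont)
  then have contf: "isCont f x" for x
    by (simp add: continuous_on_eq_continuous_at)
  have dec: "\<bar>F x\<bar> \<le> \<sigma>\<^sup>2 * (?n x * (\<bar>G 0\<bar> + B * \<bar>x\<bar>))" for x
    unfolding F_def using Gb[of x] by (simp add: abs_mult mult_left_mono)
  have ev: "\<forall>\<^sub>F x in net. norm (F x) \<le> \<sigma>\<^sup>2 * (?n x * (\<bar>G 0\<bar> + B * \<bar>x\<bar>))" for net
    using dec by (intro always_eventually) simp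
  have lim: "(F \<longlongrightarrow> 0) at_top" "(F \<longlongrightarrow> 0) at_bot"
    by (rule Lim_null_comparison[OF ev tendsto_mult_right_zero[OF normal_decay(1)[OF \<sigma>]]],
        rule Lim_null_comparison[OF ev tendsto_mult_right_zero[OF normal_decay(2)[OF \<sigma>]]])
  have "(LBINT x=-\<infinity>..\<infinity>. f x) = 0 - 0"
  proof (rule interval_integral_FTC_integrable[where F = F])
    show "set_integrable lborel (einterval (-\<infinity>) \<infinity>) f"
      using if' by (simp add: set_integrable_def)
    show "((F \<circ> real_of_ereal) \<longlongrightarrow> 0) (at_right (-\<infinity>))" "((F \<circ> real_of_ereal) \<longlongrightarrow> 0) (at_left \<infinity>)"
      using lim by (auto simp: ereal_tendsto_simps)
  qed (auto simp: derF contf)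
  then have "(\<integral>x. f x \<partial>lborel) = 0"
    by (simp add: interval_lebesgue_integral_def set_lebesgue_integral_def)
  then have "(\<integral>x. ?n x * (x * G x) \<partial>lborel) = \<sigma>\<^sup>2 * (\<integral>x. ?n x * G' x \<partial>lborel)"
    unfolding f_def using i1 i2 by simp
  then show ?thesis
    by (simp add: integral_density)
qed

lemma normal_square_integrable:
  assumes "0 < \<sigma>"
  shows "integrable (density lborel (normal_density 0 \<sigma>)) (\<lambda>x. x\<^sup>2)"
  using normal_moment_even[OF assms, of 0 1]
  by (simp add: integrable_density has_bochner_integral_iff)

text \<open>A common form for both fields: independent normal coordinates \<open>X i\<close> with
  standard deviations \<open>s i\<close>, scaled by \<open>c i\<close> along an orthonormal basis. A
  complex vector of length m is the case of 2m coordinates.\<close>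

locale gauss_vec = prob_space N for N :: "'w measure" +
  fixes X :: "'i \<Rightarrow> 'w \<Rightarrow> real" and I :: "'i set" and s c :: "'i \<Rightarrow> real"
    and b :: "'i \<Rightarrow> 'e::euclidean_space" and Z :: "'w \<Rightarrow> 'e"
  assumes finI: "finite I"
    and indep: "indep_vars (\<lambda>_. borel) X I"
    and normal: "\<And>i. i \<in> I \<Longrightarrow> distributed N lborel (X i) (normal_density 0 (s i))"
    and s_pos: "\<And>i. i \<in> I \<Longrightarrow> 0 < s i"
    and b: "bij_betw b I Basis"
    and Z: "\<And>\<omega>. Z \<omega> = (\<Sum>i\<in>I. (c i * X i \<omega>) *\<^sub>R b i)"
begin

lemma X_measurable [measurable]: "i \<in> I \<Longrightarrow> X i \<in> borel_measurable N"
  using normal[of i] by (simp add: distributed_def measurable_lborel1)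

lemma Z_measurable [measurable]: "Z \<in> borel_measurable N"
  unfolding Z[abs_def] by measurable

lemma b_image: "b ` I = Basis"
  using b by (simp add: bij_betw_def)

lemma I_ne: "I \<noteq> {}"
  using b_image by (metis image_empty nonempty_Basis)

lemma b_inner: "i \<in> I \<Longrightarrow> j \<in> I \<Longrightarrow> b j \<bullet> b i = (if j = i then 1 else 0)"
  using b b_image by (subst inner_Basis) (auto simp: bij_betw_def inj_on_eq_iff)

lemma Z_inner:
  assumes "i \<in> I"
  shows "Z \<omega> \<bullet> b i = c i * X i \<omega>"
proof -
  have "Z \<omega> \<bullet> b i = (\<Sum>j\<in>I. if j = i then c i * X i \<omega> else 0)"
    unfolding Z inner_sum_left
    using assms by (intro sum.cong refl) (auto simp: b_inner)
  then show ?thesis using assms finI by simp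
qed

lemma X_law: "i \<in> I \<Longrightarrow> distr N borel (X i) = density lborel (normal_density 0 (s i))"
  using normal[of i] by (simp add: distributed_def) (metis distr_cong sets_lborel)

lemma X_square_integrable: "i \<in> I \<Longrightarrow> integrable N (\<lambda>\<omega>. (X i \<omega>)\<^sup>2)"
  using integrable_distr_eq[of "X i" N borel "\<lambda>x. x\<^sup>2"] normal_square_integrable[OF s_pos, of i]
  by (simp add: X_law)

lemma Z_square_integrable: "integrable N (\<lambda>\<omega>. (norm (Z \<omega>))\<^sup>2)"
proof -
  have "(norm (Z \<omega>))\<^sup>2 = (\<Sum>i\<in>I. (c i)\<^sup>2 * (X i \<omega>)\<^sup>2)" for \<omega>
  proof -
    have "(norm (Z \<omega>))\<^sup>2 = (\<Sum>e\<in>Basis. (Z \<omega> \<bullet> e)\<^sup>2)"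
      unfolding power2_norm_eq_inner by (subst euclidean_inner) (simp add: power2_eq_square)
    also have "\<dots> = (\<Sum>i\<in>I. (Z \<omega> \<bullet> b i)\<^sup>2)"
      by (rule sum.reindex_bij_betw[OF b, symmetric])
    finally show ?thesis by (simp add: Z_inner power_mult_distrib)
  qed
  then show ?thesis
    using X_square_integrable by (simp add: finI)
qed

lemma joint_law: "distr N (\<Pi>\<^sub>M i\<in>I. borel) (\<lambda>\<omega>. \<lambda>i\<in>I. X i \<omega>) = (\<Pi>\<^sub>M i\<in>I. density lborel (normal_density 0 (s i)))"
proof -
  have "distr N (\<Pi>\<^sub>M i\<in>I. borel) (\<lambda>\<omega>. \<lambda>i\<in>I. X i \<omega>) = (\<Pi>\<^sub>M i\<in>I. distr N borel (X i))"
    using indep indep_vars_iff_distr_eq_PiM'[OF I_ne, where M' = "\<lambda>_. borel" and X = X] by simp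
  also have "\<dots> = (\<Pi>\<^sub>M i\<in>I. density lborel (normal_density 0 (s i)))"
    by (intro PiM_cong) (auto simp: X_law)
  finally show ?thesis .
qed

text \<open>Fubini reduces the claim to the one-dimensional formula in the coordinate
  \<open>i\<close> with the others frozen. The factor \<open>c i\<close> appears twice, once from
  the coordinate of \<open>Z\<close> and once from the chain rule.\<close>

lemma gaussian_ibp:
  fixes g :: "'e \<Rightarrow> real"
  assumes i: "i \<in> I" and g: "\<And>z. (g has_derivative g' z) (at z)"
    and B: "\<And>z h. \<bar>g' z h\<bar> \<le> B * norm h" and cont: "continuous_on UNIV (\<lambda>z. g' z (b i))"
  shows "(\<integral>\<omega>. (Z \<omega> \<bullet> b i) * g (Z \<omega>) \<partial>N) = (c i * s i)\<^sup>2 * (\<integral>\<omega>. g' (Z \<omega>) (b i) \<partial>N)"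
proof -
  define P where "P = (\<lambda>i. density lborel (normal_density 0 (s i)))"
  \<comment> \<open>The product locale ranges over all indices of the type; outside \<open>I\<close>
    a point mass serves as a default.\<close>
  define P' where "P' i = (if i \<in> I then P i else return borel 0)" for i
  have prP: "prob_space (P' i)" for i
    unfolding P'_def P_def using s_pos prob_space_normal_density[of "s i" 0] by (auto intro: prob_space_return)
  interpret product_prob_space P' by (rule product_prob_spaceI[OF prP])
  define J where "J = I - {i}"
  have IJ: "I = insert i J" "i \<notin> J" "finite J" using i finI by (auto simp: J_def)
  define \<zeta> where "\<zeta> y = (\<Sum>i\<in>I. (c i * y i) *\<^sub>R b i)" for y :: "'i \<Rightarrow> real"
  have setsP: "sets (PiM I P') = sets (\<Pi>\<^sub>M i\<in>I. borel)"
    by (intro sets_PiM_cong refl) (simp add: P'_def P_def)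
  have law: "distr N (\<Pi>\<^sub>M i\<in>I. borel) (\<lambda>\<omega>. \<lambda>i\<in>I. X i \<omega>) = PiM I P'"
    unfolding joint_law by (intro PiM_cong) (auto simp: P'_def P_def)
  have Zz: "Z \<omega> = \<zeta> (\<lambda>i\<in>I. X i \<omega>)" for \<omega>
    by (simp add: Z \<zeta>_def)
  have \<zeta>m [measurable]: "\<zeta> \<in> borel_measurable (\<Pi>\<^sub>M i\<in>I. borel)"
    unfolding \<zeta>_def by measurable
  have contg: "continuous_on UNIV g"
    using g by (meson has_derivative_continuous continuous_at_imp_continuous_on)
  have [measurable]: "g \<in> borel_measurable borel" "(\<lambda>z. g' z (b i)) \<in> borel_measurable borel"
    using contg cont by (auto intro: borel_measurable_continuous_onI)
  have trans: "(\<integral>\<omega>. h (\<lambda>i\<in>I. X i \<omega>) \<partial>N) = (\<integral>y. h y \<partial>PiM I P')"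
    "integrable N (\<lambda>\<omega>. h (\<lambda>i\<in>I. X i \<omega>)) = integrable (PiM I P') h"
    if "h \<in> borel_measurable (\<Pi>\<^sub>M i\<in>I. borel)" for h :: "_ \<Rightarrow> real"
    unfolding law[symmetric] using that by (auto simp: integral_distr integrable_distr_eq)
  have m1: "(\<lambda>y. (\<zeta> y \<bullet> b i) * g (\<zeta> y)) \<in> borel_measurable (\<Pi>\<^sub>M i\<in>I. borel)" by measurable
  have m2: "(\<lambda>y. g' (\<zeta> y) (b i)) \<in> borel_measurable (\<Pi>\<^sub>M i\<in>I. borel)" by measurable
  have B0: "0 \<le> B"
  proof -
    have "b i \<in> Basis" using b_image i by auto
    then show ?thesis using B[of 0 "b i"] by simp
  qed
  have gb: "\<bar>g z\<bar> \<le> \<bar>g 0\<bar> + B * norm z" for z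
  proof -
    have "norm (g z - g 0) \<le> B * norm (z - 0)"
    proof (rule differentiable_bound[where S = UNIV and f' = g'])
      show "onorm (g' x) \<le> B" for x
        using B B0 by (intro onorm_bound) (auto simp: mult.commute)
    qed (use g in \<open>auto intro: has_derivative_at_withinI\<close>)
    then show ?thesis by simp
  qed
  have int1: "integrable (PiM I P') (\<lambda>y. (\<zeta> y \<bullet> b i) * g (\<zeta> y))"
    unfolding trans(2)[OF m1, symmetric] Zz[symmetric]
  proof (rule Bochner_Integration.integrable_bound)
    show "integrable N (\<lambda>\<omega>. (\<bar>g 0\<bar> + B) * ((norm (Z \<omega>))\<^sup>2 + 1))"
      using Z_square_integrable by simp
    show "AE \<omega> in N. norm ((Z \<omega> \<bullet> b i) * g (Z \<omega>)) \<le> norm ((\<bar>g 0\<bar> + B) * ((norm (Z \<omega>))\<^sup>2 + 1))"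
    proof (rule AE_I2)
      fix \<omega>
      let ?t = "norm (Z \<omega>)"
      have "\<bar>Z \<omega> \<bullet> b i\<bar> \<le> ?t" using b i Basis_le_norm[of "b i" "Z \<omega>"] by (auto simp: bij_betw_def)
      then have "\<bar>(Z \<omega> \<bullet> b i) * g (Z \<omega>)\<bar> \<le> ?t * (\<bar>g 0\<bar> + B * ?t)"
        unfolding abs_mult using gb[of "Z \<omega>"] by (intro mult_mono) auto
      also have "\<dots> = \<bar>g 0\<bar> * (?t * 1) + B * ?t\<^sup>2"
        by (simp add: algebra_simps power2_eq_square)
      also have "\<dots> \<le> \<bar>g 0\<bar> * (?t\<^sup>2 + 1) + B * (?t\<^sup>2 + 1)"
        using mult_le_squares[of ?t 1] B0 by (intro add_mono mult_left_mono) auto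
      finally show "norm ((Z \<omega> \<bullet> b i) * g (Z \<omega>)) \<le> norm ((\<bar>g 0\<bar> + B) * ((norm (Z \<omega>))\<^sup>2 + 1))"
        using B0 by (simp add: abs_mult distrib_right)
    qed
  qed measurable
  have int2: "integrable (PiM I P') (\<lambda>y. g' (\<zeta> y) (b i))"
    unfolding trans(2)[OF m2, symmetric] Zz[symmetric]
  proof (rule Bochner_Integration.integrable_bound)
    show "integrable N (\<lambda>\<omega>. B * norm (b i))" by simp
    show "AE \<omega> in N. norm (g' (Z \<omega>) (b i)) \<le> norm (B * norm (b i))"
      using B[of _ "b i"] B0 by (intro AE_I2) (simp add: abs_mult)
  qed measurable
  have upd: "\<zeta> (y(i := t)) = (c i * t) *\<^sub>R b i + (\<Sum>j\<in>J. (c j * y j) *\<^sub>R b j)" for y t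
    unfolding \<zeta>_def IJ(1) using IJ(2,3) by (simp add: fun_upd_def) (intro sum.cong, auto)
  have inn: "\<zeta> y \<bullet> b i = c i * y i" for y
  proof -
    have "\<zeta> y \<bullet> b i = (\<Sum>j\<in>I. if j = i then c i * y i else 0)"
      unfolding \<zeta>_def inner_sum_left
      using i by (intro sum.cong refl) (auto simp: b_inner)
    then show ?thesis using i finI by simp
  qed
  have one: "(\<integral>t. (\<zeta> (y(i := t)) \<bullet> b i) * g (\<zeta> (y(i := t))) \<partial>P' i)
      = (c i * s i)\<^sup>2 * (\<integral>t. g' (\<zeta> (y(i := t))) (b i) \<partial>P' i)" for y
  proof -
    define G where "G t = g (\<zeta> (y(i := t)))" for t
    define G' where "G' t = c i * g' (\<zeta> (y(i := t))) (b i)" for t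
    have z: "((\<lambda>t. \<zeta> (y(i := t))) has_derivative (\<lambda>h. h *\<^sub>R (c i *\<^sub>R b i))) (at t)" for t
      unfolding upd by (auto intro!: derivative_eq_intros simp: mult.commute)
    have "(G has_real_derivative G' t) (at t)" for t
    proof -
      interpret g': bounded_linear "g' (\<zeta> (y(i := t)))" by (rule has_derivative_bounded_linear[OF g])
      have "(G has_derivative (\<lambda>h. g' (\<zeta> (y(i := t))) (h *\<^sub>R (c i *\<^sub>R b i)))) (at t)"
        unfolding G_def using has_derivative_compose[OF z g] by (simp add: o_def)
      moreover have "(\<lambda>h. g' (\<zeta> (y(i := t))) (h *\<^sub>R (c i *\<^sub>R b i))) = (*) (G' t)"
        by (auto simp: fun_eq_iff g'.scaleR G'_def)
      ultimately show ?thesis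
        unfolding has_field_derivative_def by simp
    qed
    moreover have "\<bar>G' t\<bar> \<le> \<bar>c i\<bar> * (B * norm (b i))" for t
      unfolding G'_def abs_mult by (intro mult_left_mono B) auto
    moreover have "continuous_on UNIV G'"
      unfolding G'_def upd
      by (intro continuous_intros continuous_on_compose2[OF cont]) auto
    ultimately have "(\<integral>t. t * G t \<partial>density lborel (normal_density 0 (s i)))
        = (s i)\<^sup>2 * (\<integral>t. G' t \<partial>density lborel (normal_density 0 (s i)))"
      by (rule normal_ibp[OF s_pos[OF i]])
    then have "(\<integral>t. t * G t \<partial>P' i) = (s i)\<^sup>2 * (\<integral>t. G' t \<partial>P' i)"
      using i by (simp add: P'_def P_def)
    moreover have "(\<integral>t. (\<zeta> (y(i := t)) \<bullet> b i) * g (\<zeta> (y(i := t))) \<partial>P' i) = c i * (\<integral>t. t * G t \<partial>P' i)"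
      unfolding inn G_def fun_upd_same mult.assoc by (rule integral_mult_right_zero)
    ultimately show ?thesis
      unfolding G'_def by (simp add: power_mult_distrib power2_eq_square)
  qed
  have "(\<integral>\<omega>. (Z \<omega> \<bullet> b i) * g (Z \<omega>) \<partial>N) = (\<integral>y. (\<zeta> y \<bullet> b i) * g (\<zeta> y) \<partial>PiM (insert i J) P')"
    unfolding Zz trans(1)[OF m1] IJ(1)[symmetric] ..
  also have "\<dots> = (\<integral>y. (\<integral>t. (\<zeta> (y(i := t)) \<bullet> b i) * g (\<zeta> (y(i := t))) \<partial>P' i) \<partial>PiM J P')"
    using int1 unfolding IJ(1)[symmetric] by (subst product_integral_insert[OF IJ(3,2), symmetric]) (auto simp flip: IJ(1))
  also have "\<dots> = (c i * s i)\<^sup>2 * (\<integral>y. (\<integral>t. g' (\<zeta> (y(i := t))) (b i) \<partial>P' i) \<partial>PiM J P')"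
    unfolding one by simp
  also have "(\<integral>y. (\<integral>t. g' (\<zeta> (y(i := t))) (b i) \<partial>P' i) \<partial>PiM J P') = (\<integral>y. g' (\<zeta> y) (b i) \<partial>PiM (insert i J) P')"
    using int2 by (subst product_integral_insert[OF IJ(3,2)]) (auto simp flip: IJ(1))
  also have "\<dots> = (\<integral>\<omega>. g' (Z \<omega>) (b i) \<partial>N)"
    unfolding Zz trans(1)[OF m2] IJ(1)[symmetric] ..
  finally show ?thesis .
qed

end

section \<open>Growth and Lipschitz estimates from a Hessian bound\<close>

section \<open>Functions with bounded second derivative\<close>

locale c2_bounded =
  fixes f :: "'e::euclidean_space \<Rightarrow> real" and B :: real
  assumes C2: "C2 f" and hess_bound: "\<And>x. onorm (hess f x) \<le> B"
begin

lemma f_derivative: "(f has_derivative (\<lambda>h. h \<bullet> grad f x)) (at x)"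
  using C2 GDERIV_grad unfolding C2_def gderiv_def by blast

lemma grad_derivative: "(grad f has_derivative hess f x) (at x)"
  using C2 unfolding C2_def hess_def frechet_derivative_works by blast

lemma hess_linear: "bounded_linear (hess f x)"
  by (rule has_derivative_bounded_linear[OF grad_derivative])

lemma B_nonneg: "0 \<le> B"
  using hess_bound[of 0] onorm_pos_le[OF hess_linear, of 0] by linarith

lemma hess_le: "norm (hess f x h) \<le> B * norm h"
  using onorm[OF hess_linear, of x h] mult_right_mono[OF hess_bound[of x], of "norm h"] by simp

lemma grad_lipschitz: "norm (grad f x - grad f y) \<le> B * norm (x - y)"
  by (rule differentiable_bound[where S = UNIV and f' = "hess f"])
    (use hess_bound grad_derivative in \<open>auto intro: has_derivative_at_withinI\<close>)

lemma grad_le: "norm (grad f x) \<le> (norm (grad f 0) + B) * (1 + norm x)"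
proof -
  have "norm (grad f x) \<le> norm (grad f 0) + B * norm x"
    using grad_lipschitz[of x 0] norm_triangle_sub[of "grad f x" "grad f 0"] by simp
  also have "\<dots> \<le> (norm (grad f 0) + B) * (1 + norm x)"
    using B_nonneg by (simp add: algebra_simps)
  finally show ?thesis .
qed

text \<open>The mean value inequality for f minus its linear part at \<open>y\<close>, whose
  gradient on the segment is at most \<open>B * norm h\<close>. The constant is therefore
  \<open>B\<close>, without the factor 1/2.\<close>

lemma taylor: "\<bar>f (y + h) - f y - h \<bullet> grad f y\<bar> \<le> B * (norm h)\<^sup>2"
proof -
  have "norm ((f (y + h) - y \<bullet> 0 - (y + h) \<bullet> grad f y) - (f y - y \<bullet> grad f y)) \<le> (B * norm h) * norm ((y + h) - y)"
  proof -
    have "norm ((f (y + h) - (y + h) \<bullet> grad f y) - (f y - y \<bullet> grad f y)) \<le> (B * norm h) * norm ((y + h) - y)"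
    proof (rule differentiable_bound[where S = "closed_segment y (y + h)" and f' = "\<lambda>x k. k \<bullet> grad f x - k \<bullet> grad f y" and f = "\<lambda>x. f x - x \<bullet> grad f y"])
      show "((\<lambda>x. f x - x \<bullet> grad f y) has_derivative (\<lambda>k. k \<bullet> grad f x - k \<bullet> grad f y)) (at x within closed_segment y (y + h))" for x
        by (intro has_derivative_diff has_derivative_at_withinI[OF f_derivative] has_derivative_inner_left has_derivative_ident)
      show "onorm (\<lambda>k. k \<bullet> grad f x - k \<bullet> grad f y) \<le> B * norm h" if x: "x \<in> closed_segment y (y + h)" for x
      proof (rule onorm_bound)
        have "norm (x - y) \<le> norm h"
          using segment_bound(1)[OF x] by simp
        then have *: "norm (grad f x - grad f y) \<le> B * norm h"
          using grad_lipschitz[of x y] mult_left_mono[OF _ B_nonneg] order_trans by blast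
        show "norm (k \<bullet> grad f x - k \<bullet> grad f y) \<le> B * norm h * norm k" for k
          using Cauchy_Schwarz_ineq2[of k "grad f x - grad f y"] mult_left_mono[OF *, of "norm k"]
          by (simp add: inner_diff_right mult_ac)
      qed (use B_nonneg in auto)
    qed auto
    then show ?thesis by simp
  qed
  then show ?thesis by (simp add: inner_add_left power2_eq_square mult.assoc algebra_simps)
qed

lemma f_le: "\<bar>f x\<bar> \<le> (\<bar>f 0\<bar> + norm (grad f 0) + B) * (1 + norm x)\<^sup>2"
proof -
  have "\<bar>f x\<bar> \<le> \<bar>f 0\<bar> + \<bar>x \<bullet> grad f 0\<bar> + B * (norm x)\<^sup>2"
    using taylor[of 0 x] by simp
  also have "\<bar>x \<bullet> grad f 0\<bar> \<le> norm (grad f 0) * norm x"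
    using Cauchy_Schwarz_ineq2[of x "grad f 0"] by (simp add: mult.commute)
  also have "\<bar>f 0\<bar> + norm (grad f 0) * norm x + B * (norm x)\<^sup>2 \<le> (\<bar>f 0\<bar> + norm (grad f 0) + B) * (1 + norm x)\<^sup>2"
  proof -
    have "\<bar>f 0\<bar> * 1 + norm (grad f 0) * norm x + B * (norm x)\<^sup>2
        \<le> \<bar>f 0\<bar> * (1 + norm x)\<^sup>2 + norm (grad f 0) * (1 + norm x)\<^sup>2 + B * (1 + norm x)\<^sup>2"
      using B_nonneg by (intro add_mono mult_left_mono) (auto simp: power2_eq_square algebra_simps)
    then show ?thesis by (simp add: distrib_right)
  qed
  finally show ?thesis by simp
qed

lemma f_continuous: "continuous_on UNIV f"
  using f_derivative by (meson has_derivative_continuous continuous_at_imp_continuous_on)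

lemma grad_continuous: "continuous_on UNIV (grad f)"
  using grad_derivative by (meson has_derivative_continuous continuous_at_imp_continuous_on)

lemma hess_continuous: "continuous_on UNIV (\<lambda>x. hess f x v)"
  using C2 unfolding C2_def by blast

lemma c2_measurable [measurable]:
  "f \<in> borel_measurable borel" "grad f \<in> borel_measurable borel" "(\<lambda>x. hess f x v) \<in> borel_measurable borel"
  using f_continuous grad_continuous hess_continuous by (auto intro: borel_measurable_continuous_onI)

end

section \<open>Interpolation between the traces and a radially scaled Gaussian vector\<close>

section \<open>The interpolation argument\<close>

text \<open>The index \<open>i\<close> stands for one real coordinate of the vector of traces: the
  power is \<open>q i\<close>, and \<open>l i\<close> selects the real or the imaginary part. The
  assumption \<open>variance\<close> matches the limit of the Stein kernel at radius 1.\<close>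

locale smart_path = sph_mat \<mu> n K + G: gauss_vec N X I sg c b Z + F: c2_bounded f B
  for \<mu> :: "pt measure" and n K and N :: "'w measure" and X :: "'i \<Rightarrow> 'w \<Rightarrow> real" and I sg c
    and b :: "'i \<Rightarrow> 'e::euclidean_space" and Z and f :: "'e \<Rightarrow> real" and B +
  fixes q :: "'i \<Rightarrow> nat" and l :: "'i \<Rightarrow> bool"
  assumes q_pos: "\<And>i. i \<in> I \<Longrightarrow> 1 \<le> q i" and l_K: "\<And>i. i \<in> I \<Longrightarrow> l i \<in> K"
    and q_l_inj: "\<And>i j. i \<in> I \<Longrightarrow> j \<in> I \<Longrightarrow> q i = q j \<Longrightarrow> l i = l j \<Longrightarrow> i = j"
    and variance: "\<And>i. i \<in> I \<Longrightarrow> (c i * sg i)\<^sup>2 = real (q i) / real (card K)"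
begin

sublocale P: pair_prob_space \<mu> N ..

definition wt :: "'i \<Rightarrow> pt \<Rightarrow> real" where
  "wt i x = pw K n (q i) (l i) x - tau K (q i) * sr n K x ^ q i"

definition W :: "pt \<Rightarrow> 'e" where
  "W x = (\<Sum>i\<in>I. pw K n (q i) (l i) x *\<^sub>R b i)"

definition tv :: 'e where
  "tv = (\<Sum>i\<in>I. tau K (q i) *\<^sub>R b i)"

definition DZ :: "pt \<Rightarrow> 'e \<Rightarrow> 'e" where
  "DZ x z = (\<Sum>i\<in>I. (sr n K x ^ q i * (z \<bullet> b i)) *\<^sub>R b i)"

definition bv :: "pt \<Rightarrow> 'e" where
  "bv x = (\<Sum>i\<in>I. (tau K (q i) * (sr n K x ^ q i - 1)) *\<^sub>R b i)"

definition Wt :: "pt \<Rightarrow> 'e" where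
  "Wt x = (\<Sum>i\<in>I. wt i x *\<^sub>R b i)"

text \<open>The Gaussian part is scaled by powers of the radius so that its covariance agrees with
  the kernel for each radius. The radial shift \<open>bv\<close> turns the radial centring in
  \<open>Wt\<close> into the constant centring \<open>tv\<close> at the end of the path.\<close>

definition path :: "real \<Rightarrow> pt \<Rightarrow> 'e \<Rightarrow> 'e" where
  "path t x z = sin t *\<^sub>R Wt x + cos t *\<^sub>R DZ x z + bv x"

lemma path_end: "path (pi / 2) x z = W x - tv"
proof -
  have "Wt x + bv x = (\<Sum>i\<in>I. (pw K n (q i) (l i) x - tau K (q i)) *\<^sub>R b i)"
    unfolding Wt_def bv_def wt_def sum.distrib[symmetric] scaleR_add_left[symmetric]
    by (intro sum.cong refl) (simp add: algebra_simps)
  then show ?thesis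
    by (simp add: path_def W_def tv_def scaleR_diff_left sum_subtractf)
qed

lemma path_start: "path 0 x z = DZ x z + bv x"
  by (simp add: path_def)

lemma pb_wt: "pb (wt i)"
  unfolding wt_def[abs_def] by (intro pb_diff pb_pw pb_mult pb_const pb_power pb_sr)

lemma pb_Wt: "pb Wt"
  unfolding Wt_def[abs_def] by (intro pb_sum pb_scaleR pb_wt pb_const)

lemma pb_bv: "pb bv"
  unfolding bv_def[abs_def] by (intro pb_sum pb_scaleR pb_diff pb_mult pb_power pb_sr pb_const)

lemma sr_measurable [measurable]: "sr n K \<in> borel_measurable \<mu>"
  using pb_sr by (rule pb_measurable)

lemma path_measurable [measurable]:
  "Wt \<in> borel_measurable \<mu>" "bv \<in> borel_measurable \<mu>" "wt i \<in> borel_measurable \<mu>"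
  using pb_Wt pb_bv pb_wt by (auto simp: pb_def)

definition U :: "pt \<Rightarrow> real" where
  "U x = norm (Wt x) + norm (bv x) + (\<Sum>i\<in>I. sr n K x ^ q i)"

lemma U_nonneg: "0 \<le> U x"
  unfolding U_def by (intro add_nonneg_nonneg sum_nonneg zero_le_power sr_nonneg norm_ge_zero)

lemma pb_U: "pb U"
  unfolding U_def[abs_def] by (intro pb_add pb_norm pb_Wt pb_bv pb_sum pb_power pb_sr)

lemma b_norm: "i \<in> I \<Longrightarrow> norm (b i) = 1"
  using G.b_image by (metis imageI norm_Basis)

lemma DZ_le: "norm (DZ x z) \<le> (\<Sum>i\<in>I. sr n K x ^ q i) * norm z"
proof -
  have "norm (DZ x z) \<le> (\<Sum>i\<in>I. norm ((sr n K x ^ q i * (z \<bullet> b i)) *\<^sub>R b i))"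
    unfolding DZ_def by (rule norm_sum)
  also have "\<dots> \<le> (\<Sum>i\<in>I. sr n K x ^ q i * norm z)"
  proof (intro sum_mono)
    fix i assume i: "i \<in> I"
    then have "\<bar>z \<bullet> b i\<bar> \<le> norm z" using G.b_image by (intro Basis_le_norm) auto
    then show "norm ((sr n K x ^ q i * (z \<bullet> b i)) *\<^sub>R b i) \<le> sr n K x ^ q i * norm z"
      by (simp add: b_norm[OF i] abs_mult sr_nonneg mult_left_mono)
  qed
  finally show ?thesis by (simp add: sum_distrib_right)
qed

lemma one_le_Z: "1 \<le> 1 + norm (z::'e)"
  by simp

lemma path_le: "1 + norm (path t x z) \<le> (1 + U x) * (1 + norm z)"
proof -
  have "norm (path t x z) \<le> norm (Wt x) + norm (DZ x z) + norm (bv x)"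
  proof -
    have "norm (path t x z) \<le> norm (sin t *\<^sub>R Wt x) + norm (cos t *\<^sub>R DZ x z) + norm (bv x)"
      unfolding path_def by (meson norm_triangle_ineq norm_triangle_le add_mono order_refl order_trans)
    also have "\<dots> \<le> norm (Wt x) + norm (DZ x z) + norm (bv x)"
      by (intro add_mono) (auto intro: mult_left_le_one_le)
    finally show ?thesis .
  qed
  also have "\<dots> \<le> U x + U x * norm z"
  proof -
    have "norm (DZ x z) \<le> U x * norm z"
      by (rule order_trans[OF DZ_le]) (auto simp: U_def intro: mult_right_mono)
    moreover have "norm (Wt x) + norm (bv x) \<le> U x"
      unfolding U_def using sum_nonneg[of I "\<lambda>i. sr n K x ^ q i"] sr_nonneg[of n K x] by auto
    ultimately show ?thesis by simp
  qed
  finally have "norm (path t x z) \<le> U x + U x * norm z" .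
  moreover have "(1 + U x) * (1 + norm z) = 1 + U x + U x * norm z + norm z"
    by (simp add: algebra_simps)
  ultimately show ?thesis using norm_ge_zero[of z] by linarith
qed

lemma path_derivative:
  "((\<lambda>t. path t x z) has_vector_derivative (cos t *\<^sub>R Wt x - sin t *\<^sub>R DZ x z)) (at t)"
proof -
  have "((\<lambda>t. sin t *\<^sub>R Wt x) has_vector_derivative cos t *\<^sub>R Wt x) (at t)"
    "((\<lambda>t. cos t *\<^sub>R DZ x z) has_vector_derivative (- sin t) *\<^sub>R DZ x z) (at t)"
    using has_vector_derivative_scaleR[OF DERIV_sin has_vector_derivative_const]
      has_vector_derivative_scaleR[OF DERIV_cos has_vector_derivative_const] by fastforce+
  from has_vector_derivative_add[OF has_vector_derivative_add[OF this] has_vector_derivative_const]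
  show ?thesis unfolding path_def by simp
qed

lemma path_derivative_le: "norm (cos t *\<^sub>R Wt x - sin t *\<^sub>R DZ x z) \<le> (1 + U x) * (1 + norm z)"
proof -
  have "norm (cos t *\<^sub>R Wt x - sin t *\<^sub>R DZ x z) \<le> norm (cos t *\<^sub>R Wt x) + norm (sin t *\<^sub>R DZ x z)"
    by (rule norm_triangle_ineq4)
  also have "\<dots> \<le> norm (Wt x) + norm (DZ x z)"
    by (intro add_mono) (auto intro: mult_left_le_one_le)
  also have "\<dots> \<le> U x + U x * norm z"
  proof (intro add_mono)
    show "norm (DZ x z) \<le> U x * norm z"
      by (rule order_trans[OF DZ_le]) (auto simp: U_def intro: mult_right_mono)
    show "norm (Wt x) \<le> U x"
      unfolding U_def using sum_nonneg[of I "\<lambda>i. sr n K x ^ q i"] sr_nonneg[of n K x] by auto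
  qed
  also have "\<dots> \<le> (1 + U x) * (1 + norm z)"
    using U_nonneg[of x] by (simp add: algebra_simps)
  finally show ?thesis .
qed

text \<open>The growth class on the product space: polynomial in the matrix and quadratic in the
  Gaussian vector, which matches the quadratic growth of \<open>f\<close>.\<close>

definition pgb :: "(pt \<times> 'w \<Rightarrow> real) \<Rightarrow> bool" where
  "pgb h \<longleftrightarrow> h \<in> borel_measurable (\<mu> \<Otimes>\<^sub>M N) \<and>
     (\<exists>u. pb u \<and> (\<forall>x\<in>space \<mu>. \<forall>\<omega>. \<bar>h (x, \<omega>)\<bar> \<le> u x * (1 + norm (Z \<omega>))\<^sup>2))"

lemma pgbI:
  assumes "h \<in> borel_measurable (\<mu> \<Otimes>\<^sub>M N)" "pb u" "\<And>x \<omega>. x \<in> space \<mu> \<Longrightarrow> \<bar>h (x, \<omega>)\<bar> \<le> u x * (1 + norm (Z \<omega>))\<^sup>2"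
  shows "pgb h"
  using assms unfolding pgb_def by blast

lemma Z_poly_integrable: "integrable N (\<lambda>\<omega>. (1 + norm (Z \<omega>))\<^sup>2)"
proof (rule Bochner_Integration.integrable_bound)
  show "integrable N (\<lambda>\<omega>. 2 * (1 + (norm (Z \<omega>))\<^sup>2))" using G.Z_square_integrable by simp
  show "AE \<omega> in N. norm ((1 + norm (Z \<omega>))\<^sup>2) \<le> norm (2 * (1 + (norm (Z \<omega>))\<^sup>2))"
  proof (rule AE_I2)
    fix \<omega>
    have "2 * norm (Z \<omega>) \<le> 1 + (norm (Z \<omega>))\<^sup>2"
      using sum_squares_bound[of 1 "norm (Z \<omega>)"] by simp
    then show "norm ((1 + norm (Z \<omega>))\<^sup>2) \<le> norm (2 * (1 + (norm (Z \<omega>))\<^sup>2))"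
      by (simp add: power2_sum)
  qed
qed simp

lemma product_integrable:
  assumes "pb u"
  shows "integrable (\<mu> \<Otimes>\<^sub>M N) (\<lambda>(x, \<omega>). u x * (1 + norm (Z \<omega>))\<^sup>2)"
proof (rule P.Fubini_integrable)
  have [measurable]: "u \<in> borel_measurable \<mu>" using assms by (rule pb_measurable)
  show "(\<lambda>(x, \<omega>). u x * (1 + norm (Z \<omega>))\<^sup>2) \<in> borel_measurable (\<mu> \<Otimes>\<^sub>M N)"
    unfolding case_prod_beta by measurable
  have "integrable \<mu> (\<lambda>x. \<bar>u x\<bar> * (\<integral>\<omega>. (1 + norm (Z \<omega>))\<^sup>2 \<partial>N))"
    using pb_integrable[OF assms] by simp
  then show "integrable \<mu> (\<lambda>x. \<integral>\<omega>. norm (case (x, \<omega>) of (x, \<omega>) \<Rightarrow> u x * (1 + norm (Z \<omega>))\<^sup>2) \<partial>N)"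
    by (simp add: abs_mult)
  show "AE x in \<mu>. integrable N (\<lambda>\<omega>. case (x, \<omega>) of (x, \<omega>) \<Rightarrow> u x * (1 + norm (Z \<omega>))\<^sup>2)"
    using Z_poly_integrable by simp
qed

lemma pgb_integrable:
  assumes "pgb h"
  shows "integrable (\<mu> \<Otimes>\<^sub>M N) h"
proof -
  obtain u where h: "h \<in> borel_measurable (\<mu> \<Otimes>\<^sub>M N)" and u: "pb u"
    and le: "\<And>x \<omega>. x \<in> space \<mu> \<Longrightarrow> \<bar>h (x, \<omega>)\<bar> \<le> u x * (1 + norm (Z \<omega>))\<^sup>2"
    using assms unfolding pgb_def by blast
  show ?thesis
  proof (rule Bochner_Integration.integrable_bound[OF product_integrable[OF u] h])
    show "AE y in \<mu> \<Otimes>\<^sub>M N. norm (h y) \<le> norm (case y of (x, \<omega>) \<Rightarrow> u x * (1 + norm (Z \<omega>))\<^sup>2)"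
    proof (rule AE_I2)
      fix y assume "y \<in> space (\<mu> \<Otimes>\<^sub>M N)"
      then obtain x \<omega> where y: "y = (x, \<omega>)" "x \<in> space \<mu>" by (auto simp: space_pair_measure)
      show "norm (h y) \<le> norm (case y of (x, \<omega>) \<Rightarrow> u x * (1 + norm (Z \<omega>))\<^sup>2)"
        using order_trans[OF le[OF y(2)] abs_ge_self] y(1) by simp
    qed
  qed
qed

lemma pgb_bounded:
  assumes k: "pb k" and \<eta>: "\<eta> \<in> borel_measurable (\<mu> \<Otimes>\<^sub>M N)" and E: "\<And>y. \<bar>\<eta> y\<bar> \<le> E"
  shows "pgb (\<lambda>y. k (fst y) * \<eta> y)"
proof (rule pgbI[where u = "\<lambda>x. \<bar>k x\<bar> * E"])
  have [measurable]: "k \<in> borel_measurable \<mu>" using k by (rule pb_measurable)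
  show "(\<lambda>y. k (fst y) * \<eta> y) \<in> borel_measurable (\<mu> \<Otimes>\<^sub>M N)" using \<eta> by measurable
  show "pb (\<lambda>x. \<bar>k x\<bar> * E)" using pb_norm[OF k] by auto
  have E0: "0 \<le> E" using E[of undefined] by linarith
  show "\<bar>k (fst (x, \<omega>)) * \<eta> (x, \<omega>)\<bar> \<le> \<bar>k x\<bar> * E * (1 + norm (Z \<omega>))\<^sup>2" for x \<omega>
  proof -
    have "\<bar>k (fst (x, \<omega>)) * \<eta> (x, \<omega>)\<bar> \<le> \<bar>k x\<bar> * E"
      unfolding abs_mult using E by (intro mult_mono) auto
    also have "\<dots> \<le> \<bar>k x\<bar> * E * (1 + norm (Z \<omega>))\<^sup>2"
      using one_le_power[OF one_le_Z, of "Z \<omega>" 2] mult_left_mono[of 1 "(1 + norm (Z \<omega>))\<^sup>2" "\<bar>k x\<bar> * E"] E0 by simp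
    finally show ?thesis .
  qed
qed

lemma integral_bounded_factor:
  fixes k :: "pt \<Rightarrow> real" and \<eta> :: "pt \<times> 'w \<Rightarrow> real"
  assumes k: "pb k" and \<eta>: "\<eta> \<in> borel_measurable (\<mu> \<Otimes>\<^sub>M N)" and E: "\<And>y. \<bar>\<eta> y\<bar> \<le> E"
  shows "\<bar>\<integral>y. k (fst y) * \<eta> y \<partial>(\<mu> \<Otimes>\<^sub>M N)\<bar> \<le> E * (\<integral>x. \<bar>k x\<bar> \<partial>\<mu>)"
proof -
  have [measurable]: "k \<in> borel_measurable \<mu>" using k by (rule pb_measurable)
  have i1: "integrable (\<mu> \<Otimes>\<^sub>M N) (\<lambda>y. k (fst y) * \<eta> y)"
    by (rule pgb_integrable[OF pgb_bounded[OF assms]])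
  have i2: "integrable (\<mu> \<Otimes>\<^sub>M N) (\<lambda>y. \<bar>k (fst y)\<bar> * E)"
    using pgb_integrable[OF pgb_bounded[of "\<lambda>x. \<bar>k x\<bar>" "\<lambda>_. E" "\<bar>E\<bar>"]] pb_norm[OF k] by simp
  have "\<bar>\<integral>y. k (fst y) * \<eta> y \<partial>(\<mu> \<Otimes>\<^sub>M N)\<bar> \<le> (\<integral>y. \<bar>k (fst y) * \<eta> y\<bar> \<partial>(\<mu> \<Otimes>\<^sub>M N))"
    by (rule integral_abs_bound)
  also have "\<dots> \<le> (\<integral>y. \<bar>k (fst y)\<bar> * E \<partial>(\<mu> \<Otimes>\<^sub>M N))"
  proof (rule Bochner_Integration.integral_mono[OF integrable_abs[OF i1] i2])
    show "\<bar>k (fst y) * \<eta> y\<bar> \<le> \<bar>k (fst y)\<bar> * E" for y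
      unfolding abs_mult by (intro mult_left_mono E) auto
  qed
  also have "\<dots> = (\<integral>x. \<integral>\<omega>. \<bar>k x\<bar> * E \<partial>N \<partial>\<mu>)"
    using P.integral_fst'[OF i2, symmetric] by (simp only: fst_conv)
  also have "\<dots> = E * (\<integral>x. \<bar>k x\<bar> \<partial>\<mu>)"
    using G.prob_space by (simp add: mult.commute)
  finally show ?thesis .
qed

lemma pair_path_measurable [measurable]: "(\<lambda>y. path t (fst y) (Z (snd y))) \<in> borel_measurable (\<mu> \<Otimes>\<^sub>M N)"
  unfolding path_def DZ_def by measurable

lemma pgb_f_path:
  assumes "pb k"
  shows "pgb (\<lambda>y. k (fst y) * f (path t (fst y) (Z (snd y))))"
proof (rule pgbI[where u = "\<lambda>x. \<bar>k x\<bar> * ((\<bar>f 0\<bar> + norm (grad f 0) + B) * (1 + U x)\<^sup>2)"])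
  have [measurable]: "k \<in> borel_measurable \<mu>" using assms by (rule pb_measurable)
  show "(\<lambda>y. k (fst y) * f (path t (fst y) (Z (snd y)))) \<in> borel_measurable (\<mu> \<Otimes>\<^sub>M N)" by measurable
  show "pb (\<lambda>x. \<bar>k x\<bar> * ((\<bar>f 0\<bar> + norm (grad f 0) + B) * (1 + U x)\<^sup>2))"
    using pb_norm[OF assms] by (intro pb_mult pb_power pb_add pb_const pb_U) simp_all
  fix x \<omega>
  have "\<bar>f (path t x (Z \<omega>))\<bar> \<le> (\<bar>f 0\<bar> + norm (grad f 0) + B) * (1 + norm (path t x (Z \<omega>)))\<^sup>2"
    by (rule F.f_le)
  also have "\<dots> \<le> (\<bar>f 0\<bar> + norm (grad f 0) + B) * ((1 + U x) * (1 + norm (Z \<omega>)))\<^sup>2"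
    using path_le F.B_nonneg by (intro mult_left_mono power_mono) auto
  finally have "\<bar>k x\<bar> * \<bar>f (path t x (Z \<omega>))\<bar> \<le> \<bar>k x\<bar> * ((\<bar>f 0\<bar> + norm (grad f 0) + B) * ((1 + U x) * (1 + norm (Z \<omega>)))\<^sup>2)"
    by (intro mult_left_mono) auto
  then show "\<bar>k (fst (x, \<omega>)) * f (path t (fst (x, \<omega>)) (Z (snd (x, \<omega>))))\<bar>
      \<le> \<bar>k x\<bar> * ((\<bar>f 0\<bar> + norm (grad f 0) + B) * (1 + U x)\<^sup>2) * (1 + norm (Z \<omega>))\<^sup>2"
    by (simp add: abs_mult power_mult_distrib mult.assoc)
qed

lemma grad_path_le: "\<bar>grad f (path t x z) \<bullet> b i\<bar> \<le> (norm (grad f 0) + B) * (1 + U x) * (1 + norm z)" if "i \<in> I"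
proof -
  have "\<bar>grad f (path t x z) \<bullet> b i\<bar> \<le> norm (grad f (path t x z))"
    using G.b_image that by (intro Basis_le_norm) auto
  also have "\<dots> \<le> (norm (grad f 0) + B) * (1 + norm (path t x z))"
    by (rule F.grad_le)
  also have "\<dots> \<le> (norm (grad f 0) + B) * ((1 + U x) * (1 + norm z))"
    using path_le F.B_nonneg by (intro mult_left_mono) auto
  finally show ?thesis by (simp add: mult.assoc)
qed

lemma pgb_grad:
  assumes i: "i \<in> I" and "pb k" and m: "a \<in> borel_measurable N" and a: "\<And>\<omega>. \<bar>a \<omega>\<bar> \<le> 1 + norm (Z \<omega>)"
  shows "pgb (\<lambda>y. k (fst y) * (a (snd y) * (grad f (path t (fst y) (Z (snd y))) \<bullet> b i)))"
proof (rule pgbI[where u = "\<lambda>x. \<bar>k x\<bar> * ((norm (grad f 0) + B) * (1 + U x))"])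
  have [measurable]: "k \<in> borel_measurable \<mu>" using assms by (simp add: pb_def)
  note m [measurable]
  show "(\<lambda>y. k (fst y) * (a (snd y) * (grad f (path t (fst y) (Z (snd y))) \<bullet> b i))) \<in> borel_measurable (\<mu> \<Otimes>\<^sub>M N)"
    by measurable
  show "pb (\<lambda>x. \<bar>k x\<bar> * ((norm (grad f 0) + B) * (1 + U x)))"
    using pb_norm[OF assms(2)] by (intro pb_mult pb_add pb_const pb_U) simp_all
  fix x \<omega>
  have "\<bar>a \<omega>\<bar> * \<bar>grad f (path t x (Z \<omega>)) \<bullet> b i\<bar> \<le> (1 + norm (Z \<omega>)) * ((norm (grad f 0) + B) * (1 + U x) * (1 + norm (Z \<omega>)))"
    by (intro mult_mono a grad_path_le i) auto
  then have "\<bar>k x\<bar> * (\<bar>a \<omega>\<bar> * \<bar>grad f (path t x (Z \<omega>)) \<bullet> b i\<bar>)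
      \<le> \<bar>k x\<bar> * ((1 + norm (Z \<omega>)) * ((norm (grad f 0) + B) * (1 + U x) * (1 + norm (Z \<omega>))))"
    by (intro mult_left_mono) auto
  then show "\<bar>k (fst (x, \<omega>)) * (a (snd (x, \<omega>)) * (grad f (path t (fst (x, \<omega>)) (Z (snd (x, \<omega>)))) \<bullet> b i))\<bar>
      \<le> \<bar>k x\<bar> * ((norm (grad f 0) + B) * (1 + U x)) * (1 + norm (Z \<omega>))\<^sup>2"
    by (simp add: abs_mult power2_eq_square mult_ac)
qed

lemma hess_path_le: "\<bar>hess f y (b e) \<bullet> b i\<bar> \<le> B" if "i \<in> I" "e \<in> I"
proof -
  have "\<bar>hess f y (b e) \<bullet> b i\<bar> \<le> norm (hess f y (b e))"
    using G.b_image that by (intro Basis_le_norm) auto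
  also have "\<dots> \<le> B" using F.hess_le[of y "b e"] by (simp add: b_norm that)
  finally show ?thesis .
qed

text \<open>The Stein identity for the matrix with the Gaussian variable frozen. The test function
  is a coordinate of the gradient of \<open>f\<close> along the path, whose tangential derivative
  involves only the power traces.\<close>

lemma stein_x:
  assumes r: "pb (\<lambda>x. r (nrm (ix n K) x) :: real)" and i: "i \<in> I"
  shows "(\<integral>x. r (nrm (ix n K) x) * (wt i x * (grad f (path t x z) \<bullet> b i)) \<partial>\<mu>)
    = (\<integral>x. r (nrm (ix n K) x) * (kerR K n (q i) (l i) x * (grad f (path t x z) \<bullet> b i)
       + (\<Sum>e\<in>I. kerA K n (q i) (l i) (q e) (l e) x * (sin t * (hess f (path t x z) (b e) \<bullet> b i)))) \<partial>\<mu>)"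
  unfolding wt_def
proof (rule stein_identity[OF r])
  \<comment> \<open>All that the path contains besides the power traces, as a function of the
    radius; it has derivative zero for \<open>tdiff\<close>.\<close>
  define R where "R y = cos t *\<^sub>R (\<Sum>i\<in>I. ((y / sqrt (real n)) ^ q i * (z \<bullet> b i)) *\<^sub>R b i)
      + (\<Sum>i\<in>I. (tau K (q i) * ((y / sqrt (real n)) ^ q i - 1)) *\<^sub>R b i)
      - sin t *\<^sub>R (\<Sum>i\<in>I. (tau K (q i) * (y / sqrt (real n)) ^ q i) *\<^sub>R b i)" for y
  have path: "path t x z = (\<Sum>e\<in>I. (sin t * pw K n (q e) (l e) x) *\<^sub>R b e) + R (nrm (ix n K) x)" for x
  proof -
    have "sin t *\<^sub>R Wt x = (\<Sum>e\<in>I. (sin t * pw K n (q e) (l e) x) *\<^sub>R b e) - sin t *\<^sub>R (\<Sum>i\<in>I. (tau K (q i) * sr n K x ^ q i) *\<^sub>R b i)"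
      by (simp add: Wt_def wt_def scaleR_sum_right scaleR_diff_left scaleR_diff_right right_diff_distrib flip: sum_subtractf)
    then show ?thesis unfolding path_def DZ_def bv_def R_def sr_def by simp
  qed
  have tp: "tdiff (ix n K) (\<lambda>x. path t x z) (\<lambda>x c. (\<Sum>e\<in>I. (sin t * dpw K n (q e) (l e) x c) *\<^sub>R b e) + 0)"
    unfolding path
  proof (intro tdiff_add tdiff_sum tdiff_radial)
    fix e assume "e \<in> I"
    have bl: "bounded_linear (\<lambda>y. (sin t * y) *\<^sub>R b e)"
      by (intro bounded_linear_scaleR_const bounded_linear_mult_right)
    show "tdiff (ix n K) (\<lambda>x. (sin t * pw K n (q e) (l e) x) *\<^sub>R b e) (\<lambda>x c. (sin t * dpw K n (q e) (l e) x c) *\<^sub>R b e)"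
      by (rule tdiff_bounded_linear[OF bl tdiff_pw])
  qed
  have "tdiff (ix n K) (\<lambda>x. grad f (path t x z) \<bullet> b i)
      (\<lambda>x c. hess f (path t x z) ((\<Sum>e\<in>I. (sin t * dpw K n (q e) (l e) x c) *\<^sub>R b e) + 0) \<bullet> b i)"
    using tdiff_compose[where G = "\<lambda>y. grad f y \<bullet> b i" and G' = "\<lambda>y h. hess f y h \<bullet> b i", OF _ tp]
    by (simp add: has_derivative_inner_left[OF F.grad_derivative])
  moreover have "hess f y ((\<Sum>e\<in>I. (sin t * dpw K n (q e) (l e) x c) *\<^sub>R b e) + 0) \<bullet> b i
      = (\<Sum>e\<in>I. sin t * (hess f y (b e) \<bullet> b i) * dpw K n (q e) (l e) x c)" for x c y
  proof -
    interpret h: bounded_linear "hess f y" by (rule F.hess_linear)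
    show ?thesis by (simp add: h.sum h.scaleR inner_sum_left mult_ac)
  qed
  ultimately show "tdiff (ix n K) (\<lambda>x. grad f (path t x z) \<bullet> b i)
      (\<lambda>x c. \<Sum>e\<in>I. sin t * (hess f (path t x z) (b e) \<bullet> b i) * dpw K n (q e) (l e) x c)"
    by simp
  have [measurable]: "(\<lambda>x. path t x z) \<in> borel_measurable \<mu>"
    unfolding path_def DZ_def by measurable
  have cb: "pb (\<lambda>x. (norm (grad f 0) + B) * (1 + U x) * (1 + norm z))"
    by (intro pb_mult pb_add pb_const pb_U)
  show "pb (\<lambda>x. grad f (path t x z) \<bullet> b i)"
  proof (rule pb_dom[OF cb])
    show "norm (grad f (path t x z) \<bullet> b i) \<le> norm ((norm (grad f 0) + B) * (1 + U x) * (1 + norm z))" for x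
      using grad_path_le[OF i, of t x z] by simp
  qed measurable
  show "pb (\<lambda>x. sin t * (hess f (path t x z) (b e) \<bullet> b i))" if e: "e \<in> I" for e
  proof (intro pb_mult pb_const)
    show "pb (\<lambda>x. hess f (path t x z) (b e) \<bullet> b i)"
    proof (rule pb_dom[OF pb_const[of B]])
      show "norm (hess f (path t x z) (b e) \<bullet> b i) \<le> norm B" for x
        using hess_path_le[OF i e] F.B_nonneg by simp
    qed measurable
  qed
qed (use l_K q_pos i in auto)

text \<open>Gaussian integration by parts with the matrix frozen; the scaling by the radius
  contributes one more power of it and completes s^(2q).\<close>

lemma stein_z:
  assumes i: "i \<in> I"
  shows "(\<integral>\<omega>. (Z \<omega> \<bullet> b i) * (grad f (path t x (Z \<omega>)) \<bullet> b i) \<partial>N)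
    = (\<integral>\<omega>. real (q i) / real (card K) * (cos t * sr n K x ^ q i * (hess f (path t x (Z \<omega>)) (b i) \<bullet> b i)) \<partial>N)"
proof -
  have Dl: "bounded_linear (DZ x)"
    unfolding DZ_def[abs_def]
    by (intro bounded_linear_sum bounded_linear_scaleR_const bounded_linear_const_mult bounded_linear_inner_left)
  have Db: "DZ x (b i) = sr n K x ^ q i *\<^sub>R b i"
  proof -
    have "DZ x (b i) = (\<Sum>j\<in>I. if j = i then sr n K x ^ q i *\<^sub>R b i else 0)"
      unfolding DZ_def using i by (intro sum.cong refl) (auto simp: G.b_inner)
    then show ?thesis using i G.finI by simp
  qed
  define g' where "g' z h = hess f (path t x z) (cos t *\<^sub>R DZ x h) \<bullet> b i" for z h
  have pd: "((\<lambda>z. path t x z) has_derivative (\<lambda>h. cos t *\<^sub>R DZ x h)) (at z)" for z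
    unfolding path_def
    by (auto intro!: derivative_eq_intros bounded_linear.has_derivative[OF Dl])
  have "(\<integral>\<omega>. (Z \<omega> \<bullet> b i) * (grad f (path t x (Z \<omega>)) \<bullet> b i) \<partial>N) = (c i * sg i)\<^sup>2 * (\<integral>\<omega>. g' (Z \<omega>) (b i) \<partial>N)"
  proof (rule G.gaussian_ibp[OF i])
    show "((\<lambda>z. grad f (path t x z) \<bullet> b i) has_derivative g' z) (at z)" for z
      unfolding g'_def by (intro has_derivative_inner_left has_derivative_compose[OF pd F.grad_derivative])
    show "\<bar>g' z h\<bar> \<le> (B * (\<Sum>i\<in>I. sr n K x ^ q i)) * norm h" for z h
    proof -
      have "\<bar>g' z h\<bar> \<le> norm (hess f (path t x z) (cos t *\<^sub>R DZ x h))"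
        unfolding g'_def using G.b_image i by (intro Basis_le_norm) auto
      also have "\<dots> \<le> B * norm (cos t *\<^sub>R DZ x h)" by (rule F.hess_le)
      also have "\<dots> \<le> B * norm (DZ x h)"
        using F.B_nonneg by (intro mult_left_mono) (auto intro: mult_left_le_one_le)
      also have "\<dots> \<le> B * ((\<Sum>i\<in>I. sr n K x ^ q i) * norm h)"
        using F.B_nonneg DZ_le by (intro mult_left_mono) auto
      finally show ?thesis by (simp add: mult.assoc)
    qed
    have cp: "continuous_on UNIV (\<lambda>z. path t x z)"
      using pd by (meson has_derivative_continuous continuous_at_imp_continuous_on)
    show "continuous_on UNIV (\<lambda>z. g' z (b i))"
      unfolding g'_def by (intro continuous_intros continuous_on_compose2[OF F.hess_continuous cp]) auto
  qed
  moreover have "g' z (b i) = cos t * sr n K x ^ q i * (hess f (path t x z) (b i) \<bullet> b i)" for z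
  proof -
    interpret h: bounded_linear "hess f (path t x z)" by (rule F.hess_linear)
    show ?thesis by (simp add: g'_def Db h.scaleR)
  qed
  ultimately show ?thesis by (simp add: variance[OF i])
qed

end

context smart_path
begin

lemma b_Basis: "i \<in> I \<Longrightarrow> b i \<in> Basis"
  using G.b_image by blast

definition Phi :: "(real \<Rightarrow> real) \<Rightarrow> real \<Rightarrow> real" where
  "Phi r t = (\<integral>y. r (nrm (ix n K) (fst y)) * f (path t (fst y) (Z (snd y))) \<partial>(\<mu> \<Otimes>\<^sub>M N))"

definition dPhi :: "(real \<Rightarrow> real) \<Rightarrow> real \<Rightarrow> real" where
  "dPhi r t = (\<integral>y. r (nrm (ix n K) (fst y)) * ((cos t *\<^sub>R Wt (fst y) - sin t *\<^sub>R DZ (fst y) (Z (snd y)))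
      \<bullet> grad f (path t (fst y) (Z (snd y)))) \<partial>(\<mu> \<Otimes>\<^sub>M N))"

lemma Phi_derivative:
  assumes r: "pb (\<lambda>x. r (nrm (ix n K) x) :: real)"
  shows "(Phi r has_vector_derivative dPhi r t) (at t)"
  unfolding Phi_def[abs_def] dPhi_def
proof (rule has_vector_derivative_integral(2))
  let ?u = "\<lambda>x. \<bar>r (nrm (ix n K) x)\<bar> * ((norm (grad f 0) + B) * ((1 + U x) * (1 + U x)))"
  show "integrable (\<mu> \<Otimes>\<^sub>M N) (\<lambda>y. r (nrm (ix n K) (fst y)) * f (path t (fst y) (Z (snd y))))" for t
    by (rule pgb_integrable[OF pgb_f_path[OF r]])
  show "integrable (\<mu> \<Otimes>\<^sub>M N) (\<lambda>(x, \<omega>). ?u x * (1 + norm (Z \<omega>))\<^sup>2)"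
    using pb_norm[OF r] by (intro product_integrable pb_mult pb_add pb_const pb_U) simp_all
  show "((\<lambda>t. r (nrm (ix n K) (fst y)) * f (path t (fst y) (Z (snd y)))) has_vector_derivative
      r (nrm (ix n K) (fst y)) * ((cos t *\<^sub>R Wt (fst y) - sin t *\<^sub>R DZ (fst y) (Z (snd y)))
      \<bullet> grad f (path t (fst y) (Z (snd y))))) (at t)" for t y
  proof -
    have "((\<lambda>t. f (path t (fst y) (Z (snd y)))) has_vector_derivative
        (cos t *\<^sub>R Wt (fst y) - sin t *\<^sub>R DZ (fst y) (Z (snd y))) \<bullet> grad f (path t (fst y) (Z (snd y)))) (at t)"
      using vector_derivative_diff_chain_within[OF path_derivative has_derivative_at_withinI[OF F.f_derivative]]
      by (simp add: o_def)
    from bounded_linear.has_vector_derivative[OF bounded_linear_mult_right this]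
    show ?thesis .
  qed
  show "norm (r (nrm (ix n K) (fst y)) * ((cos t *\<^sub>R Wt (fst y) - sin t *\<^sub>R DZ (fst y) (Z (snd y)))
      \<bullet> grad f (path t (fst y) (Z (snd y))))) \<le> (case y of (x, \<omega>) \<Rightarrow> ?u x * (1 + norm (Z \<omega>))\<^sup>2)" for t y
  proof -
    obtain x \<omega> where y: "y = (x, \<omega>)" by (cases y)
    let ?p = "cos t *\<^sub>R Wt x - sin t *\<^sub>R DZ x (Z \<omega>)" and ?g = "grad f (path t x (Z \<omega>))"
    have "norm ?g \<le> (norm (grad f 0) + B) * ((1 + U x) * (1 + norm (Z \<omega>)))"
      using F.grad_le[of "path t x (Z \<omega>)"] mult_left_mono[OF path_le[of t x "Z \<omega>"], of "norm (grad f 0) + B"] F.B_nonneg by simp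
    then have "\<bar>?p \<bullet> ?g\<bar> \<le> ((1 + U x) * (1 + norm (Z \<omega>))) * ((norm (grad f 0) + B) * ((1 + U x) * (1 + norm (Z \<omega>))))"
      using U_nonneg[of x] F.B_nonneg by (intro order_trans[OF Cauchy_Schwarz_ineq2] mult_mono path_derivative_le) auto
    then have "\<bar>r (nrm (ix n K) x)\<bar> * \<bar>?p \<bullet> ?g\<bar> \<le> \<bar>r (nrm (ix n K) x)\<bar> * (((1 + U x) * (1 + norm (Z \<omega>))) * ((norm (grad f 0) + B) * ((1 + U x) * (1 + norm (Z \<omega>)))))"
      by (intro mult_left_mono) auto
    then show ?thesis unfolding y by (simp add: abs_mult power2_eq_square mult_ac)
  qed
qed

lemma grad_measurable [measurable]: "(\<lambda>y. grad f (path t (fst y) (Z (snd y))) \<bullet> b i) \<in> borel_measurable (\<mu> \<Otimes>\<^sub>M N)"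
  "(\<lambda>y. hess f (path t (fst y) (Z (snd y))) (b e) \<bullet> b i) \<in> borel_measurable (\<mu> \<Otimes>\<^sub>M N)"
  by measurable

lemma dPhi_terms:
  assumes r: "pb (\<lambda>x. r (nrm (ix n K) x) :: real)"
  shows "dPhi r t = (\<Sum>i\<in>I. cos t * (\<integral>y. (r (nrm (ix n K) (fst y)) * wt i (fst y)) * (grad f (path t (fst y) (Z (snd y))) \<bullet> b i) \<partial>(\<mu> \<Otimes>\<^sub>M N))
     - sin t * (\<integral>y. (r (nrm (ix n K) (fst y)) * sr n K (fst y) ^ q i) * ((Z (snd y) \<bullet> b i) * (grad f (path t (fst y) (Z (snd y))) \<bullet> b i)) \<partial>(\<mu> \<Otimes>\<^sub>M N)))"
proof -
  let ?r = "\<lambda>y. r (nrm (ix n K) (fst y))"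
  let ?G = "\<lambda>i y. grad f (path t (fst y) (Z (snd y))) \<bullet> b i"
  have i1: "integrable (\<mu> \<Otimes>\<^sub>M N) (\<lambda>y. (?r y * wt i (fst y)) * ?G i y)" if "i \<in> I" for i
    using pgb_integrable[OF pgb_grad[OF that pb_mult[OF r pb_wt[of i]], where a = "\<lambda>_. 1" and t = t]] by simp
  have i2: "integrable (\<mu> \<Otimes>\<^sub>M N) (\<lambda>y. (?r y * sr n K (fst y) ^ q i) * ((Z (snd y) \<bullet> b i) * ?G i y))" if i: "i \<in> I" for i
  proof (rule pgb_integrable[OF pgb_grad[OF i pb_mult[OF r pb_power[OF pb_sr]]]])
    show "\<bar>Z \<omega> \<bullet> b i\<bar> \<le> 1 + norm (Z \<omega>)" for \<omega>
      using Basis_le_norm[OF b_Basis[OF i], of "Z \<omega>"] by simp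
  qed measurable
  have e: "?r y * ((cos t *\<^sub>R Wt (fst y) - sin t *\<^sub>R DZ (fst y) (Z (snd y))) \<bullet> grad f (path t (fst y) (Z (snd y))))
      = (\<Sum>i\<in>I. cos t * ((?r y * wt i (fst y)) * ?G i y) - sin t * ((?r y * sr n K (fst y) ^ q i) * ((Z (snd y) \<bullet> b i) * ?G i y)))" for y
  proof -
    have "(cos t *\<^sub>R Wt (fst y) - sin t *\<^sub>R DZ (fst y) (Z (snd y))) \<bullet> grad f (path t (fst y) (Z (snd y)))
        = (\<Sum>i\<in>I. cos t * (wt i (fst y) * ?G i y) - sin t * ((sr n K (fst y) ^ q i * (Z (snd y) \<bullet> b i)) * ?G i y))"
      unfolding Wt_def DZ_def inner_diff_left inner_scaleR_left inner_sum_left sum_distrib_left sum_subtractf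
      by (simp add: inner_commute)
    then show ?thesis by (simp add: sum_distrib_left right_diff_distrib mult_ac)
  qed
  show ?thesis
    unfolding dPhi_def e
    using i1 i2 by (subst Bochner_Integration.integral_sum) (auto intro!: sum.cong)
qed

lemma integral_wt:
  assumes r: "pb (\<lambda>x. r (nrm (ix n K) x) :: real)" and i: "i \<in> I"
  shows "(\<integral>y. (r (nrm (ix n K) (fst y)) * wt i (fst y)) * (grad f (path t (fst y) (Z (snd y))) \<bullet> b i) \<partial>(\<mu> \<Otimes>\<^sub>M N))
    = (\<integral>y. (r (nrm (ix n K) (fst y)) * kerR K n (q i) (l i) (fst y)) * (grad f (path t (fst y) (Z (snd y))) \<bullet> b i) \<partial>(\<mu> \<Otimes>\<^sub>M N))
     + sin t * (\<Sum>e\<in>I. \<integral>y. (r (nrm (ix n K) (fst y)) * kerA K n (q i) (l i) (q e) (l e) (fst y))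
         * (hess f (path t (fst y) (Z (snd y))) (b e) \<bullet> b i) \<partial>(\<mu> \<Otimes>\<^sub>M N))"
proof -
  let ?r = "\<lambda>x. r (nrm (ix n K) x)"
  let ?G = "\<lambda>x \<omega>. grad f (path t x (Z \<omega>)) \<bullet> b i"
  let ?H = "\<lambda>e x \<omega>. hess f (path t x (Z \<omega>)) (b e) \<bullet> b i"
  have i1: "integrable (\<mu> \<Otimes>\<^sub>M N) (\<lambda>(x, \<omega>). ?r x * (wt i x * ?G x \<omega>))"
    using pgb_integrable[OF pgb_grad[OF i pb_mult[OF r pb_wt[of i]], where a = "\<lambda>_. 1" and t = t]] by (simp add: case_prod_beta' mult.assoc)
  have i2: "integrable (\<mu> \<Otimes>\<^sub>M N) (\<lambda>y. (?r (fst y) * kerR K n (q i) (l i) (fst y)) * ?G (fst y) (snd y))"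
    using pgb_integrable[OF pgb_grad[OF i pb_mult[OF r pb_kerR], where a = "\<lambda>_. 1" and t = t]] by simp
  have i3: "integrable (\<mu> \<Otimes>\<^sub>M N) (\<lambda>y. (?r (fst y) * kerA K n (q i) (l i) (q e) (l e) (fst y)) * ?H e (fst y) (snd y))" if "e \<in> I" for e
    using hess_path_le[OF i that] by (intro pgb_integrable pgb_bounded[where E = B] pb_mult r pb_kerA) auto
  have eq: "?r x * (kerR K n (q i) (l i) x * ?G x \<omega> + (\<Sum>e\<in>I. kerA K n (q i) (l i) (q e) (l e) x * (sin t * ?H e x \<omega>)))
     = (?r x * kerR K n (q i) (l i) x) * ?G x \<omega> + sin t * (\<Sum>e\<in>I. (?r x * kerA K n (q i) (l i) (q e) (l e) x) * ?H e x \<omega>)" for x \<omega>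
    by (simp add: distrib_left sum_distrib_left mult_ac)
  have i4: "integrable (\<mu> \<Otimes>\<^sub>M N) (\<lambda>(x, \<omega>). ?r x * (kerR K n (q i) (l i) x * ?G x \<omega> + (\<Sum>e\<in>I. kerA K n (q i) (l i) (q e) (l e) x * (sin t * ?H e x \<omega>))))"
    unfolding eq case_prod_beta' using i2 i3 by simp
  have "(\<integral>y. (?r (fst y) * wt i (fst y)) * ?G (fst y) (snd y) \<partial>(\<mu> \<Otimes>\<^sub>M N))
      = (\<integral>\<omega>. (\<integral>x. ?r x * (wt i x * ?G x \<omega>) \<partial>\<mu>) \<partial>N)"
    using P.integral_snd[OF i1] by (simp add: case_prod_beta' mult.assoc)
  also have "\<dots> = (\<integral>\<omega>. (\<integral>x. ?r x * (kerR K n (q i) (l i) x * ?G x \<omega> + (\<Sum>e\<in>I. kerA K n (q i) (l i) (q e) (l e) x * (sin t * ?H e x \<omega>))) \<partial>\<mu>) \<partial>N)"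
    unfolding stein_x[OF r i] ..
  also have "\<dots> = (\<integral>(x, \<omega>). ?r x * (kerR K n (q i) (l i) x * ?G x \<omega> + (\<Sum>e\<in>I. kerA K n (q i) (l i) (q e) (l e) x * (sin t * ?H e x \<omega>))) \<partial>(\<mu> \<Otimes>\<^sub>M N))"
    by (rule P.integral_snd[OF i4])
  also have "\<dots> = (\<integral>y. (?r (fst y) * kerR K n (q i) (l i) (fst y)) * ?G (fst y) (snd y)
      + sin t * (\<Sum>e\<in>I. (?r (fst y) * kerA K n (q i) (l i) (q e) (l e) (fst y)) * ?H e (fst y) (snd y)) \<partial>(\<mu> \<Otimes>\<^sub>M N))"
    unfolding eq case_prod_beta' ..
  also have "\<dots> = (\<integral>y. (?r (fst y) * kerR K n (q i) (l i) (fst y)) * ?G (fst y) (snd y) \<partial>(\<mu> \<Otimes>\<^sub>M N))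
      + sin t * (\<Sum>e\<in>I. \<integral>y. (?r (fst y) * kerA K n (q i) (l i) (q e) (l e) (fst y)) * ?H e (fst y) (snd y) \<partial>(\<mu> \<Otimes>\<^sub>M N))"
    using i2 i3 by (subst Bochner_Integration.integral_add) (auto simp: Bochner_Integration.integral_sum)
  finally show ?thesis .
qed

lemma integral_z:
  assumes r: "pb (\<lambda>x. r (nrm (ix n K) x) :: real)" and i: "i \<in> I"
  shows "(\<integral>y. (r (nrm (ix n K) (fst y)) * sr n K (fst y) ^ q i) * ((Z (snd y) \<bullet> b i) * (grad f (path t (fst y) (Z (snd y))) \<bullet> b i)) \<partial>(\<mu> \<Otimes>\<^sub>M N))
    = cos t * (\<integral>y. (r (nrm (ix n K) (fst y)) * (real (q i) / real (card K) * sr n K (fst y) ^ (2 * q i)))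
         * (hess f (path t (fst y) (Z (snd y))) (b i) \<bullet> b i) \<partial>(\<mu> \<Otimes>\<^sub>M N))"
proof -
  let ?r = "\<lambda>x. r (nrm (ix n K) x)"
  let ?G = "\<lambda>x \<omega>. grad f (path t x (Z \<omega>)) \<bullet> b i"
  let ?H = "\<lambda>x \<omega>. hess f (path t x (Z \<omega>)) (b i) \<bullet> b i"
  let ?s = "\<lambda>x. sr n K x ^ q i"
  have i1: "integrable (\<mu> \<Otimes>\<^sub>M N) (\<lambda>(x, \<omega>). (?r x * ?s x) * ((Z \<omega> \<bullet> b i) * ?G x \<omega>))"
    unfolding case_prod_beta'
  proof (rule pgb_integrable[OF pgb_grad[OF i pb_mult[OF r pb_power[OF pb_sr]]]])
    show "\<bar>Z \<omega> \<bullet> b i\<bar> \<le> 1 + norm (Z \<omega>)" for \<omega>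
      using Basis_le_norm[OF b_Basis[OF i], of "Z \<omega>"] by simp
  qed measurable
  have i2: "integrable (\<mu> \<Otimes>\<^sub>M N) (\<lambda>y. (?r (fst y) * (real (q i) / real (card K) * sr n K (fst y) ^ (2 * q i))) * ?H (fst y) (snd y))"
    using hess_path_le[OF i i] by (intro pgb_integrable pgb_bounded[where E = B] pb_mult r pb_power pb_sr pb_const) auto
  have eq: "(?r x * ?s x) * (real (q i) / real (card K) * (cos t * ?s x * ?H x \<omega>))
      = cos t * ((?r x * (real (q i) / real (card K) * sr n K x ^ (2 * q i))) * ?H x \<omega>)" for x \<omega>
  proof -
    have "sr n K x ^ (2 * q i) = ?s x * ?s x" by (simp add: mult_2 power_add)
    then show ?thesis by (simp only: mult_ac)
  qed
  have i3: "integrable (\<mu> \<Otimes>\<^sub>M N) (\<lambda>(x, \<omega>). (?r x * ?s x) * (real (q i) / real (card K) * (cos t * ?s x * ?H x \<omega>)))"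
    unfolding eq case_prod_beta' by (rule integrable_mult_right) (rule i2)
  have "(\<integral>y. (?r (fst y) * ?s (fst y)) * ((Z (snd y) \<bullet> b i) * ?G (fst y) (snd y)) \<partial>(\<mu> \<Otimes>\<^sub>M N))
      = (\<integral>x. (\<integral>\<omega>. (?r x * ?s x) * ((Z \<omega> \<bullet> b i) * ?G x \<omega>) \<partial>N) \<partial>\<mu>)"
    using P.integral_fst[OF i1] by (simp add: case_prod_beta')
  also have "\<dots> = (\<integral>x. (\<integral>\<omega>. (?r x * ?s x) * (real (q i) / real (card K) * (cos t * ?s x * ?H x \<omega>)) \<partial>N) \<partial>\<mu>)"
    unfolding integral_mult_right_zero[where c = "?r _ * ?s _"] stein_z[OF i] ..
  also have "\<dots> = (\<integral>(x, \<omega>). (?r x * ?s x) * (real (q i) / real (card K) * (cos t * ?s x * ?H x \<omega>)) \<partial>(\<mu> \<Otimes>\<^sub>M N))"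
    by (rule P.integral_fst[OF i3])
  also have "\<dots> = cos t * (\<integral>y. (?r (fst y) * (real (q i) / real (card K) * sr n K (fst y) ^ (2 * q i))) * ?H (fst y) (snd y) \<partial>(\<mu> \<Otimes>\<^sub>M N))"
    unfolding eq case_prod_beta' by (rule integral_mult_right_zero)
  finally show ?thesis .
qed

definition dev :: "'i \<Rightarrow> 'i \<Rightarrow> pt \<Rightarrow> real" where
  "dev i e x = kerA K n (q i) (l i) (q e) (l e) x
     - (if q i = q e \<and> l i = l e then real (q i) / real (card K) * sr n K x ^ (2 * q i) else 0)"

text \<open>The traces contribute cos t times sin t times the kernel, the Gaussian vector sin t
  times cos t times its covariance. The trigonometric path makes these factors equal, so only the
  difference \<open>dev\<close> meets the Hessian.\<close>

lemma dPhi_eq: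
  assumes r: "pb (\<lambda>x. r (nrm (ix n K) x) :: real)"
  shows "dPhi r t = (\<Sum>i\<in>I. cos t * (\<integral>y. (r (nrm (ix n K) (fst y)) * kerR K n (q i) (l i) (fst y)) * (grad f (path t (fst y) (Z (snd y))) \<bullet> b i) \<partial>(\<mu> \<Otimes>\<^sub>M N))
    + sin t * cos t * (\<Sum>e\<in>I. \<integral>y. (r (nrm (ix n K) (fst y)) * dev i e (fst y)) * (hess f (path t (fst y) (Z (snd y))) (b e) \<bullet> b i) \<partial>(\<mu> \<Otimes>\<^sub>M N)))"
  unfolding dPhi_terms[OF r]
proof (intro sum.cong refl)
  fix i assume i: "i \<in> I"
  let ?r = "\<lambda>x. r (nrm (ix n K) x)"
  let ?H = "\<lambda>e y. hess f (path t (fst y) (Z (snd y))) (b e) \<bullet> b i"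
  define IA where "IA e = (\<integral>y. (?r (fst y) * kerA K n (q i) (l i) (q e) (l e) (fst y)) * ?H e y \<partial>(\<mu> \<Otimes>\<^sub>M N))" for e
  define IS where "IS = (\<integral>y. (?r (fst y) * (real (q i) / real (card K) * sr n K (fst y) ^ (2 * q i))) * ?H i y \<partial>(\<mu> \<Otimes>\<^sub>M N))"
  have i1: "integrable (\<mu> \<Otimes>\<^sub>M N) (\<lambda>y. (?r (fst y) * kerA K n (q i) (l i) (q e) (l e) (fst y)) * ?H e y)" if "e \<in> I" for e
    using hess_path_le[OF i that] by (intro pgb_integrable pgb_bounded[where E = B] pb_mult r pb_kerA) auto
  have i2: "integrable (\<mu> \<Otimes>\<^sub>M N) (\<lambda>y. (?r (fst y) * (real (q i) / real (card K) * sr n K (fst y) ^ (2 * q i))) * ?H i y)"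
    using hess_path_le[OF i i] by (intro pgb_integrable pgb_bounded[where E = B] pb_mult r pb_power pb_sr pb_const) auto
  have d: "(\<integral>y. (?r (fst y) * dev i e (fst y)) * ?H e y \<partial>(\<mu> \<Otimes>\<^sub>M N)) = IA e - (if e = i then IS else 0)" if e: "e \<in> I" for e
  proof (cases "e = i")
    case True
    then show ?thesis
      using Bochner_Integration.integral_diff[OF i1[OF i] i2]
      unfolding IA_def IS_def dev_def by (simp add: algebra_simps)
  next
    case False
    then have "\<not> (q i = q e \<and> l i = l e)" using q_l_inj[OF i e] by auto
    then show ?thesis using False unfolding IA_def dev_def by (simp only: if_False diff_zero)
  qed
  have "(\<Sum>e\<in>I. \<integral>y. (?r (fst y) * dev i e (fst y)) * ?H e y \<partial>(\<mu> \<Otimes>\<^sub>M N)) = (\<Sum>e\<in>I. IA e) - IS"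
    using i G.finI by (simp add: d sum_subtractf)
  note eqS = this
  show "cos t * (\<integral>y. (?r (fst y) * wt i (fst y)) * (grad f (path t (fst y) (Z (snd y))) \<bullet> b i) \<partial>(\<mu> \<Otimes>\<^sub>M N))
     - sin t * (\<integral>y. (?r (fst y) * sr n K (fst y) ^ q i) * ((Z (snd y) \<bullet> b i) * (grad f (path t (fst y) (Z (snd y))) \<bullet> b i)) \<partial>(\<mu> \<Otimes>\<^sub>M N))
    = cos t * (\<integral>y. (?r (fst y) * kerR K n (q i) (l i) (fst y)) * (grad f (path t (fst y) (Z (snd y))) \<bullet> b i) \<partial>(\<mu> \<Otimes>\<^sub>M N))
    + sin t * cos t * (\<Sum>e\<in>I. \<integral>y. (?r (fst y) * dev i e (fst y)) * ?H e y \<partial>(\<mu> \<Otimes>\<^sub>M N))"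
    unfolding integral_wt[OF r i] integral_z[OF r i] IA_def[symmetric] IS_def[symmetric] eqS by (simp add: algebra_simps)
qed

lemma pb_dev: "pb (dev i e)"
proof (cases "q i = q e \<and> l i = l e")
  case True
  show ?thesis unfolding dev_def[abs_def] if_P[OF True] by (intro pb_diff pb_mult pb_power pb_sr pb_kerA pb_const)
next
  case False
  show ?thesis unfolding dev_def[abs_def] if_not_P[OF False] by (intro pb_diff pb_kerA pb_const)
qed

text \<open>The derivative along the path is bounded by the kernel errors times the Hessian bound,
  plus \<open>kerR\<close> times the gradient bound. In the complex case the latter term vanishes
  and \<open>B1\<close> is a free nonnegative number.\<close>

theorem interpolation_bound:
  assumes r: "pb (\<lambda>x. r (nrm (ix n K) x) :: real)" "\<And>y. 0 \<le> r y"
    and B1: "0 \<le> B1" "K = UNIV \<or> (\<forall>y. norm (grad f y) \<le> B1)"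
    and R: "\<And>i. i \<in> I \<Longrightarrow> K \<noteq> UNIV \<Longrightarrow> (\<integral>x. r (nrm (ix n K) x) * \<bar>kerR K n (q i) (l i) x\<bar> \<partial>\<mu>) \<le> \<epsilon>"
    and A: "\<And>i e. i \<in> I \<Longrightarrow> e \<in> I \<Longrightarrow> (\<integral>x. r (nrm (ix n K) x) * \<bar>dev i e x\<bar> \<partial>\<mu>) \<le> \<epsilon>"
    and \<epsilon>: "0 \<le> \<epsilon>"
  shows "\<bar>(\<integral>x. r (nrm (ix n K) x) * f (W x - tv) \<partial>\<mu>)
     - (\<integral>y. r (nrm (ix n K) (fst y)) * f (DZ (fst y) (Z (snd y)) + bv (fst y)) \<partial>(\<mu> \<Otimes>\<^sub>M N))\<bar>
    \<le> 2 * (real (card I) * (B1 * \<epsilon> + real (card I) * (B * \<epsilon>)))"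
proof -
  let ?r = "\<lambda>x. r (nrm (ix n K) x)"
  have D: "\<bar>dPhi r t\<bar> \<le> real (card I) * (B1 * \<epsilon> + real (card I) * (B * \<epsilon>))" for t
  proof -
    have s1: "\<bar>\<integral>y. (?r (fst y) * kerR K n (q i) (l i) (fst y)) * (grad f (path t (fst y) (Z (snd y))) \<bullet> b i) \<partial>(\<mu> \<Otimes>\<^sub>M N)\<bar> \<le> B1 * \<epsilon>"
      if i: "i \<in> I" for i
    proof (cases "K = UNIV")
      case True
      then show ?thesis using B1 \<epsilon> by (simp add: kerR_complex)
    next
      case False
      have "\<bar>grad f y \<bullet> b i\<bar> \<le> B1" for y
        using B1(2) False Basis_le_norm[OF b_Basis[OF i]] order_trans by blast
      then have "\<bar>\<integral>y. (?r (fst y) * kerR K n (q i) (l i) (fst y)) * (grad f (path t (fst y) (Z (snd y))) \<bullet> b i) \<partial>(\<mu> \<Otimes>\<^sub>M N)\<bar>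
          \<le> B1 * (\<integral>x. \<bar>?r x * kerR K n (q i) (l i) x\<bar> \<partial>\<mu>)"
        by (intro integral_bounded_factor pb_mult r pb_kerR) auto
      also have "\<dots> \<le> B1 * \<epsilon>"
        using R[OF i False] r(2) by (intro mult_left_mono B1) (simp add: abs_mult)
      finally show ?thesis .
    qed
    have s2: "\<bar>\<integral>y. (?r (fst y) * dev i e (fst y)) * (hess f (path t (fst y) (Z (snd y))) (b e) \<bullet> b i) \<partial>(\<mu> \<Otimes>\<^sub>M N)\<bar> \<le> B * \<epsilon>"
      if "i \<in> I" "e \<in> I" for i e
    proof -
      have "\<bar>\<integral>y. (?r (fst y) * dev i e (fst y)) * (hess f (path t (fst y) (Z (snd y))) (b e) \<bullet> b i) \<partial>(\<mu> \<Otimes>\<^sub>M N)\<bar>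
          \<le> B * (\<integral>x. \<bar>?r x * dev i e x\<bar> \<partial>\<mu>)"
        using hess_path_le[OF that] by (intro integral_bounded_factor pb_mult r pb_dev) auto
      also have "\<dots> \<le> B * \<epsilon>"
        using A[OF that] r(2) by (intro mult_left_mono F.B_nonneg) (simp add: abs_mult)
      finally show ?thesis .
    qed
    have "\<bar>dPhi r t\<bar> \<le> (\<Sum>i\<in>I. B1 * \<epsilon> + real (card I) * (B * \<epsilon>))"
      unfolding dPhi_eq[OF r(1)]
    proof (rule order_trans[OF sum_abs], intro sum_mono)
      fix i assume i: "i \<in> I"
      have c: "\<bar>cos t * a\<bar> \<le> \<bar>a\<bar>" "\<bar>sin t * cos t * a\<bar> \<le> \<bar>a\<bar>" for a
        using mult_mono[OF abs_sin_le_one[of t] abs_cos_le_one[of t]]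
        by (auto simp: abs_mult intro: mult_left_le_one_le)
      have "\<bar>\<Sum>e\<in>I. \<integral>y. (?r (fst y) * dev i e (fst y)) * (hess f (path t (fst y) (Z (snd y))) (b e) \<bullet> b i) \<partial>(\<mu> \<Otimes>\<^sub>M N)\<bar>
          \<le> (\<Sum>e\<in>I. B * \<epsilon>)"
        by (rule order_trans[OF sum_abs], intro sum_mono s2 i)
      then show "\<bar>cos t * (\<integral>y. (?r (fst y) * kerR K n (q i) (l i) (fst y)) * (grad f (path t (fst y) (Z (snd y))) \<bullet> b i) \<partial>(\<mu> \<Otimes>\<^sub>M N))
        + sin t * cos t * (\<Sum>e\<in>I. \<integral>y. (?r (fst y) * dev i e (fst y)) * (hess f (path t (fst y) (Z (snd y))) (b e) \<bullet> b i) \<partial>(\<mu> \<Otimes>\<^sub>M N))\<bar>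
        \<le> B1 * \<epsilon> + real (card I) * (B * \<epsilon>)"
        by (intro order_trans[OF abs_triangle_ineq] add_mono order_trans[OF c(1) s1[OF i]] order_trans[OF c(2)]) simp
    qed
    then show ?thesis by simp
  qed
  let ?C = "real (card I) * (B1 * \<epsilon> + real (card I) * (B * \<epsilon>))"
  have C: "0 \<le> ?C" using D[of 0] by linarith
  have "norm (Phi r (pi / 2) - Phi r 0) \<le> ?C * norm (pi / 2 - 0)"
  proof (rule differentiable_bound[where S = UNIV and f' = "\<lambda>t u. u *\<^sub>R dPhi r t"])
    show "(Phi r has_derivative (\<lambda>u. u *\<^sub>R dPhi r t)) (at t within UNIV)" for t
      using Phi_derivative[OF r(1), of t] by (simp add: has_vector_derivative_def)
    show "onorm (\<lambda>u. u *\<^sub>R dPhi r t) \<le> ?C" for t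
    proof (rule onorm_bound[OF C])
      show "norm (u *\<^sub>R dPhi r t) \<le> ?C * norm u" for u :: real
      proof -
        have "norm (u *\<^sub>R dPhi r t) = \<bar>dPhi r t\<bar> * \<bar>u\<bar>" by (simp add: abs_mult)
        also have "\<dots> \<le> ?C * \<bar>u\<bar>" by (rule mult_right_mono[OF D]) simp
        finally show ?thesis by simp
      qed
    qed
  qed auto
  \<comment> \<open>The path has parameter length pi / 2 < 2.\<close>
  also have "\<dots> \<le> ?C * 2"
    using C pi_half_less_two by (intro mult_left_mono) auto
  finally have "\<bar>Phi r (pi / 2) - Phi r 0\<bar> \<le> 2 * ?C" by simp
  moreover have "Phi r (pi / 2) = (\<integral>x. ?r x * f (W x - tv) \<partial>\<mu>)"
  proof -
    have i: "integrable (\<mu> \<Otimes>\<^sub>M N) (\<lambda>y. ?r (fst y) * f (W (fst y) - tv))"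
      using pgb_integrable[OF pgb_f_path[OF r(1), of "pi / 2"]] by (simp add: path_end)
    have "Phi r (pi / 2) = (\<integral>y. ?r (fst y) * f (W (fst y) - tv) \<partial>(\<mu> \<Otimes>\<^sub>M N))"
      by (simp add: Phi_def path_end)
    also have "\<dots> = (\<integral>x. \<integral>\<omega>. ?r x * f (W x - tv) \<partial>N \<partial>\<mu>)"
      using P.integral_fst'[OF i, symmetric] by (simp only: fst_conv)
    finally show ?thesis by (simp add: G.prob_space)
  qed
  moreover have "Phi r 0 = (\<integral>y. ?r (fst y) * f (DZ (fst y) (Z (snd y)) + bv (fst y)) \<partial>(\<mu> \<Otimes>\<^sub>M N))"
    by (simp add: Phi_def path_start)
  ultimately show ?thesis by simp
qed

end

context gauss_vec
begin

lemma inner_second_moment: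
  assumes i: "i \<in> I"
  shows "(\<integral>\<omega>. (Z \<omega> \<bullet> b i)\<^sup>2 \<partial>N) = (c i * s i)\<^sup>2"
proof -
  have "(\<integral>\<omega>. (Z \<omega> \<bullet> b i) * (Z \<omega> \<bullet> b i) \<partial>N) = (c i * s i)\<^sup>2 * (\<integral>\<omega>. (b i \<bullet> b i) \<partial>N)"
  proof (rule gaussian_ibp[OF i, where g' = "\<lambda>z h. h \<bullet> b i"])
    show "((\<lambda>z. z \<bullet> b i) has_derivative (\<lambda>h. h \<bullet> b i)) (at z)" for z
      by (auto intro!: derivative_eq_intros)
    have "b i \<in> Basis" using i b_image by blast
    from Basis_le_norm[OF this] show "\<bar>h \<bullet> b i\<bar> \<le> 1 * norm h" for h by simp
  qed simp
  then show ?thesis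
    using i by (simp add: b_inner prob_space power2_eq_square)
qed

lemma inner_square_integrable: "i \<in> I \<Longrightarrow> integrable N (\<lambda>\<omega>. (Z \<omega> \<bullet> b i)\<^sup>2)"
  using X_square_integrable[of i] by (simp add: Z_inner power_mult_distrib)

end

context smart_path
begin

lemma product_integral:
  assumes k: "pb k" and m: "g \<in> borel_measurable N" and g: "\<And>\<omega>. \<bar>g \<omega>\<bar> \<le> A * (1 + norm (Z \<omega>))\<^sup>2"
  shows "integrable (\<mu> \<Otimes>\<^sub>M N) (\<lambda>y. k (fst y) * g (snd y) :: real)"
    "(\<integral>y. k (fst y) * g (snd y) \<partial>(\<mu> \<Otimes>\<^sub>M N)) = (\<integral>x. k x \<partial>\<mu>) * (\<integral>\<omega>. g \<omega> \<partial>N)"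
proof -
  have [measurable]: "k \<in> borel_measurable \<mu>" using k by (rule pb_measurable)
  note m [measurable]
  show i: "integrable (\<mu> \<Otimes>\<^sub>M N) (\<lambda>y. k (fst y) * g (snd y))"
  proof (rule pgb_integrable, rule pgbI[where u = "\<lambda>x. \<bar>k x\<bar> * A"])
    show "pb (\<lambda>x. \<bar>k x\<bar> * A)" using pb_norm[OF k] by auto
    show "\<bar>k (fst (x, \<omega>)) * g (snd (x, \<omega>))\<bar> \<le> \<bar>k x\<bar> * A * (1 + norm (Z \<omega>))\<^sup>2" for x \<omega>
      using mult_left_mono[OF g[of \<omega>], of "\<bar>k x\<bar>"] by (simp add: abs_mult mult.assoc)
  qed measurable
  have "(\<integral>y. k (fst y) * g (snd y) \<partial>(\<mu> \<Otimes>\<^sub>M N)) = (\<integral>x. \<integral>\<omega>. k x * g \<omega> \<partial>N \<partial>\<mu>)"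
    using P.integral_fst'[OF i, symmetric] by (simp only: fst_conv snd_conv)
  then show "(\<integral>y. k (fst y) * g (snd y) \<partial>(\<mu> \<Otimes>\<^sub>M N)) = (\<integral>x. k x \<partial>\<mu>) * (\<integral>\<omega>. g \<omega> \<partial>N)"
    by simp
qed

lemma Z_expand: "Z \<omega> = (\<Sum>i\<in>I. (Z \<omega> \<bullet> b i) *\<^sub>R b i)"
proof -
  have "(\<Sum>i\<in>I. (Z \<omega> \<bullet> b i) *\<^sub>R b i) = (\<Sum>e\<in>Basis. (Z \<omega> \<bullet> e) *\<^sub>R e)"
    by (rule sum.reindex_bij_betw[OF G.b])
  then show ?thesis by (simp add: euclidean_representation)
qed

lemma Z_variance: "i \<in> I \<Longrightarrow> (\<integral>\<omega>. (Z \<omega> \<bullet> b i)\<^sup>2 \<partial>N) = real (q i) / real (card K)"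
  by (simp add: G.inner_second_moment variance)

lemma card_K: "1 \<le> real (card K)"
  using K by auto

lemma Z_variance_le: "i \<in> I \<Longrightarrow> (\<integral>\<omega>. (Z \<omega> \<bullet> b i)\<^sup>2 \<partial>N) \<le> real (q i)"
  using card_K frac_le[of "real (q i)" "real (q i)" 1 "real (card K)"] by (simp add: Z_variance)

lemma tau_range: "0 \<le> tau K p" "tau K p \<le> 1" "K = UNIV \<Longrightarrow> tau K p = 0"
proof -
  have "(UNIV :: bool set) \<noteq> {True}" by blast
  then show "K = UNIV \<Longrightarrow> tau K p = 0" by (simp add: tau_def)
qed (auto simp: tau_def)

lemma norm_square_Basis: "(norm (\<Sum>i\<in>I. a i *\<^sub>R b i))\<^sup>2 = (\<Sum>i\<in>I. (a i)\<^sup>2)"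
proof -
  let ?v = "\<Sum>i\<in>I. a i *\<^sub>R b i"
  have inn: "?v \<bullet> b i = a i" if "i \<in> I" for i
  proof -
    have "?v \<bullet> b i = (\<Sum>j\<in>I. if j = i then a i else 0)"
      unfolding inner_sum_left using that by (intro sum.cong refl) (auto simp: G.b_inner)
    then show ?thesis using that G.finI by simp
  qed
  have "(norm ?v)\<^sup>2 = (\<Sum>e\<in>Basis. (?v \<bullet> e)\<^sup>2)"
    unfolding power2_norm_eq_inner by (subst euclidean_inner) (simp add: power2_eq_square)
  also have "\<dots> = (\<Sum>i\<in>I. (?v \<bullet> b i)\<^sup>2)"
    by (rule sum.reindex_bij_betw[OF G.b, symmetric])
  finally show ?thesis using inn by simp
qed

text \<open>
  The radial part of the distribution enters only here: it is independent of the Gaussian vector, and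
  a first order term with mean \<open>O(1/n)\<close> and a quadratic remainder are left.
\<close>

lemma radial_comparison:
  assumes r: "pb (\<lambda>x. r (nrm (ix n K) x) :: real)" "\<And>y. 0 \<le> r y"
    and B1: "0 \<le> B1" "K = UNIV \<or> (\<forall>y. norm (grad f y) \<le> B1)"
    and m: "\<And>i. i \<in> I \<Longrightarrow> q i \<le> m"
    and M1: "\<And>i. i \<in> I \<Longrightarrow> \<bar>\<integral>x. r (nrm (ix n K) x) * (sr n K x ^ q i - 1) \<partial>\<mu>\<bar> \<le> \<eta>"
    and M2: "\<And>i. i \<in> I \<Longrightarrow> (\<integral>x. r (nrm (ix n K) x) * (sr n K x ^ q i - 1)\<^sup>2 \<partial>\<mu>) \<le> \<eta>"
  shows "\<bar>(\<integral>y. r (nrm (ix n K) (fst y)) * f (DZ (fst y) (Z (snd y)) + bv (fst y)) \<partial>(\<mu> \<Otimes>\<^sub>M N))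
      - (\<integral>x. r (nrm (ix n K) x) \<partial>\<mu>) * (\<integral>\<omega>. f (Z \<omega>) \<partial>N)\<bar>
    \<le> real (card I) * (\<eta> * (real m * B + B1) + 2 * B * \<eta> * (real m + 1))"
proof -
  let ?r = "\<lambda>x. r (nrm (ix n K) x)"
  define v where "v i x = sr n K x ^ q i - 1" for i x
  define g1 where "g1 i \<omega> = (Z \<omega> \<bullet> b i + tau K (q i)) * (grad f (Z \<omega>) \<bullet> b i)" for i \<omega>
  define g2 where "g2 i \<omega> = 2 * B * ((Z \<omega> \<bullet> b i)\<^sup>2 + 1)" for i \<omega>
  have pv: "pb (v i)" for i unfolding v_def[abs_def] by (intro pb_diff pb_power pb_sr pb_const)
  have Zb: "\<bar>Z \<omega> \<bullet> b i\<bar> \<le> norm (Z \<omega>)" if "i \<in> I" for i \<omega>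
    using Basis_le_norm[OF b_Basis[OF that]] .
  \<comment> \<open>The increment in the Taylor expansion at \<open>Z \<omega>\<close> is linear in
    the radial deviations \<open>v i\<close>, with Gaussian coefficients.\<close>
  have h: "DZ x (Z \<omega>) + bv x = Z \<omega> + (\<Sum>i\<in>I. (v i x * (Z \<omega> \<bullet> b i + tau K (q i))) *\<^sub>R b i)" for x \<omega>
  proof -
    have "(\<Sum>i\<in>I. (Z \<omega> \<bullet> b i) *\<^sub>R b i) + (\<Sum>i\<in>I. (v i x * (Z \<omega> \<bullet> b i + tau K (q i))) *\<^sub>R b i) = DZ x (Z \<omega>) + bv x"
      unfolding DZ_def bv_def sum.distrib[symmetric] scaleR_add_left[symmetric]
      by (intro sum.cong refl) (simp add: v_def algebra_simps)
    then show ?thesis unfolding Z_expand[of \<omega>, symmetric] by simp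
  qed
  have g1m: "g1 i \<in> borel_measurable N" and g2m: "g2 i \<in> borel_measurable N" for i
    unfolding g1_def[abs_def] g2_def[abs_def] by measurable
  have g1b: "\<bar>g1 i \<omega>\<bar> \<le> (norm (grad f 0) + B) * (1 + norm (Z \<omega>))\<^sup>2" if i: "i \<in> I" for i \<omega>
  proof -
    have "\<bar>g1 i \<omega>\<bar> \<le> (1 + norm (Z \<omega>)) * ((norm (grad f 0) + B) * (1 + norm (Z \<omega>)))"
      unfolding g1_def abs_mult
    proof (intro mult_mono)
      show "\<bar>Z \<omega> \<bullet> b i + tau K (q i)\<bar> \<le> 1 + norm (Z \<omega>)"
        using Zb[OF i, of \<omega>] tau_range[of "q i"] by linarith
      show "\<bar>grad f (Z \<omega>) \<bullet> b i\<bar> \<le> (norm (grad f 0) + B) * (1 + norm (Z \<omega>))"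
        using Basis_le_norm[OF b_Basis[OF i], of "grad f (Z \<omega>)"] F.grad_le[of "Z \<omega>"] by linarith
    qed auto
    then show ?thesis by (simp add: power2_eq_square mult_ac)
  qed
  have g2b: "\<bar>g2 i \<omega>\<bar> \<le> (2 * B) * (1 + norm (Z \<omega>))\<^sup>2" if i: "i \<in> I" for i \<omega>
  proof -
    have "(Z \<omega> \<bullet> b i)\<^sup>2 \<le> (norm (Z \<omega>))\<^sup>2" using power_mono[OF Zb[OF i, of \<omega>] abs_ge_zero, of 2] by simp
    moreover have "(1 + norm (Z \<omega>))\<^sup>2 = 1 + 2 * norm (Z \<omega>) + (norm (Z \<omega>))\<^sup>2" by (simp add: power2_sum)
    ultimately have "(Z \<omega> \<bullet> b i)\<^sup>2 + 1 \<le> (1 + norm (Z \<omega>))\<^sup>2" using norm_ge_zero[of "Z \<omega>"] by linarith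
    then show ?thesis using F.B_nonneg mult_left_mono[of "(Z \<omega> \<bullet> b i)\<^sup>2 + 1" "(1 + norm (Z \<omega>))\<^sup>2" "2 * B"]
      by (simp add: g2_def)
  qed
  have fb: "\<bar>f (Z \<omega>)\<bar> \<le> (\<bar>f 0\<bar> + norm (grad f 0) + B) * (1 + norm (Z \<omega>))\<^sup>2" for \<omega>
    by (rule F.f_le)
  have i0: "integrable (\<mu> \<Otimes>\<^sub>M N) (\<lambda>y. ?r (fst y) * f (DZ (fst y) (Z (snd y)) + bv (fst y)))"
    using pgb_integrable[OF pgb_f_path[OF r(1), of 0]] by (simp add: path_start)
  note pf = product_integral[OF r(1) _ fb]
  have fm: "(\<lambda>\<omega>. f (Z \<omega>)) \<in> borel_measurable N" by measurable
  note p1 = product_integral[OF pb_mult[OF r(1) pv] g1m g1b]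
  note p2 = product_integral[OF pb_mult[OF r(1) pb_power[OF pv]] g2m g2b]
  have pointwise: "\<bar>?r x * f (DZ x (Z \<omega>) + bv x) - ?r x * f (Z \<omega>) - (\<Sum>i\<in>I. (?r x * v i x) * g1 i \<omega>)\<bar>
      \<le> (\<Sum>i\<in>I. (?r x * (v i x)\<^sup>2) * g2 i \<omega>)" for x \<omega>
  proof -
    let ?h = "\<Sum>i\<in>I. (v i x * (Z \<omega> \<bullet> b i + tau K (q i))) *\<^sub>R b i"
    have t: "\<bar>f (Z \<omega> + ?h) - f (Z \<omega>) - ?h \<bullet> grad f (Z \<omega>)\<bar> \<le> B * (norm ?h)\<^sup>2"
      by (rule F.taylor)
    have e1: "?h \<bullet> grad f (Z \<omega>) = (\<Sum>i\<in>I. v i x * g1 i \<omega>)"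
      unfolding inner_sum_left g1_def by (intro sum.cong refl) (simp add: inner_commute mult_ac)
    have "B * (norm ?h)\<^sup>2 = (\<Sum>i\<in>I. B * (v i x * (Z \<omega> \<bullet> b i + tau K (q i)))\<^sup>2)"
      unfolding norm_square_Basis sum_distrib_left ..
    also have "\<dots> \<le> (\<Sum>i\<in>I. (v i x)\<^sup>2 * g2 i \<omega>)"
    proof (intro sum_mono)
      fix i assume "i \<in> I"
      have "(tau K (q i))\<^sup>2 \<le> 1" using tau_range[of "q i"] by (simp add: power_le_one)
      then have "(Z \<omega> \<bullet> b i + tau K (q i))\<^sup>2 \<le> 2 * ((Z \<omega> \<bullet> b i)\<^sup>2 + 1)"
        using sum_squares_bound[of "Z \<omega> \<bullet> b i" "tau K (q i)"] by (simp add: power2_sum)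
      then have "(B * (v i x)\<^sup>2) * (Z \<omega> \<bullet> b i + tau K (q i))\<^sup>2 \<le> (B * (v i x)\<^sup>2) * (2 * ((Z \<omega> \<bullet> b i)\<^sup>2 + 1))"
        using F.B_nonneg by (intro mult_left_mono) auto
      then show "B * (v i x * (Z \<omega> \<bullet> b i + tau K (q i)))\<^sup>2 \<le> (v i x)\<^sup>2 * g2 i \<omega>"
        by (simp only: g2_def power_mult_distrib mult_ac)
    qed
    finally have "?r x * \<bar>f (Z \<omega> + ?h) - f (Z \<omega>) - (\<Sum>i\<in>I. v i x * g1 i \<omega>)\<bar> \<le> ?r x * (\<Sum>i\<in>I. (v i x)\<^sup>2 * g2 i \<omega>)"
      using t e1 r(2) by (intro mult_left_mono) auto
    moreover have "?r x * \<bar>f (Z \<omega> + ?h) - f (Z \<omega>) - (\<Sum>i\<in>I. v i x * g1 i \<omega>)\<bar>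
        = \<bar>?r x * f (Z \<omega> + ?h) - ?r x * f (Z \<omega>) - (\<Sum>i\<in>I. (?r x * v i x) * g1 i \<omega>)\<bar>"
    proof -
      have "?r x * f (Z \<omega> + ?h) - ?r x * f (Z \<omega>) - (\<Sum>i\<in>I. (?r x * v i x) * g1 i \<omega>)
          = ?r x * (f (Z \<omega> + ?h) - f (Z \<omega>) - (\<Sum>i\<in>I. v i x * g1 i \<omega>))"
        by (simp add: right_diff_distrib sum_distrib_left mult.assoc)
      then show ?thesis using r(2) by (simp add: abs_mult)
    qed
    ultimately show ?thesis unfolding h by (simp add: sum_distrib_left mult.assoc)
  qed
  have iS1: "integrable (\<mu> \<Otimes>\<^sub>M N) (\<lambda>y. \<Sum>i\<in>I. (?r (fst y) * v i (fst y)) * g1 i (snd y))"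
    using p1(1) by simp
  have iS2: "integrable (\<mu> \<Otimes>\<^sub>M N) (\<lambda>y. \<Sum>i\<in>I. (?r (fst y) * (v i (fst y))\<^sup>2) * g2 i (snd y))"
    using p2(1) by simp
  let ?d = "\<lambda>y. ?r (fst y) * f (DZ (fst y) (Z (snd y)) + bv (fst y)) - ?r (fst y) * f (Z (snd y)) - (\<Sum>i\<in>I. (?r (fst y) * v i (fst y)) * g1 i (snd y))"
  have id: "integrable (\<mu> \<Otimes>\<^sub>M N) ?d"
    by (intro Bochner_Integration.integrable_diff i0 pf(1) fm iS1)
  have "\<bar>\<integral>y. ?d y \<partial>(\<mu> \<Otimes>\<^sub>M N)\<bar> \<le> (\<integral>y. \<bar>?d y\<bar> \<partial>(\<mu> \<Otimes>\<^sub>M N))"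
    by (rule integral_abs_bound)
  also have "\<dots> \<le> (\<integral>y. (\<Sum>i\<in>I. (?r (fst y) * (v i (fst y))\<^sup>2) * g2 i (snd y)) \<partial>(\<mu> \<Otimes>\<^sub>M N))"
    by (rule Bochner_Integration.integral_mono[OF integrable_abs[OF id] iS2]) (rule pointwise)
  also have "\<dots> = (\<Sum>i\<in>I. (\<integral>x. ?r x * (v i x)\<^sup>2 \<partial>\<mu>) * (\<integral>\<omega>. g2 i \<omega> \<partial>N))"
    using p2 by (subst Bochner_Integration.integral_sum) auto
  also have "\<dots> \<le> (\<Sum>i\<in>I. \<eta> * (2 * B * (real m + 1)))"
  proof (intro sum_mono mult_mono)
    fix i assume i: "i \<in> I"
    show "(\<integral>x. ?r x * (v i x)\<^sup>2 \<partial>\<mu>) \<le> \<eta>" using M2[OF i] by (simp add: v_def)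
    then show "0 \<le> \<eta>" using r(2) by (intro order_trans[OF integral_nonneg_AE]) auto
    have "(\<integral>\<omega>. g2 i \<omega> \<partial>N) = 2 * B * ((\<integral>\<omega>. (Z \<omega> \<bullet> b i)\<^sup>2 \<partial>N) + 1)"
      unfolding g2_def using G.inner_square_integrable[OF i] by (simp add: G.prob_space)
    also have "\<dots> \<le> 2 * B * (real m + 1)"
      using Z_variance_le[OF i] m[OF i] F.B_nonneg by (intro mult_left_mono) auto
    finally show "(\<integral>\<omega>. g2 i \<omega> \<partial>N) \<le> 2 * B * (real m + 1)" .
    show "0 \<le> (\<integral>\<omega>. g2 i \<omega> \<partial>N)"
      using F.B_nonneg by (intro integral_nonneg_AE AE_I2) (simp add: g2_def)
  qed
  finally have second: "\<bar>\<integral>y. ?d y \<partial>(\<mu> \<Otimes>\<^sub>M N)\<bar> \<le> real (card I) * (2 * B * \<eta> * (real m + 1))"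
    by (simp add: mult_ac)
  have first: "\<bar>\<Sum>i\<in>I. (\<integral>x. ?r x * v i x \<partial>\<mu>) * (\<integral>\<omega>. g1 i \<omega> \<partial>N)\<bar> \<le> real (card I) * (\<eta> * (real m * B + B1))"
  proof -
    have "\<bar>\<integral>\<omega>. g1 i \<omega> \<partial>N\<bar> \<le> real m * B + B1" if i: "i \<in> I" for i
    proof -
      \<comment> \<open>Integration by parts turns this part of the first order coefficient into a
        Hessian term; the gradient bound is left for \<open>tau\<close> only, which is zero in the
        complex case.\<close>
      have gz: "(\<integral>\<omega>. (Z \<omega> \<bullet> b i) * (grad f (Z \<omega>) \<bullet> b i) \<partial>N) = (c i * sg i)\<^sup>2 * (\<integral>\<omega>. hess f (Z \<omega>) (b i) \<bullet> b i \<partial>N)"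
      proof (rule G.gaussian_ibp[OF i, where g = "\<lambda>z. grad f z \<bullet> b i" and g' = "\<lambda>z h. hess f z h \<bullet> b i"])
        show "((\<lambda>z. grad f z \<bullet> b i) has_derivative (\<lambda>h. hess f z h \<bullet> b i)) (at z)" for z
          by (intro has_derivative_inner_left F.grad_derivative)
        show "\<bar>hess f z h \<bullet> b i\<bar> \<le> B * norm h" for z h
          using Basis_le_norm[OF b_Basis[OF i], of "hess f z h"] F.hess_le[of z h] by linarith
        show "continuous_on UNIV (\<lambda>z. hess f z (b i) \<bullet> b i)"
          by (intro continuous_intros F.hess_continuous)
      qed
      have ih: "\<bar>\<integral>\<omega>. hess f (Z \<omega>) (b i) \<bullet> b i \<partial>N\<bar> \<le> B"
      proof -
        have "integrable N (\<lambda>\<omega>. hess f (Z \<omega>) (b i) \<bullet> b i)"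
          by (rule G.integrable_const_bound[where B = B]) (use hess_path_le[OF i i] in auto)
        then have "(\<integral>\<omega>. \<bar>hess f (Z \<omega>) (b i) \<bullet> b i\<bar> \<partial>N) \<le> (\<integral>\<omega>. B \<partial>N)"
          using hess_path_le[OF i i] by (intro Bochner_Integration.integral_mono) auto
        then have "(\<integral>\<omega>. \<bar>hess f (Z \<omega>) (b i) \<bullet> b i\<bar> \<partial>N) \<le> B" by (simp add: G.prob_space)
        then show ?thesis by (rule order_trans[OF integral_abs_bound])
      qed
      have a: "\<bar>\<integral>\<omega>. (Z \<omega> \<bullet> b i) * (grad f (Z \<omega>) \<bullet> b i) \<partial>N\<bar> \<le> real m * B"
      proof -
        have "real (q i) / real (card K) \<le> real m"
          using card_K m[OF i] frac_le[of "real m" "real (q i)" 1 "real (card K)"] by simp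
        then show ?thesis
          unfolding gz variance[OF i] abs_mult using ih by (intro mult_mono) auto
      qed
      have ig: "integrable N (\<lambda>\<omega>. grad f (Z \<omega>) \<bullet> b i)"
      proof (rule Bochner_Integration.integrable_bound[OF integrable_mult_right[OF Z_poly_integrable, of "norm (grad f 0) + B"]])
        show "AE \<omega> in N. norm (grad f (Z \<omega>) \<bullet> b i) \<le> norm ((norm (grad f 0) + B) * (1 + norm (Z \<omega>))\<^sup>2)"
        proof (rule AE_I2)
          fix \<omega>
          have "\<bar>grad f (Z \<omega>) \<bullet> b i\<bar> \<le> (norm (grad f 0) + B) * (1 + norm (Z \<omega>))"
            using Basis_le_norm[OF b_Basis[OF i], of "grad f (Z \<omega>)"] F.grad_le[of "Z \<omega>"] by linarith
          also have "\<dots> \<le> (norm (grad f 0) + B) * (1 + norm (Z \<omega>))\<^sup>2"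
            using F.B_nonneg by (intro mult_left_mono self_le_power) auto
          finally show "norm (grad f (Z \<omega>) \<bullet> b i) \<le> norm ((norm (grad f 0) + B) * (1 + norm (Z \<omega>))\<^sup>2)"
            using F.B_nonneg by (simp add: abs_mult)
        qed
      qed measurable
      have b': "\<bar>tau K (q i) * (\<integral>\<omega>. grad f (Z \<omega>) \<bullet> b i \<partial>N)\<bar> \<le> B1"
      proof (cases "K = UNIV")
        case True
        then show ?thesis using tau_range(3) B1 by simp
      next
        case False
        have le: "\<bar>grad f y \<bullet> b i\<bar> \<le> B1" for y
          using B1(2) False Basis_le_norm[OF b_Basis[OF i]] order_trans by blast
        have "(\<integral>\<omega>. \<bar>grad f (Z \<omega>) \<bullet> b i\<bar> \<partial>N) \<le> (\<integral>\<omega>. B1 \<partial>N)"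
          using le ig by (intro Bochner_Integration.integral_mono) auto
        then have "(\<integral>\<omega>. \<bar>grad f (Z \<omega>) \<bullet> b i\<bar> \<partial>N) \<le> B1" by (simp add: G.prob_space)
        then have "\<bar>\<integral>\<omega>. grad f (Z \<omega>) \<bullet> b i \<partial>N\<bar> \<le> B1"
          by (rule order_trans[OF integral_abs_bound])
        then have "\<bar>tau K (q i)\<bar> * \<bar>\<integral>\<omega>. grad f (Z \<omega>) \<bullet> b i \<partial>N\<bar> \<le> 1 * B1"
          using tau_range by (intro mult_mono) auto
        then show ?thesis by (simp add: abs_mult)
      qed
      have izg: "integrable N (\<lambda>\<omega>. (Z \<omega> \<bullet> b i) * (grad f (Z \<omega>) \<bullet> b i))"
      proof -
        have "integrable N (g1 i)"
          by (rule Bochner_Integration.integrable_bound[OF integrable_mult_right[OF Z_poly_integrable, of "norm (grad f 0) + B"] g1m])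
            (use g1b[OF i] F.B_nonneg in auto)
        then have "integrable N (\<lambda>\<omega>. g1 i \<omega> - tau K (q i) * (grad f (Z \<omega>) \<bullet> b i))"
          using ig by simp
        then show ?thesis by (simp add: g1_def distrib_right)
      qed
      have "(\<integral>\<omega>. g1 i \<omega> \<partial>N) = (\<integral>\<omega>. (Z \<omega> \<bullet> b i) * (grad f (Z \<omega>) \<bullet> b i) \<partial>N) + tau K (q i) * (\<integral>\<omega>. grad f (Z \<omega>) \<bullet> b i \<partial>N)"
        unfolding g1_def distrib_right using izg ig by simp
      then show ?thesis using a b' by linarith
    qed
    then have "\<bar>(\<integral>x. ?r x * v i x \<partial>\<mu>) * (\<integral>\<omega>. g1 i \<omega> \<partial>N)\<bar> \<le> \<eta> * (real m * B + B1)" if "i \<in> I" for i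
      unfolding abs_mult using M1[OF that] that by (intro mult_mono) (auto simp: v_def intro: order_trans[OF abs_ge_zero])
    then have "(\<Sum>i\<in>I. \<bar>(\<integral>x. ?r x * v i x \<partial>\<mu>) * (\<integral>\<omega>. g1 i \<omega> \<partial>N)\<bar>) \<le> (\<Sum>i\<in>I. \<eta> * (real m * B + B1))"
      by (intro sum_mono)
    then show ?thesis by (intro order_trans[OF sum_abs]) simp
  qed
  have "(\<integral>y. ?d y \<partial>(\<mu> \<Otimes>\<^sub>M N)) = (\<integral>y. ?r (fst y) * f (DZ (fst y) (Z (snd y)) + bv (fst y)) \<partial>(\<mu> \<Otimes>\<^sub>M N))
      - (\<integral>x. ?r x \<partial>\<mu>) * (\<integral>\<omega>. f (Z \<omega>) \<partial>N) - (\<Sum>i\<in>I. (\<integral>x. ?r x * v i x \<partial>\<mu>) * (\<integral>\<omega>. g1 i \<omega> \<partial>N))"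
  proof -
    have "(\<integral>y. ?d y \<partial>(\<mu> \<Otimes>\<^sub>M N)) = (\<integral>y. ?r (fst y) * f (DZ (fst y) (Z (snd y)) + bv (fst y)) \<partial>(\<mu> \<Otimes>\<^sub>M N))
      - (\<integral>y. ?r (fst y) * f (Z (snd y)) \<partial>(\<mu> \<Otimes>\<^sub>M N)) - (\<integral>y. (\<Sum>i\<in>I. (?r (fst y) * v i (fst y)) * g1 i (snd y)) \<partial>(\<mu> \<Otimes>\<^sub>M N))"
      by (simp only: Bochner_Integration.integral_diff Bochner_Integration.integrable_diff i0 pf(1)[OF fm] iS1)
    also have "(\<integral>y. (\<Sum>i\<in>I. (?r (fst y) * v i (fst y)) * g1 i (snd y)) \<partial>(\<mu> \<Otimes>\<^sub>M N)) = (\<Sum>i\<in>I. (\<integral>x. ?r x * v i x \<partial>\<mu>) * (\<integral>\<omega>. g1 i \<omega> \<partial>N))"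
      using p1 by (subst Bochner_Integration.integral_sum) auto
    finally show ?thesis unfolding pf(2)[OF fm] .
  qed
  note eq = this
  have tri: "\<bar>x\<bar> \<le> c * (u + v)" if "\<bar>x - y\<bar> \<le> c * v" "\<bar>y\<bar> \<le> c * u" for x y u v c :: real
    using that unfolding distrib_left by linarith
  show ?thesis
    by (rule tri[OF second[unfolded eq] first])
qed

end

section \<open>Constants uniform over sizes, laws and test functions\<close>

section \<open>Uniform bounds\<close>

text \<open>For fixed m there are finitely many pairs of powers and parts, and the sum of their
  constants serves them all.\<close>

lemma kernel_bounds:
  assumes K: "K = {True} \<or> K = UNIV"
  obtains C where "C \<ge> 0"
    "\<And>n \<mu> r p q k l. adm K n \<mu> r \<Longrightarrow> 1 \<le> p \<Longrightarrow> p \<le> m \<Longrightarrow> 1 \<le> q \<Longrightarrow> q \<le> m \<Longrightarrow>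
      (\<integral>x. r (nrm (ix n K) x) * \<bar>kerA K n p k q l x - (if p = q \<and> k = l then real p / real (card K) * sr n K x ^ (2 * p) else 0)\<bar> \<partial>\<mu>)
      \<le> C / real n * (\<integral>x. r (nrm (ix n K) x) * (1 + sr n K x ^ (2 * m)) \<partial>\<mu>)"
    "\<And>n \<mu> r p. K = {True} \<Longrightarrow> adm K n \<mu> r \<Longrightarrow> 1 \<le> p \<Longrightarrow> p \<le> m \<Longrightarrow>
      (\<integral>x. r (nrm (ix n K) x) * \<bar>kerR K n p True x\<bar> \<partial>\<mu>)
      \<le> C / real n * (\<integral>x. r (nrm (ix n K) x) * (1 + sr n K x ^ (2 * m)) \<partial>\<mu>)"
proof -
  define QA where "QA t B \<longleftrightarrow> B \<ge> 0 \<and> (\<forall>n \<mu> r. adm K n \<mu> r \<longrightarrow> (case t of (p, q, k, l) \<Rightarrow>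
      (\<integral>x. r (nrm (ix n K) x) * \<bar>kerA K n p k q l x - (if p = q \<and> k = l then real p / real (card K) * sr n K x ^ (2 * p) else 0)\<bar> \<partial>\<mu>)
      \<le> B / real n * (\<integral>x. r (nrm (ix n K) x) * (1 + sr n K x ^ (2 * m)) \<partial>\<mu>)))" for t :: "nat \<times> nat \<times> bool \<times> bool" and B :: real
  define QR where "QR p B \<longleftrightarrow> B \<ge> 0 \<and> (K = {True} \<longrightarrow> (\<forall>n \<mu> r. adm K n \<mu> r \<longrightarrow>
      (\<integral>x. r (nrm (ix n K) x) * \<bar>kerR K n p True x\<bar> \<partial>\<mu>)
      \<le> B / real n * (\<integral>x. r (nrm (ix n K) x) * (1 + sr n K x ^ (2 * m)) \<partial>\<mu>)))" for p :: nat and B :: real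
  define S where "S = {1..m} \<times> {1..m} \<times> (UNIV :: bool set) \<times> (UNIV :: bool set)"
  have exA: "\<exists>B. QA t B" if "t \<in> S" for t
  proof -
    obtain p q k l where t1: "t = (p, q, k, l)" by (cases t)
    then have t: "t = (p, q, k, l)" "1 \<le> p" "p \<le> m" "1 \<le> q" "q \<le> m" using that by (auto simp: S_def)
    have d: "2 * p \<le> 2 * m" "2 * q \<le> 2 * m" using t by auto
    show ?thesis unfolding t(1) QA_def prod.case
      by (rule kerA_L1[OF K t(2,4) d, where k = k and l = l]) blast
  qed
  have exR: "\<exists>B. QR p B" if "p \<in> {1..m}" for p
  proof (cases "K = {True}")
    case True
    have "1 \<le> p" "p \<le> 2 * m" using that by auto
    note p = this
    show ?thesis unfolding QR_def True
      by (rule kerR_L1[OF p]) blast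
  qed (auto simp: QR_def)
  define BA where "BA t = (SOME B. QA t B)" for t
  define BR where "BR p = (SOME B. QR p B)" for p
  have BA: "QA t (BA t)" if "t \<in> S" for t unfolding BA_def using exA[OF that] by (rule someI_ex)
  have BR: "QR p (BR p)" if "p \<in> {1..m}" for p unfolding BR_def using exR[OF that] by (rule someI_ex)
  define C where "C = (\<Sum>t\<in>S. BA t) + (\<Sum>p\<in>{1..m}. BR p)"
  have finS: "finite S" by (simp add: S_def)
  have A0: "0 \<le> BA t" if "t \<in> S" for t using BA[OF that] by (simp add: QA_def)
  have R0: "0 \<le> BR p" if "p \<in> {1..m}" for p using BR[OF that] by (simp add: QR_def)
  have AC: "BA t \<le> C" if "t \<in> S" for t
  proof -
    have "BA t \<le> sum BA S" by (rule member_le_sum[OF that]) (auto intro: A0 finS)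
    moreover have "0 \<le> sum BR {1..m}" by (intro sum_nonneg R0)
    ultimately show ?thesis by (simp add: C_def)
  qed
  have RC: "BR p \<le> C" if "p \<in> {1..m}" for p
  proof -
    have "BR p \<le> sum BR {1..m}" by (rule member_le_sum[OF that]) (auto intro: R0)
    moreover have "0 \<le> sum BA S" by (intro sum_nonneg A0)
    ultimately show ?thesis by (simp add: C_def)
  qed
  have mono: "B / real n * T \<le> C / real n * T" if "B \<le> C" "0 \<le> T" for B n T
    using that by (intro mult_right_mono divide_right_mono) auto
  have T: "0 \<le> (\<integral>x. r (nrm (ix n K) x) * (1 + sr n K x ^ (2 * m)) \<partial>\<mu>)" if "adm K n \<mu> r" for n \<mu> r
    using admD(2)[OF that] by (intro integral_nonneg_AE AE_I2) (simp add: sr_nonneg)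
  show ?thesis
  proof (rule that[of C])
    show "0 \<le> C" unfolding C_def using A0 R0 by (intro add_nonneg_nonneg sum_nonneg) auto
    fix n \<mu> r p q k l assume a: "adm K n \<mu> r" "1 \<le> p" "p \<le> m" "1 \<le> q" "q \<le> m"
    then have t: "(p, q, k, l) \<in> S" by (simp add: S_def)
    from BA[OF t] a(1) have "(\<integral>x. r (nrm (ix n K) x) * \<bar>kerA K n p k q l x - (if p = q \<and> k = l then real p / real (card K) * sr n K x ^ (2 * p) else 0)\<bar> \<partial>\<mu>)
      \<le> BA (p, q, k, l) / real n * (\<integral>x. r (nrm (ix n K) x) * (1 + sr n K x ^ (2 * m)) \<partial>\<mu>)"
      unfolding QA_def prod.case by blast
    then show "(\<integral>x. r (nrm (ix n K) x) * \<bar>kerA K n p k q l x - (if p = q \<and> k = l then real p / real (card K) * sr n K x ^ (2 * p) else 0)\<bar> \<partial>\<mu>)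
      \<le> C / real n * (\<integral>x. r (nrm (ix n K) x) * (1 + sr n K x ^ (2 * m)) \<partial>\<mu>)"
      using mono[OF AC[OF t] T[OF a(1)]] by (rule order_trans)
  next
    fix n \<mu> r p assume a: "K = {True}" "adm K n \<mu> r" "1 \<le> p" "p \<le> m"
    then have p: "p \<in> {1..m}" by simp
    from BR[OF p] a(1,2) have "(\<integral>x. r (nrm (ix n K) x) * \<bar>kerR K n p True x\<bar> \<partial>\<mu>)
      \<le> BR p / real n * (\<integral>x. r (nrm (ix n K) x) * (1 + sr n K x ^ (2 * m)) \<partial>\<mu>)"
      unfolding QR_def by blast
    then show "(\<integral>x. r (nrm (ix n K) x) * \<bar>kerR K n p True x\<bar> \<partial>\<mu>)
      \<le> C / real n * (\<integral>x. r (nrm (ix n K) x) * (1 + sr n K x ^ (2 * m)) \<partial>\<mu>)"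
      using mono[OF RC[OF p] T[OF a(2)]] by (rule order_trans)
  qed
qed

text \<open>Interpolation and removal of the radius combined. The weight stays in the statement, and
  the total mass of the weight multiplies the Gaussian mean, so that both the constant weight and a
  cut-off can be inserted.\<close>

theorem weighted_comparison:
  fixes m :: nat
  assumes K: "K = {True} \<or> K = UNIV"
  obtains C where "C \<ge> 0"
    "\<And>\<mu> n N X I sg c b Z (f :: 'e::euclidean_space \<Rightarrow> real) B q l r B1 C0.
      smart_path \<mu> n K N X I sg c b Z f B q l \<Longrightarrow> adm K n \<mu> r \<Longrightarrow> (\<And>i. i \<in> I \<Longrightarrow> q i \<le> m) \<Longrightarrow> 0 \<le> B1 \<Longrightarrow>
      K = UNIV \<or> (\<forall>y. norm (grad f y) \<le> B1) \<Longrightarrow>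
      (\<integral>x. r (nrm (ix n K) x) * (1 + sr n K x ^ (2 * m)) \<partial>\<mu>) \<le> C0 \<Longrightarrow>
      (\<And>p. 1 \<le> p \<Longrightarrow> p \<le> m \<Longrightarrow> \<bar>\<integral>x. r (nrm (ix n K) x) * (sr n K x ^ p - 1) \<partial>\<mu>\<bar> \<le> C0 / real n) \<Longrightarrow>
      (\<And>p. 1 \<le> p \<Longrightarrow> p \<le> m \<Longrightarrow> (\<integral>x. r (nrm (ix n K) x) * (sr n K x ^ p - 1)\<^sup>2 \<partial>\<mu>) \<le> C0 / real n) \<Longrightarrow>
      \<bar>(\<integral>x. r (nrm (ix n K) x) * f ((\<Sum>i\<in>I. pw K n (q i) (l i) x *\<^sub>R b i) - (\<Sum>i\<in>I. tau K (q i) *\<^sub>R b i)) \<partial>\<mu>)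
        - (\<integral>x. r (nrm (ix n K) x) \<partial>\<mu>) * (\<integral>\<omega>. f (Z \<omega>) \<partial>N)\<bar> \<le> C * C0 * (B1 + B) / real n"
proof -
  obtain C1 where C1: "C1 \<ge> 0"
    "\<And>n \<mu> r p q k l. adm K n \<mu> r \<Longrightarrow> 1 \<le> p \<Longrightarrow> p \<le> m \<Longrightarrow> 1 \<le> q \<Longrightarrow> q \<le> m \<Longrightarrow>
      (\<integral>x. r (nrm (ix n K) x) * \<bar>kerA K n p k q l x - (if p = q \<and> k = l then real p / real (card K) * sr n K x ^ (2 * p) else 0)\<bar> \<partial>\<mu>)
      \<le> C1 / real n * (\<integral>x. r (nrm (ix n K) x) * (1 + sr n K x ^ (2 * m)) \<partial>\<mu>)"
    "\<And>n \<mu> r p. K = {True} \<Longrightarrow> adm K n \<mu> r \<Longrightarrow> 1 \<le> p \<Longrightarrow> p \<le> m \<Longrightarrow>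
      (\<integral>x. r (nrm (ix n K) x) * \<bar>kerR K n p True x\<bar> \<partial>\<mu>)
      \<le> C1 / real n * (\<integral>x. r (nrm (ix n K) x) * (1 + sr n K x ^ (2 * m)) \<partial>\<mu>)"
    using kernel_bounds[OF K, of m] by blast
  define D where "D = real DIM('e)"
  define C where "C = 2 * (D * (1 + D)) * C1 + D * (3 * real m + 3)"
  have D0: "0 \<le> D" by (simp add: D_def)
  show ?thesis
  proof (rule that[of C])
    show "0 \<le> C" using C1(1) D0 by (simp add: C_def)
    fix \<mu> n N X I sg c b Z and f :: "'e \<Rightarrow> real" and B q l r B1 C0
    assume sp: "smart_path \<mu> n K N X I sg c b Z f B q l" and ad: "adm K n \<mu> r"
      and qm: "\<And>i. i \<in> I \<Longrightarrow> q i \<le> m" and B1: "0 \<le> B1" "K = UNIV \<or> (\<forall>y. norm (grad f y) \<le> B1)"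
      and T: "(\<integral>x. r (nrm (ix n K) x) * (1 + sr n K x ^ (2 * m)) \<partial>\<mu>) \<le> C0"
      and M1: "\<And>p. 1 \<le> p \<Longrightarrow> p \<le> m \<Longrightarrow> \<bar>\<integral>x. r (nrm (ix n K) x) * (sr n K x ^ p - 1) \<partial>\<mu>\<bar> \<le> C0 / real n"
      and M2: "\<And>p. 1 \<le> p \<Longrightarrow> p \<le> m \<Longrightarrow> (\<integral>x. r (nrm (ix n K) x) * (sr n K x ^ p - 1)\<^sup>2 \<partial>\<mu>) \<le> C0 / real n"
    interpret smart_path \<mu> n K N X I sg c b Z f B q l by (rule sp)
    define \<epsilon> where "\<epsilon> = C1 / real n * C0"
    have C0: "0 \<le> C0"
      using T admD(2)[OF ad] by (intro order_trans[OF integral_nonneg_AE T]) (auto intro!: AE_I2 mult_nonneg_nonneg simp: sr_nonneg)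
    have \<epsilon>: "0 \<le> \<epsilon>" using C1(1) C0 by (simp add: \<epsilon>_def)
    have cI: "real (card I) = D"
      using bij_betw_same_card[OF G.b] by (simp add: D_def)
    have up: "C1 / real n * (\<integral>x. r (nrm (ix n K) x) * (1 + sr n K x ^ (2 * m)) \<partial>\<mu>) \<le> \<epsilon>"
      unfolding \<epsilon>_def using T C1(1) by (intro mult_left_mono) auto
    have I1: "\<bar>(\<integral>x. r (nrm (ix n K) x) * f (W x - tv) \<partial>\<mu>)
     - (\<integral>y. r (nrm (ix n K) (fst y)) * f (DZ (fst y) (Z (snd y)) + bv (fst y)) \<partial>(\<mu> \<Otimes>\<^sub>M N))\<bar>
      \<le> 2 * (real (card I) * (B1 * \<epsilon> + real (card I) * (B * \<epsilon>)))"
    proof (rule interpolation_bound[OF admD(3)[OF ad] admD(2)[OF ad] B1 _ _ \<epsilon>])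
      show "(\<integral>x. r (nrm (ix n K) x) * \<bar>kerR K n (q i) (l i) x\<bar> \<partial>\<mu>) \<le> \<epsilon>" if i: "i \<in> I" "K \<noteq> UNIV" for i
      proof -
        have KT: "K = {True}" using K that by auto
        then have "l i = True" using l_K[OF i(1)] by auto
        then show ?thesis using order_trans[OF C1(3)[OF KT ad q_pos[OF i(1)] qm[OF i(1)]] up] by simp
      qed
      show "(\<integral>x. r (nrm (ix n K) x) * \<bar>dev i e x\<bar> \<partial>\<mu>) \<le> \<epsilon>" if "i \<in> I" "e \<in> I" for i e
        unfolding dev_def
        by (rule order_trans[OF C1(2)[OF ad q_pos[OF that(1)] qm[OF that(1)] q_pos[OF that(2)] qm[OF that(2)]] up])
    qed
    have I2: "\<bar>(\<integral>y. r (nrm (ix n K) (fst y)) * f (DZ (fst y) (Z (snd y)) + bv (fst y)) \<partial>(\<mu> \<Otimes>\<^sub>M N))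
      - (\<integral>x. r (nrm (ix n K) x) \<partial>\<mu>) * (\<integral>\<omega>. f (Z \<omega>) \<partial>N)\<bar>
      \<le> real (card I) * (C0 / real n * (real m * B + B1) + 2 * B * (C0 / real n) * (real m + 1))"
      by (rule radial_comparison[OF admD(3)[OF ad] admD(2)[OF ad] B1 qm]) (use M1 M2 q_pos qm in auto)
    have "2 * (D * (B1 * \<epsilon> + D * (B * \<epsilon>))) + D * (C0 / real n * (real m * B + B1) + 2 * B * (C0 / real n) * (real m + 1))
        = (2 * D * C1 * (B1 + D * B) + D * (B1 + (3 * real m + 2) * B)) * (C0 / real n)"
    proof -
      have "2 * (D * (B1 * (C1 * t) + D * (B * (C1 * t)))) + D * (t * (real m * B + B1) + 2 * B * t * (real m + 1))
        = (2 * D * C1 * (B1 + D * B) + D * (B1 + (3 * real m + 2) * B)) * t" for t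
        by (simp add: algebra_simps)
      from this[of "C0 / real n"] show ?thesis by (simp add: \<epsilon>_def)
    qed
    also have "\<dots> \<le> (C * (B1 + B)) * (C0 / real n)"
    proof (intro mult_right_mono)
      have "2 * D * C1 * (B1 + D * B) \<le> 2 * D * C1 * ((1 + D) * (B1 + B))"
        using D0 C1(1) B1 F.B_nonneg by (intro mult_left_mono) (auto simp: algebra_simps)
      moreover have "D * (B1 + (3 * real m + 2) * B) \<le> D * ((3 * real m + 3) * (B1 + B))"
        using D0 B1 F.B_nonneg by (intro mult_left_mono) (auto simp: algebra_simps)
      moreover have "C * (B1 + B) = 2 * D * C1 * ((1 + D) * (B1 + B)) + D * ((3 * real m + 3) * (B1 + B))"
        by (simp add: C_def algebra_simps)
      ultimately show "2 * D * C1 * (B1 + D * B) + D * (B1 + (3 * real m + 2) * B) \<le> C * (B1 + B)"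
        by linarith
    qed (use C0 in simp)
    also have "\<dots> = C * C0 * (B1 + B) / real n" by simp
    finally show "\<bar>(\<integral>x. r (nrm (ix n K) x) * f ((\<Sum>i\<in>I. pw K n (q i) (l i) x *\<^sub>R b i) - (\<Sum>i\<in>I. tau K (q i) *\<^sub>R b i)) \<partial>\<mu>)
        - (\<integral>x. r (nrm (ix n K) x) \<partial>\<mu>) * (\<integral>\<omega>. f (Z \<omega>) \<partial>N)\<bar> \<le> C * C0 * (B1 + B) / real n"
      using I1 I2 unfolding W_def tv_def cI by linarith
  qed
qed

section \<open>Truncation of the radius with moments up to order m\<close>

lemma power_minus_one_le:
  fixes s :: real
  assumes "0 \<le> s" "s \<le> 2"
  shows "\<bar>s ^ p - 1\<bar> \<le> real p * 2 ^ p * \<bar>s - 1\<bar>"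
proof -
  have "\<bar>\<Sum>i<p. s ^ i\<bar> \<le> (\<Sum>i<p. 2 ^ p)"
  proof (rule order_trans[OF sum_abs], intro sum_mono)
    fix i assume "i \<in> {..<p}"
    have "s ^ i \<le> 2 ^ i" using assms by (intro power_mono) auto
    also have "(2::real) ^ i \<le> 2 ^ p" using \<open>i \<in> {..<p}\<close> by (intro power_increasing) auto
    finally show "\<bar>s ^ i\<bar> \<le> 2 ^ p" using assms by simp
  qed
  then have "\<bar>\<Sum>i<p. s ^ i\<bar> * \<bar>s - 1\<bar> \<le> real p * 2 ^ p * \<bar>s - 1\<bar>"
    by (intro mult_right_mono) auto
  then show ?thesis by (simp add: power_diff_1_eq abs_mult mult.commute)
qed

text \<open>In the variable s^2 the function s^(k+2) is convex, and the affine part subtracted is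
  twice its tangent at 1. The induction rests on an explicit nonnegative remainder with the factor
  (s - 1)^2.\<close>

lemma power_tangent:
  fixes s :: real
  assumes "0 \<le> s"
  shows "0 \<le> 2 * s ^ (k + 2) - real (k + 2) * s\<^sup>2 + real k"
proof (induction k)
  case (Suc k)
  let ?m = "real (k + 2)"
  have "s * (2 * s ^ (k + 2) - ?m * s\<^sup>2 + real k) \<ge> 0"
    using Suc assms by simp
  moreover have "2 * s ^ (Suc k + 2) - real (Suc k + 2) * s\<^sup>2 + real (Suc k)
      = s * (2 * s ^ (k + 2) - ?m * s\<^sup>2 + real k) + (s - 1)\<^sup>2 * (?m * s + (?m - 1))"
    by (simp add: algebra_simps power2_eq_square)
  moreover have "0 \<le> (s - 1)\<^sup>2 * (?m * s + (?m - 1))" using assms by simp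
  ultimately show ?case by linarith
qed (simp add: power2_eq_square)

text \<open>Beyond 2 the power already dominates: the quadratic part of the tangent is at most three
  quarters of \<open>2 * s ^ (k + 3)\<close>.\<close>

lemma power_tangent_large:
  fixes s :: real
  assumes "2 < s"
  shows "s ^ (k + 3) / 2 \<le> 2 * s ^ (k + 3) - real (k + 3) * s\<^sup>2 + real (k + 1)"
proof -
  have "real (k + 3) * 2 \<le> 3 * 2 ^ (k + 1)"
  proof (induction k)
    case (Suc k)
    have "(1::real) \<le> 2 ^ k" by simp
    with Suc show ?case by simp
  qed simp
  also have "3 * 2 ^ (k + 1) \<le> 3 * s ^ (k + 1)"
    using assms by (intro mult_left_mono power_mono) auto
  finally have "real (k + 3) * 2 * s\<^sup>2 \<le> 3 * s ^ (k + 1) * s\<^sup>2"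
    by (intro mult_right_mono) auto
  also have "3 * s ^ (k + 1) * s\<^sup>2 = 3 * s ^ (k + 3)"
    by (simp add: power2_eq_square power3_eq_cube power_add mult_ac)
  finally have "2 * (real (k + 3) * s\<^sup>2) \<le> 3 * s ^ (k + 3)"
    by (simp only: mult_ac)
  then show ?thesis using of_nat_0_le_iff[of "k + 1", where 'a = real] by linarith
qed

text \<open>The cut-off is at normalised radius 2, where \<open>power_tangent_large\<close>
  starts.\<close>

definition low :: "nat \<Rightarrow> real \<Rightarrow> real" where
  "low n y = (if \<bar>y\<bar> / sqrt (real n) \<le> 2 then 1 else 0)"

definition high :: "nat \<Rightarrow> real \<Rightarrow> real" where
  "high n y = (if \<bar>y\<bar> / sqrt (real n) \<le> 2 then 0 else 1)"

lemma low_high: "low n y + high n y = 1" "0 \<le> low n y" "0 \<le> high n y"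
  by (auto simp: low_def high_def)

context sph_mat
begin

abbreviation s where "s \<equiv> sr n K"
abbreviation lo where "lo x \<equiv> low n (nrm (ix n K) x)"
abbreviation hi where "hi x \<equiv> high n (nrm (ix n K) x)"

lemma lo_s: "lo x = (if s x \<le> 2 then 1 else 0)" and hi_s: "hi x = (if s x \<le> 2 then 0 else 1)"
  by (auto simp: low_def high_def sr_def nrm_nonneg)

lemma pb_lo: "pb (\<lambda>x. lo x)" and pb_hi: "pb (\<lambda>x. hi x)"
proof -
  have [measurable]: "s \<in> borel_measurable \<mu>" using pb_sr by (rule pb_measurable)
  show "pb (\<lambda>x. lo x)" unfolding lo_s by (rule pb_dom[OF pb_const[of "1::real"]]) auto
  show "pb (\<lambda>x. hi x)" unfolding hi_s by (rule pb_dom[OF pb_const[of "1::real"]]) auto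
qed

lemma adm_weights: "adm K n \<mu> (low n)" "adm K n \<mu> (high n)" "adm K n \<mu> (\<lambda>_. 1)"
  using pb_lo pb_hi low_high sph_mat_axioms by (auto simp: adm_def)

lemma int_s: "integrable \<mu> (\<lambda>x. s x ^ k)"
  by (intro pb_integrable pb_power pb_sr)

text \<open>Integrating the tangent inequality leaves only E s^m - 1, because E s^2 = 1 is exact;
  hence the tail of s^m is O(1/n). Below the cut-off s^p - 1 is Lipschitz in s, and E (s - 1)^2 is
  determined by E s.\<close>

lemma truncated_moments:
  assumes m: "3 \<le> m" and a: "0 \<le> a" and two: "(\<integral>x. (s x)\<^sup>2 \<partial>\<mu>) = 1"
    and M: "\<And>k. 1 \<le> k \<Longrightarrow> k \<le> m \<Longrightarrow> \<bar>(\<integral>x. s x ^ k \<partial>\<mu>) - 1\<bar> \<le> a / real n"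
  shows "(\<integral>x. hi x * s x ^ m \<partial>\<mu>) \<le> 4 * a / real n"
    "\<And>p. 1 \<le> p \<Longrightarrow> p \<le> m \<Longrightarrow> \<bar>\<integral>x. lo x * (s x ^ p - 1) \<partial>\<mu>\<bar> \<le> 5 * a / real n"
    "\<And>p. 1 \<le> p \<Longrightarrow> p \<le> m \<Longrightarrow> (\<integral>x. lo x * (s x ^ p - 1)\<^sup>2 \<partial>\<mu>) \<le> (real m * 2 ^ m)\<^sup>2 * (2 * a) / real n"
    "(\<integral>x. lo x * (1 + s x ^ (2 * m)) \<partial>\<mu>) \<le> 1 + 2 ^ (2 * m)"
proof -
  have m2: "m - 2 + 2 = m" and m3: "m - 3 + 3 = m" "m - 3 + 1 = m - 2" using m by auto
  let ?g = "\<lambda>x. 2 * s x ^ m - real m * (s x)\<^sup>2 + real (m - 2)"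
  have g: "hi x * s x ^ m \<le> 2 * ?g x" for x
  proof (cases "s x \<le> 2")
    case True
    then show ?thesis using power_tangent[OF sr_nonneg[of n K x], of "m - 2", unfolded m2] by (simp add: hi_s)
  next
    case False
    then have "2 < s x" by simp
    from power_tangent_large[OF this, of "m - 3", unfolded m3] False show ?thesis by (simp add: hi_s)
  qed
  have ig: "integrable \<mu> ?g" using int_s by (auto intro!: Bochner_Integration.integrable_add Bochner_Integration.integrable_diff)
  have "(\<integral>x. hi x * s x ^ m \<partial>\<mu>) \<le> (\<integral>x. 2 * ?g x \<partial>\<mu>)"
    by (rule Bochner_Integration.integral_mono[OF _ integrable_mult_right[OF ig] g])
      (intro pb_integrable pb_mult pb_hi pb_power pb_sr)
  \<comment> \<open>With E s^2 = 1 the terms \<open>- real m\<close> and \<open>real (m - 2)\<close>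
    add up to -2.\<close>
  also have "\<dots> = 4 * ((\<integral>x. s x ^ m \<partial>\<mu>) - 1)"
    using int_s two m by (simp add: prob_space of_nat_diff algebra_simps)
  also have "\<dots> \<le> 4 * (a / real n)" using M[of m] m by (intro mult_left_mono) auto
  finally show H: "(\<integral>x. hi x * s x ^ m \<partial>\<mu>) \<le> 4 * a / real n" by simp
  show "\<bar>\<integral>x. lo x * (s x ^ p - 1) \<partial>\<mu>\<bar> \<le> 5 * a / real n" if p: "1 \<le> p" "p \<le> m" for p
  proof -
    have i: "integrable \<mu> (\<lambda>x. lo x * (s x ^ p - 1))" "integrable \<mu> (\<lambda>x. hi x * (s x ^ p - 1))"
      by (intro pb_integrable pb_mult pb_lo pb_hi pb_diff pb_power pb_sr pb_const)+
    have "(\<integral>x. lo x * (s x ^ p - 1) \<partial>\<mu>) + (\<integral>x. hi x * (s x ^ p - 1) \<partial>\<mu>) = (\<integral>x. s x ^ p - 1 \<partial>\<mu>)"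
      unfolding Bochner_Integration.integral_add[OF i, symmetric] distrib_right[symmetric] low_high by simp
    also have "\<dots> = (\<integral>x. s x ^ p \<partial>\<mu>) - 1"
      using int_s by (simp add: prob_space)
    finally have e: "(\<integral>x. lo x * (s x ^ p - 1) \<partial>\<mu>) = ((\<integral>x. s x ^ p \<partial>\<mu>) - 1) - (\<integral>x. hi x * (s x ^ p - 1) \<partial>\<mu>)" by simp
    have "\<bar>\<integral>x. hi x * (s x ^ p - 1) \<partial>\<mu>\<bar> \<le> (\<integral>x. \<bar>hi x * (s x ^ p - 1)\<bar> \<partial>\<mu>)"
      by (rule integral_abs_bound)
    also have "\<dots> \<le> (\<integral>x. hi x * s x ^ m \<partial>\<mu>)"
    proof (intro Bochner_Integration.integral_mono integrable_abs i(2) pb_integrable pb_mult pb_hi pb_power pb_sr)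
      fix x
      show "\<bar>hi x * (s x ^ p - 1)\<bar> \<le> hi x * s x ^ m"
      proof (cases "s x \<le> 2")
        case False
        then have "1 \<le> s x ^ p" "s x ^ p \<le> s x ^ m" using p by (auto intro: one_le_power power_increasing)
        then have "\<bar>s x ^ p - 1\<bar> \<le> s x ^ m" by linarith
        then show ?thesis using False by (simp add: hi_s)
      qed (simp add: hi_s)
    qed
    also note H
    finally have "\<bar>\<integral>x. hi x * (s x ^ p - 1) \<partial>\<mu>\<bar> \<le> 4 * a / real n" .
    moreover have "5 * a / real n = a / real n + 4 * a / real n"
      by (simp flip: add_divide_distrib)
    ultimately show ?thesis using M[OF p] unfolding e by linarith
  qed
  show "(\<integral>x. lo x * (s x ^ p - 1)\<^sup>2 \<partial>\<mu>) \<le> (real m * 2 ^ m)\<^sup>2 * (2 * a) / real n" if p: "1 \<le> p" "p \<le> m" for p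
  proof -
    have "(\<integral>x. lo x * (s x ^ p - 1)\<^sup>2 \<partial>\<mu>) \<le> (\<integral>x. (real m * 2 ^ m)\<^sup>2 * (s x - 1)\<^sup>2 \<partial>\<mu>)"
    proof (intro Bochner_Integration.integral_mono pb_integrable pb_mult pb_lo pb_power pb_sr pb_diff pb_const)
      fix x
      show "lo x * (s x ^ p - 1)\<^sup>2 \<le> (real m * 2 ^ m)\<^sup>2 * (s x - 1)\<^sup>2"
      proof (cases "s x \<le> 2")
        case True
        have "real p * 2 ^ p * \<bar>s x - 1\<bar> \<le> real m * 2 ^ m * \<bar>s x - 1\<bar>"
          using p by (intro mult_right_mono mult_mono power_increasing) auto
        then have "\<bar>s x ^ p - 1\<bar> \<le> real m * 2 ^ m * \<bar>s x - 1\<bar>"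
          using power_minus_one_le[OF sr_nonneg True, of p] by linarith
        from power_mono[OF this abs_ge_zero, of 2] show ?thesis
          using True by (simp add: lo_s power_mult_distrib)
      qed (simp add: lo_s)
    qed
    \<comment> \<open>Expanding the square and using E s^2 = 1 reduces the second moment to the
      deviation of the first.\<close>
    also have "\<dots> = (real m * 2 ^ m)\<^sup>2 * (2 - 2 * (\<integral>x. s x \<partial>\<mu>))"
    proof -
      have "(s x - 1)\<^sup>2 = (s x)\<^sup>2 - 2 * s x + 1" for x by (simp add: power2_diff)
      then show ?thesis using int_s[of 1] int_s[of 2] two by (simp add: prob_space)
    qed
    also have "\<dots> \<le> (real m * 2 ^ m)\<^sup>2 * (2 * a / real n)"
      using M[of 1] m by (intro mult_left_mono) auto
    finally show ?thesis by simp
  qed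
  have "(\<integral>x. lo x * (1 + s x ^ (2 * m)) \<partial>\<mu>) \<le> (\<integral>x. 1 + 2 ^ (2 * m) \<partial>\<mu>)"
  proof (intro Bochner_Integration.integral_mono pb_integrable pb_mult pb_lo pb_power pb_sr pb_add pb_const)
    fix x
    show "lo x * (1 + s x ^ (2 * m)) \<le> 1 + 2 ^ (2 * m)"
      using power_mono[OF _ sr_nonneg[of n K x], of 2 "2 * m"] by (simp add: lo_s)
  qed
  then show "(\<integral>x. lo x * (1 + s x ^ (2 * m)) \<partial>\<mu>) \<le> 1 + 2 ^ (2 * m)"
    by (simp add: prob_space)
qed

end

text \<open>The weight is constant, since \<open>f\<close> has only a Hessian bound and its tail
  could not be controlled by a gradient. The second moments of s^p - 1 for p up to m then bring in
  the radial moments up to 2m.\<close>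

theorem complex_comparison:
  fixes m :: nat
  assumes m: "1 \<le> m"
  obtains C where "C \<ge> 0"
    "\<And>\<mu> n (N :: 'w measure) (X :: 'i \<Rightarrow> 'w \<Rightarrow> real) I sg c b Z (f :: 'e::euclidean_space \<Rightarrow> real) B q l a.
      smart_path \<mu> n UNIV N X I sg c b Z f B q l \<Longrightarrow> (\<And>i. i \<in> I \<Longrightarrow> q i \<le> m) \<Longrightarrow> 0 \<le> a \<Longrightarrow>
      (\<And>k. 1 \<le> k \<Longrightarrow> k \<le> 2 * m \<Longrightarrow> \<bar>(\<integral>x. sr n UNIV x ^ k \<partial>\<mu>) - 1\<bar> \<le> a / real n) \<Longrightarrow>
      \<bar>(\<integral>x. f (\<Sum>i\<in>I. pw UNIV n (q i) (l i) x *\<^sub>R b i) \<partial>\<mu>) - (\<integral>\<omega>. f (Z \<omega>) \<partial>N)\<bar> \<le> C * (1 + a) * B / real n"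
proof -
  obtain C where C: "C \<ge> 0"
    "\<And>\<mu> n (N :: 'w measure) (X :: 'i \<Rightarrow> 'w \<Rightarrow> real) I sg c b Z (f :: 'e \<Rightarrow> real) B q l r B1 C0.
      smart_path \<mu> n UNIV N X I sg c b Z f B q l \<Longrightarrow> adm UNIV n \<mu> r \<Longrightarrow> (\<And>i. i \<in> I \<Longrightarrow> q i \<le> m) \<Longrightarrow> 0 \<le> B1 \<Longrightarrow>
      UNIV = (UNIV :: bool set) \<or> (\<forall>y. norm (grad f y) \<le> B1) \<Longrightarrow>
      (\<integral>x. r (nrm (ix n UNIV) x) * (1 + sr n UNIV x ^ (2 * m)) \<partial>\<mu>) \<le> C0 \<Longrightarrow>
      (\<And>p. 1 \<le> p \<Longrightarrow> p \<le> m \<Longrightarrow> \<bar>\<integral>x. r (nrm (ix n UNIV) x) * (sr n UNIV x ^ p - 1) \<partial>\<mu>\<bar> \<le> C0 / real n) \<Longrightarrow>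
      (\<And>p. 1 \<le> p \<Longrightarrow> p \<le> m \<Longrightarrow> (\<integral>x. r (nrm (ix n UNIV) x) * (sr n UNIV x ^ p - 1)\<^sup>2 \<partial>\<mu>) \<le> C0 / real n) \<Longrightarrow>
      \<bar>(\<integral>x. r (nrm (ix n UNIV) x) * f ((\<Sum>i\<in>I. pw UNIV n (q i) (l i) x *\<^sub>R b i) - (\<Sum>i\<in>I. tau UNIV (q i) *\<^sub>R b i)) \<partial>\<mu>)
        - (\<integral>x. r (nrm (ix n UNIV) x) \<partial>\<mu>) * (\<integral>\<omega>. f (Z \<omega>) \<partial>N)\<bar> \<le> C * C0 * (B1 + B) / real n"
    by (rule weighted_comparison[of "UNIV :: bool set" m]) (simp, blast)
  show ?thesis
  proof (rule that[of "C * 3"])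
    show "0 \<le> C * 3" using C(1) by simp
    fix \<mu> n and N :: "'w measure" and X :: "'i \<Rightarrow> 'w \<Rightarrow> real" and I sg c b Z and f :: "'e \<Rightarrow> real" and B q l a
    assume sp: "smart_path \<mu> n UNIV N X I sg c b Z f B q l" and qm: "\<And>i. i \<in> I \<Longrightarrow> q i \<le> m" and a: "0 \<le> a"
      and M: "\<And>k. 1 \<le> k \<Longrightarrow> k \<le> 2 * m \<Longrightarrow> \<bar>(\<integral>x. sr n UNIV x ^ k \<partial>\<mu>) - 1\<bar> \<le> a / real n"
    interpret smart_path \<mu> n UNIV N X I sg c b Z f B q l by (rule sp)
    have n1: "1 \<le> real n" using n_pos by simp
    have an: "a / real n \<le> a" using divide_left_mono[of 1 "real n" a] n1 a by simp
    have le: "x / real n \<le> 3 * (1 + a) / real n" if "x \<le> 3 * (1 + a)" for x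
      using that n1 by (intro divide_right_mono) auto
    have "\<bar>(\<integral>x. 1 * f ((\<Sum>i\<in>I. pw UNIV n (q i) (l i) x *\<^sub>R b i) - (\<Sum>i\<in>I. tau UNIV (q i) *\<^sub>R b i)) \<partial>\<mu>)
        - (\<integral>x. 1 \<partial>\<mu>) * (\<integral>\<omega>. f (Z \<omega>) \<partial>N)\<bar> \<le> C * (3 * (1 + a)) * (0 + B) / real n"
    proof (rule C(2)[OF sp adm_weights(3) qm])
      have "(\<integral>x. 1 * (1 + s x ^ (2 * m)) \<partial>\<mu>) = 1 + (\<integral>x. s x ^ (2 * m) \<partial>\<mu>)"
        using int_s by (simp add: prob_space)
      also have "\<dots> \<le> 3 * (1 + a)" using M[of "2 * m", simplified] m an a by simp
      finally show "(\<integral>x. 1 * (1 + s x ^ (2 * m)) \<partial>\<mu>) \<le> 3 * (1 + a)" .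
      fix p assume p: "1 \<le> p" "p \<le> m"
      have M1: "\<bar>(\<integral>x. s x ^ p \<partial>\<mu>) - 1\<bar> \<le> a / real n" and M2: "\<bar>(\<integral>x. s x ^ (2 * p) \<partial>\<mu>) - 1\<bar> \<le> a / real n"
        using M[of p] M[of "2 * p"] p by auto
      have "(\<integral>x. 1 * (s x ^ p - 1) \<partial>\<mu>) = (\<integral>x. s x ^ p \<partial>\<mu>) - 1"
        using int_s by (simp add: prob_space)
      then show "\<bar>\<integral>x. 1 * (s x ^ p - 1) \<partial>\<mu>\<bar> \<le> 3 * (1 + a) / real n"
        using order_trans[OF M1 le[of a]] a by simp
      have "(s x ^ p - 1)\<^sup>2 = s x ^ (2 * p) - 2 * s x ^ p + 1" for x
        by (simp add: power2_diff power_mult[symmetric] mult.commute)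
      then have "(\<integral>x. 1 * (s x ^ p - 1)\<^sup>2 \<partial>\<mu>) = (\<integral>x. s x ^ (2 * p) \<partial>\<mu>) - 2 * (\<integral>x. s x ^ p \<partial>\<mu>) + 1"
        using int_s by (simp add: prob_space)
      also have "\<dots> \<le> 3 * a / real n" using M1 M2 by simp
      also have "\<dots> \<le> 3 * (1 + a) / real n" by (rule le) simp
      finally show "(\<integral>x. 1 * (s x ^ p - 1)\<^sup>2 \<partial>\<mu>) \<le> 3 * (1 + a) / real n" .
    qed auto
    moreover have "(\<Sum>i\<in>I. tau UNIV (q i) *\<^sub>R b i) = 0"
      using tau_range(3) by simp
    ultimately show "\<bar>(\<integral>x. f (\<Sum>i\<in>I. pw UNIV n (q i) (l i) x *\<^sub>R b i) \<partial>\<mu>) - (\<integral>\<omega>. f (Z \<omega>) \<partial>N)\<bar> \<le> C * 3 * (1 + a) * B / real n"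
      by (simp add: prob_space mult.assoc)
  qed
qed

context c2_bounded
begin

lemma lipschitz:
  assumes "\<And>y. norm (grad f y) \<le> B1"
  shows "\<bar>f u - f v\<bar> \<le> B1 * norm (u - v)"
proof -
  have B1: "0 \<le> B1" using assms[of 0] norm_ge_zero order_trans by blast
  have "norm (f u - f v) \<le> B1 * norm (u - v)"
  proof (rule differentiable_bound[where S = UNIV and f' = "\<lambda>x h. h \<bullet> grad f x"])
    show "onorm (\<lambda>h. h \<bullet> grad f x) \<le> B1" for x
    proof (rule onorm_bound[OF B1])
      show "norm (h \<bullet> grad f x) \<le> B1 * norm h" for h
        using Cauchy_Schwarz_ineq2[of h "grad f x"] mult_left_mono[OF assms[of x], of "norm h"] by (simp add: mult.commute)
    qed
  qed (use f_derivative in \<open>auto intro: has_derivative_at_withinI\<close>)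
  then show ?thesis by simp
qed

lemma expectation_diff_le:
  fixes Y :: "'z \<Rightarrow> 'e"
  assumes P: "prob_space P" and B1: "\<And>y. norm (grad f y) \<le> B1" and Y: "integrable P Y"
  shows "\<bar>(\<integral>\<omega>. f (Y \<omega>) \<partial>P) - f 0\<bar> \<le> B1 * (\<integral>\<omega>. norm (Y \<omega>) \<partial>P)"
proof -
  interpret prob_space P by (rule P)
  have [measurable]: "Y \<in> borel_measurable P" using Y by simp
  have i: "integrable P (\<lambda>\<omega>. f (Y \<omega>) - f 0)"
  proof (rule Bochner_Integration.integrable_bound)
    show "integrable P (\<lambda>\<omega>. B1 * norm (Y \<omega>))" using Y by simp
    show "AE \<omega> in P. norm (f (Y \<omega>) - f 0) \<le> norm (B1 * norm (Y \<omega>))"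
      using lipschitz[OF B1, of _ 0] order_trans[OF _ abs_ge_self] by auto
  qed measurable
  from Bochner_Integration.integrable_add[OF i integrable_const[of "f 0"]]
  have "integrable P (\<lambda>\<omega>. f (Y \<omega>))" by simp
  then have "\<bar>(\<integral>\<omega>. f (Y \<omega>) \<partial>P) - f 0\<bar> = \<bar>\<integral>\<omega>. f (Y \<omega>) - f 0 \<partial>P\<bar>"
    by (simp add: prob_space)
  also have "\<dots> \<le> (\<integral>\<omega>. \<bar>f (Y \<omega>) - f 0\<bar> \<partial>P)" by (rule integral_abs_bound)
  also have "\<dots> \<le> (\<integral>\<omega>. B1 * norm (Y \<omega>) \<partial>P)"
    using lipschitz[OF B1, of _ 0] Y i by (intro Bochner_Integration.integral_mono) auto
  finally show ?thesis by simp
qed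

end

text \<open>First absolute moment of the Gaussian vector, for the tail estimate and for 1 by 1
  matrices.\<close>

context gauss_vec
begin

lemma norm_le_sum_inner: "norm (v :: 'e) \<le> (\<Sum>i\<in>I. \<bar>v \<bullet> b i\<bar>)"
  using norm_le_l1[of v] sum.reindex_bij_betw[OF b, of "\<lambda>e. \<bar>v \<bullet> e\<bar>"] by simp

lemma expectation_norm_Z:
  assumes "\<And>i. i \<in> I \<Longrightarrow> (c i * s i)\<^sup>2 \<le> V"
  shows "integrable N (\<lambda>\<omega>. norm (Z \<omega>))" "(\<integral>\<omega>. norm (Z \<omega>) \<partial>N) \<le> real (card I) * (1 + V)"
proof -
  have le: "norm (Z \<omega>) \<le> (\<Sum>i\<in>I. 1 + (Z \<omega> \<bullet> b i)\<^sup>2)" for \<omega>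
  proof (rule order_trans[OF norm_le_sum_inner], intro sum_mono)
    show "\<bar>Z \<omega> \<bullet> b i\<bar> \<le> 1 + (Z \<omega> \<bullet> b i)\<^sup>2" for i
      using mult_le_squares[of 1 "\<bar>Z \<omega> \<bullet> b i\<bar>"] by simp
  qed
  have i: "integrable N (\<lambda>\<omega>. \<Sum>i\<in>I. 1 + (Z \<omega> \<bullet> b i)\<^sup>2)"
    using inner_square_integrable by simp
  show iz: "integrable N (\<lambda>\<omega>. norm (Z \<omega>))"
  proof (rule Bochner_Integration.integrable_bound[OF i])
    show "AE \<omega> in N. norm (norm (Z \<omega>)) \<le> norm (\<Sum>i\<in>I. 1 + (Z \<omega> \<bullet> b i)\<^sup>2)"
      using order_trans[OF le abs_ge_self] by simp
  qed measurable
  have "(\<integral>\<omega>. norm (Z \<omega>) \<partial>N) \<le> (\<integral>\<omega>. (\<Sum>i\<in>I. 1 + (Z \<omega> \<bullet> b i)\<^sup>2) \<partial>N)"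
    by (rule Bochner_Integration.integral_mono[OF iz i le])
  also have "\<dots> = (\<Sum>i\<in>I. 1 + (\<integral>\<omega>. (Z \<omega> \<bullet> b i)\<^sup>2 \<partial>N))"
    using inner_square_integrable by (subst Bochner_Integration.integral_sum) (auto simp: prob_space)
  also have "\<dots> \<le> (\<Sum>i\<in>I. 1 + V)"
    using assms by (intro sum_mono add_left_mono) (simp add: inner_second_moment)
  finally show "(\<integral>\<omega>. norm (Z \<omega>) \<partial>N) \<le> real (card I) * (1 + V)" by simp
qed

end

context smart_path
begin

lemma pb_W: "pb W"
  unfolding W_def[abs_def] by (intro pb_sum pb_scaleR pb_pw pb_const)

lemma pb_f_W: "pb (\<lambda>x. f (W x - v))"
proof (rule pb_dom)
  show "pb (\<lambda>x. (\<bar>f 0\<bar> + norm (grad f 0) + B) * (1 + norm (W x - v))\<^sup>2)"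
    by (intro pb_mult pb_power pb_add pb_norm pb_diff pb_W pb_const)
  have [measurable]: "W \<in> borel_measurable \<mu>" using pb_W by (rule pb_measurable)
  show "(\<lambda>x. f (W x - v)) \<in> borel_measurable \<mu>" by measurable
  show "norm (f (W x - v)) \<le> norm ((\<bar>f 0\<bar> + norm (grad f 0) + B) * (1 + norm (W x - v))\<^sup>2)" for x
    using order_trans[OF F.f_le[of "W x - v"] abs_ge_self] by simp
qed

lemma W_inner: "i \<in> I \<Longrightarrow> W x \<bullet> b i = pw K n (q i) (l i) x"
proof -
  assume i: "i \<in> I"
  have "W x \<bullet> b i = (\<Sum>j\<in>I. if j = i then pw K n (q i) (l i) x else 0)"
    unfolding W_def inner_sum_left using i by (intro sum.cong refl) (auto simp: G.b_inner)
  then show ?thesis using i G.finI by simp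
qed

lemma tv_inner: "i \<in> I \<Longrightarrow> tv \<bullet> b i = tau K (q i)"
proof -
  assume i: "i \<in> I"
  have "tv \<bullet> b i = (\<Sum>j\<in>I. if j = i then tau K (q i) else 0)"
    unfolding tv_def inner_sum_left using i by (intro sum.cong refl) (auto simp: G.b_inner)
  then show ?thesis using i G.finI by simp
qed

lemma f_Z_integrable: "integrable N (\<lambda>\<omega>. f (Z \<omega>))"
proof (rule Bochner_Integration.integrable_bound[OF integrable_mult_right[OF Z_poly_integrable]])
  show "AE \<omega> in N. norm (f (Z \<omega>)) \<le> norm ((\<bar>f 0\<bar> + norm (grad f 0) + B) * (1 + norm (Z \<omega>))\<^sup>2)"
    using order_trans[OF F.f_le abs_ge_self] by simp
qed measurable

end

text \<open>Three errors are added: replacing the mean of W by \<open>tv\<close>, the comparison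
  below the cut-off, and the tail, in which f - f 0 is controlled by the gradient bound and both the
  tail mass and the tail means of the traces are O(1/n).\<close>

theorem real_comparison:
  fixes m :: nat
  assumes m: "3 \<le> m"
  obtains C where "C \<ge> 0"
    "\<And>\<mu> n (N :: 'w measure) (X :: 'i \<Rightarrow> 'w \<Rightarrow> real) I sg c b Z (f :: 'e::euclidean_space \<Rightarrow> real) B B1 q l a.
      smart_path \<mu> n {True} N X I sg c b Z f B q l \<Longrightarrow> (\<And>i. i \<in> I \<Longrightarrow> q i \<le> m) \<Longrightarrow> 0 \<le> a \<Longrightarrow>
      (\<And>y. norm (grad f y) \<le> B1) \<Longrightarrow> (\<integral>x. (sr n {True} x)\<^sup>2 \<partial>\<mu>) = 1 \<Longrightarrow>
      (\<And>k. 1 \<le> k \<Longrightarrow> k \<le> m \<Longrightarrow> \<bar>(\<integral>x. sr n {True} x ^ k \<partial>\<mu>) - 1\<bar> \<le> a / real n) \<Longrightarrow>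
      \<bar>(\<integral>x. f ((\<Sum>i\<in>I. pw {True} n (q i) (l i) x *\<^sub>R b i) - (\<integral>x. (\<Sum>i\<in>I. pw {True} n (q i) (l i) x *\<^sub>R b i) \<partial>\<mu>)) \<partial>\<mu>)
        - (\<integral>\<omega>. f (Z \<omega>) \<partial>N)\<bar> \<le> C * (1 + a) * (B1 + B) / real n"
proof -
  define K where "K = {True}"
  have K: "K = {True} \<or> K = UNIV" by (simp add: K_def)
  obtain C where C: "C \<ge> 0"
    "\<And>\<mu> n (N :: 'w measure) (X :: 'i \<Rightarrow> 'w \<Rightarrow> real) I sg c b Z (f :: 'e \<Rightarrow> real) B q l r B1 C0.
      smart_path \<mu> n K N X I sg c b Z f B q l \<Longrightarrow> adm K n \<mu> r \<Longrightarrow> (\<And>i. i \<in> I \<Longrightarrow> q i \<le> m) \<Longrightarrow> 0 \<le> B1 \<Longrightarrow>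
      K = UNIV \<or> (\<forall>y. norm (grad f y) \<le> B1) \<Longrightarrow>
      (\<integral>x. r (nrm (ix n K) x) * (1 + sr n K x ^ (2 * m)) \<partial>\<mu>) \<le> C0 \<Longrightarrow>
      (\<And>p. 1 \<le> p \<Longrightarrow> p \<le> m \<Longrightarrow> \<bar>\<integral>x. r (nrm (ix n K) x) * (sr n K x ^ p - 1) \<partial>\<mu>\<bar> \<le> C0 / real n) \<Longrightarrow>
      (\<And>p. 1 \<le> p \<Longrightarrow> p \<le> m \<Longrightarrow> (\<integral>x. r (nrm (ix n K) x) * (sr n K x ^ p - 1)\<^sup>2 \<partial>\<mu>) \<le> C0 / real n) \<Longrightarrow>
      \<bar>(\<integral>x. r (nrm (ix n K) x) * f ((\<Sum>i\<in>I. pw K n (q i) (l i) x *\<^sub>R b i) - (\<Sum>i\<in>I. tau K (q i) *\<^sub>R b i)) \<partial>\<mu>)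
        - (\<integral>x. r (nrm (ix n K) x) \<partial>\<mu>) * (\<integral>\<omega>. f (Z \<omega>) \<partial>N)\<bar> \<le> C * C0 * (B1 + B) / real n"
    by (rule weighted_comparison[OF K, of m]) blast
  obtain C1 where C1: "C1 \<ge> 0"
    "\<And>n \<mu> r p. K = {True} \<Longrightarrow> adm K n \<mu> r \<Longrightarrow> 1 \<le> p \<Longrightarrow> p \<le> m \<Longrightarrow>
      (\<integral>x. r (nrm (ix n K) x) * \<bar>kerR K n p True x\<bar> \<partial>\<mu>)
      \<le> C1 / real n * (\<integral>x. r (nrm (ix n K) x) * (1 + sr n K x ^ (2 * m)) \<partial>\<mu>)"
    by (rule kernel_bounds[OF K, of m]) blast
  have cw1: "cw (adj (replicate p True)) = cw (replicate p True)" for p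
    using cw_adj_alternating[of p True 0] by simp
  have "LB K m (\<lambda>n x. \<Sum>p\<in>{1..m}. sr n K x ^ 0 * norm (fl K (replicate p True) n x))"
    \<comment> \<open>Degree m, not 2m, in the radius: this sharpness of \<open>LB_fl\<close> is
      what the tail estimate by s^m can match.\<close>
    by (intro LB_sum LB_fl K cw1) auto
  then obtain CF where CF: "CF \<ge> 0" "\<And>n \<mu> r. adm K n \<mu> r \<Longrightarrow>
     (\<integral>x. r (nrm (ix n K) x) * (\<Sum>p\<in>{1..m}. sr n K x ^ 0 * norm (fl K (replicate p True) n x)) \<partial>\<mu>)
       \<le> CF * (\<integral>x. r (nrm (ix n K) x) * (1 + sr n K x ^ m) \<partial>\<mu>)"
    unfolding LB_def by blast
  define D where "D = real DIM('e)"
  define E where "E = C1 * (1 + 2 ^ (2 * m)) + 8 * CF + 5"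
  define C0 where "C0 = 6 + 2 ^ (2 * m) + 2 * (real m * 2 ^ m)\<^sup>2"
  define C' where "C' = D * E + C * C0 + (D * (8 * CF + 4) + 4 * (D * (1 + real m)))"
  have D0: "0 \<le> D" by (simp add: D_def)
  have E0: "0 \<le> E" using C1 CF by (simp add: E_def)
  show ?thesis
  proof (rule that[of C'])
    show "0 \<le> C'" using C(1) CF(1) D0 E0 by (auto simp: C'_def C0_def)
    fix \<mu> n and N :: "'w measure" and X :: "'i \<Rightarrow> 'w \<Rightarrow> real" and I sg c b Z and f :: "'e \<Rightarrow> real" and B B1 q l a
    assume sp': "smart_path \<mu> n {True} N X I sg c b Z f B q l" and qm: "\<And>i. i \<in> I \<Longrightarrow> q i \<le> m" and a: "0 \<le> a"
      and B1: "\<And>y. norm (grad f y) \<le> B1" and two': "(\<integral>x. (sr n {True} x)\<^sup>2 \<partial>\<mu>) = 1"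
      and M': "\<And>k. 1 \<le> k \<Longrightarrow> k \<le> m \<Longrightarrow> \<bar>(\<integral>x. sr n {True} x ^ k \<partial>\<mu>) - 1\<bar> \<le> a / real n"
    have sp: "smart_path \<mu> n K N X I sg c b Z f B q l" using sp' by (simp add: K_def)
    interpret smart_path \<mu> n K N X I sg c b Z f B q l by (rule sp)
    have two: "(\<integral>x. (s x)\<^sup>2 \<partial>\<mu>) = 1" using two' by (simp add: K_def)
    have M: "\<bar>(\<integral>x. s x ^ k \<partial>\<mu>) - 1\<bar> \<le> a / real n" if "1 \<le> k" "k \<le> m" for k using M'[OF that] by (simp add: K_def)
    have n1: "1 \<le> real n" using n_pos by simp
    have B10: "0 \<le> B1" using B1[of 0] norm_ge_zero order_trans by blast
    have cI: "real (card I) = D" using bij_betw_same_card[OF G.b] by (simp add: D_def)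
    have tm: "(\<integral>x. hi x * s x ^ m \<partial>\<mu>) \<le> 4 * a / real n"
      "\<And>p. 1 \<le> p \<Longrightarrow> p \<le> m \<Longrightarrow> \<bar>\<integral>x. lo x * (s x ^ p - 1) \<partial>\<mu>\<bar> \<le> 5 * a / real n"
      "\<And>p. 1 \<le> p \<Longrightarrow> p \<le> m \<Longrightarrow> (\<integral>x. lo x * (s x ^ p - 1)\<^sup>2 \<partial>\<mu>) \<le> (real m * 2 ^ m)\<^sup>2 * (2 * a) / real n"
      "(\<integral>x. lo x * (1 + s x ^ (2 * m)) \<partial>\<mu>) \<le> 1 + 2 ^ (2 * m)"
      using truncated_moments[OF m a two] M by blast+
    have var: "(c i * sg i)\<^sup>2 \<le> real m" if "i \<in> I" for i
      using variance[OF that] qm[OF that] by (simp add: K_def)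
    have lT: "l i = True" if "i \<in> I" for i using l_K[OF that] by (auto simp: K_def)
    have hi_le: "(\<integral>x. hi x * (1 + s x ^ m) \<partial>\<mu>) \<le> 8 * a / real n" "(\<integral>x. hi x \<partial>\<mu>) \<le> 4 * a / real n"
      "1 \<le> p \<Longrightarrow> p \<le> m \<Longrightarrow> (\<integral>x. hi x * s x ^ p \<partial>\<mu>) \<le> 4 * a / real n" for p
    proof -
      have mono: "s x ^ j \<le> s x ^ m" if "2 < s x" "j \<le> m" for x j
        using that by (intro power_increasing) auto
      have one: "1 \<le> s x ^ m" if "2 < s x" for x using that by (intro one_le_power) auto
      have "(\<integral>x. hi x * (1 + s x ^ m) \<partial>\<mu>) \<le> (\<integral>x. 2 * (hi x * s x ^ m) \<partial>\<mu>)"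
        using one by (intro Bochner_Integration.integral_mono pb_integrable pb_mult pb_hi pb_add pb_const pb_power pb_sr)
          (auto simp: hi_s not_le)
      then show "(\<integral>x. hi x * (1 + s x ^ m) \<partial>\<mu>) \<le> 8 * a / real n" using tm(1) by simp
      have "(\<integral>x. hi x \<partial>\<mu>) \<le> (\<integral>x. hi x * s x ^ m \<partial>\<mu>)"
        using one by (intro Bochner_Integration.integral_mono pb_integrable pb_mult pb_hi pb_power pb_sr) (auto simp: hi_s not_le)
      then show "(\<integral>x. hi x \<partial>\<mu>) \<le> 4 * a / real n" using tm(1) by linarith
      assume "1 \<le> p" "p \<le> m"
      then have "(\<integral>x. hi x * s x ^ p \<partial>\<mu>) \<le> (\<integral>x. hi x * s x ^ m \<partial>\<mu>)"
        using mono by (intro Bochner_Integration.integral_mono pb_integrable pb_mult pb_hi pb_power pb_sr) (auto simp: hi_s not_le)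
      then show "(\<integral>x. hi x * s x ^ p \<partial>\<mu>) \<le> 4 * a / real n" using tm(1) by linarith
    qed
    have pwhi: "(\<integral>x. hi x * \<bar>pw K n (q i) (l i) x\<bar> \<partial>\<mu>) \<le> CF * (8 * a / real n)" if i: "i \<in> I" for i
    proof -
      have "(\<integral>x. hi x * \<bar>pw K n (q i) (l i) x\<bar> \<partial>\<mu>)
          \<le> (\<integral>x. hi x * (\<Sum>p\<in>{1..m}. s x ^ 0 * norm (fl K (replicate p True) n x)) \<partial>\<mu>)"
      proof (intro weighted_mono low_high pb_hi pb_sum pb_mult pb_power pb_sr pb_norm pb_fl)
        show "pb (\<lambda>x. \<bar>pw K n (q i) (l i) x\<bar>)" using pb_norm[OF pb_pw] by simp
        fix x
        have "norm (fl K (replicate (q i) True) n x) \<le> (\<Sum>p\<in>{1..m}. norm (fl K (replicate p True) n x))"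
          using q_pos[OF i] qm[OF i] by (intro member_le_sum[where f = "\<lambda>p. norm (fl K (replicate p True) n x)"]) auto
        then show "\<bar>pw K n (q i) (l i) x\<bar> \<le> (\<Sum>p\<in>{1..m}. s x ^ 0 * norm (fl K (replicate p True) n x))"
          using abs_pw_le[OF q_pos[OF i], of K n "l i" x] by simp
      qed
      also have "\<dots> \<le> CF * (\<integral>x. hi x * (1 + s x ^ m) \<partial>\<mu>)"
        by (rule CF(2)[OF adm_weights(2)])
      also have "\<dots> \<le> CF * (8 * a / real n)" by (rule mult_left_mono[OF hi_le(1) CF(1)])
      finally show ?thesis .
    qed
    define EW where "EW = (\<integral>x. W x \<partial>\<mu>)"
    have EWtv: "norm (EW - tv) \<le> D * (E * (1 + a) / real n)"
    proof -
      have "\<bar>(EW - tv) \<bullet> b i\<bar> \<le> E * (1 + a) / real n" if i: "i \<in> I" for i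
      proof -
        note qi = q_pos[OF i] qm[OF i]
        have EWi: "EW \<bullet> b i = (\<integral>x. pw K n (q i) (l i) x \<partial>\<mu>)"
          unfolding EW_def W_inner[OF i, symmetric] using pb_integrable[OF pb_W] by simp
        have wt_int: "(\<integral>x. wt i x \<partial>\<mu>) = (\<integral>x. pw K n (q i) (l i) x \<partial>\<mu>) - tau K (q i) * (\<integral>x. s x ^ q i \<partial>\<mu>)"
          unfolding wt_def using int_s pb_integrable[OF pb_pw] by simp
        have e: "(EW - tv) \<bullet> b i = (\<integral>x. wt i x \<partial>\<mu>) + tau K (q i) * ((\<integral>x. s x ^ q i \<partial>\<mu>) - 1)"
          unfolding inner_diff_left EWi tv_inner[OF i] wt_int by (simp add: algebra_simps)
        have i1: "integrable \<mu> (\<lambda>x. lo x * wt i x)" "integrable \<mu> (\<lambda>x. hi x * wt i x)"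
          by (intro pb_integrable pb_mult pb_lo pb_hi pb_wt)+
        have split: "(\<integral>x. wt i x \<partial>\<mu>) = (\<integral>x. lo x * wt i x \<partial>\<mu>) + (\<integral>x. hi x * wt i x \<partial>\<mu>)"
          unfolding Bochner_Integration.integral_add[OF i1, symmetric] distrib_right[symmetric] low_high by simp
        have A: "\<bar>\<integral>x. lo x * wt i x \<partial>\<mu>\<bar> \<le> C1 * (1 + 2 ^ (2 * m)) / real n"
        proof -
          \<comment> \<open>The Stein identity for the constant test function has no derivative term
            and computes the truncated mean of a trace.\<close>
          have "(\<integral>x. lo x * (wt i x * 1) \<partial>\<mu>) = (\<integral>x. lo x * (kerR K n (q i) (l i) x * 1 + (\<Sum>e\<in>{}. kerA K n (q i) (l i) (q e) (l e) x * 0)) \<partial>\<mu>)"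
            unfolding wt_def
            by (rule stein_identity[OF pb_lo, where E = "{}" and H = "\<lambda>x. 1" and h = "\<lambda>e x. 0"])
              (use tdiff_const[of "ix n K" "1::real"] q_pos[OF i] in auto)
          then have "\<bar>\<integral>x. lo x * wt i x \<partial>\<mu>\<bar> = \<bar>\<integral>x. lo x * kerR K n (q i) True x \<partial>\<mu>\<bar>" by (simp add: lT[OF i])
          also have "\<dots> \<le> (\<integral>x. \<bar>lo x * kerR K n (q i) True x\<bar> \<partial>\<mu>)" by (rule integral_abs_bound)
          also have "\<dots> = (\<integral>x. lo x * \<bar>kerR K n (q i) True x\<bar> \<partial>\<mu>)" by (simp add: abs_mult low_high)
          also have "\<dots> \<le> C1 / real n * (\<integral>x. lo x * (1 + s x ^ (2 * m)) \<partial>\<mu>)"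
            by (rule C1(2)[OF K_def adm_weights(1) qi])
          also have "\<dots> \<le> C1 / real n * (1 + 2 ^ (2 * m))"
            using C1(1) by (intro mult_left_mono tm(4)) auto
          finally show ?thesis by simp
        qed
        have H: "\<bar>\<integral>x. hi x * wt i x \<partial>\<mu>\<bar> \<le> CF * (8 * a / real n) + 4 * a / real n"
        proof -
          have "\<bar>\<integral>x. hi x * wt i x \<partial>\<mu>\<bar> \<le> (\<integral>x. \<bar>hi x * wt i x\<bar> \<partial>\<mu>)" by (rule integral_abs_bound)
          also have "\<dots> \<le> (\<integral>x. hi x * \<bar>pw K n (q i) (l i) x\<bar> + hi x * s x ^ q i \<partial>\<mu>)"
          proof (intro Bochner_Integration.integral_mono integrable_abs i1 pb_integrable pb_add pb_mult pb_hi pb_power pb_sr)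
            show "pb (\<lambda>x. \<bar>pw K n (q i) (l i) x\<bar>)" using pb_norm[OF pb_pw] by simp
            fix x
            have "\<bar>tau K (q i) * s x ^ q i\<bar> \<le> s x ^ q i"
              using tau_range[of "q i"] sr_nonneg[of n K x] by (simp add: abs_mult mult_left_le_one_le)
            then have "\<bar>wt i x\<bar> \<le> \<bar>pw K n (q i) (l i) x\<bar> + s x ^ q i" unfolding wt_def by linarith
            then show "\<bar>hi x * wt i x\<bar> \<le> hi x * \<bar>pw K n (q i) (l i) x\<bar> + hi x * s x ^ q i"
              using low_high(3) by (simp add: abs_mult mult_left_mono flip: distrib_left)
          qed
          also have "\<dots> = (\<integral>x. hi x * \<bar>pw K n (q i) (l i) x\<bar> \<partial>\<mu>) + (\<integral>x. hi x * s x ^ q i \<partial>\<mu>)"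
          proof (intro Bochner_Integration.integral_add pb_integrable pb_mult pb_hi pb_power pb_sr)
            show "pb (\<lambda>x. \<bar>pw K n (q i) (l i) x\<bar>)" using pb_norm[OF pb_pw] by simp
          qed
          finally show ?thesis using pwhi[OF i] hi_le(3)[OF qi] by linarith
        qed
        have T: "\<bar>tau K (q i) * ((\<integral>x. s x ^ q i \<partial>\<mu>) - 1)\<bar> \<le> a / real n"
        proof -
          have "\<bar>tau K (q i)\<bar> * \<bar>(\<integral>x. s x ^ q i \<partial>\<mu>) - 1\<bar> \<le> 1 * (a / real n)"
            using tau_range[of "q i"] M[OF qi] by (intro mult_mono) auto
          then show ?thesis by (simp add: abs_mult)
        qed
        have "\<bar>(EW - tv) \<bullet> b i\<bar> \<le> (C1 * (1 + 2 ^ (2 * m)) + (8 * CF + 5) * a) / real n"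
        proof -
          have e': "P / real n + (CF * (8 * a / real n) + 4 * a / real n) + a / real n = (P + (8 * CF + 5) * a) / real n" for P
            by (simp add: add_divide_distrib distrib_right)
          have "\<bar>u + v + w\<bar> \<le> \<bar>u\<bar> + \<bar>v\<bar> + \<bar>w\<bar>" for u v w :: real by linarith
          then show ?thesis unfolding e split e'[symmetric] by (rule order_trans) (intro add_mono A H T)
        qed
        also have "\<dots> \<le> E * (1 + a) / real n"
        proof (intro divide_right_mono)
          have "0 \<le> C1 * (1 + 2 ^ (2 * m)) * a" "0 \<le> 8 * CF + 5" using C1(1) CF(1) a by auto
          then show "C1 * (1 + 2 ^ (2 * m)) + (8 * CF + 5) * a \<le> E * (1 + a)"
            unfolding E_def distrib_left distrib_right by linarith
        qed simp
        finally show ?thesis .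
      qed
      then have "(\<Sum>i\<in>I. \<bar>(EW - tv) \<bullet> b i\<bar>) \<le> (\<Sum>i\<in>I. E * (1 + a) / real n)" by (intro sum_mono)
      then show ?thesis using G.norm_le_sum_inner[of "EW - tv"] cI by simp
    qed
    have S1: "\<bar>(\<integral>x. f (W x - EW) \<partial>\<mu>) - (\<integral>x. f (W x - tv) \<partial>\<mu>)\<bar> \<le> B1 * (D * (E * (1 + a) / real n))"
    proof -
      have id: "integrable \<mu> (\<lambda>x. f (W x - EW) - f (W x - tv))"
        by (intro pb_integrable pb_diff pb_f_W)
      have "(\<integral>x. f (W x - EW) \<partial>\<mu>) - (\<integral>x. f (W x - tv) \<partial>\<mu>) = (\<integral>x. f (W x - EW) - f (W x - tv) \<partial>\<mu>)"
        by (intro Bochner_Integration.integral_diff[symmetric] pb_integrable pb_f_W)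
      then have "\<bar>(\<integral>x. f (W x - EW) \<partial>\<mu>) - (\<integral>x. f (W x - tv) \<partial>\<mu>)\<bar> \<le> (\<integral>x. \<bar>f (W x - EW) - f (W x - tv)\<bar> \<partial>\<mu>)"
        using integral_abs_bound by simp
      also have "\<dots> \<le> (\<integral>x. B1 * norm (EW - tv) \<partial>\<mu>)"
      proof (intro Bochner_Integration.integral_mono integrable_abs id integrable_const)
        show "\<bar>f (W x - EW) - f (W x - tv)\<bar> \<le> B1 * norm (EW - tv)" for x
          using F.lipschitz[OF B1, of "W x - EW" "W x - tv"] by (simp add: norm_minus_commute)
      qed
      also have "\<dots> \<le> B1 * (D * (E * (1 + a) / real n))"
        using mult_left_mono[OF EWtv B10] by (simp add: prob_space)
      finally show ?thesis .
    qed
    have S2: "\<bar>(\<integral>x. lo x * f (W x - tv) \<partial>\<mu>) - (\<integral>x. lo x \<partial>\<mu>) * (\<integral>\<omega>. f (Z \<omega>) \<partial>N)\<bar> \<le> C * (C0 * (1 + a)) * (B1 + B) / real n"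
      unfolding W_def tv_def
    proof (rule C(2)[OF sp adm_weights(1) qm B10])
      have le: "x / real n \<le> C0 * (1 + a) / real n" if "x \<le> C0 * (1 + a)" for x
        using that n1 by (intro divide_right_mono) auto
      let ?Q = "(real m * 2 ^ m)\<^sup>2"
      have Q: "0 \<le> ?Q" "0 \<le> ?Q * a" "0 \<le> (2::real) ^ (2 * m) * a" using a by auto
      have CA: "C0 * (1 + a) = 6 + 2 ^ (2 * m) + 2 * ?Q + 6 * a + 2 ^ (2 * m) * a + 2 * (?Q * a)"
        by (simp add: C0_def algebra_simps)
      have "1 + 2 ^ (2 * m) \<le> C0 * (1 + a)" unfolding CA using Q a by linarith
      then show "(\<integral>x. lo x * (1 + s x ^ (2 * m)) \<partial>\<mu>) \<le> C0 * (1 + a)" using tm(4) by linarith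
      fix p assume p: "1 \<le> p" "p \<le> m"
      have "5 * a \<le> C0 * (1 + a)" unfolding CA using Q a zero_le_power[of "2::real" "2 * m"] by linarith
      then show "\<bar>\<integral>x. lo x * (s x ^ p - 1) \<partial>\<mu>\<bar> \<le> C0 * (1 + a) / real n" using tm(2)[OF p] le[of "5 * a"] by linarith
      have "?Q * (2 * a) \<le> C0 * (1 + a)" unfolding CA using Q a zero_le_power[of "2::real" "2 * m"] by linarith
      then show "(\<integral>x. lo x * (s x ^ p - 1)\<^sup>2 \<partial>\<mu>) \<le> C0 * (1 + a) / real n" using tm(3)[OF p] le[of "?Q * (2 * a)"] by linarith
    qed (use B1 in auto)
    have S3: "\<bar>(\<integral>x. hi x * f (W x - tv) \<partial>\<mu>) - (\<integral>x. hi x \<partial>\<mu>) * (\<integral>\<omega>. f (Z \<omega>) \<partial>N)\<bar>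
        \<le> B1 * ((D * (8 * CF + 4) + 4 * (D * (1 + real m))) * a / real n)"
    proof -
      have i1: "integrable \<mu> (\<lambda>x. hi x * f (W x - tv))" "integrable \<mu> (\<lambda>x. hi x)"
        by (intro pb_integrable pb_mult pb_hi pb_f_W)+
      have i2: "integrable \<mu> (\<lambda>x. hi x * (f (W x - tv) - f 0))"
        by (intro pb_integrable pb_mult pb_hi pb_diff pb_f_W pb_const)
      have pa: "pb (\<lambda>x. \<bar>pw K n (q i) (l i) x\<bar>)" for i using pb_norm[OF pb_pw] by simp
      \<comment> \<open>Subtracting \<open>f 0\<close> on both sides changes nothing, as the two
        terms carry the same mass, and makes the Lipschitz bound applicable.\<close>
      have "(\<integral>x. hi x * f (W x - tv) \<partial>\<mu>) - (\<integral>x. hi x \<partial>\<mu>) * (\<integral>\<omega>. f (Z \<omega>) \<partial>N)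
          = (\<integral>x. hi x * (f (W x - tv) - f 0) \<partial>\<mu>) - (\<integral>x. hi x \<partial>\<mu>) * ((\<integral>\<omega>. f (Z \<omega>) \<partial>N) - f 0)"
        using i1 by (simp add: right_diff_distrib)
      moreover have "\<bar>\<integral>x. hi x * (f (W x - tv) - f 0) \<partial>\<mu>\<bar> \<le> B1 * (D * (CF * (8 * a / real n) + 4 * a / real n))"
      proof -
        have "\<bar>\<integral>x. hi x * (f (W x - tv) - f 0) \<partial>\<mu>\<bar> \<le> (\<integral>x. \<bar>hi x * (f (W x - tv) - f 0)\<bar> \<partial>\<mu>)"
          by (rule integral_abs_bound)
        also have "\<dots> \<le> (\<integral>x. B1 * (\<Sum>i\<in>I. hi x * \<bar>pw K n (q i) (l i) x\<bar> + hi x) \<partial>\<mu>)"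
        proof (intro Bochner_Integration.integral_mono integrable_abs i2 pb_integrable pb_mult pb_const pb_sum pb_add pb_hi pa)
          fix x
          have "norm (W x - tv) \<le> (\<Sum>i\<in>I. \<bar>(W x - tv) \<bullet> b i\<bar>)" by (rule G.norm_le_sum_inner)
          also have "\<dots> \<le> (\<Sum>i\<in>I. \<bar>pw K n (q i) (l i) x\<bar> + 1)"
          proof (intro sum_mono)
            fix i assume i: "i \<in> I"
            show "\<bar>(W x - tv) \<bullet> b i\<bar> \<le> \<bar>pw K n (q i) (l i) x\<bar> + 1"
              using tau_range[of "q i"] unfolding inner_diff_left W_inner[OF i] tv_inner[OF i] by linarith
          qed
          finally have "hi x * norm (W x - tv) \<le> hi x * (\<Sum>i\<in>I. \<bar>pw K n (q i) (l i) x\<bar> + 1)"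
            using low_high(3) by (rule mult_left_mono)
          also have "\<dots> = (\<Sum>i\<in>I. hi x * \<bar>pw K n (q i) (l i) x\<bar> + hi x)"
            by (simp add: sum_distrib_left distrib_left)
          finally have h: "B1 * (hi x * norm (W x - tv)) \<le> B1 * (\<Sum>i\<in>I. hi x * \<bar>pw K n (q i) (l i) x\<bar> + hi x)"
            using B10 by (rule mult_left_mono)
          have "\<bar>hi x * (f (W x - tv) - f 0)\<bar> \<le> hi x * (B1 * norm (W x - tv))"
            using F.lipschitz[OF B1, of "W x - tv" 0] low_high(3) by (simp add: abs_mult mult_left_mono)
          then show "\<bar>hi x * (f (W x - tv) - f 0)\<bar> \<le> B1 * (\<Sum>i\<in>I. hi x * \<bar>pw K n (q i) (l i) x\<bar> + hi x)"
            using h by (simp add: mult.left_commute)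
        qed
        also have "\<dots> = B1 * (\<Sum>i\<in>I. (\<integral>x. hi x * \<bar>pw K n (q i) (l i) x\<bar> \<partial>\<mu>) + (\<integral>x. hi x \<partial>\<mu>))"
        proof -
          have "integrable \<mu> (\<lambda>x. hi x * \<bar>pw K n (q i) (l i) x\<bar>)" for i
            by (intro pb_integrable pb_mult pb_hi pa)
          then show ?thesis using i1(2) by (simp add: Bochner_Integration.integral_sum)
        qed
        also have "\<dots> \<le> B1 * (\<Sum>i\<in>I. CF * (8 * a / real n) + 4 * a / real n)"
          by (intro mult_left_mono sum_mono add_mono pwhi hi_le(2) B10)
        finally show ?thesis using cI by simp
      qed
      moreover have "\<bar>(\<integral>x. hi x \<partial>\<mu>) * ((\<integral>\<omega>. f (Z \<omega>) \<partial>N) - f 0)\<bar> \<le> (4 * a / real n) * (B1 * (D * (1 + real m)))"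
      proof -
        have "(\<integral>\<omega>. f (Z \<omega>) \<partial>N) - f 0 = (\<integral>\<omega>. f (Z \<omega>) - f 0 \<partial>N)"
          using f_Z_integrable by (simp add: G.prob_space)
        then have "\<bar>(\<integral>\<omega>. f (Z \<omega>) \<partial>N) - f 0\<bar> \<le> (\<integral>\<omega>. \<bar>f (Z \<omega>) - f 0\<bar> \<partial>N)"
          using integral_abs_bound by simp
        also have "\<dots> \<le> (\<integral>\<omega>. B1 * norm (Z \<omega>) \<partial>N)"
          using F.lipschitz[OF B1, of _ 0] f_Z_integrable G.expectation_norm_Z(1)[OF var]
          by (intro Bochner_Integration.integral_mono) auto
        also have "\<dots> \<le> B1 * (D * (1 + real m))"
          using mult_left_mono[OF G.expectation_norm_Z(2)[OF var] B10] cI by simp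
        finally have z: "\<bar>(\<integral>\<omega>. f (Z \<omega>) \<partial>N) - f 0\<bar> \<le> B1 * (D * (1 + real m))" .
        have "0 \<le> (\<integral>x. hi x \<partial>\<mu>)" using low_high(3) by (intro integral_nonneg_AE) auto
        then have "\<bar>\<integral>x. hi x \<partial>\<mu>\<bar> \<le> 4 * a / real n" using hi_le(2) by simp
        then show ?thesis unfolding abs_mult using z a by (intro mult_mono) auto
      qed
      moreover have "B1 * (D * (CF * (8 * a / real n) + 4 * a / real n)) + (4 * a / real n) * (B1 * (D * (1 + real m)))
          = B1 * ((D * (8 * CF + 4) + 4 * (D * (1 + real m))) * a / real n)"
        by (simp add: add_divide_distrib distrib_left distrib_right mult_ac)
      ultimately show ?thesis by linarith
    qed
    have "(\<integral>x. f (W x - tv) \<partial>\<mu>) = (\<integral>x. lo x * f (W x - tv) \<partial>\<mu>) + (\<integral>x. hi x * f (W x - tv) \<partial>\<mu>)"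
      "(\<integral>\<omega>. f (Z \<omega>) \<partial>N) = (\<integral>x. lo x \<partial>\<mu>) * (\<integral>\<omega>. f (Z \<omega>) \<partial>N) + (\<integral>x. hi x \<partial>\<mu>) * (\<integral>\<omega>. f (Z \<omega>) \<partial>N)"
    proof -
      have i: "integrable \<mu> (\<lambda>x. lo x * f (W x - tv))" "integrable \<mu> (\<lambda>x. hi x * f (W x - tv))"
        "integrable \<mu> (\<lambda>x. lo x)" "integrable \<mu> (\<lambda>x. hi x)"
        by (intro pb_integrable pb_mult pb_lo pb_hi pb_f_W)+
      show "(\<integral>x. f (W x - tv) \<partial>\<mu>) = (\<integral>x. lo x * f (W x - tv) \<partial>\<mu>) + (\<integral>x. hi x * f (W x - tv) \<partial>\<mu>)"
        unfolding Bochner_Integration.integral_add[OF i(1,2), symmetric] distrib_right[symmetric] low_high by simp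
      show "(\<integral>\<omega>. f (Z \<omega>) \<partial>N) = (\<integral>x. lo x \<partial>\<mu>) * (\<integral>\<omega>. f (Z \<omega>) \<partial>N) + (\<integral>x. hi x \<partial>\<mu>) * (\<integral>\<omega>. f (Z \<omega>) \<partial>N)"
        unfolding distrib_right[symmetric] Bochner_Integration.integral_add[OF i(3,4), symmetric] low_high by (simp add: prob_space)
    qed
    then have "\<bar>(\<integral>x. f (W x - EW) \<partial>\<mu>) - (\<integral>\<omega>. f (Z \<omega>) \<partial>N)\<bar>
        \<le> B1 * (D * (E * (1 + a) / real n)) + C * (C0 * (1 + a)) * (B1 + B) / real n
          + B1 * ((D * (8 * CF + 4) + 4 * (D * (1 + real m))) * a / real n)"
      using S1 S2 S3 by linarith
    also have "\<dots> = (B1 * (D * E * (1 + a)) + C * C0 * (1 + a) * (B1 + B)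
          + B1 * ((D * (8 * CF + 4) + 4 * (D * (1 + real m))) * a)) / real n"
      by (simp add: add_divide_distrib mult.assoc)
    also have "\<dots> \<le> C' * (1 + a) * (B1 + B) / real n"
    proof (intro divide_right_mono)
      define F' where "F' = D * (8 * CF + 4) + 4 * (D * (1 + real m))"
      have F0: "0 \<le> F'" using D0 CF(1) by (simp add: F'_def)
      have "B1 * (D * E * (1 + a)) \<le> (B1 + B) * (D * E * (1 + a))"
        using F.B_nonneg D0 E0 a by (intro mult_right_mono) auto
      moreover have "B1 * (F' * a) \<le> (B1 + B) * (F' * (1 + a))"
        using F.B_nonneg B10 F0 a by (intro mult_mono) auto
      moreover have "C' * (1 + a) * (B1 + B) = (B1 + B) * (D * E * (1 + a)) + C * C0 * (1 + a) * (B1 + B) + (B1 + B) * (F' * (1 + a))"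
        unfolding C'_def F'_def[symmetric] by (simp add: algebra_simps)
      ultimately show "B1 * (D * E * (1 + a)) + C * C0 * (1 + a) * (B1 + B)
          + B1 * ((D * (8 * CF + 4) + 4 * (D * (1 + real m))) * a) \<le> C' * (1 + a) * (B1 + B)"
        unfolding F'_def[symmetric] by linarith
    qed simp
    finally have fin: "\<bar>(\<integral>x. f (W x - EW) \<partial>\<mu>) - (\<integral>\<omega>. f (Z \<omega>) \<partial>N)\<bar> \<le> C' * (1 + a) * (B1 + B) / real n" .
    show "\<bar>(\<integral>x. f ((\<Sum>i\<in>I. pw {True} n (q i) (l i) x *\<^sub>R b i) - (\<integral>x. (\<Sum>i\<in>I. pw {True} n (q i) (l i) x *\<^sub>R b i) \<partial>\<mu>)) \<partial>\<mu>)
        - (\<integral>\<omega>. f (Z \<omega>) \<partial>N)\<bar> \<le> C' * (1 + a) * (B1 + B) / real n"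
      using fin[unfolded EW_def W_def[abs_def]] unfolding K_def .
  qed
qed

section \<open>From random matrices to laws on real coordinates\<close>

section \<open>Random matrices in coordinates\<close>

lemma sum_rot_mult:
  assumes "finite C" "a \<in> C" "b \<in> C" "a \<noteq> b"
  shows "(\<Sum>c\<in>C. rot a b t x c * rot a b t y c) = (\<Sum>c\<in>C. x c * y c)"
proof -
  define D where "D = C - {a, b}"
  have C: "C = insert a (insert b D)" "finite D" "a \<notin> insert b D" "b \<notin> D"
    using assms by (auto simp: D_def)
  have D: "(\<Sum>c\<in>D. rot a b t x c * rot a b t y c) = (\<Sum>c\<in>D. x c * y c)"
    by (intro sum.cong refl) (auto simp: D_def rot_def)
  have "(cc * xa - ss * xb) * (cc * ya - ss * yb) + (ss * xa + cc * xb) * (ss * ya + cc * yb)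
      = (ss\<^sup>2 + cc\<^sup>2) * (xa * ya + xb * yb)" for cc ss xa xb ya yb :: real
    by (simp add: power2_eq_square algebra_simps)
  from this[of "cos t" "x a" "sin t" "x b" "y a" "y b"]
  have "rot a b t x a * rot a b t y a + rot a b t x b * rot a b t y b = x a * y a + x b * y b"
    using assms(4) by (simp add: rot_def)
  then show ?thesis
    unfolding C(1) using C(2-4) D by simp
qed

lemma mat_adjoint_index:
  "B \<in> carrier_mat n n \<Longrightarrow> i < n \<Longrightarrow> j < n \<Longrightarrow> mat_adjoint B $$ (j, i) = conjugate (B $$ (i, j))"
  by (simp add: mat_adjoint_def mat_of_rows_index)

lemma mat_trace_mult:
  assumes "A \<in> carrier_mat n n" "B \<in> carrier_mat n n"
  shows "mat_trace (A * mat_adjoint B) = (\<Sum>i<n. \<Sum>j<n. A $$ (i, j) * conjugate (B $$ (i, j)))"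
proof -
  have B: "mat_adjoint B \<in> carrier_mat n n" using assms(2) by (auto simp: mat_adjoint_def)
  have "(A * mat_adjoint B) $$ (i, i) = (\<Sum>j<n. A $$ (i, j) * conjugate (B $$ (i, j)))" if "i < n" for i
    using assms B that by (auto simp: scalar_prod_def atLeast0LessThan mat_adjoint_index intro!: sum.cong)
  then show ?thesis using assms(1) by (simp add: mat_trace_def)
qed

text \<open>Real and complex entries at once: \<open>e\<close> reads off the real coordinates of an
  entry, \<open>u\<close> is the dual basis, and \<open>emb\<close> places the entry in the complex
  numbers, where the words are evaluated.\<close>

locale entry_coords =
  fixes K :: "bool set"
    and e :: "'a::{conjugatable_field, real_normed_field, real_inner, second_countable_topology} \<Rightarrow> bool \<Rightarrow> real"
    and u :: "bool \<Rightarrow> 'a" and emb :: "'a \<Rightarrow> complex"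
  assumes linear_e: "\<And>k. k \<in> K \<Longrightarrow> bounded_linear (\<lambda>z. e z k)"
    and e_u: "\<And>j k. j \<in> K \<Longrightarrow> k \<in> K \<Longrightarrow> e (u j) k = (if j = k then 1 else 0)"
    and rep: "\<And>z. (\<Sum>k\<in>K. e z k *\<^sub>R u k) = z"
    and inner_e: "\<And>x y. 1 \<bullet> (x * conjugate y) = (\<Sum>k\<in>K. e x k * e y k)"
    and emb_e: "\<And>z. emb z = (\<Sum>k\<in>K. e z k *\<^sub>R uc True k)"
    and emb_mult: "\<And>x y. emb (x * y) = emb x * emb y"
    and emb_1: "emb 1 = 1"
begin

definition co :: "nat \<Rightarrow> 'a mat \<Rightarrow> pt" where
  "co n A = (\<lambda>c\<in>ix n K. e (A $$ fst c) (snd c))"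

definition mk :: "nat \<Rightarrow> pt \<Rightarrow> 'a mat" where
  "mk n x = mat n n (\<lambda>ij. \<Sum>k\<in>K. x (ij, k) *\<^sub>R u k)"

lemma e_sum: "k \<in> K \<Longrightarrow> e (\<Sum>j\<in>K. y j *\<^sub>R u j) k = y k"
proof -
  assume k: "k \<in> K"
  interpret bounded_linear "\<lambda>z. e z k" by (rule linear_e[OF k])
  have "e (\<Sum>j\<in>K. y j *\<^sub>R u j) k = (\<Sum>j\<in>K. if j = k then y k else 0)"
    unfolding sum scaleR using k by (intro sum.cong refl) (auto simp: e_u)
  then show ?thesis using k by simp
qed

lemma mk_carrier: "mk n x \<in> carrier_mat n n"
  by (simp add: mk_def)

lemma co_mk: "co n (mk n x) = restrict x (ix n K)"
  by (rule ext) (auto simp: mk_def co_def ix_def e_sum)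

lemma co_mk': "x \<in> extensional (ix n K) \<Longrightarrow> co n (mk n x) = x"
  by (simp add: co_mk extensional_restrict)

lemma co_extensional: "co n A \<in> extensional (ix n K)"
  by (simp add: co_def)

lemma hs_inner_co:
  assumes "A \<in> carrier_mat n n" "B \<in> carrier_mat n n"
  shows "hs_inner A B = (\<Sum>c\<in>ix n K. co n A c * co n B c)"
proof -
  have "hs_inner A B = (\<Sum>i<n. \<Sum>j<n. \<Sum>k\<in>K. e (A $$ (i, j)) k * e (B $$ (i, j)) k)"
    unfolding hs_inner_def mat_trace_mult[OF assms] inner_sum_right inner_e ..
  also have "\<dots> = (\<Sum>c\<in>ix n K. e (A $$ fst c) (snd c) * e (B $$ fst c) (snd c))"
    unfolding ix_def by (simp only: sum.cartesian_product' fst_conv snd_conv)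
  finally show ?thesis by (simp add: co_def)
qed

lemma hs_norm_co: "A \<in> carrier_mat n n \<Longrightarrow> hs_norm A = nrm (ix n K) (co n A)"
  using hs_inner_co[of A n A] by (simp add: hs_norm_def hs_inner_def nrm_def power2_eq_square)

lemma entry_measurable:
  assumes "ij \<in> {..<n} \<times> {..<n}"
  shows "(\<lambda>A :: 'a mat. A $$ ij) \<in> borel_measurable (mat_borel n)"
proof -
  have "(\<lambda>A :: 'a mat. \<lambda>ij \<in> {..<n} \<times> {..<n}. A $$ ij) \<in> mat_borel n \<rightarrow>\<^sub>M (\<Pi>\<^sub>M ij \<in> {..<n} \<times> {..<n}. borel)"
    unfolding mat_borel_def by (rule measurable_vimage_algebra1) (auto simp: space_PiM)
  from measurable_compose[OF this measurable_component_singleton[OF assms]] show ?thesis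
    using assms by simp
qed

lemma co_measurable: "co n \<in> mat_borel n \<rightarrow>\<^sub>M (\<Pi>\<^sub>M c\<in>ix n K. borel)"
  unfolding co_def[abs_def]
proof (rule measurable_restrict)
  fix c assume "c \<in> ix n K"
  then have c: "fst c \<in> {..<n} \<times> {..<n}" "snd c \<in> K" by (auto simp: ix_def)
  have "(\<lambda>z. e z (snd c)) \<in> borel_measurable borel"
    by (intro borel_measurable_continuous_onI linear_continuous_on linear_e c)
  from measurable_compose[OF entry_measurable[OF c(1)] this]
  show "(\<lambda>A. e (A $$ fst c) (snd c)) \<in> borel_measurable (mat_borel n)" .
qed

lemma mk_measurable: "mk n \<in> (\<Pi>\<^sub>M c\<in>ix n K. borel) \<rightarrow>\<^sub>M mat_borel n"
  unfolding mat_borel_def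
proof (rule measurable_vimage_algebra2)
  show "mk n \<in> space (\<Pi>\<^sub>M c\<in>ix n K. borel) \<rightarrow> carrier_mat n n" using mk_carrier by blast
  show "(\<lambda>x. \<lambda>ij\<in>{..<n} \<times> {..<n}. mk n x $$ ij) \<in> (\<Pi>\<^sub>M c\<in>ix n K. borel) \<rightarrow>\<^sub>M (\<Pi>\<^sub>M ij\<in>{..<n} \<times> {..<n}. borel)"
  proof (rule measurable_restrict)
    fix ij :: "nat \<times> nat" assume ij: "ij \<in> {..<n} \<times> {..<n}"
    have "(\<lambda>x. \<Sum>k\<in>K. x (ij, k) *\<^sub>R u k) \<in> borel_measurable (\<Pi>\<^sub>M c\<in>ix n K. borel)"
      using ij by (intro borel_measurable_sum borel_measurable_scaleR measurable_const measurable_component_singleton) (auto simp: ix_def)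
    then show "(\<lambda>x. mk n x $$ ij) \<in> borel_measurable (\<Pi>\<^sub>M c\<in>ix n K. borel)"
      using ij by (auto simp: mk_def)
  qed
qed

lemma co_add: "A \<in> carrier_mat n n \<Longrightarrow> B \<in> carrier_mat n n \<Longrightarrow> c \<in> ix n K \<Longrightarrow> co n (A + B) c = co n A c + co n B c"
  using linear_add[OF bounded_linear.linear[OF linear_e]] by (auto simp: co_def ix_def)

lemma co_smult: "A \<in> carrier_mat n n \<Longrightarrow> c \<in> ix n K \<Longrightarrow> co n (of_real r \<cdot>\<^sub>m A) c = r * co n A c"
  using linear_scale[OF bounded_linear.linear[OF linear_e]]
  by (auto simp: co_def ix_def simp flip: scaleR_conv_of_real)

lemma mk_cong: "(\<And>c. c \<in> ix n K \<Longrightarrow> x c = y c) \<Longrightarrow> mk n x = mk n y"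
  unfolding mk_def by (intro cong_mat refl sum.cong) (auto simp: ix_def)

text \<open>A rotation of one coordinate plane is a real-linear isometry, because the inner product
  of matrices is the Euclidean one of the coordinates (\<open>hs_inner_co\<close>). So the
  invariance hypothesis yields the invariance in \<open>rot_inv\<close>.\<close>

lemma rotation_rot:
  assumes ab: "a \<in> ix n K" "b \<in> ix n K" "a \<noteq> b"
  shows "rotation n (\<lambda>A. mk n (rot a b t (co n A)))"
  unfolding rotation_def
proof (intro conjI ballI allI)
  show "(\<lambda>A. mk n (rot a b t (co n A))) \<in> carrier_mat n n \<rightarrow> carrier_mat n n" using mk_carrier by blast
  have mk_add: "mk n (\<lambda>c. x c + y c) = mk n x + mk n y" for x y
    by (rule eq_matI) (auto simp: mk_def scaleR_left_distrib sum.distrib)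
  fix A B :: "'a mat" assume A: "A \<in> carrier_mat n n" and B: "B \<in> carrier_mat n n"
  show "mk n (rot a b t (co n (A + B))) = mk n (rot a b t (co n A)) + mk n (rot a b t (co n B))"
    unfolding mk_add[symmetric] by (rule mk_cong) (use ab A B in \<open>auto simp: rot_def co_add algebra_simps\<close>)
  show "hs_inner (mk n (rot a b t (co n A))) (mk n (rot a b t (co n B))) = hs_inner A B"
    unfolding hs_inner_co[OF mk_carrier mk_carrier] hs_inner_co[OF A B] co_mk
    using sum_rot_mult[OF _ ab, of t "co n A" "co n B"] by (simp add: ix_def)
next
  fix r :: real and A :: "'a mat" assume A: "A \<in> carrier_mat n n"
  have mk_smult: "mk n (\<lambda>c. r * x c) = of_real r \<cdot>\<^sub>m mk n x" for x
    by (rule eq_matI) (auto simp: mk_def scaleR_sum_right simp flip: scaleR_conv_of_real)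
  show "mk n (rot a b t (co n (of_real r \<cdot>\<^sub>m A))) = of_real r \<cdot>\<^sub>m mk n (rot a b t (co n A))"
    unfolding mk_smult[symmetric] by (rule mk_cong) (use ab A in \<open>auto simp: rot_def co_smult algebra_simps\<close>)
qed

lemma emb_sum: "emb (sum g A) = (\<Sum>i\<in>A. emb (g i))"
proof -
  have "emb (sum g A) = (\<Sum>k\<in>K. (\<Sum>i\<in>A. e (g i) k) *\<^sub>R uc True k)"
    unfolding emb_e by (intro sum.cong refl arg_cong2[where f = scaleR] linear_sum bounded_linear.axioms(1) linear_e)
  also have "\<dots> = (\<Sum>i\<in>A. \<Sum>k\<in>K. e (g i) k *\<^sub>R uc True k)"
    unfolding scaleR_sum_left by (rule sum.swap)
  finally show ?thesis by (simp add: emb_e)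
qed

lemma emb_power_entry:
  assumes A: "A \<in> carrier_mat n n"
  shows "i < n \<Longrightarrow> j < n \<Longrightarrow> emb ((A ^\<^sub>m p) $$ (i, j)) = wd n K (replicate p True) i j (co n A)"
proof (induction p arbitrary: j)
  case 0
  then show ?case using A emb_sum[of "\<lambda>_. 0" "{}"] by (simp add: emb_1)
next
  case (Suc p)
  have l: "ltr K True k j (co n A) = emb (A $$ (k, j))" if "k < n" for k
    unfolding ltr_def emb_e using that Suc.prems by (intro sum.cong refl) (auto simp: co_def ix_def pos_def)
  have P: "A ^\<^sub>m p \<in> carrier_mat n n" using A by (rule pow_carrier_mat)
  have "(A ^\<^sub>m Suc p) $$ (i, j) = (\<Sum>k<n. (A ^\<^sub>m p) $$ (i, k) * A $$ (k, j))"
    using A P Suc.prems by (auto simp: scalar_prod_def atLeast0LessThan intro!: sum.cong)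
  then have "emb ((A ^\<^sub>m Suc p) $$ (i, j)) = (\<Sum>k<n. wd n K (replicate p True) i k (co n A) * wd n K [True] k j (co n A))"
    using Suc l by (simp add: emb_sum emb_mult wd_single del: wd.simps)
  also have "\<dots> = wd n K (replicate p True @ [True]) i j (co n A)"
    using Suc.prems by (simp add: wd_append del: wd.simps)
  finally show ?case by (simp only: replicate_append_same replicate_Suc)
qed

lemma emb_trace: "A \<in> carrier_mat n n \<Longrightarrow> emb (mat_trace (A ^\<^sub>m p)) = tr n K (replicate p True) (co n A)"
  using pow_carrier_mat[of A n p] by (simp add: mat_trace_def tr_def emb_sum emb_power_entry)

lemma pw_co: "A \<in> carrier_mat n n \<Longrightarrow> pw K n p k (co n A) = Re (cnj (uc True k) * emb (mat_trace (A ^\<^sub>m p)))"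
  by (simp add: pw_def emb_trace)

end

text \<open>The bridge between the hypotheses on X and the coordinate law: the push-forward
  \<open>law\<close> satisfies \<open>rot_inv\<close>, and its radial moments are those in
  \<open>moment_dev\<close>.\<close>

locale rot_inv_matrix = entry_coords K e u emb + prob_space M
  for K e and u :: "bool \<Rightarrow> 'a::{conjugatable_field, real_normed_field, real_inner, second_countable_topology}"
    and emb and M :: "'w measure" +
  fixes n :: nat and X :: "'w \<Rightarrow> 'a mat"
  assumes n_pos: "0 < n" and X: "X \<in> M \<rightarrow>\<^sub>M mat_borel n" and inv: "rotation_invariant n M X"
    and moments: "\<And>k. 1 \<le> k \<Longrightarrow> integrable M (\<lambda>\<omega>. hs_norm (X \<omega>) ^ k)"
begin

definition law :: "pt measure" where
  "law = distr M (\<Pi>\<^sub>M c\<in>ix n K. borel) (\<lambda>\<omega>. co n (X \<omega>))"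

lemma X_carrier: "\<omega> \<in> space M \<Longrightarrow> X \<omega> \<in> carrier_mat n n"
  using measurable_space[OF X] by (simp add: mat_borel_def)

lemma co_X_measurable: "(\<lambda>\<omega>. co n (X \<omega>)) \<in> M \<rightarrow>\<^sub>M (\<Pi>\<^sub>M c\<in>ix n K. borel)"
  by (rule measurable_compose[OF X co_measurable])

lemma rot_law:
  assumes ab: "a \<in> ix n K" "b \<in> ix n K" "a \<noteq> b"
  shows "distr law law (rot a b t) = law"
proof -
  let ?P = "\<Pi>\<^sub>M c\<in>ix n K. borel :: real measure" and ?T = "\<lambda>A. mk n (rot a b t (co n A))"
  have rm: "rot a b t \<in> ?P \<rightarrow>\<^sub>M ?P"
  proof (rule measurable_PiM_single')
    fix c assume c: "c \<in> ix n K"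
    have "(\<lambda>x. rot a b t x c) = (\<lambda>x. if c = b then sin t * x a + cos t * x b else if c = a then cos t * x a - sin t * x b else x c)"
      by (auto simp: rot_def)
    moreover have "\<dots> \<in> borel_measurable ?P"
      using ab c measurable_component_singleton[where M = "\<lambda>_. borel :: real measure" and I = "ix n K"] by (auto intro!: borel_measurable_add borel_measurable_diff borel_measurable_times)
    ultimately show "(\<lambda>x. rot a b t x c) \<in> borel_measurable ?P" by simp
  next
    show "rot a b t \<in> space ?P \<rightarrow> (\<Pi>\<^sub>E c\<in>ix n K. space borel)"
      using ab by (auto simp: space_PiM PiE_def extensional_def rot_def)
  qed
  have Tm: "(\<lambda>\<omega>. ?T (X \<omega>)) \<in> M \<rightarrow>\<^sub>M mat_borel n"
    by (rule measurable_compose[OF measurable_compose[OF co_X_measurable rm] mk_measurable])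
  have "distr law law (rot a b t) = distr law ?P (rot a b t)" by (intro distr_cong) (auto simp: law_def)
  also have "\<dots> = distr M ?P (rot a b t \<circ> (\<lambda>\<omega>. co n (X \<omega>)))"
    unfolding law_def by (rule distr_distr[OF rm co_X_measurable])
  also have "\<dots> = distr M ?P (co n \<circ> (\<lambda>\<omega>. ?T (X \<omega>)))"
  proof (intro distr_cong refl)
    fix \<omega>
    have "rot a b t (co n (X \<omega>)) \<in> extensional (ix n K)"
      using co_extensional[of n "X \<omega>"] ab by (auto simp: extensional_def rot_def)
    then show "(rot a b t \<circ> (\<lambda>\<omega>. co n (X \<omega>))) \<omega> = (co n \<circ> (\<lambda>\<omega>. ?T (X \<omega>))) \<omega>" by (simp add: co_mk')
  qed
  also have "\<dots> = distr (distr M (mat_borel n) (\<lambda>\<omega>. ?T (X \<omega>))) ?P (co n)"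
    by (rule distr_distr[OF co_measurable Tm, symmetric])
  also have "\<dots> = distr (distr M (mat_borel n) X) ?P (co n)"
    by (simp only: inv[unfolded rotation_invariant_def, rule_format, OF rotation_rot[OF ab, of t]])
  also have "\<dots> = law"
    unfolding law_def distr_distr[OF co_measurable X] by (simp add: comp_def)
  finally show ?thesis .
qed

lemma sets_law: "sets law = sets (\<Pi>\<^sub>M c\<in>ix n K. borel)"
  by (simp add: law_def)

lemma integral_law:
  fixes g :: "pt \<Rightarrow> 'b::{banach, second_countable_topology}"
  assumes "g \<in> borel_measurable law"
  shows "(\<integral>x. g x \<partial>law) = (\<integral>\<omega>. g (co n (X \<omega>)) \<partial>M)"
  using integral_distr[OF co_X_measurable, of g] assms by (simp add: law_def)

lemma integrable_law_iff:
  fixes g :: "pt \<Rightarrow> 'b::{banach, second_countable_topology}"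
  assumes "g \<in> borel_measurable law"
  shows "integrable law g \<longleftrightarrow> integrable M (\<lambda>\<omega>. g (co n (X \<omega>)))"
  using integrable_distr_eq[OF co_X_measurable, of g] assms by (simp add: law_def)

sublocale L: rot_inv law "ix n K"
proof (rule rot_inv.intro)
  show "prob_space law"
    unfolding law_def by (rule prob_space_distr[OF co_X_measurable])
  show "rot_inv_axioms law (ix n K)"
  proof
    show fin: "finite (ix n K)" by (simp add: ix_def)
    show "sets law = sets (\<Pi>\<^sub>M c\<in>ix n K. borel)" by (rule sets_law)
    show "distr law law (rot a b t) = law" if "a \<in> ix n K" "b \<in> ix n K" "a \<noteq> b" for a b t
      by (rule rot_law[OF that])
    fix k
    have "nrm (ix n K) \<in> borel_measurable law"
      unfolding nrm_def[abs_def] measurable_cong_sets[OF sets_law refl]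
      by (intro measurable_compose[OF _ borel_measurable_sqrt] borel_measurable_sum borel_measurable_power measurable_component_singleton)
    then have m: "(\<lambda>x. nrm (ix n K) x ^ k) \<in> borel_measurable law" by simp
    have "integrable M (\<lambda>\<omega>. hs_norm (X \<omega>) ^ k)"
      by (cases "k = 0") (use moments in auto)
    then show "integrable law (\<lambda>x. nrm (ix n K) x ^ k)"
      unfolding integrable_law_iff[OF m] by (rule iffD1[OF Bochner_Integration.integrable_cong, rotated 2]) (auto simp: hs_norm_co[OF X_carrier])
  qed
qed

lemma integral_sr_power:
  "(\<integral>x. sr n K x ^ k \<partial>law) = real n powr (- (real k / 2)) * (\<integral>\<omega>. hs_norm (X \<omega>) ^ k \<partial>M)"
proof -
  have sq: "sqrt (real n) ^ k = real n powr (real k / 2)"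
    using n_pos by (simp add: powr_half_sqrt[symmetric] powr_realpow[symmetric] powr_powr)
  have "(\<lambda>x. sr n K x ^ k) \<in> borel_measurable law"
    unfolding sr_def[abs_def] using L.nrm_measurable by simp
  from integral_law[OF this] have "(\<integral>x. sr n K x ^ k \<partial>law) = (\<integral>\<omega>. sr n K (co n (X \<omega>)) ^ k \<partial>M)" .
  also have "\<dots> = (\<integral>\<omega>. real n powr (- (real k / 2)) * hs_norm (X \<omega>) ^ k \<partial>M)"
    by (intro Bochner_Integration.integral_cong refl)
      (simp add: sr_def hs_norm_co[OF X_carrier] power_divide sq powr_minus field_simps)
  finally show ?thesis by simp
qed

lemma moment_dev_sr: "\<bar>(\<integral>x. sr n K x ^ k \<partial>law) - 1\<bar> = moment_dev n M X k"
  by (simp add: integral_sr_power moment_dev_def)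

end

context rot_inv_matrix
begin

lemma pw_measurable: "pw K n p k \<in> borel_measurable law"
proof -
  have l: "ltr K b i j \<in> borel_measurable (\<Pi>\<^sub>M c\<in>ix n K. borel)" if "i < n" "j < n" for b i j
    unfolding ltr_def[abs_def] using that
    by (intro borel_measurable_sum borel_measurable_scaleR measurable_const measurable_component_singleton pos_ix) simp_all
  have w: "wd n K v i j \<in> borel_measurable (\<Pi>\<^sub>M c\<in>ix n K. borel)" if "i < n" for v i j
    using that
  proof (induction v arbitrary: i)
    case Nil
    then show ?case by (cases "i = j") auto
  next
    case (Cons b v)
    then show ?case unfolding wd.simps by (intro borel_measurable_sum borel_measurable_times l Cons) auto
  qed
  have "(\<lambda>x. tr n K (replicate p True) x) \<in> borel_measurable (\<Pi>\<^sub>M c\<in>ix n K. borel)"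
    unfolding tr_def by (intro borel_measurable_sum w) auto
  then show ?thesis
    unfolding pw_def[abs_def] measurable_cong_sets[OF sets_law refl]
    by (intro measurable_compose[OF _ borel_measurable_Re] borel_measurable_times measurable_const) simp_all
qed

lemma pw_sum_measurable:
  "(\<lambda>x. \<Sum>i\<in>I. pw K n (q i) (l i) x *\<^sub>R (b i :: 'e::euclidean_space)) \<in> borel_measurable law"
  by (intro borel_measurable_sum borel_measurable_scaleR measurable_const pw_measurable) simp

lemma integral_pw_sum:
  fixes F :: "'e::euclidean_space \<Rightarrow> 'f::{banach, second_countable_topology}" and T :: "'a mat \<Rightarrow> 'e"
  assumes F: "F \<in> borel_measurable borel"
    and T: "\<And>A. A \<in> carrier_mat n n \<Longrightarrow> (\<Sum>i\<in>I. pw K n (q i) (l i) (co n A) *\<^sub>R b i) = T A"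
  shows "(\<integral>x. F (\<Sum>i\<in>I. pw K n (q i) (l i) x *\<^sub>R b i) \<partial>law) = (\<integral>\<omega>. F (T (X \<omega>)) \<partial>M)"
  unfolding integral_law[OF measurable_compose[OF pw_sum_measurable F]]
  by (intro Bochner_Integration.integral_cong refl) (simp add: T X_carrier)

lemma T_measurable:
  fixes T :: "'a mat \<Rightarrow> 'e::euclidean_space"
  assumes T: "\<And>A. A \<in> carrier_mat n n \<Longrightarrow> (\<Sum>i\<in>I. pw K n (q i) (l i) (co n A) *\<^sub>R b i) = T A"
  shows "(\<lambda>\<omega>. T (X \<omega>)) \<in> borel_measurable M"
proof -
  have "(\<lambda>\<omega>. \<Sum>i\<in>I. pw K n (q i) (l i) (co n (X \<omega>)) *\<^sub>R b i) \<in> borel_measurable M"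
    by (rule measurable_compose[OF co_X_measurable]) (use pw_sum_measurable in \<open>simp add: law_def\<close>)
  then show ?thesis
    by (rule subst[OF measurable_cong, rotated]) (simp add: T X_carrier)
qed

end

interpretation real_coords: entry_coords "{True}" "\<lambda>z _. z" "\<lambda>_. 1" complex_of_real
  by (rule entry_coords.intro) (auto simp: uc_def scaleR_conv_of_real bounded_linear_ident)

interpretation complex_coords: entry_coords UNIV "\<lambda>z k. if k then Re z else Im z" "\<lambda>k. if k then 1 else \<i>" "\<lambda>z. z"
proof (rule entry_coords.intro)
  show "bounded_linear (\<lambda>z. if k then Re z else Im z)" for k
    by (cases k) (auto intro: bounded_linear_Re bounded_linear_Im)
qed (auto simp: uc_def UNIV_bool complex_eq_iff inner_complex_def)

lemma sum_scaleR_axis: "(\<Sum>p\<in>UNIV. g p *\<^sub>R axis p x) = (\<chi> p. g p *\<^sub>R x)" for x :: "'b::real_vector" and g :: "'m::finite \<Rightarrow> real"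
proof (rule Finite_Cartesian_Product.vec_eq_iff[THEN iffD2, OF allI])
  show "(\<Sum>p\<in>UNIV. g p *\<^sub>R axis p x) $ i = (\<chi> p. g p *\<^sub>R x) $ i" for i
    by (simp add: sum_component axis_def if_distrib[of "\<lambda>x. _ *\<^sub>R x"] cong: if_cong)
qed

lemma real_trace_vec:
  assumes "A \<in> carrier_mat n n"
  shows "(\<Sum>p\<in>UNIV. pw {True} n (idx p) True (real_coords.co n A) *\<^sub>R axis p 1) = trace_vec idx A"
proof -
  have p: "pw {True} n p True (real_coords.co n A) = mat_trace (A ^\<^sub>m p)" for p
    unfolding real_coords.pw_co[OF assms] by (simp add: uc_def)
  show ?thesis by (simp add: p sum_scaleR_axis trace_vec_def)
qed

lemma bij_axis_real: "bij_betw (\<lambda>p. axis p (1::real)) UNIV (Basis :: (real ^ 'm) set)"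
  unfolding bij_betw_def by (auto simp: Basis_vec_def inj_on_def axis_eq_axis)

text \<open>The standard basis of the complex vectors as a real Euclidean space, indexed by the same
  sum type as \<open>re_im_parts\<close>.\<close>

definition cax :: "'m + 'm \<Rightarrow> complex ^ 'm::finite" where
  "cax k = (case k of Inl p \<Rightarrow> axis p 1 | Inr p \<Rightarrow> axis p \<i>)"

lemma sum_cax: "(\<Sum>k\<in>UNIV. g k *\<^sub>R cax k) = (\<chi> p. Complex (g (Inl p)) (g (Inr p)))"
proof -
  have "(\<Sum>k\<in>UNIV. g k *\<^sub>R cax k) = (\<Sum>p\<in>UNIV. g (Inl p) *\<^sub>R axis p 1) + (\<Sum>p\<in>UNIV. g (Inr p) *\<^sub>R axis p \<i>)"
    unfolding UNIV_Plus_UNIV[symmetric] by (subst sum.Plus) (auto simp: cax_def)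
  then show ?thesis
    by (simp add: sum_scaleR_axis Finite_Cartesian_Product.vec_eq_iff complex_eq_iff)
qed

lemma complex_trace_vec:
  assumes "A \<in> carrier_mat n n"
  shows "(\<Sum>k\<in>UNIV. pw UNIV n (case_sum idx idx k) (isl k) (complex_coords.co n A) *\<^sub>R cax k) = trace_vec idx A"
  unfolding sum_cax complex_coords.pw_co[OF assms] by (simp add: uc_def trace_vec_def)

lemma bij_cax: "bij_betw cax UNIV (Basis :: (complex ^ 'm::finite) set)"
  unfolding bij_betw_def
proof
  show "inj (cax :: 'm + 'm \<Rightarrow> complex ^ 'm)"
    by (auto simp: inj_on_def cax_def axis_eq_axis split: sum.splits)
  show "range (cax :: 'm + 'm \<Rightarrow> complex ^ 'm) = Basis"
  proof
    show "range (cax :: 'm + 'm \<Rightarrow> complex ^ 'm) \<subseteq> Basis"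
      by (auto simp: cax_def Basis_vec_def Basis_complex_def split: sum.splits)
    show "Basis \<subseteq> range (cax :: 'm + 'm \<Rightarrow> complex ^ 'm)"
    proof
      fix v :: "complex ^ 'm" assume "v \<in> Basis"
      then obtain p where "v = axis p 1 \<or> v = axis p \<i>" by (auto simp: Basis_vec_def Basis_complex_def)
      then have "v = cax (Inl p) \<or> v = cax (Inr p)" by (simp add: cax_def)
      then show "v \<in> range cax" by blast
    qed
  qed
qed

lemma Sigma_half_mult:
  fixes idx :: "'m::finite \<Rightarrow> nat" and x :: "'a::real_algebra_1 ^ 'm"
  shows "Sigma_half idx *v x = (\<chi> p. of_real (sqrt (real (idx p))) * x $ p)"
proof -
  have "(\<Sum>j\<in>UNIV. (if i = j then d i else 0) * x $ j) = d i * x $ i" for i and d :: "'m \<Rightarrow> 'a"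
    by (simp add: if_distrib[of "\<lambda>y. y * _"] cong: if_cong)
  from this[of _ "\<lambda>p. of_real (sqrt (real (idx p)))"] show ?thesis
    by (simp add: Sigma_half_def diag_matrix_def matrix_vector_mult_def Finite_Cartesian_Product.vec_eq_iff)
qed

lemma gauss_vec_real:
  assumes "std_gaussian N G"
  shows "gauss_vec N (\<lambda>p \<omega>. G \<omega> $ p) UNIV (\<lambda>_. 1) (\<lambda>p. sqrt (real (idx p))) (\<lambda>p. axis p 1) (\<lambda>\<omega>. Sigma_half idx *v G \<omega>)"
proof (intro gauss_vec.intro gauss_vec_axioms.intro)
  show "Sigma_half idx *v G \<omega> = (\<Sum>p\<in>UNIV. (sqrt (real (idx p)) * G \<omega> $ p) *\<^sub>R axis p 1)" for \<omega>
    by (simp add: Sigma_half_mult sum_scaleR_axis)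
qed (use assms bij_axis_real in \<open>auto simp: std_gaussian_def\<close>)

lemma gauss_vec_complex:
  assumes "std_complex_gaussian N G"
  shows "gauss_vec N (re_im_parts G) UNIV (\<lambda>_. sqrt (1 / 2)) (\<lambda>k. sqrt (real (case_sum idx idx k))) cax (\<lambda>\<omega>. Sigma_half idx *v G \<omega>)"
proof (intro gauss_vec.intro gauss_vec_axioms.intro)
  show "Sigma_half idx *v G \<omega> = (\<Sum>k\<in>UNIV. (sqrt (real (case_sum idx idx k)) * re_im_parts G k \<omega>) *\<^sub>R cax k)" for \<omega>
    unfolding sum_cax by (simp add: Sigma_half_mult Finite_Cartesian_Product.vec_eq_iff fun_eq_iff re_im_parts_def complex_eq_iff)
qed (use assms bij_cax in \<open>auto simp: std_complex_gaussian_def\<close>)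

lemma idx_range:
  assumes "bij_betw idx UNIV {1..CARD('m)}"
  shows "1 \<le> idx (p :: 'm::finite)" "idx p \<le> CARD('m)" "idx p = idx p' \<Longrightarrow> p = p'"
  using assms by (auto simp: bij_betw_def inj_on_def)

text \<open>\<open>complex_comparison\<close> for the 2m coordinates of the trace vector. The
  variance p / 2 of each real and imaginary part agrees with p / \<open>card K\<close>.\<close>

lemma complex_trace_comparison:
  assumes m: "3 \<le> CARD('m::finite)"
  obtains C where "C \<ge> 0"
    "\<And>n (idx :: 'm \<Rightarrow> nat) (M :: 'w measure) (X :: 'w \<Rightarrow> complex mat) (N :: 'v measure) (G :: 'v \<Rightarrow> complex ^ 'm) (f :: complex ^ 'm \<Rightarrow> real) B a.
      0 < n \<Longrightarrow> bij_betw idx UNIV {1..CARD('m)} \<Longrightarrow> prob_space M \<Longrightarrow> X \<in> M \<rightarrow>\<^sub>M mat_borel n \<Longrightarrow>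
      rotation_invariant n M X \<Longrightarrow> (\<forall>k\<ge>1. integrable M (\<lambda>\<omega>. hs_norm (X \<omega>) ^ k)) \<Longrightarrow>
      std_complex_gaussian N G \<Longrightarrow> C2 f \<Longrightarrow> (\<And>x. onorm (hess f x) \<le> B) \<Longrightarrow> 0 \<le> a \<Longrightarrow>
      (\<And>k. 1 \<le> k \<Longrightarrow> k \<le> 2 * CARD('m) \<Longrightarrow> moment_dev n M X k \<le> a / real n) \<Longrightarrow>
      \<bar>(\<integral>\<omega>. f (trace_vec idx (X \<omega>)) \<partial>M) - (\<integral>\<omega>. f (Sigma_half idx *v G \<omega>) \<partial>N)\<bar> \<le> C * (1 + a) * B / real n"
proof -
  have "1 \<le> CARD('m)" using m by simp
  then obtain C where C: "C \<ge> 0"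
    "\<And>\<mu> n (N :: 'v measure) (X :: ('m + 'm) \<Rightarrow> 'v \<Rightarrow> real) I sg c b Z (f :: complex ^ 'm \<Rightarrow> real) B q l a.
      smart_path \<mu> n UNIV N X I sg c b Z f B q l \<Longrightarrow> (\<And>i. i \<in> I \<Longrightarrow> q i \<le> CARD('m)) \<Longrightarrow> 0 \<le> a \<Longrightarrow>
      (\<And>k. 1 \<le> k \<Longrightarrow> k \<le> 2 * CARD('m) \<Longrightarrow> \<bar>(\<integral>x. sr n UNIV x ^ k \<partial>\<mu>) - 1\<bar> \<le> a / real n) \<Longrightarrow>
      \<bar>(\<integral>x. f (\<Sum>i\<in>I. pw UNIV n (q i) (l i) x *\<^sub>R b i) \<partial>\<mu>) - (\<integral>\<omega>. f (Z \<omega>) \<partial>N)\<bar> \<le> C * (1 + a) * B / real n"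
    by (rule complex_comparison) blast
  show ?thesis
  proof (rule that[OF C(1)])
    fix n and idx :: "'m \<Rightarrow> nat" and M :: "'w measure" and X :: "'w \<Rightarrow> complex mat" and N :: "'v measure"
      and G :: "'v \<Rightarrow> complex ^ 'm" and f :: "complex ^ 'm \<Rightarrow> real" and B a
    assume n: "0 < n" and idx: "bij_betw idx UNIV {1..CARD('m)}" and M: "prob_space M" and X: "X \<in> M \<rightarrow>\<^sub>M mat_borel n"
      and inv: "rotation_invariant n M X" and mom: "\<forall>k\<ge>1. integrable M (\<lambda>\<omega>. hs_norm (X \<omega>) ^ k)"
      and G: "std_complex_gaussian N G" and f: "C2 f" and B: "\<And>x. onorm (hess f x) \<le> B" and a: "0 \<le> a"
      and dev: "\<And>k. 1 \<le> k \<Longrightarrow> k \<le> 2 * CARD('m) \<Longrightarrow> moment_dev n M X k \<le> a / real n"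
    interpret R: rot_inv_matrix UNIV "\<lambda>z k. if k then Re z else Im z" "\<lambda>k. if k then 1 else \<i>" "\<lambda>z. z" M n X
      by (intro rot_inv_matrix.intro rot_inv_matrix_axioms.intro complex_coords.entry_coords_axioms M)
        (use n X inv mom in auto)
    have q: "1 \<le> case_sum idx idx k" "case_sum idx idx k \<le> CARD('m)" for k
      using idx_range[OF idx] by (cases k; simp)+
    have sp: "smart_path R.law n UNIV N (re_im_parts G) UNIV (\<lambda>_. sqrt (1 / 2)) (\<lambda>k. sqrt (real (case_sum idx idx k)))
        cax (\<lambda>\<omega>. Sigma_half idx *v G \<omega>) f B (case_sum idx idx) isl"
    proof (intro smart_path.intro smart_path_axioms.intro gauss_vec_complex[OF G] c2_bounded.intro f B q(1)
        sph_mat.intro sph_mat_axioms.intro R.L.rot_inv_axioms)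
      show "i = j" if "case_sum idx idx i = case_sum idx idx j" "isl i = isl j" for i j
        using that idx_range(3)[OF idx] by (cases i; cases j) auto
      show "(sqrt (real (case_sum idx idx i)) * sqrt (1 / 2))\<^sup>2 = real (case_sum idx idx i) / real (card (UNIV :: bool set))" for i
        by (simp add: power_mult_distrib)
    qed (use n in auto)
    have "f \<in> borel_measurable borel"
      by (rule c2_bounded.c2_measurable(1)[OF c2_bounded.intro[OF f B]])
    then have tr: "(\<integral>x. f (\<Sum>i\<in>UNIV. pw UNIV n (case_sum idx idx i) (isl i) x *\<^sub>R cax i) \<partial>R.law)
        = (\<integral>\<omega>. f (trace_vec idx (X \<omega>)) \<partial>M)"
      by (rule R.integral_pw_sum) (rule complex_trace_vec)
    have "\<bar>(\<integral>x. f (\<Sum>i\<in>UNIV. pw UNIV n (case_sum idx idx i) (isl i) x *\<^sub>R cax i) \<partial>R.law)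
        - (\<integral>\<omega>. f (Sigma_half idx *v G \<omega>) \<partial>N)\<bar> \<le> C * (1 + a) * B / real n"
      by (rule C(2)[OF sp q(2) a]) (simp add: R.moment_dev_sr dev)
    then show "\<bar>(\<integral>\<omega>. f (trace_vec idx (X \<omega>)) \<partial>M) - (\<integral>\<omega>. f (Sigma_half idx *v G \<omega>) \<partial>N)\<bar> \<le> C * (1 + a) * B / real n"
      unfolding tr .
  qed
qed

text \<open>Both expectations are compared with \<open>f 0\<close>. There is no decay in this bound;
  it serves n = 1, where none is required.\<close>

lemma expectation_shift_le:
  fixes f :: "'e::euclidean_space \<Rightarrow> real"
  assumes M: "prob_space M" and N: "prob_space N" and f: "c2_bounded f B" and B1: "\<And>x. norm (grad f x) \<le> B1"
    and W: "integrable M W" "(\<integral>\<omega>. norm (W \<omega>) \<partial>M) \<le> v" and Z: "integrable N Z" "(\<integral>\<omega>. norm (Z \<omega>) \<partial>N) \<le> v'"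
  shows "\<bar>(\<integral>\<omega>. f (W \<omega> - (\<integral>\<omega>'. W \<omega>' \<partial>M)) \<partial>M) - (\<integral>\<omega>. f (Z \<omega>) \<partial>N)\<bar> \<le> B1 * (2 * v + v')"
proof -
  interpret F: c2_bounded f B by (rule f)
  interpret M: prob_space M by (rule M)
  have B10: "0 \<le> B1" using B1[of 0] norm_ge_zero order_trans by blast
  define w where "w = (\<integral>\<omega>. W \<omega> \<partial>M)"
  have i: "integrable M (\<lambda>\<omega>. W \<omega> - w)" using W(1) by simp
  have "(\<integral>\<omega>. norm (W \<omega> - w) \<partial>M) \<le> (\<integral>\<omega>. norm (W \<omega>) + norm w \<partial>M)"
    using W(1) i by (intro Bochner_Integration.integral_mono norm_triangle_ineq4) auto
  also have "\<dots> = (\<integral>\<omega>. norm (W \<omega>) \<partial>M) + norm w" using W(1) by (simp add: M.prob_space)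
  also have "\<dots> \<le> v + v"
    using W(2) integral_norm_bound[of M W] unfolding w_def by linarith
  finally have *: "(\<integral>\<omega>. norm (W \<omega> - w) \<partial>M) \<le> 2 * v" by simp
  have "\<bar>(\<integral>\<omega>. f (W \<omega> - w) \<partial>M) - f 0\<bar> \<le> B1 * (2 * v)"
    by (rule order_trans[OF F.expectation_diff_le[OF M B1 i] mult_left_mono[OF * B10]])
  moreover have "\<bar>(\<integral>\<omega>. f (Z \<omega>) \<partial>N) - f 0\<bar> \<le> B1 * v'"
    by (rule order_trans[OF F.expectation_diff_le[OF N B1 Z(1)] mult_left_mono[OF Z(2) B10]])
  ultimately show ?thesis unfolding w_def[symmetric] distrib_left by linarith
qed

lemma trace_vec_one_by_one:
  fixes A :: "real mat" and idx :: "'m::finite \<Rightarrow> nat"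
  assumes "A \<in> carrier_mat 1 1"
  shows "norm (trace_vec idx A) \<le> (\<Sum>p\<in>UNIV. hs_norm A ^ idx p)"
proof -
  have p: "(A ^\<^sub>m k) $$ (0, 0) = (A $$ (0, 0)) ^ k" for k
  proof (induction k)
    case (Suc k)
    have "A ^\<^sub>m k \<in> carrier_mat 1 1" using assms by (rule pow_carrier_mat)
    then show ?case using Suc assms by (simp add: scalar_prod_def)
  qed (use assms in simp)
  have "hs_norm A = \<bar>A $$ (0, 0)\<bar>"
    unfolding hs_norm_def mat_trace_mult[OF assms assms] by simp
  then have "\<bar>trace_vec idx A $ p\<bar> = hs_norm A ^ idx p" for p
    using pow_carrier_mat[OF assms, of "idx p"] assms by (simp add: trace_vec_def mat_trace_def p power_abs)
  then show ?thesis using norm_le_l1_cart[of "trace_vec idx A"] by simp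
qed

text \<open>For \<open>n\<close> at least 2 this is \<open>real_comparison\<close> transported to
  the matrix. The case n = 1 is outside \<open>sph_mat\<close> and is treated directly.\<close>

lemma real_trace_comparison:
  assumes m: "3 \<le> CARD('m::finite)"
  obtains C where "C \<ge> 0"
    "\<And>n (idx :: 'm \<Rightarrow> nat) (M :: 'w measure) (X :: 'w \<Rightarrow> real mat) (N :: 'v measure) (G :: 'v \<Rightarrow> real ^ 'm) f B B1 a.
      0 < n \<Longrightarrow> bij_betw idx UNIV {1..CARD('m)} \<Longrightarrow> prob_space M \<Longrightarrow> X \<in> M \<rightarrow>\<^sub>M mat_borel n \<Longrightarrow>
      rotation_invariant n M X \<Longrightarrow> (\<forall>k\<ge>1. integrable M (\<lambda>\<omega>. hs_norm (X \<omega>) ^ k)) \<Longrightarrow>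
      (\<integral>\<omega>. (hs_norm (X \<omega>))\<^sup>2 \<partial>M) = real n \<Longrightarrow> std_gaussian N G \<Longrightarrow> C2 f \<Longrightarrow>
      (\<And>x. onorm (hess f x) \<le> B) \<Longrightarrow> (\<And>x. norm (grad f x) \<le> B1) \<Longrightarrow> 0 \<le> a \<Longrightarrow>
      (\<And>k. 1 \<le> k \<Longrightarrow> k \<le> CARD('m) \<Longrightarrow> moment_dev n M X k \<le> a / real n) \<Longrightarrow>
      \<bar>(\<integral>\<omega>. f (trace_vec idx (X \<omega>) - (\<integral>\<omega>'. trace_vec idx (X \<omega>') \<partial>M)) \<partial>M)
        - (\<integral>\<omega>. f (Sigma_half idx *v G \<omega>) \<partial>N)\<bar> \<le> C * (1 + a) * (B1 + B) / real n"
proof -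
  obtain C where C: "C \<ge> 0"
    "\<And>\<mu> n (N :: 'v measure) (X :: 'm \<Rightarrow> 'v \<Rightarrow> real) I sg c b Z (f :: real ^ 'm \<Rightarrow> real) B B1 q l a.
      smart_path \<mu> n {True} N X I sg c b Z f B q l \<Longrightarrow> (\<And>i. i \<in> I \<Longrightarrow> q i \<le> CARD('m)) \<Longrightarrow> 0 \<le> a \<Longrightarrow>
      (\<And>y. norm (grad f y) \<le> B1) \<Longrightarrow> (\<integral>x. (sr n {True} x)\<^sup>2 \<partial>\<mu>) = 1 \<Longrightarrow>
      (\<And>k. 1 \<le> k \<Longrightarrow> k \<le> CARD('m) \<Longrightarrow> \<bar>(\<integral>x. sr n {True} x ^ k \<partial>\<mu>) - 1\<bar> \<le> a / real n) \<Longrightarrow>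
      \<bar>(\<integral>x. f ((\<Sum>i\<in>I. pw {True} n (q i) (l i) x *\<^sub>R b i) - (\<integral>x. (\<Sum>i\<in>I. pw {True} n (q i) (l i) x *\<^sub>R b i) \<partial>\<mu>)) \<partial>\<mu>)
        - (\<integral>\<omega>. f (Z \<omega>) \<partial>N)\<bar> \<le> C * (1 + a) * (B1 + B) / real n"
    by (rule real_comparison[OF m]) blast
  define m' where "m' = real CARD('m)"
  define C' where "C' = C + (2 * m' + m' * (1 + m'))"
  have m'0: "0 \<le> m'" by (simp add: m'_def)
  show ?thesis
  proof (rule that[of C'])
    show "0 \<le> C'" using C(1) m'0 by (simp add: C'_def)
    fix n and idx :: "'m \<Rightarrow> nat" and M :: "'w measure" and X :: "'w \<Rightarrow> real mat" and N :: "'v measure"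
      and G :: "'v \<Rightarrow> real ^ 'm" and f :: "real ^ 'm \<Rightarrow> real" and B B1 a
    assume n: "0 < n" and idx: "bij_betw idx UNIV {1..CARD('m)}" and M: "prob_space M" and X: "X \<in> M \<rightarrow>\<^sub>M mat_borel n"
      and inv: "rotation_invariant n M X" and mom: "\<forall>k\<ge>1. integrable M (\<lambda>\<omega>. hs_norm (X \<omega>) ^ k)"
      and two: "(\<integral>\<omega>. (hs_norm (X \<omega>))\<^sup>2 \<partial>M) = real n"
      and G: "std_gaussian N G" and f: "C2 f" and B: "\<And>x. onorm (hess f x) \<le> B" and B1: "\<And>x. norm (grad f x) \<le> B1" and a: "0 \<le> a"
      and dev: "\<And>k. 1 \<le> k \<Longrightarrow> k \<le> CARD('m) \<Longrightarrow> moment_dev n M X k \<le> a / real n"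
    interpret R: rot_inv_matrix "{True}" "\<lambda>z _. z" "\<lambda>_. 1" complex_of_real M n X
      by (intro rot_inv_matrix.intro rot_inv_matrix_axioms.intro real_coords.entry_coords_axioms M)
        (use n X inv mom in auto)
    note idx' = idx_range[OF idx]
    have F: "c2_bounded f B" by (rule c2_bounded.intro[OF f B])
    have fm: "f \<in> borel_measurable borel" by (rule c2_bounded.c2_measurable(1)[OF F])
    interpret GV: gauss_vec N "\<lambda>p \<omega>. G \<omega> $ p" UNIV "\<lambda>_. 1" "\<lambda>p. sqrt (real (idx p))" "\<lambda>p. axis p 1" "\<lambda>\<omega>. Sigma_half idx *v G \<omega>"
      by (rule gauss_vec_real[OF G])
    have B10: "0 \<le> B1" using B1[of 0] norm_ge_zero order_trans by blast
    have B0: "0 \<le> B" by (rule c2_bounded.B_nonneg[OF F])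
    let ?L = "\<bar>(\<integral>\<omega>. f (trace_vec idx (X \<omega>) - (\<integral>\<omega>'. trace_vec idx (X \<omega>') \<partial>M)) \<partial>M)
        - (\<integral>\<omega>. f (Sigma_half idx *v G \<omega>) \<partial>N)\<bar>"
    show "?L \<le> C' * (1 + a) * (B1 + B) / real n"
    proof (cases "n = 1")
      case False
      have sp: "smart_path R.law n {True} N (\<lambda>p \<omega>. G \<omega> $ p) UNIV (\<lambda>_. 1) (\<lambda>p. sqrt (real (idx p)))
          (\<lambda>p. axis p 1) (\<lambda>\<omega>. Sigma_half idx *v G \<omega>) f B idx (\<lambda>_. True)"
        by (intro smart_path.intro smart_path_axioms.intro gauss_vec_real[OF G] F
          sph_mat.intro sph_mat_axioms.intro R.L.rot_inv_axioms) (use n False idx' in auto)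
      let ?V = "\<lambda>x. \<Sum>p\<in>UNIV. pw {True} n (idx p) True x *\<^sub>R axis p 1 :: real ^ 'm"
      have tr0: "(\<integral>x. ?V x \<partial>R.law) = (\<integral>\<omega>. trace_vec idx (X \<omega>) \<partial>M)"
        by (rule R.integral_pw_sum[where F = "\<lambda>x. x"]) (auto intro: real_trace_vec)
      have tr: "(\<integral>x. f (?V x - w) \<partial>R.law) = (\<integral>\<omega>. f (trace_vec idx (X \<omega>) - w) \<partial>M)" for w
        by (rule R.integral_pw_sum[where F = "\<lambda>x. f (x - w)"]) (use fm in \<open>auto intro: real_trace_vec\<close>)
      have two': "(\<integral>x. (sr n {True} x)\<^sup>2 \<partial>R.law) = 1"
        using n by (simp add: R.integral_sr_power two powr_minus_divide)
      have "\<bar>(\<integral>x. f (?V x - (\<integral>x. ?V x \<partial>R.law)) \<partial>R.law) - (\<integral>\<omega>. f (Sigma_half idx *v G \<omega>) \<partial>N)\<bar>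
          \<le> C * (1 + a) * (B1 + B) / real n"
        by (rule C(2)[OF sp idx'(2) a B1 two']) (simp add: R.moment_dev_sr dev)
      then have "?L \<le> C * (1 + a) * (B1 + B) / real n" unfolding tr tr0 .
      also have "\<dots> \<le> C' * (1 + a) * (B1 + B) / real n"
        using a B10 B0 m'0 by (intro divide_right_mono mult_right_mono) (auto simp: C'_def)
      finally show ?thesis .
    next
      \<comment> \<open>A 1 by 1 matrix: its traces are powers of one number with absolute values
        equal to powers of the norm, so first moments are at most 1 + a.\<close>
      case True
      have Wm: "(\<lambda>\<omega>. trace_vec idx (X \<omega>)) \<in> borel_measurable M"
        by (rule R.T_measurable) (rule real_trace_vec)
      have h: "integrable M (\<lambda>\<omega>. hs_norm (X \<omega>) ^ idx p)" for p using mom idx'(1) by blast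
      have le: "norm (trace_vec idx (X \<omega>)) \<le> (\<Sum>p\<in>UNIV. hs_norm (X \<omega>) ^ idx p)" if "\<omega> \<in> space M" for \<omega>
        using R.X_carrier[OF that] True by (intro trace_vec_one_by_one) simp
      have hs: "integrable M (\<lambda>\<omega>. \<Sum>p\<in>UNIV. hs_norm (X \<omega>) ^ idx p)" using h by simp
      have Wi: "integrable M (\<lambda>\<omega>. trace_vec idx (X \<omega>))"
        by (rule Bochner_Integration.integrable_bound[OF hs Wm]) (use le in \<open>auto intro: order_trans[OF _ abs_ge_self]\<close>)
      have "(\<integral>\<omega>. norm (trace_vec idx (X \<omega>)) \<partial>M) \<le> (\<integral>\<omega>. (\<Sum>p\<in>UNIV. hs_norm (X \<omega>) ^ idx p) \<partial>M)"
        by (rule Bochner_Integration.integral_mono[OF integrable_norm[OF Wi] hs le])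
      also have "\<dots> = (\<Sum>p\<in>UNIV. \<integral>\<omega>. hs_norm (X \<omega>) ^ idx p \<partial>M)"
        using h by (rule Bochner_Integration.integral_sum)
      also have "\<dots> \<le> (\<Sum>p::'m\<in>UNIV. 1 + a)"
      proof (intro sum_mono)
        show "(\<integral>\<omega>. hs_norm (X \<omega>) ^ idx p \<partial>M) \<le> 1 + a" for p
          using dev[OF idx'(1,2), of p] True by (simp add: moment_dev_def)
      qed
      finally have W: "(\<integral>\<omega>. norm (trace_vec idx (X \<omega>)) \<partial>M) \<le> m' * (1 + a)" by (simp add: m'_def)
      have var: "(sqrt (real (idx p)) * 1)\<^sup>2 \<le> m'" for p using idx'(2)[of p] by (simp add: m'_def)
      have Zi: "integrable N (\<lambda>\<omega>. Sigma_half idx *v G \<omega>)"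
        by (rule integrable_norm_cancel[OF GV.expectation_norm_Z(1)[OF var] GV.Z_measurable])
      have Z: "(\<integral>\<omega>. norm (Sigma_half idx *v G \<omega>) \<partial>N) \<le> m' * (1 + m')"
        using GV.expectation_norm_Z(2)[OF var] by (simp add: m'_def)
      have "?L \<le> B1 * (2 * (m' * (1 + a)) + m' * (1 + m'))"
        by (rule expectation_shift_le[OF M GV.prob_space_axioms F B1 Wi W Zi Z])
      also have "\<dots> \<le> (B1 + B) * (C' * (1 + a))"
      proof (intro mult_mono)
        have "0 \<le> C * (1 + a)" "0 \<le> m' * (1 + m') * a" using C(1) a m'0 by auto
        then show "2 * (m' * (1 + a)) + m' * (1 + m') \<le> C' * (1 + a)"
          by (simp add: C'_def algebra_simps)
      qed (use B0 B10 a m'0 in auto)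
      finally show ?thesis using True by (simp add: mult_ac)
    qed
  qed
qed

section \<open>Possibly infinite suprema and the choice of the constants\<close>

lemma le_enn2real_SUP:
  fixes g :: "'z \<Rightarrow> real"
  assumes "(SUP x. ennreal (g x)) \<noteq> \<top>"
  shows "g x \<le> enn2real (SUP x. ennreal (g x))"
proof -
  have "ennreal (g x) \<le> (SUP x. ennreal (g x))" by (rule SUP_upper) simp
  also have "\<dots> = ennreal (enn2real (SUP x. ennreal (g x)))"
    by (rule ennreal_enn2real[symmetric, OF top.not_eq_extremum[THEN iffD1, OF assms]])
  finally show ?thesis by (simp add: ennreal_le_iff)
qed

text \<open>If the supremum is infinite, so is the right side because the constant is positive;
  otherwise the inequality is one between real numbers.\<close>

lemma ennreal_bound:
  assumes "0 < n" "0 < \<kappa>" and R: "S \<noteq> \<top> \<Longrightarrow> R \<le> \<kappa> * enn2real S / real n"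
  shows "ennreal R \<le> ennreal \<kappa> * S / of_nat n"
proof (cases "S = \<top>")
  case True
  then have "ennreal \<kappa> * S / of_nat n = \<top>"
    using assms(1,2) by (simp add: ennreal_mult_top ennreal_top_divide)
  then show ?thesis by simp
next
  case False
  have "ennreal R \<le> ennreal (\<kappa> * enn2real S / real n)" by (rule ennreal_leI[OF R[OF False]])
  also have "\<dots> = ennreal \<kappa> * ennreal (enn2real S) / of_nat n"
    using assms(1,2) by (simp add: divide_ennreal[symmetric] ennreal_mult ennreal_of_nat_eq_real_of_nat)
  also have "ennreal (enn2real S) = S"
    using False by (simp add: ennreal_enn2real top.not_eq_extremum)
  finally show ?thesis .
qed

lemma le_sum_list_abs:
  fixes \<alpha> :: "nat \<Rightarrow> real"
  assumes "1 \<le> k" "k \<le> d"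
  shows "\<alpha> k \<le> sum_list (map abs (map \<alpha> [1..<Suc d]))"
proof -
  have "\<bar>\<alpha> k\<bar> \<le> sum_list (map abs (map \<alpha> [1..<Suc d]))"
  proof (rule member_le_sum_list)
    show "\<bar>\<alpha> k\<bar> \<in> set (map abs (map \<alpha> [1..<Suc d]))"
      unfolding set_map set_upt using assms by (intro imageI) simp
  qed auto
  then show ?thesis by linarith
qed

theorem theorem2:
  assumes "3 \<le> CARD('m::finite)"
  shows
    "(\<exists>\<kappa> :: real list \<Rightarrow> real.
        (\<forall>a. 0 < \<kappa> a) \<and>
        (\<forall>(\<alpha> :: nat \<Rightarrow> real) (n :: nat) (idx :: 'm \<Rightarrow> nat)
           (M :: complex mat measure) (X :: complex mat \<Rightarrow> complex mat)
           (N :: (complex ^ 'm) measure) (G :: complex ^ 'm \<Rightarrow> complex ^ 'm)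
           (f :: complex ^ 'm \<Rightarrow> real).
           0 < n \<longrightarrow>
           bij_betw idx UNIV {1..CARD('m)} \<longrightarrow>
           prob_space M \<longrightarrow>
           X \<in> M \<rightarrow>\<^sub>M mat_borel n \<longrightarrow>
           rotation_invariant n M X \<longrightarrow>
           (\<forall>k\<ge>1. integrable M (\<lambda>\<omega>. hs_norm (X \<omega>) ^ k)) \<longrightarrow>
           (\<integral>\<omega>. (hs_norm (X \<omega>))\<^sup>2 \<partial>M) = real n \<longrightarrow>
           (\<forall>k\<ge>1. moment_dev n M X k \<le> \<alpha> k / real n) \<longrightarrow>
           std_complex_gaussian N G \<longrightarrow>
           C2 f \<longrightarrow>
           ennreal \<bar>(\<integral>\<omega>. f (trace_vec idx (X \<omega>)) \<partial>M) - (\<integral>\<omega>. f (Sigma_half idx *v G \<omega>) \<partial>N)\<bar>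
             \<le> ennreal (\<kappa> (map \<alpha> [1..<Suc (2 * CARD('m))])) * M2 f / of_nat n))
     \<and>
     (\<exists>\<kappa> :: real list \<Rightarrow> real.
        (\<forall>a. 0 < \<kappa> a) \<and>
        (\<forall>(\<alpha> :: nat \<Rightarrow> real) (n :: nat) (idx :: 'm \<Rightarrow> nat)
           (M :: real mat measure) (X :: real mat \<Rightarrow> real mat)
           (N :: (real ^ 'm) measure) (G :: real ^ 'm \<Rightarrow> real ^ 'm)
           (f :: real ^ 'm \<Rightarrow> real).
           0 < n \<longrightarrow>
           bij_betw idx UNIV {1..CARD('m)} \<longrightarrow>
           prob_space M \<longrightarrow>
           X \<in> M \<rightarrow>\<^sub>M mat_borel n \<longrightarrow>
           rotation_invariant n M X \<longrightarrow>
           (\<forall>k\<ge>1. integrable M (\<lambda>\<omega>. hs_norm (X \<omega>) ^ k)) \<longrightarrow>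
           (\<integral>\<omega>. (hs_norm (X \<omega>))\<^sup>2 \<partial>M) = real n \<longrightarrow>
           (\<forall>k\<ge>1. moment_dev n M X k \<le> \<alpha> k / real n) \<longrightarrow>
           std_gaussian N G \<longrightarrow>
           C2 f \<longrightarrow>
           ennreal \<bar>(\<integral>\<omega>. f (trace_vec idx (X \<omega>) - (\<integral>\<omega>'. trace_vec idx (X \<omega>') \<partial>M)) \<partial>M)
                    - (\<integral>\<omega>. f (Sigma_half idx *v G \<omega>) \<partial>N)\<bar>
             \<le> ennreal (\<kappa> (map \<alpha> [1..<Suc CARD('m)])) * (M1 f + M2 f) / of_nat n))"
proof (intro conjI)
  \<comment> \<open>The sum of absolute values dominates every \<alpha> in the list, and the final 1
    keeps the constant positive for arbitrary lists even if \<open>C\<close> is zero.\<close>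
  define \<kappa> :: "real \<Rightarrow> real list \<Rightarrow> real" where "\<kappa> C a = C * (1 + sum_list (map abs a)) + 1" for C a
  have nonneg: "0 \<le> sum_list (map abs a)" for a :: "real list"
    by (rule sum_list_nonneg) auto
  have pos: "0 < \<kappa> C a" if "0 \<le> C" for C a
    using that nonneg[of a] by (auto simp: \<kappa>_def intro!: add_nonneg_pos mult_nonneg_nonneg)
  have le: "R \<le> \<kappa> C a * B / real n" if "R \<le> C * (1 + sum_list (map abs a)) * B / real n" "0 \<le> B" for R C B a and n :: nat
    by (rule order_trans[OF that(1)]) (use that(2) in \<open>simp add: \<kappa>_def divide_right_mono mult_right_mono\<close>)
  have dev: "moment_dev n M X k \<le> sum_list (map abs (map \<alpha> [1..<Suc d])) / real n"
    if "\<forall>k\<ge>1. moment_dev n M X k \<le> \<alpha> k / real n" "1 \<le> k" "k \<le> d"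
    for n and M :: "'z measure" and X :: "'z \<Rightarrow> 'y::{conjugatable_field, real_normed_field, real_inner} mat" and \<alpha> k d
    using that(1)[rule_format, OF that(2)] divide_right_mono[OF le_sum_list_abs[OF that(2,3), of \<alpha>], of "real n"] by linarith
  obtain C where C: "C \<ge> 0"
    "\<And>n (idx :: 'm \<Rightarrow> nat) (M :: complex mat measure) (X :: complex mat \<Rightarrow> complex mat) (N :: (complex ^ 'm) measure) (G :: complex ^ 'm \<Rightarrow> complex ^ 'm) (f :: complex ^ 'm \<Rightarrow> real) B a.
      0 < n \<Longrightarrow> bij_betw idx UNIV {1..CARD('m)} \<Longrightarrow> prob_space M \<Longrightarrow> X \<in> M \<rightarrow>\<^sub>M mat_borel n \<Longrightarrow>
      rotation_invariant n M X \<Longrightarrow> (\<forall>k\<ge>1. integrable M (\<lambda>\<omega>. hs_norm (X \<omega>) ^ k)) \<Longrightarrow>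
      std_complex_gaussian N G \<Longrightarrow> C2 f \<Longrightarrow> (\<And>x. onorm (hess f x) \<le> B) \<Longrightarrow> 0 \<le> a \<Longrightarrow>
      (\<And>k. 1 \<le> k \<Longrightarrow> k \<le> 2 * CARD('m) \<Longrightarrow> moment_dev n M X k \<le> a / real n) \<Longrightarrow>
      \<bar>(\<integral>\<omega>. f (trace_vec idx (X \<omega>)) \<partial>M) - (\<integral>\<omega>. f (Sigma_half idx *v G \<omega>) \<partial>N)\<bar> \<le> C * (1 + a) * B / real n"
    by (rule complex_trace_comparison[OF assms]) blast
  show "\<exists>\<kappa> :: real list \<Rightarrow> real. (\<forall>a. 0 < \<kappa> a) \<and> (\<forall>(\<alpha> :: nat \<Rightarrow> real) (n :: nat) (idx :: 'm \<Rightarrow> nat)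
           (M :: complex mat measure) (X :: complex mat \<Rightarrow> complex mat)
           (N :: (complex ^ 'm) measure) (G :: complex ^ 'm \<Rightarrow> complex ^ 'm)
           (f :: complex ^ 'm \<Rightarrow> real).
           0 < n \<longrightarrow>
           bij_betw idx UNIV {1..CARD('m)} \<longrightarrow>
           prob_space M \<longrightarrow>
           X \<in> M \<rightarrow>\<^sub>M mat_borel n \<longrightarrow>
           rotation_invariant n M X \<longrightarrow>
           (\<forall>k\<ge>1. integrable M (\<lambda>\<omega>. hs_norm (X \<omega>) ^ k)) \<longrightarrow>
           (\<integral>\<omega>. (hs_norm (X \<omega>))\<^sup>2 \<partial>M) = real n \<longrightarrow>
           (\<forall>k\<ge>1. moment_dev n M X k \<le> \<alpha> k / real n) \<longrightarrow>
           std_complex_gaussian N G \<longrightarrow>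
           C2 f \<longrightarrow>
           ennreal \<bar>(\<integral>\<omega>. f (trace_vec idx (X \<omega>)) \<partial>M) - (\<integral>\<omega>. f (Sigma_half idx *v G \<omega>) \<partial>N)\<bar>
             \<le> ennreal (\<kappa> (map \<alpha> [1..<Suc (2 * CARD('m))])) * M2 f / of_nat n)"
  proof (intro exI[of _ "\<kappa> C"] conjI allI impI pos C(1), goal_cases)
    case (1 \<alpha> n idx M X N G f)
    show ?case
    proof (rule ennreal_bound[OF 1(1) pos[OF C(1)]], rule le)
      assume "M2 f \<noteq> \<top>"
      then have B: "onorm (hess f x) \<le> enn2real (M2 f)" for x
        unfolding M2_def by (rule le_enn2real_SUP)
      show "\<bar>(\<integral>\<omega>. f (trace_vec idx (X \<omega>)) \<partial>M) - (\<integral>\<omega>. f (Sigma_half idx *v G \<omega>) \<partial>N)\<bar>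
          \<le> C * (1 + sum_list (map abs (map \<alpha> [1..<Suc (2 * CARD('m))]))) * enn2real (M2 f) / real n"
        by (rule C(2)[OF 1(1-6,9,10) B nonneg dev[OF 1(8)]])
    qed simp
  qed
  obtain C' where C': "C' \<ge> 0"
    "\<And>n (idx :: 'm \<Rightarrow> nat) (M :: real mat measure) (X :: real mat \<Rightarrow> real mat) (N :: (real ^ 'm) measure) (G :: real ^ 'm \<Rightarrow> real ^ 'm) (f :: real ^ 'm \<Rightarrow> real) B B1 a.
      0 < n \<Longrightarrow> bij_betw idx UNIV {1..CARD('m)} \<Longrightarrow> prob_space M \<Longrightarrow> X \<in> M \<rightarrow>\<^sub>M mat_borel n \<Longrightarrow>
      rotation_invariant n M X \<Longrightarrow> (\<forall>k\<ge>1. integrable M (\<lambda>\<omega>. hs_norm (X \<omega>) ^ k)) \<Longrightarrow>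
      (\<integral>\<omega>. (hs_norm (X \<omega>))\<^sup>2 \<partial>M) = real n \<Longrightarrow> std_gaussian N G \<Longrightarrow> C2 f \<Longrightarrow>
      (\<And>x. onorm (hess f x) \<le> B) \<Longrightarrow> (\<And>x. norm (grad f x) \<le> B1) \<Longrightarrow> 0 \<le> a \<Longrightarrow>
      (\<And>k. 1 \<le> k \<Longrightarrow> k \<le> CARD('m) \<Longrightarrow> moment_dev n M X k \<le> a / real n) \<Longrightarrow>
      \<bar>(\<integral>\<omega>. f (trace_vec idx (X \<omega>) - (\<integral>\<omega>'. trace_vec idx (X \<omega>') \<partial>M)) \<partial>M)
        - (\<integral>\<omega>. f (Sigma_half idx *v G \<omega>) \<partial>N)\<bar> \<le> C' * (1 + a) * (B1 + B) / real n"
    by (rule real_trace_comparison[OF assms]) blast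
  show "\<exists>\<kappa> :: real list \<Rightarrow> real. (\<forall>a. 0 < \<kappa> a) \<and> (\<forall>(\<alpha> :: nat \<Rightarrow> real) (n :: nat) (idx :: 'm \<Rightarrow> nat)
           (M :: real mat measure) (X :: real mat \<Rightarrow> real mat)
           (N :: (real ^ 'm) measure) (G :: real ^ 'm \<Rightarrow> real ^ 'm)
           (f :: real ^ 'm \<Rightarrow> real).
           0 < n \<longrightarrow>
           bij_betw idx UNIV {1..CARD('m)} \<longrightarrow>
           prob_space M \<longrightarrow>
           X \<in> M \<rightarrow>\<^sub>M mat_borel n \<longrightarrow>
           rotation_invariant n M X \<longrightarrow>
           (\<forall>k\<ge>1. integrable M (\<lambda>\<omega>. hs_norm (X \<omega>) ^ k)) \<longrightarrow>
           (\<integral>\<omega>. (hs_norm (X \<omega>))\<^sup>2 \<partial>M) = real n \<longrightarrow>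
           (\<forall>k\<ge>1. moment_dev n M X k \<le> \<alpha> k / real n) \<longrightarrow>
           std_gaussian N G \<longrightarrow>
           C2 f \<longrightarrow>
           ennreal \<bar>(\<integral>\<omega>. f (trace_vec idx (X \<omega>) - (\<integral>\<omega>'. trace_vec idx (X \<omega>') \<partial>M)) \<partial>M)
                    - (\<integral>\<omega>. f (Sigma_half idx *v G \<omega>) \<partial>N)\<bar>
             \<le> ennreal (\<kappa> (map \<alpha> [1..<Suc CARD('m)])) * (M1 f + M2 f) / of_nat n)"
  proof (intro exI[of _ "\<kappa> C'"] conjI allI impI pos C'(1), goal_cases)
    case (1 \<alpha> n idx M X N G f)
    show ?case
    proof (rule ennreal_bound[OF 1(1) pos[OF C'(1)]], rule le)
      assume "M1 f + M2 f \<noteq> \<top>"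
      then have fin: "M1 f \<noteq> \<top>" "M2 f \<noteq> \<top>" by auto
      have B: "onorm (hess f x) \<le> enn2real (M2 f)" for x
        using fin(2) unfolding M2_def by (rule le_enn2real_SUP)
      have B1: "norm (grad f x) \<le> enn2real (M1 f)" for x
        using fin(1) unfolding M1_def by (rule le_enn2real_SUP)
      have sum: "enn2real (M1 f + M2 f) = enn2real (M1 f) + enn2real (M2 f)"
        using fin by (intro enn2real_plus) (auto simp: top.not_eq_extremum)
      show "\<bar>(\<integral>\<omega>. f (trace_vec idx (X \<omega>) - (\<integral>\<omega>'. trace_vec idx (X \<omega>') \<partial>M)) \<partial>M)
          - (\<integral>\<omega>. f (Sigma_half idx *v G \<omega>) \<partial>N)\<bar>
          \<le> C' * (1 + sum_list (map abs (map \<alpha> [1..<Suc CARD('m)]))) * enn2real (M1 f + M2 f) / real n"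
        unfolding sum by (rule C'(2)[OF 1(1-7,9,10) B B1 nonneg dev[OF 1(8)]])
    qed simp
  qed
qed

end
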